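(* Assume the $abc$-conjecture. Then there exist absolute constants $c>0$ and $C>0$ such that for all real $x \ge 1$ and all real $y$ with $1 \le y \le x$, \[ Q_2(x+y) - Q_2(x) \le C\,\frac{y}{\log^{1+c}(y+1)}. \]
   Context: A positive integer $n$ is squarefull if every prime $p$ dividing $n$ satisfies $p^2\mid n$. $Q_2(x)$ denotes the number of squarefull positive integers $n \le x$. For a nonzero integer $m$, $\kappa(m)=\prod_{p\mid m} p$. The $abc$-conjecture is the statement: for every $\epsilon>0$ there is a constant $C_\epsilon>0$ such that for all integers $a,b,c$ with $a+b=c$ and $\gcd(a,b)=1$, one has $\max\{|a|,|b|,|c|\} \le C_\epsilon\, \kappa(abc)^{1+\epsilon}$. *)

theory Defs
  imports Complex_Main "HOL-Computational_Algebra.Primes"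
begin

definition squarefull :: "nat \<Rightarrow> bool" where
  "squarefull n \<longleftrightarrow> (\<forall>p. prime p \<and> p dvd n \<longrightarrow> p ^ 2 dvd n)"

definition Q2 :: "real \<Rightarrow> nat" where
  "Q2 x = card {n::nat. 0 < n \<and> real n \<le> x \<and> squarefull n}"

definition kappa :: "int \<Rightarrow> int" where
  "kappa m = (\<Prod>p\<in>prime_factors m. p)"

definition abc_conjecture :: bool where
  "abc_conjecture \<longleftrightarrow>
     (\<forall>\<epsilon>::real. \<epsilon> > 0 \<longrightarrow> (\<exists>C::real. C > 0 \<and>
        (\<forall>a b c :: int. a + b = c \<and> gcd a b = 1 \<and> a * b * c \<noteq> 0 \<longrightarrow>
           real_of_int (max \<bar>a\<bar> (max \<bar>b\<bar> \<bar>c\<bar>)) \<le> C * real_of_int (kappa (a * b * c)) powr (1 + \<epsilon>))))"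

end

theory Submission
  imports Defs "HOL-Analysis.Analysis" "HOL-Computational_Algebra.Computational_Algebra" "HOL-Real_Asymp.Real_Asymp"
begin

text \<open>
  If \<open>n - d\<close>, \<open>n\<close>, \<open>n + d\<close> are squarefull, then the identity \<open>(n - d) (n + d) + d\<^sup>2 = n\<^sup>2\<close>, divided by the
  square of \<open>gcd n d\<close>, contradicts the abc conjecture unless \<open>d\<close> exceeds \<open>n\<close> to the power 6/25 or \<open>n\<close> is
  bounded.  Hence a short interval contains no three squarefull numbers in arithmetic progression.  Long
  intervals are treated by counting the pairs in \<open>n = a\<^sup>2 b\<^sup>3\<close>.

  Few squarefull numbers in the interval are divisible by a prime between a power of \<open>log y\<close> and
  a power of \<open>y\<close>.  The others form a progression-free set that a Selberg sieve majorizes with density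
  about \<open>1 / log y\<close>, and Roth's density increment argument, carried out relative to the
  sieve majorant, saves a further power of \<open>log y\<close>.  The increment steps use the majorant only at
  frequencies close to a small generalized progression.  The sieve discards the few primes for which such
  frequencies approach more than one rational point with a small denominator; on what
  remains, its Fourier transform is small on average.
\<close>

subsection \<open>Fourier analysis on a cyclic group\<close>

text \<open>The exponent 6/25 lies between 1/5, above which counting pairs saves a power of
  \<open>y\<close>, and 1/4, below which the abc conjecture excludes progressions once the common
  factor of \<open>n\<close> and \<open>d\<close> has been put back.

  The sieve alone gives a density of order 1 / log y up to powers of log log y, just short of the
  goal. A relative increment of order \<open>p^2\<close> would take about (log y)^2 steps, and the
  complexity of the weights grows with the square of the number of steps. The increment therefore
  has to be of order \<open>(H * p)^2\<close>, where \<open>H * p\<close> is the density relative to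
  the majorant. Then a small power of log y steps suffices, and the spectrum has at most exp ((log
  y)^(1/10)) elements. These are too few to contain all subset sums of many fractions with different
  primes in their denominators, so only few primes can be harmful. The majorant has to be chosen
  after the spectrum.

  Smooth weights with nonnegative transforms of explicit finite support replace Bohr sets. The
  majorant is tested only on that support, and almost invariance under shifts follows from a bound
  for the mean energy, without regular radii.\<close>

locale cyclic =
  fixes N :: int
  assumes N_gt_1: "N > 1" and N_odd: "odd N"
begin

definition per :: "(int \<Rightarrow> 'a) \<Rightarrow> bool" where
  "per f \<longleftrightarrow> (\<forall>n. f (n mod N) = f n)"

definition e :: "int \<Rightarrow> complex" where
  "e k = cis (2 * pi * of_int k / of_int N)"

lemma N_pos: "N > 0" using N_gt_1 by simp

lemma perD: "per f \<Longrightarrow> m mod N = n mod N \<Longrightarrow> f m = f n"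
  by (metis per_def)

lemma sum_reindex_mod:
  fixes f :: "int \<Rightarrow> 'a::comm_monoid_add"
  assumes "per f" and inj: "\<And>m n. m \<in> {0..<N} \<Longrightarrow> n \<in> {0..<N} \<Longrightarrow> h m mod N = h n mod N \<Longrightarrow> m = n"
  shows "(\<Sum>n\<in>{0..<N}. f (h n)) = (\<Sum>n\<in>{0..<N}. f n)"
proof -
  let ?g = "\<lambda>n. h n mod N"
  have "inj_on ?g {0..<N}" by (rule inj_onI) (rule inj, assumption+)
  moreover have "?g ` {0..<N} \<subseteq> {0..<N}" using N_pos by (auto simp: image_subset_iff)
  ultimately have "bij_betw ?g {0..<N} {0..<N}"
    unfolding bij_betw_def using endo_inj_surj[of "{0..<N}" ?g] by blast
  then have "(\<Sum>n\<in>{0..<N}. f (?g n)) = (\<Sum>n\<in>{0..<N}. f n)"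
    by (rule sum.reindex_bij_betw)
  then show ?thesis using assms(1) by (simp add: per_def)
qed

lemma sum_shift:
  fixes f :: "int \<Rightarrow> 'a::comm_monoid_add"
  assumes "per f"
  shows "(\<Sum>n\<in>{0..<N}. f (n + a)) = (\<Sum>n\<in>{0..<N}. f n)"
proof (rule sum_reindex_mod[OF assms])
  fix m n assume "m \<in> {0..<N}" "n \<in> {0..<N}" "(m + a) mod N = (n + a) mod N"
  then show "m = n"
    by (metis add_diff_cancel_right' atLeastLessThan_iff mod_diff_left_eq mod_pos_pos_trivial)
qed

lemma sum_reflect:
  fixes f :: "int \<Rightarrow> 'a::comm_monoid_add"
  assumes "per f"
  shows "(\<Sum>n\<in>{0..<N}. f (a - n)) = (\<Sum>n\<in>{0..<N}. f n)"
proof (rule sum_reindex_mod[OF assms])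
  fix m n assume "m \<in> {0..<N}" "n \<in> {0..<N}" "(a - m) mod N = (a - n) mod N"
  then show "m = n"
    by (metis (no_types, opaque_lifting) atLeastLessThan_iff diff_diff_eq2 add_diff_cancel_left' mod_diff_right_eq mod_pos_pos_trivial)
qed

lemma sum_double:
  fixes f :: "int \<Rightarrow> 'a::comm_monoid_add"
  assumes "per f"
  shows "(\<Sum>n\<in>{0..<N}. f (a + 2 * n)) = (\<Sum>n\<in>{0..<N}. f n)"
proof (rule sum_reindex_mod[OF assms])
  fix m n assume mn: "m \<in> {0..<N}" "n \<in> {0..<N}" "(a + 2 * m) mod N = (a + 2 * n) mod N"
  then have "N dvd 2 * (m - n)"
    by (metis add_diff_cancel_left mod_eq_dvd_iff right_diff_distrib)
  moreover have "coprime N 2" using N_odd by simp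
  ultimately have "N dvd m - n" using coprime_dvd_mult_right_iff by blast
  then show "m = n" using mn
    by (metis atLeastLessThan_iff mod_eq_dvd_iff mod_pos_pos_trivial)
qed

lemma e_0 [simp]: "e 0 = 1" by (simp add: e_def)

lemma e_add: "e (a + b) = e a * e b"
  by (simp add: e_def cis_mult add_divide_distrib distrib_left)

lemma e_minus: "e (- a) = cnj (e a)"
  by (simp add: e_def cis_cnj)

lemma norm_e [simp]: "norm (e a) = 1" by (simp add: e_def)

lemma e_N_mult: "e (N * k) = 1"
proof -
  have "2 * pi * of_int (N * k) / of_int N = 2 * pi * of_int k" using N_pos by simp
  then have "e (N * k) = cis (2 * pi * of_int k)" by (simp add: e_def)
  then show ?thesis by (simp add: cis_multiple_2pi)
qed

lemma e_mod: "e (k mod N) = e k"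
proof -
  have "e k = e (N * (k div N) + k mod N)" by simp
  then show ?thesis by (simp only: e_add e_N_mult) simp
qed

lemma e_cong: "a mod N = b mod N \<Longrightarrow> e a = e b" by (metis e_mod)

lemma e_eq_1_iff: "e k = 1 \<longleftrightarrow> N dvd k"
proof
  assume "e k = 1"
  then have "cos (2 * pi * of_int k / of_int N) = 1" by (simp add: e_def complex_eq_iff)
  then obtain j :: int where j: "2 * pi * of_int k / of_int N = of_int j * 2 * pi"
    using cos_one_2pi_int by blast
  then have "(of_int k :: real) = of_int (j * N)"
    using N_pos by (simp add: field_simps)
  then have "k = j * N" using of_int_eq_iff by blast
  then show "N dvd k" by simp
next
  assume "N dvd k" then show "e k = 1" by (auto simp: e_N_mult dvd_def)
qed

lemma per_e: "per (\<lambda>n. e (k * n))" "per (\<lambda>n. e (n * k))"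
  unfolding per_def by (intro allI e_cong mod_mult_right_eq mod_mult_left_eq)+

lemma sum_e: "(\<Sum>n\<in>{0..<N}. e (k * n)) = (if N dvd k then of_int N else 0)"
proof (cases "N dvd k")
  case True
  then have "e (k * n) = 1" for n by (simp add: e_eq_1_iff)
  then show ?thesis using True N_pos by simp
next
  case False
  let ?S = "\<Sum>n\<in>{0..<N}. e (k * n)"
  have "?S = (\<Sum>n\<in>{0..<N}. e (k * (n + 1)))"
    using sum_shift[OF per_e(1), of k 1] by simp
  also have "\<dots> = e k * ?S" by (simp add: distrib_left e_add sum_distrib_left mult.commute)
  finally have "(e k - 1) * ?S = 0" by (simp add: algebra_simps)
  with False show ?thesis using e_eq_1_iff by simp
qed

lemma per_comp2: "per f \<Longrightarrow> per (\<lambda>n. f (a + k * n))"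
  unfolding per_def by (metis (no_types, opaque_lifting) mod_add_right_eq mod_mult_right_eq)

lemma per_shift: "per f \<Longrightarrow> per (\<lambda>n. f (n + a))"
  using per_comp2[of f a 1] by (simp add: add.commute)

lemma per_reflect: "per f \<Longrightarrow> per (\<lambda>n. f (a - n))"
  using per_comp2[of f a "-1"] by simp

definition FT :: "(int \<Rightarrow> complex) \<Rightarrow> int \<Rightarrow> complex" where
  "FT f s = (\<Sum>n\<in>{0..<N}. f n * e (- s * n))"

lemma per_FT: "per (FT f)"
  unfolding per_def
proof
  fix s
  have "e (- (s mod N) * n) = e (- s * n)" for n
    by (rule e_cong) (metis mod_minus_eq mod_mult_left_eq)
  then show "FT f (s mod N) = FT f s" by (simp add: FT_def)
qed

lemma sum_delta_mod:
  fixes f :: "int \<Rightarrow> complex"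
  assumes "per f"
  shows "(\<Sum>m\<in>{0..<N}. f m * (if N dvd n - m then of_int N else 0)) = of_int N * f n"
proof -
  have "(\<Sum>m\<in>{0..<N}. f m * (if N dvd n - m then of_int N else 0))
      = (\<Sum>m\<in>{0..<N}. if m = n mod N then of_int N * f m else 0)"
  proof (intro sum.cong refl)
    fix m assume "m \<in> {0..<N}"
    then have "N dvd n - m \<longleftrightarrow> m = n mod N"
      by (metis atLeastLessThan_iff mod_eq_dvd_iff mod_pos_pos_trivial)
    then show "f m * (if N dvd n - m then of_int N else 0) = (if m = n mod N then of_int N * f m else 0)"
      by simp
  qed
  also have "\<dots> = of_int N * f (n mod N)" using N_pos by simp
  finally show ?thesis using assms by (simp add: per_def)
qed

lemma FT_inversion:
  assumes "per f"
  shows "(\<Sum>s\<in>{0..<N}. FT f s * e (s * n)) = of_int N * f n"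
proof -
  have *: "f m * e (- s * m) * e (s * n) = f m * e ((n - m) * s)" for m s
  proof -
    have "(n - m) * s = - s * m + s * n" by (simp add: algebra_simps)
    then show ?thesis by (simp only: e_add mult.assoc)
  qed
  have "(\<Sum>s\<in>{0..<N}. FT f s * e (s * n)) = (\<Sum>s\<in>{0..<N}. \<Sum>m\<in>{0..<N}. f m * e ((n - m) * s))"
    by (simp only: FT_def sum_distrib_right *)
  also have "\<dots> = (\<Sum>m\<in>{0..<N}. f m * (\<Sum>s\<in>{0..<N}. e ((n - m) * s)))"
    by (subst sum.swap) (simp add: sum_distrib_left)
  also have "\<dots> = of_int N * f n" by (simp only: sum_e sum_delta_mod[OF assms])
  finally show ?thesis .
qed

lemma FT_conv:
  assumes "per g"
  shows "(\<Sum>s\<in>{0..<N}. FT f s * FT g s * e (s * u)) = of_int N * (\<Sum>m\<in>{0..<N}. f m * g (u - m))"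
proof -
  have *: "f m * e (- s * m) * (\<Sum>n\<in>{0..<N}. g n * e (- s * n)) * e (s * u) = (\<Sum>n\<in>{0..<N}. f m * (g n * e (((u - m) - n) * s)))" for m s
  proof -
    have "((u - m) - n) * s = - s * m + (- s * n + s * u)" for n by (simp add: algebra_simps)
    then have "f m * (g n * e (((u - m) - n) * s)) = f m * e (- s * m) * (g n * e (- s * n)) * e (s * u)" for n
      by (simp only: e_add mult.assoc mult.left_commute)
    then show ?thesis by (simp only: sum_distrib_left sum_distrib_right)
  qed
  have "(\<Sum>s\<in>{0..<N}. FT f s * FT g s * e (s * u))
      = (\<Sum>s\<in>{0..<N}. \<Sum>m\<in>{0..<N}. \<Sum>n\<in>{0..<N}. f m * (g n * e (((u - m) - n) * s)))"
    by (simp only: FT_def sum_distrib_right[of _ "{0..<N}" "\<Sum>n\<in>{0..<N}. g n * e (- s * n)" for s] sum_distrib_right[of _ "{0..<N}" "e (s * u)" for s] *)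
  also have "\<dots> = (\<Sum>m\<in>{0..<N}. \<Sum>n\<in>{0..<N}. \<Sum>s\<in>{0..<N}. f m * (g n * e (((u - m) - n) * s)))"
    by (subst sum.swap) (intro sum.cong refl sum.swap)
  also have "\<dots> = (\<Sum>m\<in>{0..<N}. f m * (\<Sum>n\<in>{0..<N}. g n * (\<Sum>s\<in>{0..<N}. e (((u - m) - n) * s))))"
    by (simp only: sum_distrib_left)
  also have "\<dots> = of_int N * (\<Sum>m\<in>{0..<N}. f m * g (u - m))"
    by (simp only: sum_e sum_delta_mod[OF assms]) (simp add: sum_distrib_left mult.left_commute)
  finally show ?thesis .
qed

abbreviation cc :: "(int \<Rightarrow> real) \<Rightarrow> int \<Rightarrow> complex" where
  "cc f \<equiv> (\<lambda>n. complex_of_real (f n))"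

lemma per_cc: "per f \<Longrightarrow> per (cc f)" by (simp add: per_def)

lemma FT_reflect:
  assumes "per f"
  shows "FT (\<lambda>n. f (- n)) s = FT f (- s)"
proof -
  have "per (\<lambda>n. f n * e (s * n))"
    using assms per_e(1)[of s] by (simp add: per_def)
  from sum_reflect[OF this, of 0] show ?thesis by (simp add: FT_def)
qed

lemma FT_cnj: "FT (cc b) (- s) = cnj (FT (cc b) s)"
  by (simp add: FT_def e_minus[symmetric])

lemma FT_autocorr:
  assumes "per b"
  shows "(\<Sum>s\<in>{0..<N}. complex_of_real ((norm (FT (cc b) s))\<^sup>2) * e (s * u))
       = of_real (of_int N * (\<Sum>x\<in>{0..<N}. b x * b (x - u)))"
proof -
  have "complex_of_real ((norm (FT (cc b) s))\<^sup>2) = FT (cc b) s * FT (\<lambda>n. cc b (- n)) s" for s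
    using FT_reflect[OF per_cc[OF assms]] by (simp add: FT_cnj complex_norm_square[symmetric])
  moreover have "per (\<lambda>n. cc b (- n))" using per_reflect[OF per_cc[OF assms], of 0] by simp
  ultimately show ?thesis by (simp only: FT_conv) simp
qed

lemma Parseval:
  assumes "per b"
  shows "(\<Sum>s\<in>{0..<N}. (norm (FT (cc b) s))\<^sup>2) = of_int N * (\<Sum>x\<in>{0..<N}. (b x)\<^sup>2)"
proof -
  have "complex_of_real (\<Sum>s\<in>{0..<N}. (norm (FT (cc b) s))\<^sup>2)
      = complex_of_real (of_int N * (\<Sum>x\<in>{0..<N}. (b x)\<^sup>2))"
    using FT_autocorr[OF assms, of 0] by (simp add: power2_eq_square)
  then show ?thesis by (simp only: of_real_eq_iff)
qed

subsection \<open>Positive definite weights\<close>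

text \<open>Nonnegative combinations of characters. \<open>B\<close> is a set of integers rather
  than of residues, so congruent frequencies stay separate; \<open>pd_image\<close> merges only
  equal ones.\<close>

definition pd :: "(int \<Rightarrow> real) \<Rightarrow> int set \<Rightarrow> bool" where
  "pd W B \<longleftrightarrow> finite B \<and> (\<exists>c. (\<forall>g\<in>B. 0 \<le> c g) \<and> (\<forall>n. cc W n = (\<Sum>g\<in>B. complex_of_real (c g) * e (g * n))))"

lemma pd_image:
  assumes "finite I" "\<And>i. i \<in> I \<Longrightarrow> 0 \<le> c i" "h ` I \<subseteq> B" "finite B"
    and "\<And>n. cc W n = (\<Sum>i\<in>I. complex_of_real (c i) * e (h i * n))"
  shows "pd W B"
  unfolding pd_def
proof (intro conjI exI ballI allI)
  let ?c = "\<lambda>g. \<Sum>i\<in>{i\<in>I. h i = g}. c i"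
  show "0 \<le> ?c g" for g using assms(2) by (auto intro: sum_nonneg)
  fix n
  have "cc W n = (\<Sum>g\<in>B. \<Sum>i\<in>{i\<in>I. h i = g}. complex_of_real (c i) * e (h i * n))"
    unfolding assms(5) by (rule sum.group[OF assms(1,4,3), symmetric])
  also have "\<dots> = (\<Sum>g\<in>B. complex_of_real (?c g) * e (g * n))"
    by (simp add: sum_distrib_right)
  finally show "cc W n = (\<Sum>g\<in>B. complex_of_real (?c g) * e (g * n))" .
qed fact

lemma pd_mult:
  assumes "pd V A" "pd W B"
  shows "pd (\<lambda>n. V n * W n) ((\<lambda>(a, b). a + b) ` (A \<times> B))"
proof -
  from assms obtain c d where c: "finite A" "\<forall>g\<in>A. 0 \<le> c g" "\<And>n. cc V n = (\<Sum>g\<in>A. complex_of_real (c g) * e (g * n))"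
    and d: "finite B" "\<forall>g\<in>B. 0 \<le> d g" "\<And>n. cc W n = (\<Sum>g\<in>B. complex_of_real (d g) * e (g * n))"
    unfolding pd_def by blast
  have *: "e ((a + b) * n) = e (a * n) * e (b * n)" for a b n by (simp add: distrib_right e_add)
  show ?thesis
  proof (rule pd_image[where I = "A \<times> B" and c = "\<lambda>(a, b). c a * d b" and h = "\<lambda>(a, b). a + b"])
    show "cc (\<lambda>n. V n * W n) n = (\<Sum>i\<in>A \<times> B. complex_of_real (case i of (a, b) \<Rightarrow> c a * d b) * e ((case i of (a, b) \<Rightarrow> a + b) * n))" for n
      by (simp add: c(3) d(3) sum_product sum.cartesian_product * case_prod_unfold mult.assoc mult.left_commute)
  qed (use c d in auto)
qed

lemma pd_mono:
  assumes "pd W A" "A \<subseteq> B" "finite B"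
  shows "pd W B"
proof -
  from assms obtain c where c: "finite A" "\<forall>g\<in>A. 0 \<le> c g" "\<And>n. cc W n = (\<Sum>g\<in>A. complex_of_real (c g) * e (g * n))"
    unfolding pd_def by blast
  show ?thesis
    by (rule pd_image[where I = A and c = c and h = "\<lambda>g. g"]) (use c assms in auto)
qed

lemma pd_one: "pd (\<lambda>n. 1) {0}"
  unfolding pd_def by (auto intro!: exI[of _ "\<lambda>_. 1"])

text \<open>The Fourier coefficients 3/4, 1/8, 1/8 are nonnegative, and the values stay in [1/2, 1].
  The lower bound keeps the logarithm Lipschitz, so that logarithms of weights can be compared with
  quadratic forms.\<close>

definition bump :: "int \<Rightarrow> int \<Rightarrow> real" where
  "bump r n = (3 + cos (2 * pi * of_int (r * n) / of_int N)) / 4"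

lemma pd_bump: "pd (bump r) ((\<lambda>j. j * r) ` {-1..1})"
proof (rule pd_image[where I = "{-1..1::int}" and c = "\<lambda>j. if j = 0 then 3/4 else 1/8" and h = "\<lambda>j. j * r"])
  fix n
  have "{-1..1::int} = {-1, 0, 1}" by auto
  moreover have "complex_of_real (cos (2 * pi * of_int (r * n) / of_int N)) = e (- (r * n)) / 2 + e (r * n) / 2"
    by (simp add: e_def complex_eq_iff)
  ultimately show "cc (bump r) n = (\<Sum>j\<in>{-1..1}. complex_of_real (if j = 0 then 3/4 else 1/8) * e (j * r * n))"
    by (simp add: bump_def add_divide_distrib)
qed auto

lemma pd_bump_power: "pd (\<lambda>n. bump r n ^ m) ((\<lambda>j. j * r) ` {- int m..int m})"
proof (induction m)
  case 0 then show ?case using pd_one by simp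
next
  case (Suc m)
  have "(\<lambda>(a, b). a + b) ` ((\<lambda>j. j * r) ` {-1..1} \<times> (\<lambda>j. j * r) ` {- int m..int m}) \<subseteq> (\<lambda>j. j * r) ` {- int (Suc m)..int (Suc m)}"
  proof clarify
    fix i j :: int assume "i \<in> {-1..1}" "j \<in> {- int m..int m}"
    then have "i + j \<in> {- int (Suc m)..int (Suc m)}" by auto
    then show "i * r + j * r \<in> (\<lambda>j. j * r) ` {- int (Suc m)..int (Suc m)}"
      by (metis (no_types, lifting) distrib_right image_eqI)
  qed
  from pd_mono[OF pd_mult[OF pd_bump Suc.IH] this] show ?case by simp
qed

text \<open>An entry \<open>(r, m)\<close> stands for the frequency \<open>r\<close> with multiplicity \<open>m\<close>.  The weight \<open>wt D\<close> is a
  smooth substitute for the indicator function of the Bohr set with frequencies \<open>r\<close> and radii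
  about \<open>1 / sqrt m\<close>; its Fourier transform is nonnegative and lives on \<open>spec D\<close>.\<close>

type_synonym data = "(int \<times> nat) list"

fun wt :: "data \<Rightarrow> int \<Rightarrow> real" where
  "wt [] n = 1"
| "wt ((r, m) # D) n = bump r n ^ m * wt D n"

fun spec :: "data \<Rightarrow> int set" where
  "spec [] = {0}"
| "spec ((r, m) # D) = (\<lambda>(j, g). j * r + g) ` ({- int m..int m} \<times> spec D)"

lemma finite_spec: "finite (spec D)"
  by (induction D rule: spec.induct) auto

lemma pd_wt: "pd (wt D) (spec D)"
proof (induction D rule: spec.induct)
  case 1 then show ?case using pd_one by simp
next
  case (2 r m D)
  have "(\<lambda>(a, b). a + b) ` ((\<lambda>j. j * r) ` {- int m..int m} \<times> spec D) = spec ((r, m) # D)"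
    by (simp, force simp: image_iff)
  with pd_mult[OF pd_bump_power[of r m] 2] show ?case by simp
qed

lemma uminus_spec: "g \<in> spec D \<Longrightarrow> - g \<in> spec D"
proof (induction D arbitrary: g rule: spec.induct)
  case (2 r m D)
  then obtain j h where *: "g = j * r + h" "j \<in> {- int m..int m}" "h \<in> spec D" by auto
  with 2 have "- h \<in> spec D" "- j \<in> {- int m..int m}" by auto
  moreover have "- g = (- j) * r + (- h)" using * by simp
  ultimately show ?case unfolding spec.simps by (intro image_eqI[of _ _ "(- j, - h)"]) auto
qed simp

text \<open>Logarithm of the number of formal combinations, hence an upper bound for the logarithm
  of \<open>card (spec D)\<close>. It is the measure of complexity throughout: it also bounds the
  mean energy from above and the mass of the weight from below.\<close>

fun lcard :: "data \<Rightarrow> real" where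
  "lcard [] = 0"
| "lcard ((r, m) # D) = ln (2 * m + 1) + lcard D"

lemma card_spec: "card (spec D) \<le> exp (lcard D)"
proof (induction D rule: spec.induct)
  case (2 r m D)
  have "card (spec ((r, m) # D)) \<le> card ({- int m..int m} \<times> spec D)"
    by (simp only: spec.simps) (rule card_image_le, simp add: finite_spec)
  also have "\<dots> = (2 * m + 1) * card (spec D)"
    by (simp add: card_cartesian_product nat_add_distrib nat_mult_distrib)
  finally have "real (card (spec ((r, m) # D))) \<le> real (2 * m + 1) * card (spec D)" by (metis of_nat_le_iff of_nat_mult)
  also have "\<dots> \<le> real (2 * m + 1) * exp (lcard D)" using 2 by (intro mult_left_mono) auto
  finally show ?case by (simp add: exp_add add.commute mult.commute)
qed simp

section \<open>Energies of weights, their doubling and their shifts\<close>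

lemma bump_eq: "bump r n = 1 - (sin (pi * of_int (r * n) / of_int N))\<^sup>2 / 2"
proof -
  have "cos (2 * (pi * of_int (r * n) / of_int N)) = 1 - 2 * (sin (pi * of_int (r * n) / of_int N))\<^sup>2"
    by (rule cos_double_sin)
  then show ?thesis by (simp add: bump_def mult.assoc field_simps)
qed

lemma sin_sq_le_1: "(sin (x::real))\<^sup>2 \<le> 1"
  using abs_sin_le_one[of x] by (simp add: abs_square_le_1)

lemma bump_bounds: "1 / 2 \<le> bump r n" "bump r n \<le> 1" "0 < bump r n"
  unfolding bump_eq using sin_sq_le_1[of "pi * of_int (r * n) / of_int N"] by (auto simp del: of_int_mult)

lemma per_bump: "per (bump r)"
proof -
  have "bump r = (\<lambda>n. (3 + Re (e (r * n))) / 4)" by (simp add: bump_def e_def fun_eq_iff)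
  then show ?thesis using per_e(1)[of r] by (simp add: per_def)
qed

lemma per_wt: "per (wt D)"
proof (induction D rule: spec.induct)
  case 1 show ?case by (simp add: per_def)
next
  case (2 r m D)
  then show ?case using per_bump[of r] by (simp add: per_def)
qed

lemma wt_pos: "0 < wt D n"
  by (induction D n rule: wt.induct) (auto simp: bump_bounds)

lemma wt_le_1: "wt D n \<le> 1"
proof (induction D n rule: wt.induct)
  case (2 r m D n)
  have "bump r n ^ m \<le> 1" using bump_bounds(2,3)[of r n] by (intro power_le_one) auto
  then show ?case using 2 wt_pos[of D n] bump_bounds[of r n] by (simp add: mult_le_one)
qed simp

lemma wt_uminus: "wt D (- n) = wt D n"
  by (induction D n rule: wt.induct) (auto simp: bump_def)

definition en :: "data \<Rightarrow> int \<Rightarrow> real" where "en D n = - ln (wt D n)"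

lemma wt_en: "wt D n = exp (- en D n)" using wt_pos[of D n] by (simp add: en_def)

lemma en_nonneg: "0 \<le> en D n" using wt_pos[of D n] wt_le_1[of D n] by (simp add: en_def)

lemma en_Nil: "en [] n = 0" by (simp add: en_def)

lemma en_Cons: "en ((r, m) # D) n = m * (- ln (bump r n)) + en D n"
  using wt_pos[of D n] bump_bounds(3)[of r n] by (simp add: en_def ln_mult ln_realpow)

abbreviation sn :: "int \<Rightarrow> int \<Rightarrow> real" where
  "sn r n \<equiv> sin (pi * of_int (r * n) / of_int N)"

text \<open>Substitute for the energy, comparable to it within a factor 2 by \<open>en_qf\<close>.
  Being a combination of squares of sines, it grows at most by a factor 4 when the argument is
  doubled.\<close>

fun qf :: "data \<Rightarrow> int \<Rightarrow> real" where
  "qf [] n = 0"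
| "qf ((r, m) # D) n = m * (sn r n)\<^sup>2 + qf D n"

lemma ln_one_minus_half_bounds:
  fixes u :: real assumes "0 \<le> u" "u \<le> 1"
  shows "u / 2 \<le> - ln (1 - u / 2)" "- ln (1 - u / 2) \<le> u"
proof -
  show "u / 2 \<le> - ln (1 - u / 2)" using ln_le_minus_one[of "1 - u / 2"] assms by simp
  have "- ln (1 - u / 2) = ln (1 / (1 - u / 2))" using assms by (simp add: ln_div)
  also have "\<dots> \<le> 1 / (1 - u / 2) - 1" using assms by (intro ln_le_minus_one) auto
  also have "\<dots> \<le> u" using assms mult_left_le[of u u] by (simp add: field_simps)
  finally show "- ln (1 - u / 2) \<le> u" .
qed

lemma en_qf: "qf D n / 2 \<le> en D n" "en D n \<le> qf D n"
proof (induction D n rule: qf.induct)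
  case (2 r m D n)
  note b = ln_one_minus_half_bounds[OF zero_le_power2 sin_sq_le_1, of "pi * of_int (r * n) / of_int N", folded bump_eq]
  have "real m * ((sn r n)\<^sup>2 / 2) \<le> real m * - ln (bump r n)"
    using b(1) by (rule mult_left_mono) simp
  moreover have "real m * - ln (bump r n) \<le> real m * (sn r n)\<^sup>2"
    using b(2) by (rule mult_left_mono) simp
  ultimately show "qf ((r, m) # D) n / 2 \<le> en ((r, m) # D) n" "en ((r, m) # D) n \<le> qf ((r, m) # D) n"
    unfolding en_Cons qf.simps using 2 by (simp_all add: add_divide_distrib del: of_int_mult)
qed (simp_all add: en_Nil)

lemma qf_double: "qf D (2 * n) \<le> 4 * qf D n"
proof (induction D n rule: qf.induct)
  case (2 r m D n)
  let ?x = "pi * of_int (r * n) / of_int N"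
  have "pi * of_int (r * (2 * n)) / of_int N = 2 * ?x" by simp
  then have "(sn r (2 * n))\<^sup>2 = 4 * (sn r n)\<^sup>2 * (cos ?x)\<^sup>2"
    by (simp only: sin_double power_mult_distrib) (simp add: power_mult_distrib)
  also have "\<dots> \<le> 4 * (sn r n)\<^sup>2"
    using abs_cos_le_one[of ?x] by (intro mult_left_le) (auto simp: abs_square_le_1)
  finally have "real m * (sn r (2 * n))\<^sup>2 \<le> real m * (4 * (sn r n)\<^sup>2)" by (rule mult_left_mono) simp
  with 2 show ?case by (simp del: of_int_mult)
qed simp

lemma en_double: "en D (2 * n) \<le> 8 * en D n"
  using en_qf(2)[of D "2 * n"] qf_double[of D n] en_qf(1)[of D n] by linarith

lemma ln_diff_half:
  fixes u v :: real assumes "1/2 \<le> u" "1/2 \<le> v"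
  shows "\<bar>ln u - ln v\<bar> \<le> 2 * \<bar>u - v\<bar>"
proof -
  have *: "ln u - ln v \<le> 2 * \<bar>u - v\<bar>" if "1/2 \<le> u" "1/2 \<le> v" for u v :: real
  proof -
    have "ln u - ln v = ln (u / v)" using that by (simp add: ln_div)
    also have "\<dots> \<le> u / v - 1" using that by (intro ln_le_minus_one) auto
    also have "\<dots> = (u - v) / v" using that by (simp add: field_simps)
    also have "\<dots> \<le> \<bar>u - v\<bar> / v" using that by (intro divide_right_mono) auto
    also have "\<dots> \<le> \<bar>u - v\<bar> / (1/2)" using that by (intro divide_left_mono) auto
    finally show ?thesis by simp
  qed
  from *[OF assms] *[OF assms(2,1)] show ?thesis
    unfolding abs_minus_commute[of v u] by (simp add: abs_le_iff)
qed

lemma sin_sq_diff: "(sin (a + b))\<^sup>2 - (sin a)\<^sup>2 = sin b * sin (2 * a + b)" for a b :: real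
proof -
  have "2 * (sin (a + b))\<^sup>2 - 2 * (sin a)\<^sup>2 = cos (2 * a) - cos (2 * (a + b))"
    using cos_double_sin[of a] cos_double_sin[of "a + b"] by simp
  also have "\<dots> = 2 * sin ((2 * a + 2 * (a + b)) / 2) * sin ((2 * (a + b) - 2 * a) / 2)"
    by (rule cos_diff_cos)
  also have "(2 * a + 2 * (a + b)) / 2 = 2 * a + b" by (simp add: field_simps)
  also have "(2 * (a + b) - 2 * a) / 2 = b" by (simp add: field_simps)
  finally show ?thesis by (simp add: mult.commute)
qed

text \<open>The free parameter \<open>t\<close> plays the role of the optimal constant in the Cauchy-Schwarz inequality.\<close>

lemma en_shift:
  assumes "0 < t"
  shows "\<bar>en D (x + v) - en D x\<bar> \<le> t * qf D x + (1 / t + 1) * qf D v"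
proof (induction D)
  case Nil show ?case by (simp add: en_Nil)
next
  case (Cons d D)
  obtain r m where d: "d = (r, m)" by (cases d)
  let ?a = "pi * of_int (r * x) / of_int N" and ?b = "pi * of_int (r * v) / of_int N"
  have ab: "pi * of_int (r * (x + v)) / of_int N = ?a + ?b"
    by (simp add: distrib_left add_divide_distrib)
  have h1: "\<bar>bump r (x + v) - bump r x\<bar> = \<bar>sin ?b * sin (2 * ?a + ?b)\<bar> / 2"
    unfolding bump_eq ab sin_sq_diff[symmetric] by (simp add: abs_minus_commute diff_divide_distrib[symmetric])
  have h2: "\<bar>sin (2 * ?a + ?b)\<bar> \<le> 2 * \<bar>sin ?a\<bar> + \<bar>sin ?b\<bar>"
  proof -
    have "\<bar>sin (2 * ?a + ?b)\<bar> \<le> \<bar>sin (2 * ?a)\<bar> * \<bar>cos ?b\<bar> + \<bar>cos (2 * ?a)\<bar> * \<bar>sin ?b\<bar>"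
      by (metis sin_add abs_mult abs_triangle_ineq)
    also have "\<dots> \<le> \<bar>sin (2 * ?a)\<bar> * 1 + 1 * \<bar>sin ?b\<bar>"
      by (intro add_mono mult_left_mono mult_right_mono abs_cos_le_one) auto
    also have "\<bar>sin (2 * ?a)\<bar> = 2 * \<bar>sin ?a\<bar> * \<bar>cos ?a\<bar>" by (simp only: sin_double abs_mult abs_numeral)
    also have "\<dots> \<le> 2 * \<bar>sin ?a\<bar> * 1" by (intro mult_left_mono abs_cos_le_one) auto
    finally show ?thesis by simp
  qed
  have "2 * \<bar>bump r (x + v) - bump r x\<bar> = \<bar>sin ?b\<bar> * \<bar>sin (2 * ?a + ?b)\<bar>"
    unfolding h1 abs_mult by simp
  also have "\<dots> \<le> \<bar>sin ?b\<bar> * (2 * \<bar>sin ?a\<bar> + \<bar>sin ?b\<bar>)"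
    using h2 by (rule mult_left_mono) simp
  also have "\<dots> = 2 * \<bar>sin ?a\<bar> * \<bar>sin ?b\<bar> + (sin ?b)\<^sup>2"
    by (simp add: algebra_simps power2_eq_square)
  also have "2 * \<bar>sin ?a\<bar> * \<bar>sin ?b\<bar> \<le> t * (sin ?a)\<^sup>2 + (sin ?b)\<^sup>2 / t"
  proof -
    have "0 \<le> (t * \<bar>sin ?a\<bar> - \<bar>sin ?b\<bar>)\<^sup>2 / t" using assms by simp
    also have "\<dots> = t * (sin ?a)\<^sup>2 + (sin ?b)\<^sup>2 / t - 2 * \<bar>sin ?a\<bar> * \<bar>sin ?b\<bar>"
    proof -
      have "(t * \<alpha> - \<beta>)\<^sup>2 / t = t * \<alpha>\<^sup>2 + \<beta>\<^sup>2 / t - 2 * \<alpha> * \<beta>" for \<alpha> \<beta> :: real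
        using assms by (simp add: field_simps power2_eq_square)
      from this[of "\<bar>sin ?a\<bar>" "\<bar>sin ?b\<bar>"] show ?thesis by simp
    qed
    finally show ?thesis by simp
  qed
  finally have "\<bar>ln (bump r (x + v)) - ln (bump r x)\<bar> \<le> t * (sin ?a)\<^sup>2 + (1 / t + 1) * (sin ?b)\<^sup>2"
    using ln_diff_half[OF bump_bounds(1) bump_bounds(1), of r "x + v" r x] by (simp add: algebra_simps)
  then have "real m * \<bar>ln (bump r (x + v)) - ln (bump r x)\<bar> \<le> real m * (t * (sin ?a)\<^sup>2 + (1 / t + 1) * (sin ?b)\<^sup>2)"
    by (rule mult_left_mono) simp
  moreover have "\<bar>en (d # D) (x + v) - en (d # D) x\<bar> \<le> real m * \<bar>ln (bump r (x + v)) - ln (bump r x)\<bar> + \<bar>en D (x + v) - en D x\<bar>"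
  proof -
    have "en (d # D) (x + v) - en (d # D) x = - (real m * (ln (bump r (x + v)) - ln (bump r x))) + (en D (x + v) - en D x)"
      unfolding d en_Cons by (simp add: algebra_simps)
    then show ?thesis
      using abs_triangle_ineq[of "- (real m * (ln (bump r (x + v)) - ln (bump r x)))" "en D (x + v) - en D x"]
      by (simp add: abs_mult)
  qed
  moreover have "t * qf (d # D) x + (1 / t + 1) * qf (d # D) v = real m * (t * (sin ?a)\<^sup>2 + (1 / t + 1) * (sin ?b)\<^sup>2) + (t * qf D x + (1 / t + 1) * qf D v)"
    unfolding d qf.simps by (simp only: distrib_left mult.left_commute)
  ultimately show ?case using Cons by linarith
qed

section \<open>Probability measures and their characteristic functions\<close>

definition Z :: "data \<Rightarrow> real" where "Z D = (\<Sum>n\<in>{0..<N}. wt D n)"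

definition \<pi> :: "data \<Rightarrow> int \<Rightarrow> real" where "\<pi> D n = wt D n / Z D"

lemma Z_pos: "0 < Z D"
  unfolding Z_def using N_pos by (intro sum_pos) (auto simp: wt_pos)

lemma sum_\<pi>: "(\<Sum>n\<in>{0..<N}. \<pi> D n) = 1"
  using Z_pos[of D] by (simp add: \<pi>_def sum_divide_distrib[symmetric] Z_def[symmetric])

lemma \<pi>_nonneg: "0 \<le> \<pi> D n" using Z_pos[of D] wt_pos[of D n] by (simp add: \<pi>_def)

lemma \<pi>_uminus: "\<pi> D (- n) = \<pi> D n" by (simp add: \<pi>_def wt_uminus)

lemma per_\<pi>: "per (\<pi> D)" using per_wt[of D] by (simp add: per_def \<pi>_def)

text \<open>The value at \<open>k\<close> collects the coefficients of all \<open>g\<close>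
  congruent to \<open>- k\<close>, so it is nonnegative and at least \<open>N\<close> times each
  single one of them. For the last bound: every value is at most \<open>Z D\<close> trivially, and
  the coefficients add up to \<open>wt D 0\<close>.\<close>

lemma wt_char:
  obtains c where "(\<Sum>n\<in>{0..<N}. cc (wt D) n * e (k * n)) = complex_of_real c" "0 \<le> c"
    "c \<noteq> 0 \<Longrightarrow> \<exists>g\<in>spec D. N dvd k + g"
    and "wt D 0 * of_int N \<le> card (spec D) * Z D"
proof -
  obtain c where c: "\<forall>g\<in>spec D. 0 \<le> c g" "\<And>n. cc (wt D) n = (\<Sum>g\<in>spec D. complex_of_real (c g) * e (g * n))"
    using pd_wt[of D] unfolding pd_def by blast
  define h where "h k = (\<Sum>g\<in>spec D. c g * (if N dvd k + g then of_int N else 0))" for k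
  have h: "(\<Sum>n\<in>{0..<N}. cc (wt D) n * e (k * n)) = complex_of_real (h k)" for k
  proof -
    have "cc (wt D) n * e (k * n) = (\<Sum>g\<in>spec D. complex_of_real (c g) * e ((k + g) * n))" for n
      unfolding c(2) sum_distrib_right by (intro sum.cong refl) (simp add: distrib_right e_add)
    then have "(\<Sum>n\<in>{0..<N}. cc (wt D) n * e (k * n)) = (\<Sum>g\<in>spec D. complex_of_real (c g) * (\<Sum>n\<in>{0..<N}. e ((k + g) * n)))"
      by (simp only: sum_distrib_left) (rule sum.swap)
    also have "\<dots> = complex_of_real (h k)"
      unfolding h_def sum_e of_real_sum by (intro sum.cong) auto
    finally show ?thesis .
  qed
  have h_ge: "of_int N * c g \<le> h (- g)" if "g \<in> spec D" for g
  proof -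
    have "c g * (if N dvd (- g) + g then of_int N else 0) \<le> h (- g)"
      unfolding h_def by (rule member_le_sum[OF that]) (use c(1) N_pos finite_spec in auto)
    then show ?thesis by (simp add: mult.commute)
  qed
  have h_le: "h k \<le> Z D" for k
  proof -
    have "0 \<le> h k" using c(1) N_pos by (auto simp: h_def intro!: sum_nonneg)
    then have "h k = norm (complex_of_real (h k))" by simp
    also have "\<dots> \<le> (\<Sum>n\<in>{0..<N}. norm (cc (wt D) n * e (k * n)))"
      unfolding h[symmetric] by (rule norm_sum)
    also have "\<dots> = Z D" using wt_pos[of D] by (simp add: norm_mult Z_def abs_of_pos)
    finally show ?thesis .
  qed
  have "complex_of_real (wt D 0) = complex_of_real (\<Sum>g\<in>spec D. c g)" using c(2)[of 0] by simp
  then have "wt D 0 * of_int N = (\<Sum>g\<in>spec D. of_int N * c g)"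
    by (simp only: of_real_eq_iff) (simp add: sum_distrib_left mult.commute)
  also have "\<dots> \<le> (\<Sum>g\<in>spec D. Z D)" by (intro sum_mono order.trans[OF h_ge h_le])
  finally have "wt D 0 * of_int N \<le> card (spec D) * Z D" by simp
  moreover have "0 \<le> h k" using c(1) N_pos by (auto simp: h_def intro!: sum_nonneg)
  moreover have "\<exists>g\<in>spec D. N dvd k + g" if "h k \<noteq> 0"
  proof (rule ccontr)
    assume "\<not> (\<exists>g\<in>spec D. N dvd k + g)"
    then have "h k = 0" unfolding h_def by (intro sum.neutral) auto
    with that show False by simp
  qed
  ultimately show ?thesis using that h by blast
qed

definition chi :: "data \<Rightarrow> int \<Rightarrow> real" where
  "chi D k = Re (\<Sum>n\<in>{0..<N}. cc (\<pi> D) n * e (k * n))"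

lemma chi_complex: "(\<Sum>n\<in>{0..<N}. cc (\<pi> D) n * e (k * n)) = complex_of_real (chi D k)"
  and chi_nonneg: "0 \<le> chi D k"
  and chi_spec: "chi D k \<noteq> 0 \<Longrightarrow> \<exists>g\<in>spec D. N dvd k - g"
proof -
  obtain c where c: "(\<Sum>n\<in>{0..<N}. cc (wt D) n * e (k * n)) = complex_of_real c" "0 \<le> c"
    "c \<noteq> 0 \<Longrightarrow> \<exists>g\<in>spec D. N dvd k + g" using wt_char[of D k] by metis
  have "(\<Sum>n\<in>{0..<N}. cc (\<pi> D) n * e (k * n)) = (\<Sum>n\<in>{0..<N}. cc (wt D) n * e (k * n)) / Z D"
    by (simp add: \<pi>_def sum_divide_distrib)
  then have *: "(\<Sum>n\<in>{0..<N}. cc (\<pi> D) n * e (k * n)) = complex_of_real (c / Z D)" using c(1) by simp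
  then have chi: "chi D k = c / Z D" unfolding chi_def by simp
  show "(\<Sum>n\<in>{0..<N}. cc (\<pi> D) n * e (k * n)) = complex_of_real (chi D k)" unfolding * chi ..
  show "0 \<le> chi D k" unfolding chi using c(2) Z_pos[of D] by simp
  show "\<exists>g\<in>spec D. N dvd k - g" if "chi D k \<noteq> 0"
    using c(3) that uminus_spec unfolding chi by force
qed

lemma chi_le_1: "chi D k \<le> 1"
proof -
  have "chi D k \<le> norm (\<Sum>n\<in>{0..<N}. cc (\<pi> D) n * e (k * n))" unfolding chi_def by (rule complex_Re_le_cmod)
  also have "\<dots> \<le> (\<Sum>n\<in>{0..<N}. norm (cc (\<pi> D) n * e (k * n)))" by (rule norm_sum)
  also have "\<dots> = 1" using sum_\<pi>[of D] by (simp add: norm_mult abs_of_nonneg[OF \<pi>_nonneg])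
  finally show ?thesis .
qed

lemma Z_ge: "of_int N \<le> exp (lcard D) * Z D"
proof -
  have "wt D 0 = 1" by (induction D rule: spec.induct) (auto simp: bump_def)
  then have "of_int N \<le> card (spec D) * Z D" using wt_char[of D 0] by (metis mult_1)
  also have "\<dots> \<le> exp (lcard D) * Z D" using card_spec[of D] Z_pos[of D] by (intro mult_right_mono) auto
  finally show ?thesis .
qed

text \<open>Jensen's inequality, in the form of the Gibbs variational principle.\<close>

lemma mean_en: "(\<Sum>n\<in>{0..<N}. \<pi> D n * en D n) \<le> lcard D"
proof -
  define m where "m = (\<Sum>n\<in>{0..<N}. \<pi> D n * en D n)"
  \<comment> \<open>Integration of \<open>1 + x \<le> exp x\<close> at \<open>x = en D n - m\<close>
    against the measure. The summands on the right become 1, because \<open>\<pi> D n\<close> equals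
    \<open>exp (- en D n) / Z D\<close>.\<close>
  have "exp m * Z D = (\<Sum>n\<in>{0..<N}. exp m * Z D * (\<pi> D n * (1 + en D n - m)))"
  proof -
    have "(\<Sum>n\<in>{0..<N}. \<pi> D n * (1 + en D n - m)) = (\<Sum>n\<in>{0..<N}. (1 - m) * \<pi> D n + \<pi> D n * en D n)"
      by (intro sum.cong) (auto simp: algebra_simps)
    also have "\<dots> = 1" by (simp add: sum.distrib sum_distrib_left[symmetric] sum_\<pi> m_def[symmetric])
    finally show ?thesis by (simp add: sum_distrib_left[symmetric])
  qed
  also have "\<dots> \<le> (\<Sum>n\<in>{0..<N}. 1)"
  proof (rule sum_mono)
    fix n
    have "1 + (en D n - m) \<le> exp (en D n - m)" by (rule exp_ge_add_one_self)
    then have "exp m * Z D * (\<pi> D n * (1 + en D n - m)) \<le> exp m * Z D * (\<pi> D n * exp (en D n - m))"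
      using Z_pos[of D] \<pi>_nonneg[of D n] by (intro mult_left_mono) (auto simp: add_diff_eq)
    also have "\<dots> = 1" using Z_pos[of D] by (simp add: \<pi>_def wt_en exp_diff exp_minus field_simps)
    finally show "exp m * Z D * (\<pi> D n * (1 + en D n - m)) \<le> 1" .
  qed
  also have "\<dots> = of_int N" using N_pos by simp
  also have "\<dots> \<le> exp (lcard D) * Z D" by (rule Z_ge)
  finally show ?thesis using Z_pos[of D] by (simp add: m_def)
qed

text \<open>Raises the weight to the power \<open>l\<close>, which shrinks all radii by the square
  root of \<open>l\<close>. The frequencies stay the same, so the price in \<open>lcard\<close> is
  only logarithmic in \<open>l\<close> for each entry.\<close>

definition scale :: "nat \<Rightarrow> data \<Rightarrow> data" where "scale l D = map (\<lambda>(r, m). (r, l * m)) D"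

lemma wt_scale: "wt (scale l D) n = wt D n ^ l"
  by (induction D rule: spec.induct) (auto simp: scale_def power_mult_distrib power_mult[symmetric] mult.commute)

lemma en_scale: "en (scale l D) n = l * en D n"
  using wt_pos[of D n] by (simp add: en_def wt_scale ln_realpow)

lemma wt_append: "wt (D @ D') n = wt D n * wt D' n"
  by (induction D rule: spec.induct) auto

lemma en_append: "en (D @ D') n = en D n + en D' n"
  using wt_pos[of D n] wt_pos[of D' n] by (simp add: en_def wt_append ln_mult)

lemma lcard_scale:
  assumes "1 \<le> l"
  shows "lcard (scale l D) \<le> length D * ln l + lcard D"
proof (induction D rule: spec.induct)
  case (2 r m D)
  have "ln (real (2 * (l * m) + 1)) \<le> ln (real l * real (2 * m + 1))"
    using assms by (subst ln_le_cancel_iff) (auto simp: algebra_simps intro: add_pos_nonneg)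
  also have "\<dots> = ln l + ln (real (2 * m + 1))" using assms by (intro ln_mult_pos) auto
  finally show ?case using 2 by (simp add: scale_def algebra_simps)
qed (simp add: scale_def)

section \<open>Almost invariance of the measures under shifts\<close>

definition tv :: "data \<Rightarrow> int \<Rightarrow> real" where
  "tv D v = (\<Sum>x\<in>{0..<N}. \<bar>\<pi> D (x + v) - \<pi> D x\<bar>)"

lemma tv_uminus: "tv D (- v) = tv D v"
proof -
  have "per (\<lambda>x. \<bar>\<pi> D (x - v) - \<pi> D x\<bar>)"
    using per_\<pi>[of D] per_shift[OF per_\<pi>[of D], of "- v"] by (simp add: per_def)
  from sum_shift[OF this, of v] show ?thesis by (simp add: tv_def abs_minus_commute)
qed

text \<open>In \<open>en_shift\<close> the quadratic form of the moving point has mean at most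
  \<open>2 * lcard D\<close> by \<open>mean_en\<close>, so a shift is harmless as soon as its own
  energy is small. This takes the place of the choice of a regular radius for a Bohr set.\<close>

lemma tv_bound:
  assumes "0 < t"
  shows "tv D v \<le> 4 * t * lcard D + 4 * (1 / t + 1) * en D v"
proof -
  have exp_diff_le: "\<bar>exp (- a) - exp (- b)\<bar> \<le> \<bar>a - b\<bar> * (exp (- a) + exp (- b))" for a b :: real
  proof -
    have "exp (- a) - exp (- b) \<le> \<bar>a - b\<bar> * (exp (- a) + exp (- b))" for a b :: real
    proof -
      have "exp (- a) * (1 + (a - b)) \<le> exp (- a) * exp (a - b)" by (intro mult_left_mono exp_ge_add_one_self) auto
      also have "\<dots> = exp (- b)" by (simp add: exp_add[symmetric])
      finally have "exp (- a) - exp (- b) \<le> (b - a) * exp (- a)" by (simp add: algebra_simps)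
      also have "\<dots> \<le> \<bar>a - b\<bar> * exp (- a)" by (intro mult_right_mono) auto
      also have "\<dots> \<le> \<bar>a - b\<bar> * (exp (- a) + exp (- b))" by (intro mult_left_mono) auto
      finally show ?thesis .
    qed
    from this[of a b] this[of b a] show ?thesis by (simp add: abs_minus_commute add.commute abs_le_iff)
  qed
  let ?d = "\<lambda>x. t * qf D x + (1 / t + 1) * qf D v"
  have *: "\<bar>\<pi> D (x + v) - \<pi> D x\<bar> \<le> \<pi> D x * ?d x + \<pi> D (x + v) * (t * qf D (x + v) + (1 / t + 1) * qf D v)" for x
  proof -
    have 1: "\<bar>en D (x + v) - en D x\<bar> \<le> ?d x" by (rule en_shift[OF assms])
    have "qf D (- v) = qf D v" by (induction D v rule: qf.induct) auto
    then have 2: "\<bar>en D (x + v) - en D x\<bar> \<le> t * qf D (x + v) + (1 / t + 1) * qf D v"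
      using en_shift[OF assms, of D "x + v" "- v"] by (simp add: abs_minus_commute)
    have "\<bar>wt D (x + v) - wt D x\<bar> \<le> \<bar>en D (x + v) - en D x\<bar> * (wt D (x + v) + wt D x)"
      unfolding wt_en by (rule exp_diff_le)
    also have "\<dots> = wt D x * \<bar>en D (x + v) - en D x\<bar> + wt D (x + v) * \<bar>en D (x + v) - en D x\<bar>"
      by (simp add: algebra_simps)
    also have "\<dots> \<le> wt D x * ?d x + wt D (x + v) * (t * qf D (x + v) + (1 / t + 1) * qf D v)"
      by (intro add_mono mult_left_mono 1 2 less_imp_le[OF wt_pos])
    finally have "\<bar>wt D (x + v) - wt D x\<bar> / Z D \<le> (wt D x * ?d x + wt D (x + v) * (t * qf D (x + v) + (1 / t + 1) * qf D v)) / Z D"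
      using Z_pos[of D] by (intro divide_right_mono) auto
    then show ?thesis using Z_pos[of D]
      by (simp add: \<pi>_def diff_divide_distrib[symmetric] abs_divide add_divide_distrib)
  qed
  have perq: "per (qf D)"
  proof (induction D rule: spec.induct)
    case (2 r m D)
    have "(sn r n)\<^sup>2 = 2 - 2 * bump r n" for n unfolding bump_eq by simp
    then show ?case using 2 per_bump[of r] by (simp add: per_def)
  qed (simp add: per_def)
  have "tv D v \<le> (\<Sum>x\<in>{0..<N}. \<pi> D x * ?d x) + (\<Sum>x\<in>{0..<N}. \<pi> D (x + v) * (t * qf D (x + v) + (1 / t + 1) * qf D v))"
    unfolding tv_def sum.distrib[symmetric] by (intro sum_mono *)
  also have "(\<Sum>x\<in>{0..<N}. \<pi> D (x + v) * (t * qf D (x + v) + (1 / t + 1) * qf D v)) = (\<Sum>x\<in>{0..<N}. \<pi> D x * ?d x)"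
    by (rule sum_shift) (use per_\<pi>[of D] perq in \<open>simp add: per_def\<close>)
  also have "(\<Sum>x\<in>{0..<N}. \<pi> D x * ?d x) = t * (\<Sum>x\<in>{0..<N}. \<pi> D x * qf D x) + (1 / t + 1) * qf D v * (\<Sum>x\<in>{0..<N}. \<pi> D x)"
    unfolding sum_distrib_left sum.distrib[symmetric] by (intro sum.cong) (auto simp: algebra_simps)
  also have "(\<Sum>x\<in>{0..<N}. \<pi> D x) = 1" by (rule sum_\<pi>)
  also have "(\<Sum>x\<in>{0..<N}. \<pi> D x * qf D x) \<le> (\<Sum>x\<in>{0..<N}. \<pi> D x * (2 * en D x))"
    using en_qf(1) by (intro sum_mono mult_left_mono \<pi>_nonneg) (simp add: field_simps)
  also have "\<dots> = 2 * (\<Sum>x\<in>{0..<N}. \<pi> D x * en D x)" by (simp add: sum_distrib_left mult_ac)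
  also have "\<dots> \<le> 2 * lcard D" using mean_en by simp
  finally have "tv D v \<le> 2 * (t * (2 * lcard D)) + 2 * ((1 / t + 1) * qf D v)"
    using assms by (simp add: mult.commute)
  moreover have "(1 / t + 1) * qf D v \<le> (1 / t + 1) * (2 * en D v)"
    using en_qf(1)[of D v] assms by (intro mult_left_mono) auto
  ultimately show ?thesis by linarith
qed

lemma shift_tv:
  fixes f :: "int \<Rightarrow> 'a::real_normed_vector"
  assumes "per f" "\<And>x. norm (f x) \<le> K"
  shows "norm ((\<Sum>x\<in>{0..<N}. \<pi> D x *\<^sub>R f x) - (\<Sum>x\<in>{0..<N}. \<pi> D x *\<^sub>R f (x + v))) \<le> K * tv D v"
proof -
  have "per (\<lambda>x. \<pi> D (x - v) *\<^sub>R f x)"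
    using assms(1) per_shift[OF per_\<pi>[of D], of "-v"] by (simp add: per_def)
  from sum_shift[OF this, of v]
  have "(\<Sum>x\<in>{0..<N}. \<pi> D x *\<^sub>R f (x + v)) = (\<Sum>x\<in>{0..<N}. \<pi> D (x - v) *\<^sub>R f x)" by simp
  then have "(\<Sum>x\<in>{0..<N}. \<pi> D x *\<^sub>R f x) - (\<Sum>x\<in>{0..<N}. \<pi> D x *\<^sub>R f (x + v))
      = (\<Sum>x\<in>{0..<N}. (\<pi> D x - \<pi> D (x - v)) *\<^sub>R f x)"
    by (simp add: sum_subtractf[symmetric] scaleR_diff_left)
  also have "norm \<dots> \<le> (\<Sum>x\<in>{0..<N}. \<bar>\<pi> D (x + - v) - \<pi> D x\<bar> * K)"
    by (rule sum_norm_le) (use assms(2) in \<open>simp add: mult_left_mono abs_minus_commute\<close>)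
  also have "\<dots> = K * tv D v" 
    unfolding sum_distrib_right[symmetric] tv_def[symmetric] tv_uminus by (rule mult.commute)
  finally show ?thesis .
qed

text \<open>The majorant may depend on the set of frequencies at which its Fourier transform has to be small:
  a sieve can be adapted to a given small spectrum, but it has large Fourier coefficients near every
  rational number whose denominator is a product of sieving primes.\<close>

definition majorized :: "(int \<Rightarrow> real) \<Rightarrow> real \<Rightarrow> real \<Rightarrow> real \<Rightarrow> bool" where
  "majorized a L H \<epsilon> \<longleftrightarrow> (\<forall>D. lcard D \<le> L \<longrightarrow> (\<exists>\<nu>. per \<nu> \<and> (\<forall>n. a n \<le> \<nu> n) \<and>
     norm (FT (cc \<nu>) 0) \<le> of_int N / H \<and>
     (\<forall>\<phi>. (\<Sum>s\<in>{1..<N}. if \<exists>g\<in>spec D. N dvd s + \<phi> - g then norm (FT (cc \<nu>) s) else 0) \<le> of_int N * \<epsilon>)))"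

text \<open>\<open>(N + 1) div 2\<close> is the inverse of 2 modulo the odd number \<open>N\<close>.
  The equation \<open>x + y = 2 * z\<close> leads to frequencies \<open>2 * k\<close>; these lie in
  a spectrum if \<open>k\<close> lies in the halved one, which has the same complexity.\<close>

definition halve :: "data \<Rightarrow> data" where
  "halve D = map (\<lambda>(r, m). ((N + 1) div 2 * r, m)) D"

lemma spec_halve: "spec (halve D) = (\<lambda>g. (N + 1) div 2 * g) ` spec D"
proof (induction D rule: spec.induct)
  case (2 r m D)
  then show ?case by (simp add: halve_def image_image) (force simp: image_iff algebra_simps)
qed (simp add: halve_def)

lemma lcard_halve: "lcard (halve D) = lcard D"
  by (induction D rule: spec.induct) (auto simp: halve_def)

lemma half_N: "2 * ((N + 1) div 2) = N + 1" using N_odd by (intro dvd_mult_div_cancel) simp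

lemma spec_halve_double:
  assumes "g \<in> spec D" "N dvd 2 * k - g"
  shows "\<exists>g'\<in>spec (halve D). N dvd k - g'"
proof
  show "(N + 1) div 2 * g \<in> spec (halve D)" using assms(1) unfolding spec_halve by (rule imageI)
  have "2 * (k - (N + 1) div 2 * g) = 2 * k - (2 * ((N + 1) div 2)) * g" by (simp only: right_diff_distrib mult.assoc)
  also have "\<dots> = (2 * k - g) - N * g" by (simp only: half_N) (simp add: algebra_simps)
  finally have *: "2 * (k - (N + 1) div 2 * g) = (2 * k - g) - N * g" .
  have "N dvd 2 * (k - (N + 1) div 2 * g)" unfolding * by (rule dvd_diff[OF assms(2)]) simp
  moreover have "coprime N 2" using N_odd by simp
  ultimately show "N dvd k - (N + 1) div 2 * g" using coprime_dvd_mult_right_iff by blast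
qed

text \<open>\<open>chi D\<close> is at most 1 and vanishes off the spectrum modulo \<open>N\<close>,
  so the indicator function in \<open>majorized\<close> dominates it.\<close>

lemma majorizedE:
  assumes "majorized a L H \<epsilon>" "lcard D \<le> L" "0 \<le> \<epsilon>"
  obtains \<nu> where "per \<nu>" "\<And>n. a n \<le> \<nu> n" "norm (FT (cc \<nu>) 0) \<le> of_int N / H"
    "\<And>\<phi>. (\<Sum>s\<in>{1..<N}. norm (FT (cc \<nu>) s) * chi D (s + \<phi>)) \<le> of_int N * \<epsilon>"
proof -
  obtain \<nu> where \<nu>: "per \<nu>" "\<And>n. a n \<le> \<nu> n" "norm (FT (cc \<nu>) 0) \<le> of_int N / H"
    "\<And>\<phi>. (\<Sum>s\<in>{1..<N}. if \<exists>g\<in>spec D. N dvd s + \<phi> - g then norm (FT (cc \<nu>) s) else 0) \<le> of_int N * \<epsilon>"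
    using assms(1,2) unfolding majorized_def by blast
  have "(\<Sum>s\<in>{1..<N}. norm (FT (cc \<nu>) s) * chi D (s + \<phi>)) \<le> of_int N * \<epsilon>" for \<phi>
  proof -
    have "(\<Sum>s\<in>{1..<N}. norm (FT (cc \<nu>) s) * chi D (s + \<phi>))
        \<le> (\<Sum>s\<in>{1..<N}. if \<exists>g\<in>spec D. N dvd s + \<phi> - g then norm (FT (cc \<nu>) s) else 0)"
    proof (rule sum_mono)
      fix s
      show "norm (FT (cc \<nu>) s) * chi D (s + \<phi>) \<le> (if \<exists>g\<in>spec D. N dvd s + \<phi> - g then norm (FT (cc \<nu>) s) else 0)"
        using chi_spec[of D "s + \<phi>"] chi_le_1[of D "s + \<phi>"] chi_nonneg[of D "s + \<phi>"]
        by (cases "chi D (s + \<phi>) = 0") (auto simp: mult_left_le)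
    qed
    with \<nu>(4) show ?thesis by (rule order.trans[rotated])
  qed
  with \<nu>(1-3) that show thesis by blast
qed

lemma majorizedE_half:
  assumes "majorized a L H \<epsilon>" "lcard D \<le> L" "0 \<le> \<epsilon>"
  obtains \<nu> where "per \<nu>" "\<And>n. a n \<le> \<nu> n" "norm (FT (cc \<nu>) 0) \<le> of_int N / H"
    "\<And>\<phi>. (\<Sum>s\<in>{1..<N}. norm (FT (cc \<nu>) s) * chi D (2 * (s + \<phi>))) \<le> of_int N * \<epsilon>"
proof -
  have "lcard (halve D) \<le> L" using assms(2) by (simp add: lcard_halve)
  then obtain \<nu> where \<nu>: "per \<nu>" "\<And>n. a n \<le> \<nu> n" "norm (FT (cc \<nu>) 0) \<le> of_int N / H"
    "\<And>\<phi>. (\<Sum>s\<in>{1..<N}. if \<exists>g\<in>spec (halve D). N dvd s + \<phi> - g then norm (FT (cc \<nu>) s) else 0) \<le> of_int N * \<epsilon>"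
    using assms(1) unfolding majorized_def by blast
  have "(\<Sum>s\<in>{1..<N}. norm (FT (cc \<nu>) s) * chi D (2 * (s + \<phi>))) \<le> of_int N * \<epsilon>" for \<phi>
  proof -
    have "(\<Sum>s\<in>{1..<N}. norm (FT (cc \<nu>) s) * chi D (2 * (s + \<phi>)))
        \<le> (\<Sum>s\<in>{1..<N}. if \<exists>g\<in>spec (halve D). N dvd s + \<phi> - g then norm (FT (cc \<nu>) s) else 0)"
    proof (rule sum_mono)
      fix s
      show "norm (FT (cc \<nu>) s) * chi D (2 * (s + \<phi>)) \<le> (if \<exists>g\<in>spec (halve D). N dvd s + \<phi> - g then norm (FT (cc \<nu>) s) else 0)"
      proof (cases "chi D (2 * (s + \<phi>)) = 0")
        case False
        then have "\<exists>g\<in>spec (halve D). N dvd s + \<phi> - g"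
          using chi_spec spec_halve_double by metis
        then show ?thesis using chi_le_1[of D "2 * (s + \<phi>)"] by (simp add: mult_left_le)
      qed auto
    qed
    with \<nu>(4) show ?thesis by (rule order.trans[rotated])
  qed
  with \<nu>(1-3) that show thesis by blast
qed

lemma dvd_mod_add: "N dvd a mod N + b \<longleftrightarrow> N dvd a + b"
  by (simp add: mod_eq_0_iff_dvd[symmetric] mod_add_left_eq)

lemma eq_if_dvd: "x \<in> {0..<N} \<Longrightarrow> y \<in> {0..<N} \<Longrightarrow> N dvd x - y \<Longrightarrow> x = y"
  by (metis atLeastLessThan_iff mod_eq_dvd_iff mod_pos_pos_trivial)

text \<open>The substitution \<open>u + 2 * n\<close> multiplies frequencies by the inverse of 2 and
  leaves absolute values of the transform unchanged. A majorant chosen for \<open>halve D\<close>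
  and pulled back therefore serves \<open>D\<close>, with the phase multiplied by the same
  inverse.\<close>

lemma majorized_affine:
  assumes "majorized a L H \<epsilon>"
  shows "majorized (\<lambda>n. a (u + 2 * n)) L H \<epsilon>"
  unfolding majorized_def
proof (intro allI impI)
  fix D assume D: "lcard D \<le> L"
  define h where "h = (N + 1) div 2"
  have h: "2 * h = N + 1" unfolding h_def by (rule half_N)
  obtain \<nu> where \<nu>: "per \<nu>" "\<And>n. a n \<le> \<nu> n" "norm (FT (cc \<nu>) 0) \<le> of_int N / H"
    "\<And>\<phi>. (\<Sum>s\<in>{1..<N}. if \<exists>g\<in>spec (halve D). N dvd s + \<phi> - g then norm (FT (cc \<nu>) s) else 0) \<le> of_int N * \<epsilon>"
    using assms D unfolding majorized_def lcard_halve[symmetric, of D] by blast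
  let ?\<nu> = "\<lambda>n. \<nu> (u + 2 * n)"
  have FT: "norm (FT (cc ?\<nu>) (2 * s)) = norm (FT (cc \<nu>) s)" for s
  proof -
    have "per (\<lambda>n. cc \<nu> n * e (- s * n))"
      using \<nu>(1) per_e(1)[of "- s"] by (simp add: per_def)
    from sum_double[OF this, of u]
    have "FT (cc \<nu>) s = (\<Sum>n\<in>{0..<N}. cc ?\<nu> n * e (- s * (u + 2 * n)))" by (simp add: FT_def)
    also have "\<dots> = e (- s * u) * FT (cc ?\<nu>) (2 * s)"
    proof -
      have "e (- s * (u + 2 * n)) = e (- s * u) * e (- (2 * s) * n)" for n
      proof -
        have "- s * (u + 2 * n) = - s * u + - (2 * s) * n" by (simp add: algebra_simps)
        then show ?thesis by (simp only: e_add)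
      qed
      then show ?thesis by (simp add: FT_def sum_distrib_left mult.left_commute)
    qed
    finally show ?thesis by (simp add: norm_mult)
  qed
  have inv: "norm (FT (cc ?\<nu>) s) = norm (FT (cc \<nu>) (h * s))" for s
  proof -
    have "2 * (h * s) = (2 * h) * s" by simp
    also have "\<dots> = s + N * s" by (simp only: h) (simp add: algebra_simps)
    finally have "(2 * (h * s)) mod N = s mod N" by simp
    then have "FT (cc ?\<nu>) (2 * (h * s)) = FT (cc ?\<nu>) s" by (rule perD[OF per_FT])
    then show ?thesis using FT[of "h * s"] by simp
  qed
  show "\<exists>\<nu>'. per \<nu>' \<and> (\<forall>n. a (u + 2 * n) \<le> \<nu>' n) \<and> norm (FT (cc \<nu>') 0) \<le> of_int N / H \<and>
     (\<forall>\<phi>. (\<Sum>s\<in>{1..<N}. if \<exists>g\<in>spec D. N dvd s + \<phi> - g then norm (FT (cc \<nu>') s) else 0) \<le> of_int N * \<epsilon>)"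
  proof (intro exI[of _ ?\<nu>] conjI allI)
    show "per ?\<nu>" by (rule per_comp2[OF \<nu>(1)])
    show "norm (FT (cc ?\<nu>) 0) \<le> of_int N / H" using inv[of 0] \<nu>(3) by simp
    fix \<phi>
    have cop: "coprime N 2" using N_odd by simp
    have dvd2: "N dvd k \<longleftrightarrow> N dvd h * k" for k
    proof
      assume "N dvd h * k"
      then have "N dvd 2 * (h * k)" by simp
      also have "2 * (h * k) = (2 * h) * k" by simp
      also have "\<dots> = k + N * k" by (simp only: h) (simp add: algebra_simps)
      finally show "N dvd k" by (simp add: dvd_add_left_iff)
    qed simp
    have "(\<Sum>s\<in>{1..<N}. if \<exists>g\<in>spec D. N dvd s + \<phi> - g then norm (FT (cc ?\<nu>) s) else 0)
        = (\<Sum>s\<in>{1..<N}. if \<exists>g\<in>spec (halve D). N dvd (h * s) mod N + h * \<phi> - g then norm (FT (cc \<nu>) ((h * s) mod N)) else 0)"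
    proof (intro sum.cong refl)
      fix s
      have "(\<exists>g\<in>spec D. N dvd s + \<phi> - g) \<longleftrightarrow> (\<exists>g\<in>spec (halve D). N dvd (h * s) mod N + h * \<phi> - g)"
      proof -
        have "N dvd s + \<phi> - g \<longleftrightarrow> N dvd (h * s) mod N + h * \<phi> - h * g" for g
        proof -
          have "N dvd s + \<phi> - g \<longleftrightarrow> N dvd h * s + h * \<phi> - h * g"
            using dvd2[of "s + \<phi> - g"] by (simp add: algebra_simps)
          also have "\<dots> \<longleftrightarrow> N dvd (h * s) mod N + h * \<phi> - h * g"
            using dvd_mod_add[of "h * s" "h * \<phi> - h * g"] by (simp add: add_diff_eq)
          finally show ?thesis .
        qed
        then show ?thesis unfolding spec_halve h_def[symmetric] by simp
      qed
      moreover have "norm (FT (cc ?\<nu>) s) = norm (FT (cc \<nu>) ((h * s) mod N))"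
        unfolding inv using per_FT unfolding per_def by metis
      ultimately show "(if \<exists>g\<in>spec D. N dvd s + \<phi> - g then norm (FT (cc ?\<nu>) s) else 0)
        = (if \<exists>g\<in>spec (halve D). N dvd (h * s) mod N + h * \<phi> - g then norm (FT (cc \<nu>) ((h * s) mod N)) else 0)"
        by simp
    qed
    also have "\<dots> = (\<Sum>s\<in>{1..<N}. if \<exists>g\<in>spec (halve D). N dvd s + h * \<phi> - g then norm (FT (cc \<nu>) s) else 0)"
    proof (rule sum.reindex_bij_betw[of "\<lambda>s. (h * s) mod N" "{1..<N}" "{1..<N}"])
      have "inj_on (\<lambda>s. (h * s) mod N) {1..<N}"
      proof (rule inj_onI)
        fix x y assume xy: "x \<in> {1..<N}" "y \<in> {1..<N}" "(h * x) mod N = (h * y) mod N"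
        then have "N dvd h * (x - y)" by (simp add: mod_eq_dvd_iff right_diff_distrib)
        then have "N dvd x - y" using dvd2 by simp
        then show "x = y" using xy eq_if_dvd[of x y] by simp
      qed
      moreover have "(\<lambda>s. (h * s) mod N) ` {1..<N} \<subseteq> {1..<N}"
      proof (clarify)
        fix s assume s: "s \<in> {1..<N}"
        have "\<not> N dvd s" using s zdvd_not_zless by auto
        then have "(h * s) mod N \<noteq> 0" using dvd2 by (simp add: mod_eq_0_iff_dvd)
        moreover have "0 \<le> (h * s) mod N" "(h * s) mod N < N" using N_pos by simp_all
        ultimately show "(h * s) mod N \<in> {1..<N}" by auto
      qed
      ultimately show "bij_betw (\<lambda>s. (h * s) mod N) {1..<N} {1..<N}"
        unfolding bij_betw_def using endo_inj_surj[of "{1..<N}"] by blast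
    qed
    also have "\<dots> \<le> of_int N * \<epsilon>" by (rule \<nu>(4))
    finally show "(\<Sum>s\<in>{1..<N}. if \<exists>g\<in>spec D. N dvd s + \<phi> - g then norm (FT (cc ?\<nu>) s) else 0) \<le> of_int N * \<epsilon>" .
  qed (use \<nu>(2) in simp)
qed


section \<open>Progression-free functions and squares of weights\<close>

definition ap_free :: "(int \<Rightarrow> real) \<Rightarrow> bool" where
  "ap_free a \<longleftrightarrow> (\<forall>x y z. a x \<noteq> 0 \<and> a y \<noteq> 0 \<and> a z \<noteq> 0 \<and> N dvd x + y - 2 * z \<longrightarrow> N dvd x - z)"

lemma ap_free_affine:
  assumes "ap_free a"
  shows "ap_free (\<lambda>n. a (u + 2 * n))"
  unfolding ap_free_def
proof (intro allI impI, elim conjE)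
  fix x y z assume *: "a (u + 2 * x) \<noteq> 0" "a (u + 2 * y) \<noteq> 0" "a (u + 2 * z) \<noteq> 0" "N dvd x + y - 2 * z"
  have "(u + 2 * x) + (u + 2 * y) - 2 * (u + 2 * z) = 2 * (x + y - 2 * z)" by simp
  then have "N dvd (u + 2 * x) + (u + 2 * y) - 2 * (u + 2 * z)" using *(4) by (metis dvd_mult)
  then have "N dvd (u + 2 * x) - (u + 2 * z)" using assms * unfolding ap_free_def by blast
  then have "N dvd 2 * (x - z)" by simp
  moreover have "coprime N 2" using N_odd by simp
  ultimately show "N dvd x - z" using coprime_dvd_mult_right_iff by blast
qed

lemma wt_double: "wt (scale 2 D) n = (wt D n)\<^sup>2"
  by (simp add: wt_scale)

lemma Z_double: "(\<Sum>x\<in>{0..<N}. (wt D x)\<^sup>2) = Z (scale 2 D)"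
  by (simp add: Z_def wt_double)

lemma wt_shift_sum:
  "(\<Sum>x\<in>{0..<N}. wt D x * \<bar>wt D (x + v) - wt D x\<bar>) \<le> Z (scale 2 D) * tv (scale 2 D) v"
proof -
  have "(\<Sum>x\<in>{0..<N}. wt D x * \<bar>wt D (x + v) - wt D x\<bar>) \<le> (\<Sum>x\<in>{0..<N}. \<bar>(wt D (x + v))\<^sup>2 - (wt D x)\<^sup>2\<bar>)"
  proof (rule sum_mono)
    fix x
    have "(wt D (x + v))\<^sup>2 - (wt D x)\<^sup>2 = (wt D (x + v) + wt D x) * (wt D (x + v) - wt D x)"
      by (simp add: power2_eq_square algebra_simps)
    then have "\<bar>(wt D (x + v))\<^sup>2 - (wt D x)\<^sup>2\<bar> = (wt D (x + v) + wt D x) * \<bar>wt D (x + v) - wt D x\<bar>"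
      using wt_pos[of D x] wt_pos[of D "x + v"] by (simp add: abs_mult)
    then show "wt D x * \<bar>wt D (x + v) - wt D x\<bar> \<le> \<bar>(wt D (x + v))\<^sup>2 - (wt D x)\<^sup>2\<bar>"
      using wt_pos[of D "x + v"] by (simp add: mult_right_mono)
  qed
  also have "\<dots> = Z (scale 2 D) * tv (scale 2 D) v"
    unfolding tv_def sum_distrib_left
  proof (intro sum.cong refl)
    fix x
    have "\<pi> (scale 2 D) (x + v) - \<pi> (scale 2 D) x = ((wt D (x + v))\<^sup>2 - (wt D x)\<^sup>2) / Z (scale 2 D)"
      by (simp add: \<pi>_def wt_double diff_divide_distrib)
    then show "\<bar>(wt D (x + v))\<^sup>2 - (wt D x)\<^sup>2\<bar> = Z (scale 2 D) * \<bar>\<pi> (scale 2 D) (x + v) - \<pi> (scale 2 D) x\<bar>"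
      using Z_pos[of "scale 2 D"] by (simp add: abs_divide)
  qed
  finally show ?thesis .
qed

end

subsection \<open>One step of the density increment\<close>

text \<open>The objects of one step of the density increment argument: the square of the weight of \<open>D\<close>
  carries the long variables, the weight of \<open>M\<close> the short one.\<close>

locale increment = cyclic +
  fixes a :: "int \<Rightarrow> real" and D M :: data and p \<epsilon> :: real
  assumes a01: "a n = 0 \<or> a n = 1" and per_a: "per a" and free: "ap_free a"
    and p_def: "p = (\<Sum>x\<in>{0..<N}. \<pi> (scale 2 D) x * a x)" and p_pos: "0 < p"
    and eps_pos: "0 < \<epsilon>"
    and tv_M: "(\<Sum>z\<in>{0..<N}. \<pi> M z * tv (scale 2 D) (2 * z)) \<le> \<epsilon>"
    and Z_eps: "1 / Z (scale 2 D) \<le> \<epsilon>"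
begin

abbreviation "D2 \<equiv> scale 2 D"
abbreviation "w \<equiv> wt D"
abbreviation "\<mu> \<equiv> \<pi> M"

text \<open>Each of the two long variables carries one factor \<open>w\<close>. For short
  \<open>z\<close> the product \<open>w x * w (2 * z - x)\<close> is close to
  \<open>(w x)^2\<close>, the measure for which \<open>p\<close> is the density; hence
  \<open>b\<close> is orthogonal to \<open>w\<close>, see \<open>sum_bw\<close>.\<close>

definition b :: "int \<Rightarrow> real" where "b x = (a x - p) * w x"

definition B :: "int \<Rightarrow> real" where "B z = (\<Sum>x\<in>{0..<N}. b x * b (2 * z - x)) / Z D2"

lemma a_bounds: "0 \<le> a n" "a n \<le> 1" using a01[of n] by auto

lemma p_le_1: "p \<le> 1"
proof -
  have "p \<le> (\<Sum>x\<in>{0..<N}. \<pi> D2 x)"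
    unfolding p_def by (intro sum_mono mult_left_le a_bounds \<pi>_nonneg)
  then show ?thesis by (simp add: sum_\<pi>)
qed

lemma \<pi>D2: "\<pi> D2 x = (w x)\<^sup>2 / Z D2" by (simp add: \<pi>_def wt_double)

lemma sum_aw2: "(\<Sum>x\<in>{0..<N}. a x * (w x)\<^sup>2) = p * Z D2"
proof -
  have "p * Z D2 = (\<Sum>x\<in>{0..<N}. (w x)\<^sup>2 / Z D2 * a x * Z D2)"
    unfolding p_def \<pi>D2 sum_distrib_right by simp
  also have "\<dots> = (\<Sum>x\<in>{0..<N}. a x * (w x)\<^sup>2)"
    using Z_pos[of D2] by (intro sum.cong) auto
  finally show ?thesis by simp
qed

lemma sum_bw: "(\<Sum>x\<in>{0..<N}. b x * w x) = 0"
proof -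
  have "(\<Sum>x\<in>{0..<N}. b x * w x) = (\<Sum>x\<in>{0..<N}. a x * (w x)\<^sup>2 - p * (w x)\<^sup>2)"
    by (intro sum.cong) (auto simp: b_def power2_eq_square algebra_simps)
  also have "\<dots> = p * Z D2 - p * Z D2"
    by (simp only: sum_subtractf sum_distrib_left[symmetric] sum_aw2 Z_double)
  finally show ?thesis by simp
qed

lemma abs_b: "\<bar>b x\<bar> \<le> w x" "\<bar>b x\<bar> \<le> (a x + p) * w x"
proof -
  have "\<bar>a x - p\<bar> \<le> 1" "\<bar>a x - p\<bar> \<le> a x + p" using a_bounds[of x] p_pos p_le_1 by auto
  then show "\<bar>b x\<bar> \<le> w x" "\<bar>b x\<bar> \<le> (a x + p) * w x"
    using wt_pos[of D x] by (simp_all add: b_def abs_mult mult_right_mono mult_left_le_one_le)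
qed

lemma per_b: "per b" using per_a per_wt[of D] by (simp add: per_def b_def)

text \<open>Where \<open>a z = 1\<close>, the only \<open>x\<close> with \<open>a x\<close> and
  \<open>a (2 * z - x)\<close> both nonzero is \<open>z\<close> itself, so the sum \<open>?S\<close>
  is at most 1. Expanding \<open>a * w = b + p * w\<close> in it produces \<open>Z D2 * B z\<close>,
  a main term \<open>p^2 * Z D2\<close> and negligible cross terms. So \<open>B z\<close> is about
  \<open>- p^2\<close> or less on the support of \<open>a\<close>.\<close>

lemma correlation:
  "(\<Sum>z\<in>{0..<N}. \<mu> z * (a z * B z)) \<le> 4 * \<epsilon> - p\<^sup>2 * (\<Sum>z\<in>{0..<N}. \<mu> z * a z)"
proof -
  have *: "a z * B z \<le> \<epsilon> - p\<^sup>2 * a z + 3 * tv D2 (2 * z)" for z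
  proof -
    let ?S = "\<Sum>x\<in>{0..<N}. (a x * w x) * (a (2 * z - x) * w (2 * z - x))"
    let ?X = "\<Sum>x\<in>{0..<N}. b x * w (2 * z - x)"
    let ?Y = "\<Sum>x\<in>{0..<N}. w x * w (2 * z - x)"
    have aw: "a x * w x = b x + p * w x" for x by (simp add: b_def algebra_simps)
    have X': "(\<Sum>x\<in>{0..<N}. w x * b (2 * z - x)) = ?X"
    proof -
      have "per (\<lambda>x. w x * b (2 * z - x))"
        using per_wt[of D] per_reflect[OF per_b, of "2 * z"] by (simp add: per_def)
      from sum_reflect[OF this, of "2 * z"] show ?thesis by (simp add: mult.commute)
    qed
    have "?S = Z D2 * B z + p * ?X + p * (\<Sum>x\<in>{0..<N}. w x * b (2 * z - x)) + p\<^sup>2 * ?Y"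
      unfolding aw B_def sum_distrib_left using Z_pos[of D2]
      by (simp add: sum.distrib[symmetric] algebra_simps power2_eq_square)
    then have S: "?S = Z D2 * B z + 2 * p * ?X + p\<^sup>2 * ?Y" unfolding X' by simp
    have w2z: "w (2 * z - x) = w (x + - (2 * z))" for x using wt_uminus[of D "2 * z - x"] by simp
    have K: "(\<Sum>x\<in>{0..<N}. w x * \<bar>w (2 * z - x) - w x\<bar>) \<le> Z D2 * tv D2 (2 * z)"
      using wt_shift_sum[of D "- (2 * z)"] unfolding w2z tv_uminus .
    \<comment> \<open>By orthogonality \<open>w x\<close> may be subtracted from
      \<open>w (2 * z - x)\<close>, and only the change of the weight under a short shift
      remains.\<close>
    have "\<bar>?X\<bar> \<le> Z D2 * tv D2 (2 * z)"
    proof -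
      have "?X = (\<Sum>x\<in>{0..<N}. b x * (w (2 * z - x) - w x))"
        using sum_bw by (simp add: right_diff_distrib sum_subtractf)
      also have "\<bar>\<dots>\<bar> \<le> (\<Sum>x\<in>{0..<N}. \<bar>b x * (w (2 * z - x) - w x)\<bar>)" by (rule sum_abs)
      also have "\<dots> \<le> (\<Sum>x\<in>{0..<N}. w x * \<bar>w (2 * z - x) - w x\<bar>)"
        unfolding abs_mult by (intro sum_mono mult_right_mono abs_b) auto
      finally show ?thesis using K by linarith
    qed
    then have X: "p * ?X \<ge> - (Z D2 * tv D2 (2 * z))"
    proof -
      have "\<bar>p * ?X\<bar> \<le> 1 * (Z D2 * tv D2 (2 * z))"
        unfolding abs_mult by (rule mult_mono) (use \<open>\<bar>?X\<bar> \<le> _\<close> p_pos p_le_1 in auto)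
      then show ?thesis by simp
    qed
    have Y: "p\<^sup>2 * ?Y \<ge> p\<^sup>2 * Z D2 - Z D2 * tv D2 (2 * z)"
    proof -
      have "Z D2 - ?Y = (\<Sum>x\<in>{0..<N}. w x * (w x - w (2 * z - x)))"
        unfolding Z_double[symmetric] sum_subtractf[symmetric] by (simp add: power2_eq_square algebra_simps)
      also have "\<dots> \<le> (\<Sum>x\<in>{0..<N}. w x * \<bar>w (2 * z - x) - w x\<bar>)"
        using wt_pos[of D] by (intro sum_mono mult_left_mono) (auto simp: less_imp_le)
      finally have "p\<^sup>2 * (Z D2 - ?Y) \<le> p\<^sup>2 * (Z D2 * tv D2 (2 * z))" using K by (intro mult_left_mono) auto
      also have "\<dots> \<le> 1 * (Z D2 * tv D2 (2 * z))"
        using p_pos p_le_1 Z_pos[of D2] by (intro mult_right_mono) (auto simp: power_le_one tv_def sum_nonneg)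
      finally show ?thesis by (simp add: algebra_simps)
    qed
    show ?thesis
    proof (cases "a z = 0")
      case True
      then show ?thesis using eps_pos by (simp add: tv_def sum_nonneg)
    next
      case False
      have "?S \<le> (\<Sum>x\<in>{0..<N}. if x = z mod N then 1 else 0)"
      proof (rule sum_mono)
        fix x assume x: "x \<in> {0..<N}"
        show "a x * w x * (a (2 * z - x) * w (2 * z - x)) \<le> (if x = z mod N then 1 else 0)"
        proof (cases "a x = 0 \<or> a (2 * z - x) = 0")
          case True then show ?thesis by auto
        next
          case nz: False
          then have "N dvd x - z" using free False unfolding ap_free_def
            by (metis diff_self dvd_0_right add.commute diff_add_cancel)
          then have "x = z mod N" using x by (metis atLeastLessThan_iff mod_eq_dvd_iff mod_pos_pos_trivial)
          moreover have "a x * w x * (a (2 * z - x) * w (2 * z - x)) \<le> 1"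
            using a_bounds wt_pos[of D] wt_le_1[of D] by (intro mult_le_one) (auto simp: less_imp_le)
          ultimately show ?thesis by simp
        qed
      qed
      also have "\<dots> = 1" using N_pos by simp
      finally have "Z D2 * B z \<le> 1 - p\<^sup>2 * Z D2 + 3 * (Z D2 * tv D2 (2 * z))" using S X Y by linarith
      then have "B z \<le> (1 - p\<^sup>2 * Z D2 + 3 * (Z D2 * tv D2 (2 * z))) / Z D2"
        using Z_pos[of D2] by (simp add: field_simps)
      also have "\<dots> = 1 / Z D2 - p\<^sup>2 + 3 * tv D2 (2 * z)"
        using Z_pos[of D2] by (simp add: field_simps)
      finally show ?thesis using a01[of z] False Z_eps by simp
    qed
  qed
  have "(\<Sum>z\<in>{0..<N}. \<mu> z * (a z * B z)) \<le> (\<Sum>z\<in>{0..<N}. \<mu> z * (\<epsilon> - p\<^sup>2 * a z + 3 * tv D2 (2 * z)))"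
    by (intro sum_mono mult_left_mono * \<pi>_nonneg)
  also have "\<dots> = \<epsilon> * (\<Sum>z\<in>{0..<N}. \<mu> z) - p\<^sup>2 * (\<Sum>z\<in>{0..<N}. \<mu> z * a z) + 3 * (\<Sum>z\<in>{0..<N}. \<mu> z * tv D2 (2 * z))"
    unfolding sum_distrib_left sum_subtractf[symmetric] sum.distrib[symmetric]
    by (intro sum.cong) (auto simp: algebra_simps)
  finally show ?thesis using tv_M sum_\<pi>[of M] by simp
qed

section \<open>Fourier mass of the balanced function\<close>

abbreviation F :: "int \<Rightarrow> complex" where "F \<equiv> FT (cc b)"

abbreviation Fsq :: "int \<Rightarrow> real" where "Fsq r \<equiv> (norm (F r))\<^sup>2"

text \<open>Smoothed mass of \<open>Fsq\<close> at those \<open>s\<close> for which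
  \<open>2 * (r + s)\<close> falls into the spectrum of \<open>M\<close>. A large value means that
  \<open>b\<close> correlates with a single phase on translates of the short weight.\<close>

definition MM :: "int \<Rightarrow> real" where
  "MM r = (\<Sum>s\<in>{0..<N}. Fsq s * chi M (2 * (r + s)))"

definition \<Omega> :: real where "\<Omega> = (\<Sum>r\<in>{0..<N}. Fsq r * MM r)"

lemma MM_nonneg: "0 \<le> MM r" unfolding MM_def by (intro sum_nonneg mult_nonneg_nonneg chi_nonneg) auto

lemma per_Fsq: "per Fsq" using per_FT[of "cc b"] by (simp add: per_def)

lemma per_chi: "per (chi M)"
  unfolding per_def
proof
  fix k
  have "e ((k mod N) * n) = e (k * n)" for n by (rule e_cong) (rule mod_mult_left_eq)
  then show "chi M (k mod N) = chi M k" unfolding chi_def by (intro arg_cong[of _ _ Re] sum.cong arg_cong2[of _ _ _ _ "(*)"] refl)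
qed

lemma per_MM: "per MM"
proof -
  have "chi M (2 * (r mod N + s)) = chi M (2 * (r + s))" for r s
  proof (rule perD[OF per_chi])
    have "(2 * (r mod N + s)) mod N = (2 * ((r mod N + s) mod N)) mod N" by (rule mod_mult_right_eq[symmetric])
    also have "\<dots> = (2 * ((r + s) mod N)) mod N" by (simp only: mod_add_left_eq)
    also have "\<dots> = (2 * (r + s)) mod N" by (rule mod_mult_right_eq)
    finally show "(2 * (r mod N + s)) mod N = (2 * (r + s)) mod N" .
  qed
  then show ?thesis unfolding per_def MM_def by (intro allI sum.cong arg_cong2[of _ _ _ _ "(*)"] refl)
qed

lemma sum_Fsq: "(\<Sum>r\<in>{0..<N}. Fsq r) \<le> of_int N * Z D2"
proof -
  have "(\<Sum>x\<in>{0..<N}. (b x)\<^sup>2) \<le> (\<Sum>x\<in>{0..<N}. (w x)\<^sup>2)"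
    using abs_b(1) by (intro sum_mono) (metis power2_abs abs_ge_zero power_mono)
  then show ?thesis unfolding Parseval[OF per_b] Z_double[symmetric] using N_pos by (intro mult_left_mono) auto
qed

lemma FT_B: "complex_of_real (of_int N * (Z D2 * B z)) = (\<Sum>r\<in>{0..<N}. (F r)\<^sup>2 * e (r * (2 * z)))"
  using FT_conv[OF per_cc[OF per_b], of "cc b" "2 * z"] Z_pos[of D2]
  by (simp add: B_def power2_eq_square)

text \<open>Twisted second moment of \<open>B\<close> in unnormalised form: expanding a majorant in
  characters turns the mean of its product with \<open>B^2\<close> into a combination of these
  values.\<close>

definition QQ :: "int \<Rightarrow> complex" where "QQ s = (\<Sum>z\<in>{0..<N}. cc \<mu> z * e (s * z) * (complex_of_real (of_int N * (Z D2 * B z)))\<^sup>2)"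

lemma square_sum: "(\<Sum>i\<in>A. f i)\<^sup>2 = (\<Sum>i\<in>A. \<Sum>j\<in>A. f i * f j)" for f :: "int \<Rightarrow> 'b::comm_semiring_1"
  by (simp only: power2_eq_square sum_product)

lemma QQ_bound: "norm (QQ s) \<le> (\<Sum>r\<in>{0..<N}. \<Sum>r'\<in>{0..<N}. Fsq r * Fsq r' * chi M (s + 2 * (r + r')))"
proof -
  have "QQ s = (\<Sum>z\<in>{0..<N}. \<Sum>r\<in>{0..<N}. \<Sum>r'\<in>{0..<N}. (F r)\<^sup>2 * (F r')\<^sup>2 * (cc \<mu> z * e ((s + 2 * (r + r')) * z)))"
  proof -
    have "cc \<mu> z * e (s * z) * (((F r)\<^sup>2 * e (r * (2 * z))) * ((F r')\<^sup>2 * e (r' * (2 * z))))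
       = (F r)\<^sup>2 * (F r')\<^sup>2 * (cc \<mu> z * e ((s + 2 * (r + r')) * z))" for r r' z
    proof -
      have "(s + 2 * (r + r')) * z = s * z + (r * (2 * z) + r' * (2 * z))" by (simp add: algebra_simps)
      then show ?thesis by (simp add: e_add)
    qed
    then show ?thesis unfolding QQ_def FT_B square_sum sum_distrib_left by (simp only:)
  qed
  also have "\<dots> = (\<Sum>r\<in>{0..<N}. \<Sum>r'\<in>{0..<N}. \<Sum>z\<in>{0..<N}. (F r)\<^sup>2 * (F r')\<^sup>2 * (cc \<mu> z * e ((s + 2 * (r + r')) * z)))"
    by (subst sum.swap) (intro sum.cong refl sum.swap)
  also have "\<dots> = (\<Sum>r\<in>{0..<N}. \<Sum>r'\<in>{0..<N}. (F r)\<^sup>2 * (F r')\<^sup>2 * complex_of_real (chi M (s + 2 * (r + r'))))"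
    by (simp only: sum_distrib_left[symmetric] chi_complex)
  finally have *: "QQ s = (\<Sum>r\<in>{0..<N}. \<Sum>r'\<in>{0..<N}. (F r)\<^sup>2 * (F r')\<^sup>2 * complex_of_real (chi M (s + 2 * (r + r'))))" .
  show ?thesis
    unfolding * by (intro sum_norm_le) (simp add: norm_mult norm_power chi_nonneg)
qed

lemma QQ_0: "QQ 0 = complex_of_real ((of_int N * Z D2)\<^sup>2 * (\<Sum>z\<in>{0..<N}. \<mu> z * (B z)\<^sup>2))"
  unfolding QQ_def by (simp add: sum_distrib_left power_mult_distrib mult_ac)

lemma NZ_pos: "0 < of_int N * Z D2" using N_pos Z_pos[of D2] by simp

lemma \<Omega>_ge: "(of_int N * Z D2)\<^sup>2 * (\<Sum>z\<in>{0..<N}. \<mu> z * (B z)\<^sup>2) \<le> \<Omega>"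
proof -
  have "(of_int N * Z D2)\<^sup>2 * (\<Sum>z\<in>{0..<N}. \<mu> z * (B z)\<^sup>2) = norm (QQ 0)"
    unfolding QQ_0 norm_of_real by (simp add: sum_nonneg \<pi>_nonneg)
  also have "\<dots> \<le> \<Omega>" using QQ_bound[of 0] unfolding \<Omega>_def MM_def by (simp add: sum_distrib_left mult.assoc)
  finally show ?thesis .
qed

text \<open>The majorant is applied once here, to the short variable \<open>z\<close>, and once more in
  \<open>\<Omega>_le\<close> below, to the long variable; only thereby is one factor \<open>H\<close> gained each time.\<close>

lemma majorant_short:
  assumes "majorized a L H \<epsilon>" "lcard M \<le> L" "0 < H"
  shows "(\<Sum>z\<in>{0..<N}. \<mu> z * (a z * (B z)\<^sup>2)) \<le> (\<Sum>z\<in>{0..<N}. \<mu> z * (B z)\<^sup>2) / H + \<epsilon>"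
proof -
  obtain \<nu> where \<nu>: "per \<nu>" "\<And>n. a n \<le> \<nu> n" "norm (FT (cc \<nu>) 0) \<le> of_int N / H"
    "\<And>\<phi>. (\<Sum>s\<in>{1..<N}. norm (FT (cc \<nu>) s) * chi M (s + \<phi>)) \<le> of_int N * \<epsilon>"
    by (rule majorizedE[OF assms(1,2) less_imp_le[OF eps_pos]]) blast
  let ?S = "\<Sum>z\<in>{0..<N}. \<mu> z * (\<nu> z * (B z)\<^sup>2)"
  let ?NZ = "of_int N * Z D2"
  let ?R = "\<Sum>s\<in>{1..<N}. FT (cc \<nu>) s * QQ s"
  have ins: "{0..<N} = insert 0 {1..<N}" using N_pos by auto
  have "complex_of_real (of_int N * (?NZ\<^sup>2 * ?S)) = (\<Sum>z\<in>{0..<N}. cc \<mu> z * (of_int N * cc \<nu> z) * (complex_of_real (of_int N * (Z D2 * B z)))\<^sup>2)"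
    by (simp add: sum_distrib_left power_mult_distrib mult_ac)
  also have "\<dots> = (\<Sum>z\<in>{0..<N}. \<Sum>s\<in>{0..<N}. FT (cc \<nu>) s * (cc \<mu> z * e (s * z) * (complex_of_real (of_int N * (Z D2 * B z)))\<^sup>2))"
    unfolding FT_inversion[OF per_cc[OF \<nu>(1)], symmetric] sum_distrib_left sum_distrib_right
    by (simp only: mult.assoc mult.left_commute)
  also have "\<dots> = (\<Sum>s\<in>{0..<N}. FT (cc \<nu>) s * QQ s)"
    unfolding QQ_def sum_distrib_left by (rule sum.swap)
  also have "\<dots> = FT (cc \<nu>) 0 * QQ 0 + ?R"
    unfolding ins by (subst sum.insert) auto
  finally have eq: "complex_of_real (of_int N * (?NZ\<^sup>2 * ?S)) = FT (cc \<nu>) 0 * QQ 0 + ?R" .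
  have "of_int N * (?NZ\<^sup>2 * ?S) = Re (FT (cc \<nu>) 0 * QQ 0 + ?R)"
    unfolding eq[symmetric] by (rule Re_complex_of_real[symmetric])
  then have le: "of_int N * (?NZ\<^sup>2 * ?S) \<le> norm (FT (cc \<nu>) 0 * QQ 0) + norm ?R"
    using complex_Re_le_cmod[of "FT (cc \<nu>) 0 * QQ 0 + ?R"] norm_triangle_ineq[of "FT (cc \<nu>) 0 * QQ 0" ?R] by linarith
  have le0: "norm (FT (cc \<nu>) 0 * QQ 0) \<le> of_int N / H * (?NZ\<^sup>2 * (\<Sum>z\<in>{0..<N}. \<mu> z * (B z)\<^sup>2))"
  proof -
    have "0 \<le> ?NZ\<^sup>2 * (\<Sum>z\<in>{0..<N}. \<mu> z * (B z)\<^sup>2)"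
      by (intro mult_nonneg_nonneg sum_nonneg \<pi>_nonneg) auto
    then show ?thesis unfolding norm_mult QQ_0 norm_of_real abs_of_nonneg[OF \<open>0 \<le> _\<close>]
      by (intro mult_right_mono \<nu>(3))
  qed
  have le1: "norm ?R \<le> ?NZ\<^sup>2 * (of_int N * \<epsilon>)"
  proof -
    let ?W = "\<lambda>s r r'. Fsq r * Fsq r' * (norm (FT (cc \<nu>) s) * chi M (s + 2 * (r + r')))"
    have "norm ?R \<le> (\<Sum>s\<in>{1..<N}. norm (FT (cc \<nu>) s) * (\<Sum>r\<in>{0..<N}. \<Sum>r'\<in>{0..<N}. Fsq r * Fsq r' * chi M (s + 2 * (r + r'))))"
      by (rule sum_norm_le) (simp only: norm_mult mult_left_mono QQ_bound norm_ge_zero)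
    moreover have "(\<Sum>s\<in>{1..<N}. norm (FT (cc \<nu>) s) * (\<Sum>r\<in>{0..<N}. \<Sum>r'\<in>{0..<N}. Fsq r * Fsq r' * chi M (s + 2 * (r + r'))))
        = (\<Sum>s\<in>{1..<N}. \<Sum>r\<in>{0..<N}. \<Sum>r'\<in>{0..<N}. ?W s r r')"
      unfolding sum_distrib_left by (simp only: mult.assoc mult.left_commute)
    \<comment> \<open>For fixed \<open>r\<close> and \<open>r'\<close> the inner sum over
      \<open>s\<close> is an instance of \<open>\<nu>(4)\<close> with phase
      \<open>2 * (r + r')\<close>. These phases are out of control, which is why
      \<open>majorized\<close> asks for a bound uniform in the phase.\<close>
    moreover have "\<dots> = (\<Sum>r\<in>{0..<N}. \<Sum>r'\<in>{0..<N}. \<Sum>s\<in>{1..<N}. ?W s r r')"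
      by (subst sum.swap) (intro sum.cong refl sum.swap)
    moreover have "\<dots> \<le> (\<Sum>r\<in>{0..<N}. \<Sum>r'\<in>{0..<N}. Fsq r * Fsq r' * (of_int N * \<epsilon>))"
      unfolding sum_distrib_left[symmetric] by (intro sum_mono mult_left_mono \<nu>(4)) auto
    moreover have "\<dots> = (\<Sum>r\<in>{0..<N}. Fsq r)\<^sup>2 * (of_int N * \<epsilon>)"
      unfolding square_sum sum_distrib_right ..
    moreover have "\<dots> \<le> ?NZ\<^sup>2 * (of_int N * \<epsilon>)"
      using sum_Fsq N_pos eps_pos by (intro mult_right_mono power_mono sum_nonneg) auto
    ultimately show ?thesis by linarith
  qed
  have "of_int N * ?NZ\<^sup>2 * ?S \<le> of_int N * ?NZ\<^sup>2 * ((\<Sum>z\<in>{0..<N}. \<mu> z * (B z)\<^sup>2) / H + \<epsilon>)"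
    using le le0 le1 by (simp add: algebra_simps)
  moreover have "0 < of_int N * ?NZ\<^sup>2" using N_pos Z_pos[of D2] by (intro mult_pos_pos zero_less_power) auto
  ultimately have "?S \<le> (\<Sum>z\<in>{0..<N}. \<mu> z * (B z)\<^sup>2) / H + \<epsilon>" by (simp only: mult_le_cancel_left_pos)
  moreover have "(\<Sum>z\<in>{0..<N}. \<mu> z * (a z * (B z)\<^sup>2)) \<le> ?S"
    by (intro sum_mono mult_left_mono mult_right_mono \<nu>(2) \<pi>_nonneg) auto
  ultimately show ?thesis by linarith
qed

lemma sum_norm_eq_sqrt_bound:
  fixes f g :: "int \<Rightarrow> real"
  assumes "\<And>x. 0 \<le> u x"
  shows "(\<Sum>x\<in>A. u x * (f x * g x))\<^sup>2 \<le> (\<Sum>x\<in>A. u x * (f x)\<^sup>2) * (\<Sum>x\<in>A. u x * (g x)\<^sup>2)"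
proof -
  have "(\<Sum>x\<in>A. (sqrt (u x) * f x) * (sqrt (u x) * g x))\<^sup>2 \<le> (\<Sum>x\<in>A. (sqrt (u x) * f x)\<^sup>2) * (\<Sum>x\<in>A. (sqrt (u x) * g x)\<^sup>2)"
    by (rule Cauchy_Schwarz_ineq_sum)
  moreover have "(sqrt (u x) * f x) * (sqrt (u x) * g x) = u x * (f x * g x)" for x
  proof -
    have "(sqrt (u x) * f x) * (sqrt (u x) * g x) = (sqrt (u x) * sqrt (u x)) * (f x * g x)" by (simp only: mult_ac)
    then show ?thesis using assms[of x] by simp
  qed
  moreover have "(sqrt (u x) * f x)\<^sup>2 = u x * (f x)\<^sup>2" for x f using assms[of x] by (simp add: power_mult_distrib)
  ultimately show ?thesis by (simp only:)
qed

text \<open>The function dual to \<open>b\<close> in the form \<open>\<Omega>\<close>: its transform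
  is that of \<open>b\<close> damped by \<open>MM\<close>, up to the factor
  \<open>N\<close>.\<close>

definition G :: "int \<Rightarrow> complex" where "G x = (\<Sum>r\<in>{0..<N}. F r * of_real (MM r) * e (r * x))"

lemma \<Omega>_eq: "complex_of_real \<Omega> = (\<Sum>x\<in>{0..<N}. of_real (b x) * G x)"
proof -
  have "complex_of_real (Fsq r) = F r * (\<Sum>x\<in>{0..<N}. of_real (b x) * e (r * x))" for r
  proof -
    have "cnj (F r) = (\<Sum>x\<in>{0..<N}. of_real (b x) * e (r * x))"
      unfolding FT_cnj[symmetric] by (simp add: FT_def)
    then show ?thesis by (metis complex_norm_square)
  qed
  then have "complex_of_real \<Omega> = (\<Sum>r\<in>{0..<N}. F r * (\<Sum>x\<in>{0..<N}. of_real (b x) * e (r * x)) * of_real (MM r))"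
    unfolding \<Omega>_def by (simp only: of_real_sum of_real_mult)
  also have "\<dots> = (\<Sum>r\<in>{0..<N}. \<Sum>x\<in>{0..<N}. of_real (b x) * (F r * of_real (MM r) * e (r * x)))"
    unfolding sum_distrib_left sum_distrib_right by (simp only: mult.assoc mult.left_commute mult.commute)
  also have "\<dots> = (\<Sum>x\<in>{0..<N}. of_real (b x) * G x)"
    unfolding G_def sum_distrib_left by (rule sum.swap)
  finally show ?thesis .
qed

lemma G_corr:
  "(\<Sum>x\<in>{0..<N}. complex_of_real ((norm (G x))\<^sup>2) * e (s * x))
     = of_int N * (\<Sum>r\<in>{0..<N}. F r * of_real (MM r) * cnj (F (r + s) * of_real (MM (r + s))))"
proof -
  let ?f = "\<lambda>r. F r * of_real (MM r)"
  have per_f: "per (\<lambda>r. cnj (?f r))" using per_MM per_FT[of "cc b"] by (simp add: per_def)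
  have "complex_of_real ((norm (G x))\<^sup>2) * e (s * x) = (\<Sum>r\<in>{0..<N}. \<Sum>r'\<in>{0..<N}. ?f r * (cnj (?f r') * e (((r + s) - r') * x)))" for x
  proof -
    have cG: "cnj (G x) = (\<Sum>r'\<in>{0..<N}. cnj (?f r') * e (- (r' * x)))"
      unfolding G_def by (simp add: e_minus)
    have "complex_of_real ((norm (G x))\<^sup>2) = (\<Sum>r\<in>{0..<N}. ?f r * e (r * x)) * (\<Sum>r'\<in>{0..<N}. cnj (?f r') * e (- (r' * x)))"
      unfolding complex_norm_square cG by (simp only: G_def)
    then have sq: "complex_of_real ((norm (G x))\<^sup>2) = (\<Sum>r\<in>{0..<N}. \<Sum>r'\<in>{0..<N}. (?f r * e (r * x)) * (cnj (?f r') * e (- (r' * x))))"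
      unfolding sum_product .
    have "(?f r * e (r * x)) * (cnj (?f r') * e (- (r' * x))) * e (s * x) = ?f r * (cnj (?f r') * e (((r + s) - r') * x))" for r r'
    proof -
      have "((r + s) - r') * x = r * x + (- (r' * x) + s * x)" by (simp add: algebra_simps)
      then show ?thesis by (simp only: e_add mult.assoc mult.left_commute)
    qed
    then show ?thesis unfolding sq sum_distrib_right by (intro sum.cong refl)
  qed
  then have "(\<Sum>x\<in>{0..<N}. complex_of_real ((norm (G x))\<^sup>2) * e (s * x))
     = (\<Sum>x\<in>{0..<N}. \<Sum>r\<in>{0..<N}. \<Sum>r'\<in>{0..<N}. ?f r * (cnj (?f r') * e (((r + s) - r') * x)))" by (simp only:)
  also have "\<dots> = (\<Sum>r\<in>{0..<N}. \<Sum>r'\<in>{0..<N}. \<Sum>x\<in>{0..<N}. ?f r * (cnj (?f r') * e (((r + s) - r') * x)))"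
    by (subst sum.swap) (intro sum.cong refl sum.swap)
  also have "\<dots> = (\<Sum>r\<in>{0..<N}. ?f r * (\<Sum>r'\<in>{0..<N}. cnj (?f r') * (if N dvd (r + s) - r' then of_int N else 0)))"
    by (simp only: sum_distrib_left[symmetric] sum_e)
  also have "\<dots> = (\<Sum>r\<in>{0..<N}. ?f r * (of_int N * cnj (?f (r + s))))"
    by (simp only: sum_delta_mod[OF per_f])
  also have "\<dots> = of_int N * (\<Sum>r\<in>{0..<N}. ?f r * cnj (?f (r + s)))"
    by (simp only: sum_distrib_left mult.left_commute)
  finally show ?thesis .
qed

lemma G_sq: "(\<Sum>x\<in>{0..<N}. (norm (G x))\<^sup>2) = of_int N * (\<Sum>r\<in>{0..<N}. Fsq r * (MM r)\<^sup>2)"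
proof -
  have "complex_of_real (\<Sum>x\<in>{0..<N}. (norm (G x))\<^sup>2) = of_int N * (\<Sum>r\<in>{0..<N}. F r * of_real (MM r) * cnj (F r * of_real (MM r)))"
    using G_corr[of 0] by simp
  also have "\<dots> = complex_of_real (of_int N * (\<Sum>r\<in>{0..<N}. Fsq r * (MM r)\<^sup>2))"
  proof -
    have "F r * of_real (MM r) * cnj (F r * of_real (MM r)) = complex_of_real (Fsq r * (MM r)\<^sup>2)" for r
      unfolding complex_norm_square[symmetric] by (simp add: norm_mult power_mult_distrib)
    then show ?thesis by (simp only: of_real_mult of_real_sum of_real_of_int_eq)
  qed
  finally show ?thesis by (simp only: of_real_eq_iff)
qed

lemma chi_uminus: "chi M (- k) = chi M k"
proof -
  have "per (\<lambda>n. cc \<mu> n * e (k * n))" using per_\<pi>[of M] per_e(1)[of k] by (simp add: per_def)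
  from sum_reflect[OF this, of 0] show ?thesis by (simp add: chi_def \<pi>_uminus)
qed

text \<open>Duality: \<open>\<Omega>\<close> is the pairing of \<open>b\<close> with
  \<open>G\<close>, and Cauchy-Schwarz leaves the mean square of \<open>G\<close> over the measure
  \<open>a + p\<close>. Replacing \<open>a\<close> by a majorant, the frequency 0 contributes the
  full mean square of \<open>G\<close>, which is at most of order \<open>K * \<Omega>\<close>,
  divided by \<open>H\<close>; the other frequencies contribute an error that also contains
  \<open>\<Omega>\<close>. One factor \<open>\<Omega>\<close> then cancels.\<close>

lemma \<Omega>_le:
  assumes "majorized a L H \<epsilon>" "lcard M \<le> L" "0 < H" and K: "\<And>r. MM r \<le> K"
  shows "\<Omega> \<le> 2 * p * Z D2 * of_int N * ((1 / H + p) * K + \<epsilon> * (of_int N * Z D2))"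
proof -
  obtain \<nu> where \<nu>: "per \<nu>" "\<And>n. a n \<le> \<nu> n" "norm (FT (cc \<nu>) 0) \<le> of_int N / H"
    "\<And>\<phi>. (\<Sum>s\<in>{1..<N}. norm (FT (cc \<nu>) s) * chi M (2 * (s + \<phi>))) \<le> of_int N * \<epsilon>"
    by (rule majorizedE_half[OF assms(1,2) less_imp_le[OF eps_pos]]) blast
  have K0: "0 \<le> K" using K[of 0] MM_nonneg[of 0] by linarith
  have \<Omega>0: "0 \<le> \<Omega>" unfolding \<Omega>_def by (intro sum_nonneg mult_nonneg_nonneg MM_nonneg) auto
  let ?G2 = "\<Sum>x\<in>{0..<N}. (norm (G x))\<^sup>2"
  let ?T = "of_int N * \<epsilon> * (\<Sum>r\<in>{0..<N}. Fsq r)"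
  have sqK: "(\<Sum>r\<in>{0..<N}. Fsq r * (MM r)\<^sup>2) \<le> K * \<Omega>"
    unfolding \<Omega>_def sum_distrib_left
  proof (rule sum_mono)
    fix r
    have "Fsq r * (MM r * MM r) \<le> Fsq r * (K * MM r)"
      by (intro mult_left_mono mult_right_mono K MM_nonneg) auto
    then show "Fsq r * (MM r)\<^sup>2 \<le> K * (Fsq r * MM r)" by (simp only: power2_eq_square mult.left_commute)
  qed
  have plus: "(\<Sum>s\<in>{1..<N}. norm (FT (cc \<nu>) s) * MM (r + s)) \<le> ?T" for r
  proof -
    have "(\<Sum>s\<in>{1..<N}. norm (FT (cc \<nu>) s) * MM (r + s))
       = (\<Sum>s\<in>{1..<N}. \<Sum>r'\<in>{0..<N}. Fsq r' * (norm (FT (cc \<nu>) s) * chi M (2 * (s + (r + r')))))"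
      unfolding MM_def sum_distrib_left by (simp add: mult_ac add_ac)
    also have "\<dots> = (\<Sum>r'\<in>{0..<N}. Fsq r' * (\<Sum>s\<in>{1..<N}. norm (FT (cc \<nu>) s) * chi M (2 * (s + (r + r')))))"
      unfolding sum_distrib_left by (rule sum.swap)
    also have "\<dots> \<le> (\<Sum>r'\<in>{0..<N}. Fsq r' * (of_int N * \<epsilon>))"
      by (intro sum_mono mult_left_mono \<nu>(4)) auto
    also have "\<dots> = ?T" unfolding sum_distrib_right[symmetric] by (rule mult.commute)
    finally show ?thesis .
  qed
  have minus: "(\<Sum>s\<in>{1..<N}. norm (FT (cc \<nu>) s) * MM (r - s)) \<le> ?T" for r
  proof -
    have "MM (r - s) = (\<Sum>r'\<in>{0..<N}. Fsq r' * chi M (2 * (s + (- r - r'))))" for s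
    proof -
      have "2 * (r - s + r') = - (2 * (s + (- r - r')))" for r' by simp
      then show ?thesis unfolding MM_def by (simp only: chi_uminus)
    qed
    then have "(\<Sum>s\<in>{1..<N}. norm (FT (cc \<nu>) s) * MM (r - s))
       = (\<Sum>s\<in>{1..<N}. \<Sum>r'\<in>{0..<N}. Fsq r' * (norm (FT (cc \<nu>) s) * chi M (2 * (s + (- r - r')))))"
      by (simp add: sum_distrib_left mult_ac)
    also have "\<dots> = (\<Sum>r'\<in>{0..<N}. Fsq r' * (\<Sum>s\<in>{1..<N}. norm (FT (cc \<nu>) s) * chi M (2 * (s + (- r - r')))))"
      unfolding sum_distrib_left by (rule sum.swap)
    also have "\<dots> \<le> (\<Sum>r'\<in>{0..<N}. Fsq r' * (of_int N * \<epsilon>))"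
      by (intro sum_mono mult_left_mono \<nu>(4)) auto
    also have "\<dots> = ?T" unfolding sum_distrib_right[symmetric] by (rule mult.commute)
    finally show ?thesis .
  qed
  let ?C = "\<lambda>s. \<Sum>x\<in>{0..<N}. complex_of_real ((norm (G x))\<^sup>2) * e (s * x)"
  let ?P = "\<lambda>s. \<Sum>r\<in>{0..<N}. norm (F r) * MM r * (norm (F (r + s)) * MM (r + s))"
  have C: "norm (?C s) \<le> of_int N * ?P s" for s
  proof -
    have "norm (\<Sum>r\<in>{0..<N}. F r * of_real (MM r) * cnj (F (r + s) * of_real (MM (r + s)))) \<le> ?P s"
      by (rule sum_norm_le) (simp add: norm_mult MM_nonneg)
    then show ?thesis unfolding G_corr norm_mult using N_pos by simp
  qed
  have P_sum: "(\<Sum>s\<in>{1..<N}. norm (FT (cc \<nu>) s) * ?P s) \<le> ?T * \<Omega>"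
  proof -
    \<comment> \<open>The inequality between the means separates the two values of the transform.
      Each half then contains \<open>MM\<close> at one shifted point, and its sum over
      \<open>s\<close> is covered by \<open>plus\<close> or \<open>minus\<close>.\<close>
    have P: "2 * ?P s \<le> (\<Sum>r\<in>{0..<N}. Fsq r * MM r * MM (r + s)) + (\<Sum>r\<in>{0..<N}. Fsq r * MM r * MM (r - s))" for s
    proof -
      have "2 * (norm (F r) * MM r * (norm (F (r + s)) * MM (r + s))) \<le> Fsq r * MM r * MM (r + s) + Fsq (r + s) * MM (r + s) * MM r" for r
      proof -
        have "2 * norm (F r) * norm (F (r + s)) \<le> Fsq r + Fsq (r + s)" by (rule sum_squares_bound)
        then have "(2 * norm (F r) * norm (F (r + s))) * (MM r * MM (r + s)) \<le> (Fsq r + Fsq (r + s)) * (MM r * MM (r + s))"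
          by (intro mult_right_mono mult_nonneg_nonneg MM_nonneg)
        moreover have "2 * (f * m * (g * n)) = (2 * f * g) * (m * n)" "f\<^sup>2 * m * n + g\<^sup>2 * n * m = (f\<^sup>2 + g\<^sup>2) * (m * n)" for f g m n :: real
          by (simp_all add: algebra_simps)
        ultimately show ?thesis by (simp only:)
      qed
      then have "2 * ?P s \<le> (\<Sum>r\<in>{0..<N}. Fsq r * MM r * MM (r + s)) + (\<Sum>r\<in>{0..<N}. Fsq (r + s) * MM (r + s) * MM r)"
        unfolding sum_distrib_left sum.distrib[symmetric] by (intro sum_mono)
      moreover have "(\<Sum>r\<in>{0..<N}. Fsq (r + s) * MM (r + s) * MM r) = (\<Sum>r\<in>{0..<N}. Fsq r * MM r * MM (r - s))"
      proof -
        have "per (\<lambda>r. Fsq r * MM r * MM (r - s))"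
          using per_Fsq per_MM per_shift[OF per_MM, of "- s"] by (simp add: per_def)
        from sum_shift[OF this, of s] show ?thesis by simp
      qed
      ultimately show ?thesis by (simp only:)
    qed
    have "2 * (\<Sum>s\<in>{1..<N}. norm (FT (cc \<nu>) s) * ?P s) = (\<Sum>s\<in>{1..<N}. norm (FT (cc \<nu>) s) * (2 * ?P s))"
      by (simp only: sum_distrib_left mult.left_commute)
    also have "\<dots> \<le> (\<Sum>s\<in>{1..<N}. norm (FT (cc \<nu>) s) * ((\<Sum>r\<in>{0..<N}. Fsq r * MM r * MM (r + s)) + (\<Sum>r\<in>{0..<N}. Fsq r * MM r * MM (r - s))))"
      by (intro sum_mono mult_left_mono P) auto
    also have "\<dots> = (\<Sum>s\<in>{1..<N}. \<Sum>r\<in>{0..<N}. Fsq r * MM r * (norm (FT (cc \<nu>) s) * MM (r + s)))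
       + (\<Sum>s\<in>{1..<N}. \<Sum>r\<in>{0..<N}. Fsq r * MM r * (norm (FT (cc \<nu>) s) * MM (r - s)))"
      unfolding distrib_left sum.distrib sum_distrib_left by (simp only: mult.assoc mult.left_commute)
    also have "(\<Sum>s\<in>{1..<N}. \<Sum>r\<in>{0..<N}. Fsq r * MM r * (norm (FT (cc \<nu>) s) * MM (r + s)))
        = (\<Sum>r\<in>{0..<N}. Fsq r * MM r * (\<Sum>s\<in>{1..<N}. norm (FT (cc \<nu>) s) * MM (r + s)))"
      unfolding sum_distrib_left by (rule sum.swap)
    also have "(\<Sum>s\<in>{1..<N}. \<Sum>r\<in>{0..<N}. Fsq r * MM r * (norm (FT (cc \<nu>) s) * MM (r - s)))
        = (\<Sum>r\<in>{0..<N}. Fsq r * MM r * (\<Sum>s\<in>{1..<N}. norm (FT (cc \<nu>) s) * MM (r - s)))"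
      unfolding sum_distrib_left by (rule sum.swap)
    finally have "2 * (\<Sum>s\<in>{1..<N}. norm (FT (cc \<nu>) s) * ?P s) \<le>
       (\<Sum>r\<in>{0..<N}. Fsq r * MM r * (\<Sum>s\<in>{1..<N}. norm (FT (cc \<nu>) s) * MM (r + s)))
       + (\<Sum>r\<in>{0..<N}. Fsq r * MM r * (\<Sum>s\<in>{1..<N}. norm (FT (cc \<nu>) s) * MM (r - s)))" .
    moreover have "(\<Sum>r\<in>{0..<N}. Fsq r * MM r * (\<Sum>s\<in>{1..<N}. norm (FT (cc \<nu>) s) * MM (r + s))) \<le> (\<Sum>r\<in>{0..<N}. Fsq r * MM r * ?T)"
      by (intro sum_mono mult_left_mono plus mult_nonneg_nonneg MM_nonneg) auto
    moreover have "(\<Sum>r\<in>{0..<N}. Fsq r * MM r * (\<Sum>s\<in>{1..<N}. norm (FT (cc \<nu>) s) * MM (r - s))) \<le> (\<Sum>r\<in>{0..<N}. Fsq r * MM r * ?T)"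
      by (intro sum_mono mult_left_mono minus mult_nonneg_nonneg MM_nonneg) auto
    moreover have "(\<Sum>r\<in>{0..<N}. Fsq r * MM r * ?T) = ?T * \<Omega>"
      unfolding \<Omega>_def sum_distrib_right[symmetric] by (rule mult.commute)
    ultimately show ?thesis by linarith
  qed
  have \<nu>G: "(\<Sum>x\<in>{0..<N}. \<nu> x * (norm (G x))\<^sup>2) \<le> of_int N * (K * \<Omega>) / H + ?T * \<Omega>"
  proof -
    let ?R = "\<Sum>s\<in>{1..<N}. FT (cc \<nu>) s * ?C s"
    have ins: "{0..<N} = insert 0 {1..<N}" using N_pos by auto
    have "complex_of_real (of_int N * (\<Sum>x\<in>{0..<N}. \<nu> x * (norm (G x))\<^sup>2)) = (\<Sum>x\<in>{0..<N}. (of_int N * cc \<nu> x) * complex_of_real ((norm (G x))\<^sup>2))"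
      by (simp add: sum_distrib_left mult_ac)
    also have "\<dots> = (\<Sum>x\<in>{0..<N}. \<Sum>s\<in>{0..<N}. FT (cc \<nu>) s * (complex_of_real ((norm (G x))\<^sup>2) * e (s * x)))"
      unfolding FT_inversion[OF per_cc[OF \<nu>(1)], symmetric] sum_distrib_right
      by (simp only: mult.assoc mult.left_commute mult.commute)
    also have "\<dots> = (\<Sum>s\<in>{0..<N}. FT (cc \<nu>) s * ?C s)"
      unfolding sum_distrib_left by (rule sum.swap)
    also have "\<dots> = FT (cc \<nu>) 0 * ?C 0 + ?R"
      unfolding ins[of] by (subst sum.insert) auto
    finally have eq: "complex_of_real (of_int N * (\<Sum>x\<in>{0..<N}. \<nu> x * (norm (G x))\<^sup>2)) = FT (cc \<nu>) 0 * ?C 0 + ?R" .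
    have "of_int N * (\<Sum>x\<in>{0..<N}. \<nu> x * (norm (G x))\<^sup>2) = Re (FT (cc \<nu>) 0 * ?C 0 + ?R)"
      unfolding eq[symmetric] by (rule Re_complex_of_real[symmetric])
    then have le: "of_int N * (\<Sum>x\<in>{0..<N}. \<nu> x * (norm (G x))\<^sup>2) \<le> norm (FT (cc \<nu>) 0 * ?C 0) + norm ?R"
      using complex_Re_le_cmod[of "FT (cc \<nu>) 0 * ?C 0 + ?R"] norm_triangle_ineq[of "FT (cc \<nu>) 0 * ?C 0" ?R] by linarith
    have "?C 0 = complex_of_real ?G2" by simp
    then have C0: "norm (?C 0) = ?G2" unfolding norm_of_real by (simp only: norm_of_real abs_of_nonneg sum_nonneg zero_le_power2)
    have le0: "norm (FT (cc \<nu>) 0 * ?C 0) \<le> of_int N / H * (of_int N * (K * \<Omega>))"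
      unfolding norm_mult C0 G_sq using \<nu>(3) sqK N_pos assms(3)
      by (intro mult_mono mult_left_mono mult_nonneg_nonneg sum_nonneg) auto
    have "norm ?R \<le> (\<Sum>s\<in>{1..<N}. norm (FT (cc \<nu>) s) * (of_int N * ?P s))"
      by (rule sum_norm_le) (simp only: norm_mult mult_left_mono C norm_ge_zero)
    also have "\<dots> = of_int N * (\<Sum>s\<in>{1..<N}. norm (FT (cc \<nu>) s) * ?P s)"
      by (simp only: sum_distrib_left mult.left_commute)
    also have "\<dots> \<le> of_int N * (?T * \<Omega>)" using P_sum N_pos by (intro mult_left_mono) auto
    finally have le1: "norm ?R \<le> of_int N * (?T * \<Omega>)" .
    have "of_int N * (\<Sum>x\<in>{0..<N}. \<nu> x * (norm (G x))\<^sup>2) \<le> of_int N * (of_int N * (K * \<Omega>) / H + ?T * \<Omega>)"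
      using le le0 le1 by (simp add: distrib_left)
    then show ?thesis using N_pos by (simp only: mult_le_cancel_left_pos of_int_0_less_iff)
  qed
  have "?T \<le> of_int N * \<epsilon> * (of_int N * Z D2)"
    using sum_Fsq N_pos eps_pos by (intro mult_left_mono) auto
  then have T: "?T * \<Omega> \<le> of_int N * \<epsilon> * (of_int N * Z D2) * \<Omega>" using \<Omega>0 by (intro mult_right_mono)
  have "\<Omega> = norm (complex_of_real \<Omega>)" using \<Omega>0 by simp
  also have "\<dots> \<le> (\<Sum>x\<in>{0..<N}. (a x + p) * (w x * norm (G x)))"
    unfolding \<Omega>_eq
  proof (rule sum_norm_le)
    fix x
    show "norm (of_real (b x) * G x) \<le> (a x + p) * (w x * norm (G x))"
      using mult_right_mono[OF abs_b(2)[of x], of "norm (G x)"] by (simp add: norm_mult mult.assoc)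
  qed
  finally have "\<Omega>\<^sup>2 \<le> (\<Sum>x\<in>{0..<N}. (a x + p) * (w x * norm (G x)))\<^sup>2" using \<Omega>0 by (intro power_mono)
  \<comment> \<open>The measure \<open>a x + p\<close> is what keeps both savings: the first factor
    is \<open>2 * p * Z D2\<close> and not \<open>Z D2\<close>, and in the second one
    \<open>a\<close> can be majorized.\<close>
  also have "\<dots> \<le> (\<Sum>x\<in>{0..<N}. (a x + p) * (w x)\<^sup>2) * (\<Sum>x\<in>{0..<N}. (a x + p) * (norm (G x))\<^sup>2)"
    using a_bounds(1) p_pos by (intro sum_norm_eq_sqrt_bound) (simp add: add_nonneg_nonneg)
  also have "(\<Sum>x\<in>{0..<N}. (a x + p) * (w x)\<^sup>2) = 2 * p * Z D2"
    by (simp add: distrib_right sum.distrib sum_distrib_left[symmetric] sum_aw2 Z_double)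
  also have "(\<Sum>x\<in>{0..<N}. (a x + p) * (norm (G x))\<^sup>2) \<le> of_int N * \<Omega> * ((1 / H + p) * K + \<epsilon> * (of_int N * Z D2))"
  proof -
    have "(\<Sum>x\<in>{0..<N}. (a x + p) * (norm (G x))\<^sup>2) = (\<Sum>x\<in>{0..<N}. a x * (norm (G x))\<^sup>2) + p * ?G2"
      by (simp only: distrib_right sum.distrib sum_distrib_left)
    moreover have "(\<Sum>x\<in>{0..<N}. a x * (norm (G x))\<^sup>2) \<le> (\<Sum>x\<in>{0..<N}. \<nu> x * (norm (G x))\<^sup>2)"
      by (intro sum_mono mult_right_mono \<nu>(2)) auto
    moreover have "p * ?G2 \<le> p * (of_int N * (K * \<Omega>))"
      unfolding G_sq using sqK p_pos N_pos by (intro mult_left_mono) auto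
    ultimately have "(\<Sum>x\<in>{0..<N}. (a x + p) * (norm (G x))\<^sup>2)
       \<le> of_int N * (K * \<Omega>) / H + of_int N * \<epsilon> * (of_int N * Z D2) * \<Omega> + p * (of_int N * (K * \<Omega>))"
      using \<nu>G T by linarith
    then show ?thesis by (simp add: algebra_simps)
  qed
  finally have *: "\<Omega> * \<Omega> \<le> \<Omega> * (2 * p * Z D2 * of_int N * ((1 / H + p) * K + \<epsilon> * (of_int N * Z D2)))"
    using p_pos Z_pos[of D2] by (simp add: power2_eq_square mult_ac mult_left_mono)
  show ?thesis
  proof (cases "\<Omega> = 0")
    case True
    then show ?thesis using p_pos Z_pos[of D2] N_pos K0 eps_pos assms(3)
      by (simp add: mult_nonneg_nonneg add_nonneg_nonneg)
  next
    case False
    then show ?thesis using \<Omega>0 * by (simp add: mult_le_cancel_left_pos)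
  qed
qed

section \<open>From Fourier mass to local densities\<close>

lemma MM_phys:
  "complex_of_real (MM r) = (\<Sum>z\<in>{0..<N}. \<mu> z *\<^sub>R (e (2 * r * z) * of_real (of_int N * (\<Sum>x\<in>{0..<N}. b x * b (x - 2 * z)))))"
proof -
  have "complex_of_real (MM r) = (\<Sum>s\<in>{0..<N}. of_real (Fsq s) * (\<Sum>z\<in>{0..<N}. cc \<mu> z * e (2 * (r + s) * z)))"
    unfolding MM_def chi_complex of_real_sum of_real_mult ..
  also have "\<dots> = (\<Sum>s\<in>{0..<N}. \<Sum>z\<in>{0..<N}. cc \<mu> z * (e (2 * r * z) * (of_real (Fsq s) * e (s * (2 * z)))))"
  proof -
    have "e (2 * (r + s) * z) = e (2 * r * z) * e (s * (2 * z))" for s z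
    proof -
      have "2 * (r + s) * z = 2 * r * z + s * (2 * z)" by (simp add: algebra_simps)
      then show ?thesis by (simp only: e_add)
    qed
    then show ?thesis unfolding sum_distrib_left by (simp only: mult.left_commute)
  qed
  also have "\<dots> = (\<Sum>z\<in>{0..<N}. cc \<mu> z * (e (2 * r * z) * (\<Sum>s\<in>{0..<N}. of_real (Fsq s) * e (s * (2 * z)))))"
    unfolding sum_distrib_left by (rule sum.swap)
  finally show ?thesis unfolding FT_autocorr[OF per_b] scaleR_conv_of_real .
qed

lemma MM_le_corr:
  "MM r \<le> of_int N * (\<Sum>x\<in>{0..<N}. \<bar>b x\<bar> * norm (\<Sum>z\<in>{0..<N}. \<mu> z *\<^sub>R (e (2 * r * z) * of_real (b (x - 2 * z)))))"
proof -
  let ?Y = "\<lambda>x. \<Sum>z\<in>{0..<N}. \<mu> z *\<^sub>R (e (2 * r * z) * of_real (b (x - 2 * z)))"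
  have "complex_of_real (MM r) = (\<Sum>z\<in>{0..<N}. \<Sum>x\<in>{0..<N}. of_int N * (of_real (b x) * (\<mu> z *\<^sub>R (e (2 * r * z) * of_real (b (x - 2 * z))))))"
    unfolding MM_phys by (simp add: sum_distrib_left scaleR_conv_of_real mult_ac)
  also have "\<dots> = (\<Sum>x\<in>{0..<N}. of_int N * (of_real (b x) * ?Y x))"
    unfolding sum_distrib_left by (rule sum.swap)
  finally have *: "complex_of_real (MM r) = (\<Sum>x\<in>{0..<N}. of_int N * (of_real (b x) * ?Y x))" .
  have "MM r = norm (complex_of_real (MM r))" using MM_nonneg[of r] by simp
  also have "\<dots> \<le> (\<Sum>x\<in>{0..<N}. of_int N * (\<bar>b x\<bar> * norm (?Y x)))"
    unfolding * using N_pos by (intro sum_norm_le) (simp add: norm_mult)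
  finally show ?thesis unfolding sum_distrib_left[symmetric] .
qed

definition gg :: "data \<Rightarrow> int \<Rightarrow> real" where
  "gg S u = (\<Sum>y\<in>{0..<N}. \<pi> S y * (a (u - 2 * y) - p))"

lemma abs_a_p: "\<bar>a n - p\<bar> \<le> 1" using a_bounds[of n] p_pos p_le_1 by auto

lemma abs_gg: "\<bar>gg S u\<bar> \<le> 1"
proof -
  have "\<bar>gg S u\<bar> \<le> (\<Sum>y\<in>{0..<N}. \<bar>\<pi> S y * (a (u - 2 * y) - p)\<bar>)" unfolding gg_def by (rule sum_abs)
  also have "\<dots> \<le> (\<Sum>y\<in>{0..<N}. \<pi> S y)"
    by (intro sum_mono) (simp add: abs_mult \<pi>_nonneg abs_a_p mult_left_le)
  finally show ?thesis by (simp add: sum_\<pi>)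
qed

lemma per_gg: "per (gg S)"
proof -
  have "a (u mod N - 2 * y) = a (u - 2 * y)" for u y
    by (rule perD[OF per_a]) (rule mod_diff_left_eq)
  then show ?thesis unfolding per_def gg_def by (intro allI) (simp only:)
qed

text \<open>The short measure is almost invariant under shifts \<open>y\<close> drawn from
  \<open>S\<close>, and the phase \<open>e (2 * r * y)\<close> is almost 1 there. Averaging over
  such shifts therefore leaves the phase alone and replaces \<open>a - p\<close> by its local mean
  \<open>gg\<close>, after which the triangle inequality may discard the phase.\<close>

lemma local_phase:
  assumes "(\<Sum>y\<in>{0..<N}. \<pi> S y * tv M y) \<le> \<epsilon>"
    and "(\<Sum>y\<in>{0..<N}. \<pi> S y * norm (e (2 * r * y) - 1)) \<le> \<epsilon>"
  shows "norm (\<Sum>z\<in>{0..<N}. \<mu> z *\<^sub>R (e (2 * r * z) * of_real (a (x - 2 * z) - p))) \<le> (\<Sum>z\<in>{0..<N}. \<mu> z * \<bar>gg S (x - 2 * z)\<bar>) + 2 * \<epsilon>"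
proof -
  let ?f = "\<lambda>z. e (2 * r * z) * complex_of_real (a (x - 2 * z) - p)"
  let ?V = "\<Sum>z\<in>{0..<N}. \<mu> z *\<^sub>R ?f z"
  let ?V1 = "\<Sum>y\<in>{0..<N}. \<pi> S y *\<^sub>R (\<Sum>z\<in>{0..<N}. \<mu> z *\<^sub>R ?f (z + y))"
  let ?V2 = "\<Sum>y\<in>{0..<N}. \<pi> S y *\<^sub>R (\<Sum>z\<in>{0..<N}. \<mu> z *\<^sub>R (e (2 * r * z) * complex_of_real (a (x - 2 * (z + y)) - p)))"
  have per_f: "per ?f"
    using per_e(1)[of "2 * r"] per_comp2[OF per_a, of x "- 2"] by (simp add: per_def)
  have "?V = (\<Sum>y\<in>{0..<N}. \<pi> S y *\<^sub>R ?V)"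
    unfolding scaleR_sum_left[symmetric] sum_\<pi> by simp
  then have "?V - ?V1 = (\<Sum>y\<in>{0..<N}. \<pi> S y *\<^sub>R (?V - (\<Sum>z\<in>{0..<N}. \<mu> z *\<^sub>R ?f (z + y))))"
    by (simp only: scaleR_diff_right sum_subtractf)
  moreover have "norm (\<Sum>y\<in>{0..<N}. \<pi> S y *\<^sub>R (?V - (\<Sum>z\<in>{0..<N}. \<mu> z *\<^sub>R ?f (z + y)))) \<le> (\<Sum>y\<in>{0..<N}. \<pi> S y * tv M y)"
  proof (rule sum_norm_le)
    fix y
    have "norm (?V - (\<Sum>z\<in>{0..<N}. \<mu> z *\<^sub>R ?f (z + y))) \<le> 1 * tv M y"
    proof (rule shift_tv[OF per_f])
      show "norm (?f z) \<le> 1" for z using abs_a_p[of "x - 2 * z"] by (simp add: norm_mult del: of_real_diff)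
    qed
    then show "norm (\<pi> S y *\<^sub>R (?V - (\<Sum>z\<in>{0..<N}. \<mu> z *\<^sub>R ?f (z + y)))) \<le> \<pi> S y * tv M y"
      by (simp add: \<pi>_nonneg mult_left_mono)
  qed
  ultimately have 1: "norm (?V - ?V1) \<le> \<epsilon>" using assms(1) by simp
  have "?V1 - ?V2 = (\<Sum>y\<in>{0..<N}. \<pi> S y *\<^sub>R ((e (2 * r * y) - 1) * (\<Sum>z\<in>{0..<N}. \<mu> z *\<^sub>R (e (2 * r * z) * complex_of_real (a (x - 2 * (z + y)) - p)))))"
  proof -
    have "\<mu> z *\<^sub>R ?f (z + y) - \<mu> z *\<^sub>R (e (2 * r * z) * complex_of_real (a (x - 2 * (z + y)) - p))
        = (e (2 * r * y) - 1) * (\<mu> z *\<^sub>R (e (2 * r * z) * complex_of_real (a (x - 2 * (z + y)) - p)))" for z y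
    proof -
      have "2 * r * (z + y) = 2 * r * y + 2 * r * z" by (simp add: algebra_simps)
      then have "e (2 * r * (z + y)) = e (2 * r * y) * e (2 * r * z)" by (simp only: e_add)
      then show ?thesis by (simp only: scaleR_conv_of_real) (simp add: algebra_simps)
    qed
    then show ?thesis by (simp only: sum_subtractf[symmetric] scaleR_diff_right[symmetric] sum_distrib_left)
  qed
  moreover have "norm (\<Sum>y\<in>{0..<N}. \<pi> S y *\<^sub>R ((e (2 * r * y) - 1) * (\<Sum>z\<in>{0..<N}. \<mu> z *\<^sub>R (e (2 * r * z) * complex_of_real (a (x - 2 * (z + y)) - p)))))
       \<le> (\<Sum>y\<in>{0..<N}. \<pi> S y * norm (e (2 * r * y) - 1))"
  proof (rule sum_norm_le)
    fix y
    have "norm (\<Sum>z\<in>{0..<N}. \<mu> z *\<^sub>R (e (2 * r * z) * complex_of_real (a (x - 2 * (z + y)) - p))) \<le> (\<Sum>z\<in>{0..<N}. \<mu> z)"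
    proof (rule sum_norm_le)
      fix z
      show "norm (\<mu> z *\<^sub>R (e (2 * r * z) * complex_of_real (a (x - 2 * (z + y)) - p))) \<le> \<mu> z"
        using abs_a_p[of "x - 2 * (z + y)"] \<pi>_nonneg[of M z]
        by (simp add: norm_mult mult_left_le del: of_real_diff)
    qed
    then have "norm (e (2 * r * y) - 1) * norm (\<Sum>z\<in>{0..<N}. \<mu> z *\<^sub>R (e (2 * r * z) * complex_of_real (a (x - 2 * (z + y)) - p))) \<le> norm (e (2 * r * y) - 1) * 1"
      unfolding sum_\<pi> by (intro mult_left_mono) auto
    then show "norm (\<pi> S y *\<^sub>R ((e (2 * r * y) - 1) * (\<Sum>z\<in>{0..<N}. \<mu> z *\<^sub>R (e (2 * r * z) * complex_of_real (a (x - 2 * (z + y)) - p)))))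
        \<le> \<pi> S y * norm (e (2 * r * y) - 1)"
      using \<pi>_nonneg[of S y] by (simp add: norm_mult mult_left_mono)
  qed
  ultimately have 2: "norm (?V1 - ?V2) \<le> \<epsilon>" using assms(2) by simp
  have "?V2 = (\<Sum>z\<in>{0..<N}. \<mu> z *\<^sub>R (e (2 * r * z) * complex_of_real (gg S (x - 2 * z))))"
  proof -
    have "?V2 = (\<Sum>z\<in>{0..<N}. \<Sum>y\<in>{0..<N}. \<mu> z *\<^sub>R (e (2 * r * z) * complex_of_real (\<pi> S y * (a (x - 2 * z - 2 * y) - p))))"
      unfolding scaleR_sum_right
      by (subst sum.swap) (simp add: scaleR_conv_of_real mult_ac algebra_simps)
    also have "\<dots> = (\<Sum>z\<in>{0..<N}. \<mu> z *\<^sub>R (e (2 * r * z) * complex_of_real (gg S (x - 2 * z))))"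
      unfolding gg_def of_real_sum sum_distrib_left scaleR_sum_right ..
    finally show ?thesis .
  qed
  moreover have "norm (\<Sum>z\<in>{0..<N}. \<mu> z *\<^sub>R (e (2 * r * z) * complex_of_real (gg S (x - 2 * z)))) \<le> (\<Sum>z\<in>{0..<N}. \<mu> z * \<bar>gg S (x - 2 * z)\<bar>)"
    by (rule sum_norm_le) (simp add: norm_mult \<pi>_nonneg)
  ultimately have "norm ?V2 \<le> (\<Sum>z\<in>{0..<N}. \<mu> z * \<bar>gg S (x - 2 * z)\<bar>)" by simp
  moreover have "norm ?V \<le> norm (?V - ?V1) + norm (?V1 - ?V2) + norm ?V2"
    using norm_triangle_ineq[of "(?V - ?V1) + (?V1 - ?V2)" ?V2] norm_triangle_ineq[of "?V - ?V1" "?V1 - ?V2"] by simp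
  ultimately show ?thesis using 1 2 by linarith
qed

text \<open>After \<open>local_phase\<close> a mean of \<open>\<bar>gg\<bar>\<close> remains,
  weighted by \<open>\<bar>b\<bar>\<close>. Since \<open>\<bar>b\<bar>\<close> is at most
  \<open>(a + p) * w\<close> and \<open>sup\<close> caps the density of \<open>a\<close> on all
  translates at \<open>2 * p\<close>, this costs a factor \<open>3 * p\<close>; bounding
  \<open>\<bar>b\<bar>\<close> by \<open>w\<close> would lose that factor.\<close>

lemma MM_le:
  assumes S: "(\<Sum>y\<in>{0..<N}. \<pi> S y * tv M y) \<le> \<epsilon>" "(\<Sum>y\<in>{0..<N}. \<pi> S y * norm (e (2 * r * y) - 1)) \<le> \<epsilon>"
    and sup: "\<And>x. (\<Sum>z\<in>{0..<N}. \<mu> z * a (x + 2 * z)) \<le> 2 * p"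
  shows "MM r \<le> of_int N * Z D2 * (3 * p * (\<Sum>x\<in>{0..<N}. \<pi> D2 x * \<bar>gg S x\<bar>) + 5 * \<epsilon>)"
proof -
  let ?Y = "\<lambda>x. norm (\<Sum>z\<in>{0..<N}. \<mu> z *\<^sub>R (e (2 * r * z) * complex_of_real (b (x - 2 * z))))"
  let ?g = "\<lambda>x. \<Sum>z\<in>{0..<N}. \<mu> z * \<bar>gg S (x - 2 * z)\<bar>"
  have Y: "?Y x \<le> (\<Sum>z\<in>{0..<N}. \<mu> z * \<bar>w (x - 2 * z) - w x\<bar>) + w x * (?g x + 2 * \<epsilon>)" for x
  proof -
    let ?V = "\<Sum>z\<in>{0..<N}. \<mu> z *\<^sub>R (e (2 * r * z) * complex_of_real (a (x - 2 * z) - p))"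
    let ?E = "\<Sum>z\<in>{0..<N}. \<mu> z *\<^sub>R (e (2 * r * z) * complex_of_real ((a (x - 2 * z) - p) * (w (x - 2 * z) - w x)))"
    have "(\<Sum>z\<in>{0..<N}. \<mu> z *\<^sub>R (e (2 * r * z) * complex_of_real (b (x - 2 * z)))) = ?E + of_real (w x) * ?V"
      unfolding sum_distrib_left sum.distrib[symmetric] b_def
      by (intro sum.cong refl) (simp add: scaleR_conv_of_real algebra_simps)
    then have "?Y x \<le> norm ?E + w x * norm ?V"
      using norm_triangle_ineq[of ?E "of_real (w x) * ?V"] wt_pos[of D x] by (simp add: norm_mult)
    moreover have "norm ?E \<le> (\<Sum>z\<in>{0..<N}. \<mu> z * \<bar>w (x - 2 * z) - w x\<bar>)"
    proof (rule sum_norm_le)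
      fix z
      have "\<bar>(a (x - 2 * z) - p) * (w (x - 2 * z) - w x)\<bar> \<le> \<bar>w (x - 2 * z) - w x\<bar>"
        unfolding abs_mult by (rule mult_left_le_one_le) (use abs_a_p in auto)
      then have "\<mu> z * \<bar>(a (x - 2 * z) - p) * (w (x - 2 * z) - w x)\<bar> \<le> \<mu> z * \<bar>w (x - 2 * z) - w x\<bar>"
        by (intro mult_left_mono \<pi>_nonneg)
      then show "norm (\<mu> z *\<^sub>R (e (2 * r * z) * complex_of_real ((a (x - 2 * z) - p) * (w (x - 2 * z) - w x)))) \<le> \<mu> z * \<bar>w (x - 2 * z) - w x\<bar>"
        unfolding norm_scaleR norm_mult norm_e norm_of_real by (simp add: \<pi>_nonneg)
    qed
    moreover have "w x * norm ?V \<le> w x * (?g x + 2 * \<epsilon>)"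
      using local_phase[OF S] wt_pos[of D x] by (intro mult_left_mono) auto
    ultimately show ?thesis by linarith
  qed
  have "(\<Sum>x\<in>{0..<N}. \<bar>b x\<bar> * ?Y x) \<le> (\<Sum>x\<in>{0..<N}. w x * (\<Sum>z\<in>{0..<N}. \<mu> z * \<bar>w (x - 2 * z) - w x\<bar>) + (a x + p) * (w x)\<^sup>2 * ?g x + 2 * \<epsilon> * (w x)\<^sup>2)"
  proof (rule sum_mono)
    fix x
    let ?A = "\<Sum>z\<in>{0..<N}. \<mu> z * \<bar>w (x - 2 * z) - w x\<bar>"
    have A0: "0 \<le> ?A" and g0: "0 \<le> ?g x" by (auto intro!: sum_nonneg mult_nonneg_nonneg \<pi>_nonneg)
    have "\<bar>b x\<bar> * ?Y x \<le> \<bar>b x\<bar> * (?A + w x * (?g x + 2 * \<epsilon>))" by (intro mult_left_mono Y) auto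
    also have "\<dots> = \<bar>b x\<bar> * ?A + \<bar>b x\<bar> * (w x * ?g x) + \<bar>b x\<bar> * (2 * \<epsilon> * w x)" by (simp add: algebra_simps)
    also have "\<dots> \<le> w x * ?A + ((a x + p) * w x) * (w x * ?g x) + w x * (2 * \<epsilon> * w x)"
      using A0 g0 wt_pos[of D x] eps_pos by (intro add_mono mult_right_mono abs_b mult_nonneg_nonneg) auto
    finally show "\<bar>b x\<bar> * ?Y x \<le> w x * ?A + (a x + p) * (w x)\<^sup>2 * ?g x + 2 * \<epsilon> * (w x)\<^sup>2"
      by (simp add: power2_eq_square mult_ac)
  qed
  also have "\<dots> = (\<Sum>x\<in>{0..<N}. w x * (\<Sum>z\<in>{0..<N}. \<mu> z * \<bar>w (x - 2 * z) - w x\<bar>))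
     + (\<Sum>x\<in>{0..<N}. (a x + p) * (w x)\<^sup>2 * ?g x) + 2 * \<epsilon> * Z D2"
    by (simp only: sum.distrib sum_distrib_left[symmetric] Z_double)
  finally have tot: "(\<Sum>x\<in>{0..<N}. \<bar>b x\<bar> * ?Y x) \<le> (\<Sum>x\<in>{0..<N}. w x * (\<Sum>z\<in>{0..<N}. \<mu> z * \<bar>w (x - 2 * z) - w x\<bar>))
     + (\<Sum>x\<in>{0..<N}. (a x + p) * (w x)\<^sup>2 * ?g x) + 2 * \<epsilon> * Z D2" .
  have t1: "(\<Sum>x\<in>{0..<N}. w x * (\<Sum>z\<in>{0..<N}. \<mu> z * \<bar>w (x - 2 * z) - w x\<bar>)) \<le> Z D2 * \<epsilon>"
  proof -
    have "(\<Sum>x\<in>{0..<N}. w x * (\<Sum>z\<in>{0..<N}. \<mu> z * \<bar>w (x - 2 * z) - w x\<bar>))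
       = (\<Sum>x\<in>{0..<N}. \<Sum>z\<in>{0..<N}. \<mu> z * (w x * \<bar>w (x + - (2 * z)) - w x\<bar>))"
      unfolding sum_distrib_left by (simp add: mult_ac)
    also have "\<dots> = (\<Sum>z\<in>{0..<N}. \<mu> z * (\<Sum>x\<in>{0..<N}. w x * \<bar>w (x + - (2 * z)) - w x\<bar>))"
      unfolding sum_distrib_left by (rule sum.swap)
    also have "\<dots> \<le> (\<Sum>z\<in>{0..<N}. \<mu> z * (Z D2 * tv D2 (- (2 * z))))"
      by (intro sum_mono mult_left_mono wt_shift_sum \<pi>_nonneg)
    also have "\<dots> = Z D2 * (\<Sum>z\<in>{0..<N}. \<mu> z * tv D2 (2 * z))"
      by (simp only: tv_uminus sum_distrib_left mult.left_commute)
    also have "\<dots> \<le> Z D2 * \<epsilon>" using tv_M Z_pos[of D2] by (intro mult_left_mono) auto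
    finally show ?thesis .
  qed
  have t2: "(\<Sum>x\<in>{0..<N}. (a x + p) * (w x)\<^sup>2 * ?g x) \<le> Z D2 * (3 * p * (\<Sum>x\<in>{0..<N}. \<pi> D2 x * \<bar>gg S x\<bar>) + 2 * \<epsilon>)"
  proof -
    let ?h = "\<lambda>z x. (a x + p) * \<bar>gg S (x - 2 * z)\<bar>"
    have "(\<Sum>x\<in>{0..<N}. (a x + p) * (w x)\<^sup>2 * ?g x) = (\<Sum>x\<in>{0..<N}. \<Sum>z\<in>{0..<N}. Z D2 * (\<mu> z * (\<pi> D2 x *\<^sub>R ?h z x)))"
      unfolding sum_distrib_left \<pi>D2 using Z_pos[of D2] by (simp add: mult_ac)
    also have "\<dots> = Z D2 * (\<Sum>z\<in>{0..<N}. \<mu> z * (\<Sum>x\<in>{0..<N}. \<pi> D2 x *\<^sub>R ?h z x))"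
      unfolding sum_distrib_left by (rule sum.swap)
    \<comment> \<open>Shifting \<open>x\<close> by \<open>2 * z\<close> costs
      \<open>tv D2 (2 * z)\<close> and moves the dependence on \<open>z\<close> from
      \<open>gg\<close> to \<open>a\<close>, where \<open>sup\<close> can be applied to the mean
      over \<open>z\<close>.\<close>
    also have "\<dots> \<le> Z D2 * (\<Sum>z\<in>{0..<N}. \<mu> z * ((\<Sum>x\<in>{0..<N}. \<pi> D2 x * ((a (x + 2 * z) + p) * \<bar>gg S x\<bar>)) + 2 * tv D2 (2 * z)))"
    proof (intro mult_left_mono sum_mono \<pi>_nonneg)
      fix z
      have "norm ((\<Sum>x\<in>{0..<N}. \<pi> D2 x *\<^sub>R ?h z x) - (\<Sum>x\<in>{0..<N}. \<pi> D2 x *\<^sub>R ?h z (x + 2 * z))) \<le> 2 * tv D2 (2 * z)"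
      proof (rule shift_tv)
        show "per (?h z)" using per_a per_shift[OF per_gg, of S "- (2 * z)"] by (simp add: per_def)
        fix x
        have "(a x + p) * \<bar>gg S (x - 2 * z)\<bar> \<le> 2 * 1"
          using a_bounds[of x] p_pos p_le_1 abs_gg by (intro mult_mono) auto
        then show "norm (?h z x) \<le> 2" using a_bounds[of x] p_pos by simp
      qed
      then show "(\<Sum>x\<in>{0..<N}. \<pi> D2 x *\<^sub>R ?h z x) \<le> (\<Sum>x\<in>{0..<N}. \<pi> D2 x * ((a (x + 2 * z) + p) * \<bar>gg S x\<bar>)) + 2 * tv D2 (2 * z)"
        by (simp add: abs_le_iff)
    qed (use Z_pos[of D2] in auto)
    also have "(\<Sum>z\<in>{0..<N}. \<mu> z * ((\<Sum>x\<in>{0..<N}. \<pi> D2 x * ((a (x + 2 * z) + p) * \<bar>gg S x\<bar>)) + 2 * tv D2 (2 * z)))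
        = (\<Sum>x\<in>{0..<N}. \<pi> D2 x * \<bar>gg S x\<bar> * ((\<Sum>z\<in>{0..<N}. \<mu> z * a (x + 2 * z)) + p)) + 2 * (\<Sum>z\<in>{0..<N}. \<mu> z * tv D2 (2 * z))"
    proof -
      have "(\<Sum>z\<in>{0..<N}. \<mu> z * (\<Sum>x\<in>{0..<N}. \<pi> D2 x * ((a (x + 2 * z) + p) * \<bar>gg S x\<bar>)))
          = (\<Sum>x\<in>{0..<N}. \<Sum>z\<in>{0..<N}. \<pi> D2 x * \<bar>gg S x\<bar> * (\<mu> z * a (x + 2 * z) + p * \<mu> z))"
        unfolding sum_distrib_left by (subst sum.swap) (simp add: algebra_simps)
      also have "\<dots> = (\<Sum>x\<in>{0..<N}. \<pi> D2 x * \<bar>gg S x\<bar> * ((\<Sum>z\<in>{0..<N}. \<mu> z * a (x + 2 * z)) + p))"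
        by (simp only: sum_distrib_left[symmetric] sum.distrib sum_\<pi> mult_1_right)
      finally show ?thesis by (simp add: distrib_left sum.distrib sum_distrib_left mult_ac)
    qed
    also have "\<dots> \<le> (\<Sum>x\<in>{0..<N}. \<pi> D2 x * \<bar>gg S x\<bar> * (2 * p + p)) + 2 * \<epsilon>"
      using tv_M by (intro add_mono sum_mono mult_left_mono sup mult_nonneg_nonneg \<pi>_nonneg) auto
    also have "(\<Sum>x\<in>{0..<N}. \<pi> D2 x * \<bar>gg S x\<bar> * (2 * p + p)) = 3 * p * (\<Sum>x\<in>{0..<N}. \<pi> D2 x * \<bar>gg S x\<bar>)"
      unfolding sum_distrib_right[symmetric] by simp
    finally show ?thesis using Z_pos[of D2] by (simp add: mult_left_mono)
  qed
  have "(\<Sum>x\<in>{0..<N}. \<bar>b x\<bar> * ?Y x) \<le> Z D2 * (3 * p * (\<Sum>x\<in>{0..<N}. \<pi> D2 x * \<bar>gg S x\<bar>) + 5 * \<epsilon>)"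
    using tot t1 t2 by (simp add: algebra_simps)
  then have "of_int N * (\<Sum>x\<in>{0..<N}. \<bar>b x\<bar> * ?Y x) \<le> of_int N * (Z D2 * (3 * p * (\<Sum>x\<in>{0..<N}. \<pi> D2 x * \<bar>gg S x\<bar>) + 5 * \<epsilon>))"
    using N_pos by (intro mult_left_mono) auto
  then show ?thesis using MM_le_corr[of r] by (simp add: mult.assoc)
qed

text \<open>The mean of \<open>a - p\<close> over the long measure is exactly 0, and the additional
  average over \<open>S\<close> is nearly absorbed by it. With this one-sided bound a large mean of
  \<open>\<bar>gg\<bar>\<close> forces large positive values.\<close>

lemma mean_gg:
  assumes "(\<Sum>y\<in>{0..<N}. \<pi> S y * tv D2 (2 * y)) \<le> \<epsilon>"
  shows "- \<epsilon> \<le> (\<Sum>x\<in>{0..<N}. \<pi> D2 x * gg S x)"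
proof -
  have z: "(\<Sum>x\<in>{0..<N}. \<pi> D2 x *\<^sub>R (a x - p)) = 0"
    by (simp add: right_diff_distrib sum_subtractf p_def[symmetric] sum_distrib_right[symmetric] sum_\<pi>)
  have "(\<Sum>x\<in>{0..<N}. \<pi> D2 x * gg S x) = (\<Sum>y\<in>{0..<N}. \<pi> S y * (\<Sum>x\<in>{0..<N}. \<pi> D2 x *\<^sub>R (a (x + - (2 * y)) - p)))"
    unfolding gg_def sum_distrib_left by (subst sum.swap) (simp add: mult_ac)
  also have "\<dots> \<ge> (\<Sum>y\<in>{0..<N}. \<pi> S y * (- tv D2 (2 * y)))"
  proof (intro sum_mono mult_left_mono \<pi>_nonneg)
    fix y
    have "norm ((\<Sum>x\<in>{0..<N}. \<pi> D2 x *\<^sub>R (a x - p)) - (\<Sum>x\<in>{0..<N}. \<pi> D2 x *\<^sub>R (a (x + - (2 * y)) - p))) \<le> 1 * tv D2 (- (2 * y))"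
      by (rule shift_tv) (use per_a abs_a_p in \<open>auto simp: per_def\<close>)
    then show "- tv D2 (2 * y) \<le> (\<Sum>x\<in>{0..<N}. \<pi> D2 x *\<^sub>R (a (x + - (2 * y)) - p))"
      unfolding z tv_uminus by (simp add: abs_le_iff)
  qed
  finally show ?thesis using assms by (simp add: sum_negf)
qed

end

section \<open>Existence of a denser translate\<close>

lemma exists_ge_mean:
  fixes u f :: "int \<Rightarrow> real"
  assumes "\<And>x. 0 \<le> u x" "(\<Sum>x\<in>A. u x) = 1" "c \<le> (\<Sum>x\<in>A. u x * f x)"
  shows "\<exists>x. c \<le> f x"
proof (rule ccontr)
  assume "\<not> (\<exists>x. c \<le> f x)"
  then have less: "f x < c" for x by (simp add: not_le)
  have "(\<Sum>x\<in>A. u x * (c - f x)) \<le> 0"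
    using assms(2,3) by (simp add: right_diff_distrib sum_subtractf sum_distrib_right[symmetric])
  moreover have nn: "0 \<le> u x * (c - f x)" for x using assms(1)[of x] less[of x] by simp
  ultimately have z: "(\<Sum>x\<in>A. u x * (c - f x)) = 0" by (meson antisym sum_nonneg)
  have fin: "finite A" using assms(2) by (metis sum.infinite zero_neq_one)
  have "u x = 0" if "x \<in> A" for x
    using z sum_nonneg_eq_0_iff[OF fin, of "\<lambda>x. u x * (c - f x)"] nn that less[of x] by force
  then show False using assms(2) by simp
qed

context increment
begin

text \<open>The orders of magnitude: \<open>correlation\<close> makes the mean of
  \<open>a * B\<close> at most \<open>- p^3 / 4\<close>, and Cauchy-Schwarz on the support of
  \<open>a\<close> makes that of \<open>a * B^2\<close> at least of order \<open>p^5\<close>.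
  Removing \<open>a\<close> by the majorant gains a factor \<open>H\<close>. Comparing
  \<open>\<Omega>_ge\<close> with \<open>\<Omega>_le\<close> gains another one and yields a point
  where \<open>MM\<close> has normalised size \<open>H^2 * p^4\<close>. Finally \<open>MM_le\<close>
  divides by \<open>p\<close>, and the resulting \<open>H^2 * p^3\<close> is the fraction
  \<open>(H * p)^2\<close> of \<open>p\<close>.\<close>

lemma increment_step:
  assumes maj: "majorized a L H \<epsilon>" "lcard M \<le> L" and H: "1 \<le> H" "p \<le> 2 / H"
    and eps: "\<epsilon> \<le> p ^ 5 / 20000"
    and m: "p / 2 \<le> (\<Sum>z\<in>{0..<N}. \<mu> z * a z)" "(\<Sum>z\<in>{0..<N}. \<mu> z * a z) \<le> 2 * p"
    and sup: "\<And>x. (\<Sum>z\<in>{0..<N}. \<mu> z * a (x + 2 * z)) \<le> 2 * p"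
    and S: "\<And>r. (\<Sum>y\<in>{0..<N}. \<pi> (S r) y * tv M y) \<le> \<epsilon>"
      "\<And>r. (\<Sum>y\<in>{0..<N}. \<pi> (S r) y * norm (e (2 * r * y) - 1)) \<le> \<epsilon>"
      "\<And>r. (\<Sum>y\<in>{0..<N}. \<pi> (S r) y * tv D2 (2 * y)) \<le> \<epsilon>"
  shows "\<exists>r x. p * (1 + (H * p)\<^sup>2 / 10000) \<le> (\<Sum>y\<in>{0..<N}. \<pi> (S r) y * a (x + 2 * y))"
proof -
  have pw: "p ^ 5 \<le> p ^ 4" "p ^ 5 \<le> p ^ 3" "p ^ 4 \<le> p ^ 3"
    using p_pos p_le_1 by (auto intro!: power_decreasing)
  have pp: "0 < p ^ 3" "0 < p ^ 4" "0 < p ^ 5" using p_pos by auto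
  have H2: "1 \<le> H\<^sup>2" "H \<le> H\<^sup>2" using H(1) mult_mono[of 1 H 1 H] mult_right_mono[of 1 H H] by (auto simp: power2_eq_square)
  let ?X = "\<Sum>z\<in>{0..<N}. \<mu> z * (a z * (B z)\<^sup>2)"
  let ?Y = "\<Sum>z\<in>{0..<N}. \<mu> z * (B z)\<^sup>2"
  have X: "p ^ 5 / 32 \<le> ?X"
  proof -
    have "p\<^sup>2 * (p / 2) \<le> p\<^sup>2 * (\<Sum>z\<in>{0..<N}. \<mu> z * a z)" using m(1) by (rule mult_left_mono) simp
    moreover have "p\<^sup>2 * (p / 2) = p ^ 3 / 2" by (simp add: power2_eq_square power3_eq_cube)
    ultimately have c: "p ^ 3 / 4 \<le> - (\<Sum>z\<in>{0..<N}. \<mu> z * (a z * B z))"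
      using correlation eps pw pp by linarith
    have "(p ^ 3 / 4)\<^sup>2 \<le> (- (\<Sum>z\<in>{0..<N}. \<mu> z * (a z * B z)))\<^sup>2"
      by (rule power_mono[OF c]) (use pp in simp)
    also have "\<dots> = (\<Sum>z\<in>{0..<N}. (\<mu> z * a z) * (1 * B z))\<^sup>2" by (simp add: mult.assoc)
    also have "\<dots> \<le> (\<Sum>z\<in>{0..<N}. (\<mu> z * a z) * 1\<^sup>2) * (\<Sum>z\<in>{0..<N}. (\<mu> z * a z) * (B z)\<^sup>2)"
      by (rule sum_norm_eq_sqrt_bound) (simp add: \<pi>_nonneg a_bounds)
    also have "\<dots> = (\<Sum>z\<in>{0..<N}. \<mu> z * a z) * ?X" by (simp add: mult.assoc)
    also have "\<dots> \<le> (2 * p) * ?X"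
      by (intro mult_right_mono m(2) sum_nonneg mult_nonneg_nonneg \<pi>_nonneg a_bounds) auto
    finally have "p * (p ^ 5 / 32) \<le> p * ?X"
      by (simp add: power2_eq_square eval_nat_numeral mult_ac)
    then show ?thesis using p_pos by (simp only: mult_le_cancel_left_pos)
  qed
  have Y: "H * p ^ 5 / 64 \<le> ?Y"
  proof -
    have "p ^ 5 / 32 \<le> ?Y / H + \<epsilon>" using X majorant_short[OF maj] H by linarith
    then have "p ^ 5 / 64 \<le> ?Y / H" using eps pp by linarith
    then show ?thesis using H(1) by (simp add: field_simps)
  qed
  define K where "K = Max (MM ` {0..<N})"
  have fin: "finite (MM ` {0..<N})" "MM ` {0..<N} \<noteq> {}" using N_pos by auto
  obtain r where r: "K = MM r" using Max_in[OF fin] unfolding K_def by auto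
  have K: "MM s \<le> K" for s
  proof -
    have "MM s = MM (s mod N)" using per_MM by (simp add: per_def)
    moreover have "s mod N \<in> {0..<N}" using N_pos by simp
    ultimately show ?thesis unfolding K_def using fin(1) by (metis Max_ge imageI)
  qed
  let ?T = "of_int N * Z D2"
  have T: "0 < ?T" by (rule NZ_pos)
  have K0: "0 \<le> K" using r MM_nonneg by simp
  have "?T\<^sup>2 * (H * p ^ 5 / 64) \<le> ?T\<^sup>2 * ?Y" by (intro mult_left_mono Y) auto
  also have "\<dots> \<le> \<Omega>" by (rule \<Omega>_ge)
  also have "\<dots> \<le> 2 * p * Z D2 * of_int N * ((1 / H + p) * K + \<epsilon> * ?T)"
    by (rule \<Omega>_le[OF maj _ K]) (use H in auto)
  also have "\<dots> \<le> 2 * p * Z D2 * of_int N * (3 / H * K + \<epsilon> * ?T)"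
  proof -
    have "1 / H + p \<le> 3 / H" using H(2) by (simp add: add_divide_distrib[symmetric] field_simps)
    then have "(1 / H + p) * K \<le> 3 / H * K" using K0 by (rule mult_right_mono)
    then show ?thesis using p_pos Z_pos[of D2] N_pos by (intro mult_left_mono add_right_mono) auto
  qed
  finally have "(2 * p * ?T) * (?T * H * p ^ 4 / 128) \<le> (2 * p * ?T) * (3 / H * K + \<epsilon> * ?T)"
    by (simp add: power2_eq_square eval_nat_numeral mult_ac)
  then have "?T * H * p ^ 4 / 128 \<le> 3 / H * K + \<epsilon> * ?T"
    using p_pos T by (simp only: mult_le_cancel_left_pos mult_pos_pos zero_less_numeral)
  moreover have "\<epsilon> * ?T \<le> (H * p ^ 4 / 256) * ?T"
  proof -
    have "1 * p ^ 4 \<le> H * p ^ 4" using H(1) by (intro mult_right_mono) auto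
    then have "\<epsilon> \<le> H * p ^ 4 / 256" using eps pw pp by linarith
    then show ?thesis using T by (intro mult_right_mono) auto
  qed
  moreover have "(H * p ^ 4 / 256) * ?T = ?T * H * p ^ 4 / 256" by simp
  ultimately have "?T * H * p ^ 4 / 256 \<le> 3 / H * K" by linarith
  then have K_ge: "?T * (H\<^sup>2 * p ^ 4 / 768) \<le> K" using H(1) by (simp add: field_simps power2_eq_square)
  let ?E = "\<Sum>x\<in>{0..<N}. \<pi> D2 x * \<bar>gg (S r) x\<bar>"
  have "?T * (H\<^sup>2 * p ^ 4 / 768) \<le> ?T * (3 * p * ?E + 5 * \<epsilon>)"
    using K_ge MM_le[OF S(1,2)[of r] sup] unfolding r by linarith
  then have "H\<^sup>2 * p ^ 4 / 768 \<le> 3 * p * ?E + 5 * \<epsilon>" using T by (simp only: mult_le_cancel_left_pos)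
  moreover have eps2: "\<epsilon> \<le> p * (H\<^sup>2 * p ^ 3 / 20000)"
  proof -
    have "1 * p ^ 4 \<le> H\<^sup>2 * p ^ 4" using H2 by (intro mult_right_mono) auto
    then have "\<epsilon> \<le> H\<^sup>2 * p ^ 4 / 20000" using eps pw pp by linarith
    then show ?thesis by (simp add: eval_nat_numeral mult_ac)
  qed
  ultimately have "p * (H\<^sup>2 * p ^ 3 / 768) \<le> p * (3 * ?E + 5 * (H\<^sup>2 * p ^ 3 / 20000))"
    by (simp add: eval_nat_numeral algebra_simps)
  then have E: "H\<^sup>2 * p ^ 3 / 768 \<le> 3 * ?E + 5 * (H\<^sup>2 * p ^ 3 / 20000)"
    using p_pos by (simp only: mult_le_cancel_left_pos)
  have pH: "0 < H\<^sup>2 * p ^ 3" using pp H by simp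
  have "\<epsilon> \<le> H\<^sup>2 * p ^ 3 / 20000"
  proof -
    have "p * (H\<^sup>2 * p ^ 3 / 20000) \<le> 1 * (H\<^sup>2 * p ^ 3 / 20000)" using p_le_1 pH by (intro mult_right_mono) auto
    with eps2 show ?thesis by simp
  qed
  \<comment> \<open>The constant 10000 comes from here:
    \<open>(1/768 - 5/20000) / 3 - 1/20000\<close> exceeds \<open>2/10000\<close>.\<close>
  moreover have "x / 10000 \<le> (E - \<delta>) / 2"
    if "\<delta> \<le> x / 20000" "x / 768 \<le> 3 * E + 5 * (x / 20000)" "0 < x" for x E \<delta> :: real
  proof -
    have "\<delta> * 20000 \<le> x" "x * 20000 \<le> 768 * (60000 * E + 5 * x)" using that by (simp_all add: field_simps)
    then have "x * 2 \<le> (E - \<delta>) * 10000" using that(3) by (simp add: algebra_simps)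
    then show ?thesis by (simp add: field_simps)
  qed
  ultimately have E': "H\<^sup>2 * p ^ 3 / 10000 \<le> (?E - \<epsilon>) / 2" using E pH by blast
  \<comment> \<open>Passage to the positive part of \<open>gg\<close>: since the mean of
    \<open>gg\<close> is almost nonnegative, the positive part has at least half the mean of
    \<open>\<bar>gg\<bar>\<close>, up to an error.\<close>
  have "(?E - \<epsilon>) / 2 \<le> (\<Sum>x\<in>{0..<N}. \<pi> D2 x * ((\<bar>gg (S r) x\<bar> + gg (S r) x) / 2))"
  proof -
    have "(\<Sum>x\<in>{0..<N}. \<pi> D2 x * ((\<bar>gg (S r) x\<bar> + gg (S r) x) / 2)) = (?E + (\<Sum>x\<in>{0..<N}. \<pi> D2 x * gg (S r) x)) / 2"
      by (simp add: sum.distrib[symmetric] sum_divide_distrib distrib_left)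
    then show ?thesis using mean_gg[OF S(3)[of r]] by simp
  qed
  from exists_ge_mean[OF \<pi>_nonneg sum_\<pi> this]
  obtain x where "(?E - \<epsilon>) / 2 \<le> (\<bar>gg (S r) x\<bar> + gg (S r) x) / 2" by blast
  then have "H\<^sup>2 * p ^ 3 / 10000 \<le> gg (S r) x" using E' pH by (cases "gg (S r) x \<ge> 0") auto
  moreover have "gg (S r) x = (\<Sum>y\<in>{0..<N}. \<pi> (S r) y * a (x + 2 * y)) - p"
  proof -
    have "per (\<lambda>y. \<pi> (S r) y * a (x + 2 * y))"
      using per_\<pi>[of "S r"] per_comp2[OF per_a, of x 2] by (simp add: per_def)
    from sum_reflect[OF this, of 0]
    have "(\<Sum>y\<in>{0..<N}. \<pi> (S r) y * a (x - 2 * y)) = (\<Sum>y\<in>{0..<N}. \<pi> (S r) y * a (x + 2 * y))"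
      by (simp add: \<pi>_uminus)
    then show ?thesis
      by (simp add: gg_def right_diff_distrib sum_subtractf sum_distrib_right[symmetric] sum_\<pi>)
  qed
  moreover have "p * (1 + (H * p)\<^sup>2 / 10000) = p + H\<^sup>2 * p ^ 3 / 10000"
    by (simp add: power2_eq_square power3_eq_cube algebra_simps)
  ultimately show ?thesis by (intro exI[of _ r] exI[of _ x]) simp
qed

end

context cyclic
begin

lemma majorized_shift:
  assumes "majorized a L H \<epsilon>"
  shows "majorized (\<lambda>n. a (t + n)) L H \<epsilon>"
  unfolding majorized_def
proof (intro allI impI)
  fix D assume "lcard D \<le> L"
  then obtain \<nu> where \<nu>: "per \<nu>" "\<And>n. a n \<le> \<nu> n" "norm (FT (cc \<nu>) 0) \<le> of_int N / H"
    "\<And>\<phi>. (\<Sum>s\<in>{1..<N}. if \<exists>g\<in>spec D. N dvd s + \<phi> - g then norm (FT (cc \<nu>) s) else 0) \<le> of_int N * \<epsilon>"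
    using assms unfolding majorized_def by blast
  have *: "norm (FT (\<lambda>n. complex_of_real (\<nu> (t + n))) s) = norm (FT (cc \<nu>) s)" for s
  proof -
    have "per (\<lambda>n. cc \<nu> n * e (- s * n))"
      using \<nu>(1) per_e(1)[of "- s"] by (simp add: per_def)
    from sum_shift[OF this, of t]
    have "FT (cc \<nu>) s = (\<Sum>n\<in>{0..<N}. cc \<nu> (t + n) * e (- s * (t + n)))" by (simp add: FT_def add.commute)
    also have "\<dots> = e (- s * t) * FT (\<lambda>n. complex_of_real (\<nu> (t + n))) s"
      unfolding FT_def sum_distrib_left distrib_left e_add by (simp only: mult.left_commute)
    finally show ?thesis by (simp add: norm_mult)
  qed
  show "\<exists>\<nu>'. per \<nu>' \<and> (\<forall>n. a (t + n) \<le> \<nu>' n) \<and> norm (FT (cc \<nu>') 0) \<le> of_int N / H \<and>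
     (\<forall>\<phi>. (\<Sum>s\<in>{1..<N}. if \<exists>g\<in>spec D. N dvd s + \<phi> - g then norm (FT (cc \<nu>') s) else 0) \<le> of_int N * \<epsilon>)"
    by (rule exI[of _ "\<lambda>n. \<nu> (t + n)"], unfold *)
       (use \<nu> per_shift[OF \<nu>(1), of t] in \<open>auto simp: add.commute\<close>)
qed

lemma ap_free_shift:
  assumes "ap_free a"
  shows "ap_free (\<lambda>n. a (t + n))"
  unfolding ap_free_def
proof (intro allI impI, elim conjE)
  fix x y z assume *: "a (t + x) \<noteq> 0" "a (t + y) \<noteq> 0" "a (t + z) \<noteq> 0" "N dvd x + y - 2 * z"
  have "(t + x) + (t + y) - 2 * (t + z) = x + y - 2 * z" by simp
  then have "N dvd (t + x) - (t + z)" using assms * unfolding ap_free_def by metis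
  then show "N dvd x - z" by simp
qed

subsection \<open>The relative Roth theorem\<close>

text \<open>What an increment step needs of \<open>a\<close>, in a form stable under
  \<open>t + n\<close> and \<open>t + 2 * n\<close>. Moving to a dense translate thus changes the
  function and leaves the weights centred at 0.\<close>

definition good :: "real \<Rightarrow> real \<Rightarrow> real \<Rightarrow> (int \<Rightarrow> real) \<Rightarrow> bool" where
  "good L H \<epsilon> a \<longleftrightarrow> (\<forall>n. a n = 0 \<or> a n = 1) \<and> per a \<and> ap_free a \<and> majorized a L H \<epsilon>"

lemma good_shift: "good L H \<epsilon> a \<Longrightarrow> good L H \<epsilon> (\<lambda>n. a (t + n))"
  unfolding good_def using per_comp2[of a t 1] by (auto simp: ap_free_shift majorized_shift)

lemma good_affine: "good L H \<epsilon> a \<Longrightarrow> good L H \<epsilon> (\<lambda>n. a (t + 2 * n))"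
  unfolding good_def by (auto simp: ap_free_affine majorized_affine per_comp2)

definition dens :: "data \<Rightarrow> (int \<Rightarrow> real) \<Rightarrow> real" where
  "dens D a = (\<Sum>x\<in>{0..<N}. \<pi> D x * a x)"

text \<open>The mean of a majorant over the measure is its coefficient at 0 plus coefficients at
  frequencies of the spectrum. This cap holds for every weight of bounded complexity; exceeding it
  ends the iteration.\<close>

lemma dens_le:
  assumes "good L H \<epsilon> a" "lcard D \<le> L" "0 \<le> \<epsilon>"
  shows "dens D a \<le> 1 / H + \<epsilon>"
proof -
  have "majorized a L H \<epsilon>" using assms(1) by (simp add: good_def)
  then obtain \<nu> where \<nu>: "per \<nu>" "\<And>n. a n \<le> \<nu> n" "norm (FT (cc \<nu>) 0) \<le> of_int N / H"
    "\<And>\<phi>. (\<Sum>s\<in>{1..<N}. norm (FT (cc \<nu>) s) * chi D (s + \<phi>)) \<le> of_int N * \<epsilon>"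
    by (rule majorizedE[OF _ assms(2,3)]) blast
  let ?R = "\<Sum>s\<in>{1..<N}. FT (cc \<nu>) s * of_real (chi D s)"
  have ins: "{0..<N} = insert 0 {1..<N}" using N_pos by auto
  have "complex_of_real (of_int N * dens D \<nu>) = (\<Sum>n\<in>{0..<N}. cc (\<pi> D) n * (of_int N * cc \<nu> n))"
    by (simp add: dens_def sum_distrib_left mult_ac)
  also have "\<dots> = (\<Sum>n\<in>{0..<N}. \<Sum>s\<in>{0..<N}. FT (cc \<nu>) s * (cc (\<pi> D) n * e (s * n)))"
    unfolding FT_inversion[OF per_cc[OF \<nu>(1)], symmetric] sum_distrib_left by (simp only: mult.left_commute)
  also have "\<dots> = (\<Sum>s\<in>{0..<N}. FT (cc \<nu>) s * (\<Sum>n\<in>{0..<N}. cc (\<pi> D) n * e (s * n)))"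
    unfolding sum_distrib_left by (rule sum.swap)
  also have "\<dots> = FT (cc \<nu>) 0 * of_real (chi D 0) + ?R"
    unfolding chi_complex unfolding ins by (subst sum.insert) auto
  finally have "\<bar>of_int N * dens D \<nu>\<bar> = norm (FT (cc \<nu>) 0 * of_real (chi D 0) + ?R)"
    by (metis norm_of_real)
  also have "\<dots> \<le> norm (FT (cc \<nu>) 0 * of_real (chi D 0)) + norm ?R" by (rule norm_triangle_ineq)
  also have "norm (FT (cc \<nu>) 0 * of_real (chi D 0)) \<le> of_int N / H"
    using \<nu>(3) chi_le_1[of D 0] chi_nonneg[of D 0] mult_left_le[of "chi D 0" "norm (FT (cc \<nu>) 0)"]
    by (simp add: norm_mult)
  also have "norm ?R \<le> (\<Sum>s\<in>{1..<N}. norm (FT (cc \<nu>) s) * chi D (s + 0))"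
    by (rule sum_norm_le) (simp add: norm_mult chi_nonneg)
  also have "\<dots> \<le> of_int N * \<epsilon>" by (rule \<nu>(4))
  finally have "of_int N * dens D \<nu> \<le> of_int N * (1 / H + \<epsilon>)" by (simp add: distrib_left)
  then have "dens D \<nu> \<le> 1 / H + \<epsilon>" using N_pos by (simp only: mult_le_cancel_left_pos of_int_0_less_iff)
  moreover have "dens D a \<le> dens D \<nu>"
    unfolding dens_def by (intro sum_mono mult_left_mono \<nu>(2) \<pi>_nonneg)
  ultimately show ?thesis by linarith
qed

text \<open>With \<open>t = \<epsilon> / (16 * L)\<close> the first term of \<open>tv_bound\<close>
  is at most \<open>\<epsilon> / 4\<close>, and the mean of the second one is at most
  \<open>1024 * L^2 / (\<epsilon> * l)\<close>, hence at most \<open>3/4 * \<epsilon>\<close>. The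
  factor 8 admits \<open>v y = 2 * y\<close>, by \<open>en_double\<close>.\<close>

lemma tv_mean:
  assumes "0 < \<epsilon>" "\<epsilon> \<le> 1" "1 \<le> L" "lcard D \<le> L" "2000 * L\<^sup>2 / \<epsilon>\<^sup>2 \<le> l"
    and en: "(\<Sum>y\<in>{0..<N}. \<pi> D' y * en D y) \<le> L / l"
    and v: "\<And>y. en D (v y) \<le> 8 * en D y"
  shows "(\<Sum>y\<in>{0..<N}. \<pi> D' y * tv D (v y)) \<le> \<epsilon>"
proof -
  define t where "t = \<epsilon> / (16 * L)"
  have t: "0 < t" "t \<le> 1" using assms by (auto simp: t_def field_simps)
  have lam: "0 < l" using assms(1,3,5) by (smt (verit) divide_pos_pos zero_less_power mult_pos_pos)
  have "tv D (v y) \<le> \<epsilon> / 4 + (64 / t) * en D y" for y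
  proof -
    have "4 * t * lcard D \<le> 4 * t * L" using assms(4) t by (intro mult_left_mono) auto
    also have "\<dots> = \<epsilon> / 4" using assms(3) by (simp add: t_def)
    finally have 1: "4 * t * lcard D \<le> \<epsilon> / 4" .
    have "1 / t + 1 \<le> 2 / t" using t by (simp add: field_simps)
    then have "4 * (1 / t + 1) * en D (v y) \<le> 4 * (2 / t) * (8 * en D y)"
      using v[of y] t by (intro mult_mono mult_left_mono mult_nonneg_nonneg en_nonneg) auto
    then show ?thesis using tv_bound[OF t(1), of D "v y"] 1 by simp
  qed
  then have "(\<Sum>y\<in>{0..<N}. \<pi> D' y * tv D (v y)) \<le> (\<Sum>y\<in>{0..<N}. \<pi> D' y * (\<epsilon> / 4 + (64 / t) * en D y))"
    by (intro sum_mono mult_left_mono \<pi>_nonneg)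
  also have "\<dots> = \<epsilon> / 4 * (\<Sum>y\<in>{0..<N}. \<pi> D' y) + 64 / t * (\<Sum>y\<in>{0..<N}. \<pi> D' y * en D y)"
    unfolding sum_distrib_left sum.distrib[symmetric] by (intro sum.cong) (auto simp: algebra_simps)
  also have "\<dots> \<le> \<epsilon> / 4 * 1 + 64 / t * (L / l)"
    using en t by (simp only: sum_\<pi>) (intro add_left_mono mult_left_mono, auto)
  also have "64 / t * (L / l) = 1024 * L\<^sup>2 / (\<epsilon> * l)" using assms(1,3) lam by (simp add: t_def power2_eq_square)
  also have "\<dots> \<le> 3 / 4 * \<epsilon>"
  proof -
    have "2000 * L\<^sup>2 \<le> l * \<epsilon>\<^sup>2" using assms(1,5) by (simp add: field_simps)
    then have "1024 * L\<^sup>2 \<le> 3 / 4 * (l * \<epsilon>\<^sup>2)" using zero_le_power2[of L] by linarith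
    also have "\<dots> = 3 / 4 * \<epsilon> * (\<epsilon> * l)" by (simp add: power2_eq_square)
    finally have "1024 * L\<^sup>2 \<le> 3 / 4 * \<epsilon> * (\<epsilon> * l)" .
    then show ?thesis using assms(1) lam by (simp add: pos_divide_le_eq)
  qed
  finally show ?thesis by simp
qed

text \<open>Contradiction is the natural form here, because the absence of a denser translate is
  used repeatedly. It bounds the densities on \<open>E2\<close> and \<open>M\<close> from above; as
  their sum is large on a suitable translate, both are then close to the original density. It also
  gives the uniform upper bound over translates in \<open>increment_step\<close>, whose conclusion
  it finally refutes.\<close>

lemma dens_increment:
  assumes good: "good L H \<epsilon> a" and D: "length D \<le> k" "lcard D + 4 * (real k + 1) * ln l \<le> L"
    and H: "1 \<le> H" and \<alpha>: "0 < \<alpha>" "\<alpha> \<le> dens D a"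
    and eps: "0 < \<epsilon>" "\<epsilon> \<le> \<alpha> ^ 5 / 80000" "\<epsilon> \<le> 1 / H" and L: "1 \<le> L" "exp L / of_int N \<le> \<epsilon>"
    and lam: "2000 * L\<^sup>2 / \<epsilon>\<^sup>2 \<le> real l" "3 \<le> l"
  shows "\<exists>a' D'. good L H \<epsilon> a' \<and> length D' \<le> k + 1 \<and> lcard D' \<le> lcard D + 4 * (real k + 1) * ln l \<and>
     \<alpha> * (1 + (H * \<alpha>)\<^sup>2 / 40000) \<le> dens D' a'"
proof (rule ccontr)
  define \<alpha>0 where "\<alpha>0 = dens D a"
  \<comment> \<open>The denominator is four times that of \<open>increment_step\<close>: the gain of
    nearly \<open>4 * \<kappa>\<close> there has to pay for the loss \<open>2 * \<kappa>\<close> in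
    the choice of the translate and still leave \<open>\<kappa>\<close>.\<close>
  define \<kappa> where "\<kappa> = (H * \<alpha>0)\<^sup>2 / 40000"
  assume neg: "\<not> ?thesis"
  have \<alpha>0: "\<alpha> \<le> \<alpha>0" "0 < \<alpha>0" using \<alpha> by (auto simp: \<alpha>0_def)
  have mono: "\<alpha> * (1 + (H * \<alpha>)\<^sup>2 / 40000) \<le> \<alpha>0 * (1 + \<kappa>)"
    unfolding \<kappa>_def using \<alpha>0 \<alpha>(1) H
    by (intro mult_mono add_left_mono divide_right_mono power_mono mult_left_mono) auto
  have noinc: "dens D' a' < \<alpha>0 * (1 + \<kappa>)"
    if "good L H \<epsilon> a'" "length D' \<le> k + 1" "lcard D' \<le> lcard D + 4 * (real k + 1) * ln l" for a' D'
  proof (rule ccontr)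
    assume "\<not> dens D' a' < \<alpha>0 * (1 + \<kappa>)"
    then have "\<alpha> * (1 + (H * \<alpha>)\<^sup>2 / 40000) \<le> dens D' a'" using mono by linarith
    with that neg show False by blast
  qed
  have lnl: "ln 3 \<le> ln (real l)" "0 \<le> ln (real l)" "ln 2 \<le> ln (real l)" using lam(2) by auto
  \<comment> \<open>Nested weights, each almost invariant under shifts from the later ones.
    \<open>E2\<close> exists because the long measure is the square of the weight \<open>E\<close>,
    and only \<open>S r\<close> has a new frequency, the one exposed by
    \<open>increment_step\<close>. Each of the four scalings costs about \<open>k * ln l\<close> in
    \<open>lcard\<close>.\<close>
  define E where "E = scale l D"
  define E2 where "E2 = scale 2 E"
  define M where "M = scale l E2"
  define S where "S r = scale l (M @ [(2 * r, 1)])" for r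
  have len: "length E = length D" "length E2 = length D" "length M = length D" "length (S r) = length D + 1" for r
    by (auto simp: E_def E2_def M_def S_def scale_def)
  have lc_app: "lcard (A @ A') = lcard A + lcard A'" for A A' by (induction A rule: spec.induct) auto
  have klen: "real (length D) * ln l \<le> k * ln l" using D(1) lnl by (intro mult_right_mono) auto
  have lE: "lcard E \<le> lcard D + k * ln l"
    using lcard_scale[of l D] lam(2) klen unfolding E_def by linarith
  have lE2: "lcard E2 \<le> lcard D + 2 * (k * ln l)"
  proof -
    have "real (length E) * ln 2 \<le> real (length D) * ln l" unfolding len using lnl(3) by (rule mult_left_mono) simp
    then show ?thesis using lcard_scale[of 2 E] lE klen unfolding E2_def by simp
  qed
  have lM: "lcard M \<le> lcard D + 3 * (k * ln l)"
    using lcard_scale[of l E2] lam(2) lE2 klen unfolding M_def len by linarith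
  have lS: "lcard (S r) \<le> lcard D + 4 * (k * ln l) + 2 * ln l" for r
  proof -
    have "lcard (S r) \<le> (length D + 1) * ln l + (lcard M + ln 3)"
      using lcard_scale[of l "M @ [(2 * r, 1)]"] lam(2) unfolding S_def lc_app by (simp add: len)
    then show ?thesis using lM klen lnl(1) by (simp add: algebra_simps)
  qed
  have kl: "0 \<le> k * ln l" using lnl by simp
  have inc4: "4 * (real k + 1) * ln l = 4 * (k * ln l) + 4 * ln l" by (simp add: algebra_simps)
  have bnd: "lcard E2 \<le> lcard D + 4 * (real k + 1) * ln l" "lcard M \<le> lcard D + 4 * (real k + 1) * ln l"
    "lcard (S r) \<le> lcard D + 4 * (real k + 1) * ln l" for r
    unfolding inc4 using lE2 lM lS[of r] kl lnl by linarith+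
  then have bndL: "lcard E2 \<le> L" "lcard M \<le> L" "lcard (S r) \<le> L" "lcard D \<le> L" for r
    using D(2) kl lnl(2) bnd(3)[of r] unfolding inc4 by linarith+
  have eps1: "\<epsilon> \<le> 1" using eps(3) H by (smt (verit) divide_le_eq_1)
  have lam0: "0 < real l" using lam(2) by simp
  have en_lam: "(\<Sum>y\<in>{0..<N}. \<pi> (scale l A) y * en A y) \<le> L / l" if "lcard (scale l A) \<le> L" for A
  proof -
    have "real l * (\<Sum>y\<in>{0..<N}. \<pi> (scale l A) y * en A y) \<le> L"
      using mean_en[of "scale l A"] that by (simp add: en_scale sum_distrib_left mult_ac)
    then show ?thesis using lam0 by (simp add: field_simps)
  qed
  have en_le: "(\<Sum>y\<in>{0..<N}. \<pi> A y * en A' y) \<le> c" if "(\<Sum>y\<in>{0..<N}. \<pi> A y * en A'' y) \<le> c" "\<And>y. en A' y \<le> en A'' y" for A A' A'' c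
    by (rule order.trans[OF sum_mono[OF mult_left_mono[OF that(2) \<pi>_nonneg]] that(1)])
  have en_E2: "en E2 y = 2 * l * en D y" and en_M: "en M y = l * en E2 y"
    and en_S: "en (M @ [(2 * r, 1)]) y = en M y + en [(2 * r, 1)] y" for y r
    by (simp_all add: E2_def E_def M_def en_scale en_append)
  have scale_ge: "x \<le> real l * x" "x \<le> 2 * real l * x" if "0 \<le> x" for x
    using that lam(2) mult_right_mono[of 1 "real l" x] mult_right_mono[of 1 "2 * real l" x] by auto
  have D_le: "en D y \<le> en E2 y" and E2_le: "en E2 y \<le> en M y" for y
    unfolding en_M en_E2 using scale_ge[OF en_nonneg, of D y] scale_ge[OF en_nonneg, of E2 y] by (simp_all add: en_E2)
  have D_E2: "(\<Sum>y\<in>{0..<N}. \<pi> E2 y * en D y) \<le> L / l"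
  proof -
    have "real l * (\<Sum>y\<in>{0..<N}. \<pi> E2 y * en D y) \<le> (\<Sum>y\<in>{0..<N}. \<pi> E2 y * en E2 y)"
      unfolding sum_distrib_left en_E2
      by (intro sum_mono) (use \<pi>_nonneg en_nonneg in \<open>simp add: mult_left_mono mult_right_mono\<close>)
    then show ?thesis using mean_en[of E2] bndL(1) lam0 by (simp add: field_simps)
  qed
  have E2_M: "(\<Sum>y\<in>{0..<N}. \<pi> M y * en E2 y) \<le> L / l" using en_lam[of E2] bndL(2) unfolding M_def by simp
  have D_M: "(\<Sum>y\<in>{0..<N}. \<pi> M y * en D y) \<le> L / l"
    by (rule en_le[OF E2_M D_le])
  have MS_S: "(\<Sum>y\<in>{0..<N}. \<pi> (S r) y * en (M @ [(2 * r, 1)]) y) \<le> L / l" for r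
    using en_lam[of "M @ [(2 * r, 1)]"] bndL(3)[of r] unfolding S_def by simp
  have M_S: "(\<Sum>y\<in>{0..<N}. \<pi> (S r) y * en M y) \<le> L / l" for r
    by (rule en_le[OF MS_S]) (simp only: en_S le_add_same_cancel1 en_nonneg)
  have E2_S: "(\<Sum>y\<in>{0..<N}. \<pi> (S r) y * en E2 y) \<le> L / l" for r
    by (rule en_le[OF M_S E2_le])
  have one_S: "(\<Sum>y\<in>{0..<N}. \<pi> (S r) y * en [(2 * r, 1)] y) \<le> L / l" for r
    by (rule en_le[OF MS_S]) (simp only: en_S le_add_same_cancel2 en_nonneg)
  note tvm = tv_mean[OF eps(1) eps1 L(1) _ lam(1)]
  have id8: "en A y \<le> 8 * en A y" for A y using en_nonneg[of A y] by simp
  have tv1: "(\<Sum>y\<in>{0..<N}. \<pi> E2 y * tv D y) \<le> \<epsilon>" by (rule tvm[OF bndL(4) D_E2 id8])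
  have tv2: "(\<Sum>y\<in>{0..<N}. \<pi> M y * tv D y) \<le> \<epsilon>" by (rule tvm[OF bndL(4) D_M id8])
  have tv3: "(\<Sum>y\<in>{0..<N}. \<pi> M y * tv E2 (2 * y)) \<le> \<epsilon>" by (rule tvm[OF bndL(1) E2_M en_double])
  have tv4: "(\<Sum>y\<in>{0..<N}. \<pi> (S r) y * tv M y) \<le> \<epsilon>" for r by (rule tvm[OF bndL(2) M_S id8])
  have tv5: "(\<Sum>y\<in>{0..<N}. \<pi> (S r) y * tv E2 (2 * y)) \<le> \<epsilon>" for r by (rule tvm[OF bndL(1) E2_S en_double])
  have ph: "(\<Sum>y\<in>{0..<N}. \<pi> (S r) y * norm (e (2 * r * y) - 1)) \<le> \<epsilon>" for r
  proof -
    have "norm (e (2 * r * y) - 1) \<le> \<epsilon> / 2 + 4 / \<epsilon> * en [(2 * r, 1)] y" for y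
    proof -
      let ?s = "sn (2 * r) y"
      have "e (2 * r * y) = cis (2 * (pi * of_int (2 * r * y) / of_int N))" by (simp add: e_def mult.assoc)
      then have "(norm (e (2 * r * y) - 1))\<^sup>2 = (cos (2 * (pi * of_int (2 * r * y) / of_int N)) - 1)\<^sup>2 + (sin (2 * (pi * of_int (2 * r * y) / of_int N)))\<^sup>2"
        by (simp add: cmod_power2 del: of_int_mult)
      also have "\<dots> = 2 - 2 * cos (2 * (pi * of_int (2 * r * y) / of_int N))"
        using sin_cos_squared_add[of "2 * (pi * of_int (2 * r * y) / of_int N)"] by (simp add: power2_diff del: of_int_mult)
      also have "\<dots> = (2 * ?s)\<^sup>2" unfolding cos_double_sin by (simp add: power_mult_distrib del: of_int_mult)
      finally have "(norm (e (2 * r * y) - 1))\<^sup>2 = (2 * ?s)\<^sup>2" .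
      then have n: "norm (e (2 * r * y) - 1) = 2 * \<bar>?s\<bar>"
        by (intro power2_eq_imp_eq[of "norm (e (2 * r * y) - 1)" "2 * \<bar>?s\<bar>"]) (simp_all add: power_mult_distrib)
      have "0 \<le> (\<epsilon> / 2 - \<bar>?s\<bar>)\<^sup>2 * 2 / \<epsilon>" using eps(1) by simp
      also have "\<dots> = \<epsilon> / 2 + 2 / \<epsilon> * ?s\<^sup>2 - 2 * \<bar>?s\<bar>"
      proof -
        have "(\<epsilon> / 2 - x)\<^sup>2 * 2 / \<epsilon> = \<epsilon> / 2 + 2 / \<epsilon> * x\<^sup>2 - 2 * x" for x
          using eps(1) by (simp add: field_simps power2_eq_square)
        from this[of "\<bar>?s\<bar>"] show ?thesis by simp
      qed
      finally have "2 * \<bar>?s\<bar> \<le> \<epsilon> / 2 + 2 / \<epsilon> * ?s\<^sup>2" by simp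
      also have "2 / \<epsilon> * ?s\<^sup>2 \<le> 2 / \<epsilon> * (2 * en [(2 * r, 1)] y)"
        using en_qf(1)[of "[(2 * r, 1)]" y] eps(1) by (intro mult_left_mono) (auto simp del: of_int_mult)
      finally show ?thesis unfolding n by simp
    qed
    then have "(\<Sum>y\<in>{0..<N}. \<pi> (S r) y * norm (e (2 * r * y) - 1)) \<le> (\<Sum>y\<in>{0..<N}. \<pi> (S r) y * (\<epsilon> / 2 + 4 / \<epsilon> * en [(2 * r, 1)] y))"
      by (intro sum_mono mult_left_mono \<pi>_nonneg)
    also have "\<dots> = \<epsilon> / 2 * (\<Sum>y\<in>{0..<N}. \<pi> (S r) y) + 4 / \<epsilon> * (\<Sum>y\<in>{0..<N}. \<pi> (S r) y * en [(2 * r, 1)] y)"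
      unfolding sum_distrib_left sum.distrib[symmetric] by (intro sum.cong) (auto simp: algebra_simps)
    also have "\<dots> \<le> \<epsilon> / 2 * 1 + 4 / \<epsilon> * (L / l)"
      using one_S[of r] eps(1) by (simp only: sum_\<pi>) (intro add_left_mono mult_left_mono, auto)
    also have "4 / \<epsilon> * (L / l) \<le> \<epsilon> / 2"
    proof -
      have "L \<le> L\<^sup>2" using L(1) by (simp add: power2_eq_square mult_le_cancel_left1)
      moreover have "2000 * L\<^sup>2 \<le> real l * \<epsilon>\<^sup>2" using lam(1) eps(1) by (simp add: field_simps)
      ultimately have "8 * L \<le> real l * \<epsilon>\<^sup>2" using L(1) by linarith
      then show ?thesis using eps(1) lam0 by (simp add: field_simps power2_eq_square)
    qed
    finally show ?thesis by simp
  qed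
  have a01: "\<And>n. a n = 0 \<or> a n = 1" and per_a: "per a" and free: "ap_free a" and maj: "majorized a L H \<epsilon>"
    using good by (auto simp: good_def)
  have a_norm: "norm (a n) \<le> 1" for n using a01[of n] by auto
  have cap: "\<alpha>0 \<le> 2 / H" using dens_le[OF good bndL(4)] eps unfolding \<alpha>0_def by simp
  then have "H * \<alpha>0 \<le> 2" using H by (simp add: field_simps)
  then have "(H * \<alpha>0)\<^sup>2 \<le> 2\<^sup>2" using \<alpha>0 H by (intro power_mono) auto
  then have \<kappa>: "0 < \<kappa>" "\<kappa> \<le> 1 / 10000" using \<alpha>0 H by (auto simp: \<kappa>_def)
  have eps2: "2 * \<epsilon> \<le> \<kappa> * \<alpha>0"
  proof -
    have "\<alpha>0 \<le> dens D (\<lambda>_. 1)" unfolding \<alpha>0_def dens_def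
      using a01 by (intro sum_mono mult_left_mono \<pi>_nonneg) (metis order.refl zero_le_one)
    then have "\<alpha>0 \<le> 1" by (simp add: dens_def sum_\<pi>)
    then have "\<alpha>0 ^ 5 \<le> \<alpha>0 ^ 3" using \<alpha>0 by (intro power_decreasing) auto
    moreover have "\<alpha> ^ 5 \<le> \<alpha>0 ^ 5" using \<alpha>0 \<alpha> by (intro power_mono) auto
    moreover have "1 * \<alpha>0 ^ 3 \<le> H\<^sup>2 * \<alpha>0 ^ 3" using H \<alpha>0 by (intro mult_right_mono) auto
    ultimately have "2 * \<epsilon> \<le> H\<^sup>2 * \<alpha>0 ^ 3 / 40000" using eps(2) by linarith
    then show ?thesis by (simp add: \<kappa>_def power2_eq_square power3_eq_cube mult_ac)
  qed
  have avg: "\<alpha>0 - \<epsilon> \<le> (\<Sum>t\<in>{0..<N}. \<pi> D t * dens A (\<lambda>n. a (t + n)))"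
    if A: "(\<Sum>y\<in>{0..<N}. \<pi> A y * tv D y) \<le> \<epsilon>" for A
  proof -
    have "(\<Sum>t\<in>{0..<N}. \<pi> D t * dens A (\<lambda>n. a (t + n))) = (\<Sum>y\<in>{0..<N}. \<pi> A y * (\<Sum>t\<in>{0..<N}. \<pi> D t *\<^sub>R a (t + y)))"
      unfolding dens_def sum_distrib_left by (subst sum.swap) (simp add: mult_ac)
    also have "\<dots> \<ge> (\<Sum>y\<in>{0..<N}. \<pi> A y * (\<alpha>0 - tv D y))"
    proof (intro sum_mono mult_left_mono \<pi>_nonneg)
      fix y
      have "norm ((\<Sum>t\<in>{0..<N}. \<pi> D t *\<^sub>R a t) - (\<Sum>t\<in>{0..<N}. \<pi> D t *\<^sub>R a (t + y))) \<le> 1 * tv D y"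
        by (rule shift_tv[OF per_a a_norm])
      then show "\<alpha>0 - tv D y \<le> (\<Sum>t\<in>{0..<N}. \<pi> D t *\<^sub>R a (t + y))"
        by (simp add: \<alpha>0_def dens_def abs_le_iff)
    qed
    also have "(\<Sum>y\<in>{0..<N}. \<pi> A y * (\<alpha>0 - tv D y)) = \<alpha>0 - (\<Sum>y\<in>{0..<N}. \<pi> A y * tv D y)"
      by (simp add: right_diff_distrib sum_subtractf sum_distrib_right[symmetric] sum_\<pi>)
    finally show ?thesis using A by linarith
  qed
  \<comment> \<open>Averaging the sum of the two densities produces one translate that serves both
    weights.\<close>
  have "2 * \<alpha>0 - 2 * \<epsilon> \<le> (\<Sum>t\<in>{0..<N}. \<pi> D t * (dens E2 (\<lambda>n. a (t + n)) + dens M (\<lambda>n. a (t + n))))"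
    using avg[OF tv1] avg[OF tv2] by (simp add: distrib_left sum.distrib)
  from exists_ge_mean[OF \<pi>_nonneg sum_\<pi> this]
  obtain t where t: "2 * \<alpha>0 - 2 * \<epsilon> \<le> dens E2 (\<lambda>n. a (t + n)) + dens M (\<lambda>n. a (t + n))" by blast
  define a' where "a' n = a (t + n)" for n
  have good': "good L H \<epsilon> a'" unfolding a'_def by (rule good_shift[OF good])
  define p where "p = dens E2 a'"
  define m where "m = dens M a'"
  have up: "p < \<alpha>0 * (1 + \<kappa>)" "m < \<alpha>0 * (1 + \<kappa>)"
    unfolding p_def m_def using noinc[OF good'] bnd D(1) len by auto
  have pm: "2 * \<alpha>0 - 2 * \<epsilon> \<le> p + m" using t unfolding p_def m_def a'_def .
  have exp1: "\<alpha>0 * (1 + \<kappa>) = \<alpha>0 + \<kappa> * \<alpha>0" by (simp add: algebra_simps)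
  have lo: "\<alpha>0 - 2 * (\<kappa> * \<alpha>0) \<le> p" "\<alpha>0 - 2 * (\<kappa> * \<alpha>0) \<le> m" using up pm eps2 unfolding exp1 by linarith+
  have \<kappa>\<alpha>: "\<kappa> * \<alpha>0 \<le> \<alpha>0 / 10000" using \<kappa> \<alpha>0 mult_right_mono[of \<kappa> "1/10000" \<alpha>0] by simp
  have lo': "\<alpha>0 * (9998/10000) \<le> p" using lo(1) \<kappa>\<alpha> by linarith
  have p_pos: "0 < p" using lo(1) \<kappa>\<alpha> \<alpha>0 by linarith
  interpret inc: increment N a' E M p \<epsilon>
  proof
    show "a' n = 0 \<or> a' n = 1" for n unfolding a'_def by (rule a01)
    show "per a'" "ap_free a'" using good' by (auto simp: good_def)
    show "p = (\<Sum>x\<in>{0..<N}. \<pi> (scale 2 E) x * a' x)" unfolding p_def dens_def E2_def ..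
    show "0 < p" "0 < \<epsilon>" by fact+
    show "(\<Sum>z\<in>{0..<N}. \<pi> M z * tv (scale 2 E) (2 * z)) \<le> \<epsilon>" using tv3 unfolding E2_def .
    have "of_int N \<le> exp L * Z (scale 2 E)"
      using Z_ge[of E2] bndL(1) Z_pos[of E2] unfolding E2_def[symmetric]
      by (meson order.trans mult_right_mono exp_le_cancel_iff less_imp_le)
    then have "1 / Z (scale 2 E) \<le> exp L / of_int N"
      using Z_pos[of "scale 2 E"] N_pos by (simp add: field_simps)
    then show "1 / Z (scale 2 E) \<le> \<epsilon>" using L(2) by linarith
  qed
  have p5: "\<epsilon> \<le> p ^ 5 / 20000"
  proof -
    have "(\<alpha>0 * (9998/10000)) ^ 5 \<le> p ^ 5" using \<alpha>0 by (intro power_mono lo') auto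
    moreover have "(\<alpha>0 * (9998/10000)) ^ 5 = \<alpha>0 ^ 5 * (9998/10000) ^ 5" by (rule power_mult_distrib)
    moreover have "\<alpha>0 ^ 5 * (1/2) \<le> \<alpha>0 ^ 5 * (9998/10000) ^ 5" using \<alpha>0 by (intro mult_left_mono) (auto simp: eval_nat_numeral)
    moreover have "\<alpha> ^ 5 \<le> \<alpha>0 ^ 5" using \<alpha>0 \<alpha> by (intro power_mono) auto
    ultimately show ?thesis using eps(2) zero_le_power[of \<alpha> 5] \<alpha>(1) by linarith
  qed
  have "\<exists>r x. p * (1 + (H * p)\<^sup>2 / 10000) \<le> (\<Sum>y\<in>{0..<N}. \<pi> (S r) y * a' (x + 2 * y))"
  proof (rule inc.increment_step)
    show "majorized a' L H \<epsilon>" using good' by (simp add: good_def)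
    show "lcard M \<le> L" "1 \<le> H" "\<epsilon> \<le> p ^ 5 / 20000" by fact+
    show "p \<le> 2 / H" using dens_le[OF good' bndL(1)] eps unfolding p_def by simp
    show "p / 2 \<le> (\<Sum>z\<in>{0..<N}. \<pi> M z * a' z)" "(\<Sum>z\<in>{0..<N}. \<pi> M z * a' z) \<le> 2 * p"
      using lo up \<kappa>\<alpha> \<alpha>0 unfolding exp1 m_def dens_def by linarith+
    show "(\<Sum>z\<in>{0..<N}. \<pi> M z * a' (x + 2 * z)) \<le> 2 * p" for x
    proof -
      have "dens M (\<lambda>n. a' (x + 2 * n)) < \<alpha>0 * (1 + \<kappa>)"
        using noinc[OF good_affine[OF good', of x], of M] bnd D(1) len by auto
      moreover have "\<alpha>0 + \<kappa> * \<alpha>0 \<le> 2 * p" using lo(1) \<kappa>\<alpha> \<alpha>0(2) by linarith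
      ultimately show ?thesis unfolding exp1 dens_def by linarith
    qed
    show "(\<Sum>y\<in>{0..<N}. \<pi> (S r) y * tv M y) \<le> \<epsilon>" for r by (rule tv4)
    show "(\<Sum>y\<in>{0..<N}. \<pi> (S r) y * norm (e (2 * r * y) - 1)) \<le> \<epsilon>" for r by (rule ph)
    show "(\<Sum>y\<in>{0..<N}. \<pi> (S r) y * tv (scale 2 E) (2 * y)) \<le> \<epsilon>" for r using tv5 unfolding E2_def .
  qed
  then obtain r x where rx: "p * (1 + (H * p)\<^sup>2 / 10000) \<le> dens (S r) (\<lambda>y. a' (x + 2 * y))" unfolding dens_def by blast
  have "dens (S r) (\<lambda>y. a' (x + 2 * y)) < \<alpha>0 * (1 + \<kappa>)"
    using noinc[OF good_affine[OF good', of x], of "S r"] bnd(3)[of r] D(1) len by auto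
  moreover have "\<alpha>0 * (1 + \<kappa>) \<le> p * (1 + (H * p)\<^sup>2 / 10000)"
  proof -
    have "(H * (\<alpha>0 * (9998/10000)))\<^sup>2 \<le> (H * p)\<^sup>2" using \<alpha>0 H by (intro power_mono mult_left_mono lo') auto
    moreover have "(H * (\<alpha>0 * (9998/10000)))\<^sup>2 = (9998/10000)\<^sup>2 * (H * \<alpha>0)\<^sup>2" by (simp add: power2_eq_square)
    moreover have "(H * \<alpha>0)\<^sup>2 = 40000 * \<kappa>" by (simp add: \<kappa>_def)
    ultimately have "3.9 * \<kappa> \<le> (H * p)\<^sup>2 / 10000" using \<kappa> by (simp add: power2_eq_square)
    then have "(\<alpha>0 - 2 * (\<kappa> * \<alpha>0)) * (1 + 3.9 * \<kappa>) \<le> p * (1 + (H * p)\<^sup>2 / 10000)"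
      using lo(1) \<kappa> p_pos by (intro mult_mono) auto
    moreover have "\<alpha>0 * (1 + \<kappa>) \<le> (\<alpha>0 - 2 * (\<kappa> * \<alpha>0)) * (1 + 3.9 * \<kappa>)"
    proof -
      have "(\<alpha>0 - 2 * (\<kappa> * \<alpha>0)) * (1 + 3.9 * \<kappa>) - \<alpha>0 * (1 + \<kappa>) = \<alpha>0 * \<kappa> * (0.9 - 7.8 * \<kappa>)"
        by (simp add: field_simps)
      also have "\<dots> \<ge> 0" using \<alpha>0 \<kappa> by simp
      finally show ?thesis by simp
    qed
    ultimately show ?thesis by linarith
  qed
  ultimately show False using rx by linarith
qed

text \<open>The iteration starts from the empty data, whose measure is uniform. The relative gain
  increases with the density, so its initial value may serve in all steps. Step \<open>i\<close>
  adds \<open>4 * (i + 1) * ln l\<close> to the complexity, which stays below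
  \<open>4 * I^2 * ln l\<close>; after \<open>I\<close> steps the density violates
  \<open>dens_le\<close>.\<close>

theorem relative_roth:
  assumes good: "good L H \<epsilon> a" and H: "1 \<le> H" and \<alpha>: "0 < \<alpha>" "of_int N * \<alpha> \<le> (\<Sum>n\<in>{0..<N}. a n)"
    and eps: "0 < \<epsilon>" "\<epsilon> \<le> \<alpha> ^ 5 / 80000" "\<epsilon> \<le> 1 / H" and L: "1 \<le> L" "exp L / of_int N \<le> \<epsilon>"
    and lam: "2000 * L\<^sup>2 / \<epsilon>\<^sup>2 \<le> real l" "3 \<le> l"
    and I: "4 * (real I)\<^sup>2 * ln l \<le> L" "2 / H < \<alpha> * (1 + (H * \<alpha>)\<^sup>2 / 40000) ^ I"
  shows False
proof -
  let ?\<kappa> = "(H * \<alpha>)\<^sup>2 / 40000"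
  have lnl: "0 \<le> ln (real l)" using lam(2) by auto
  have "\<exists>a' D'. good L H \<epsilon> a' \<and> length D' \<le> i \<and> lcard D' \<le> 4 * (real i)\<^sup>2 * ln l \<and> \<alpha> * (1 + ?\<kappa>) ^ i \<le> dens D' a'"
    if "i \<le> I" for i
    using that
  proof (induction i)
    case 0
    have "dens [] a = (\<Sum>n\<in>{0..<N}. a n) / of_int N"
      using N_pos by (simp add: dens_def \<pi>_def Z_def sum_divide_distrib)
    then have "of_int N * \<alpha> \<le> of_int N * dens [] a" using \<alpha>(2) N_pos by simp
    then have "\<alpha> \<le> dens [] a" using N_pos by (simp only: mult_le_cancel_left_pos of_int_0_less_iff)
    then show ?case using good by (intro exI[of _ a] exI[of _ "[]"]) simp
  next
    case (Suc i)
    then obtain a' D' where *: "good L H \<epsilon> a'" "length D' \<le> i" "lcard D' \<le> 4 * (real i)\<^sup>2 * ln l" "\<alpha> * (1 + ?\<kappa>) ^ i \<le> dens D' a'"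
      by auto
    have "1 \<le> (1 + ?\<kappa>) ^ i" by (rule one_le_power) simp
    then have ge: "\<alpha> \<le> \<alpha> * (1 + ?\<kappa>) ^ i" using \<alpha>(1) by simp
    have inc: "lcard D' + 4 * (real i + 1) * ln l \<le> 4 * (real (Suc i))\<^sup>2 * ln l"
    proof -
      have "4 * (real i)\<^sup>2 + 4 * (real i + 1) \<le> 4 * (real (Suc i))\<^sup>2" by (simp add: power2_eq_square algebra_simps)
      then have "(4 * (real i)\<^sup>2 + 4 * (real i + 1)) * ln l \<le> 4 * (real (Suc i))\<^sup>2 * ln l" using lnl by (rule mult_right_mono)
      then show ?thesis using *(3) by (simp add: distrib_right)
    qed
    have "4 * (real (Suc i))\<^sup>2 * ln l \<le> 4 * (real I)\<^sup>2 * ln l"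
      using Suc.prems lnl by (intro mult_right_mono mult_left_mono power_mono) auto
    then have incL: "lcard D' + 4 * (real i + 1) * ln l \<le> L" using inc I(1) by linarith
    have eps': "\<epsilon> \<le> (\<alpha> * (1 + ?\<kappa>) ^ i) ^ 5 / 80000"
      using eps(2) power_mono[OF ge, of 5] \<alpha>(1) by linarith
    obtain a'' D'' where **: "good L H \<epsilon> a''" "length D'' \<le> i + 1" "lcard D'' \<le> lcard D' + 4 * (real i + 1) * ln l"
      "(\<alpha> * (1 + ?\<kappa>) ^ i) * (1 + (H * (\<alpha> * (1 + ?\<kappa>) ^ i))\<^sup>2 / 40000) \<le> dens D'' a''"
      using dens_increment[OF *(1,2) incL H order.strict_trans2[OF \<alpha>(1) ge] *(4) eps(1) eps' eps(3) L lam] by blast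
    have "1 + ?\<kappa> \<le> 1 + (H * (\<alpha> * (1 + ?\<kappa>) ^ i))\<^sup>2 / 40000"
      using ge H \<alpha>(1) by (intro add_left_mono divide_right_mono power_mono mult_left_mono) auto
    then have "(\<alpha> * (1 + ?\<kappa>) ^ i) * (1 + ?\<kappa>) \<le> dens D'' a''"
      using **(4) ge \<alpha>(1) by (meson order.trans mult_left_mono less_imp_le)
    then show ?case using ** inc by (intro exI[of _ a''] exI[of _ D'']) (auto simp: mult_ac)
  qed
  then obtain a' D' where "good L H \<epsilon> a'" "lcard D' \<le> 4 * (real I)\<^sup>2 * ln l" "\<alpha> * (1 + ?\<kappa>) ^ I \<le> dens D' a'"
    by blast
  then show False using dens_le[of L H \<epsilon> a' D'] I eps by fastforce
qed

end

subsection \<open>Selberg weights\<close>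

text \<open>Squarefree divisors are encoded as sets of primes: multiplicative functions become
  products over the set, divisibility becomes inclusion, and least common multiples become unions.
  The downward closed family \<open>Q\<close> plays the role of the divisors up to the sieve
  level.\<close>

locale selberg =
  fixes P :: "nat set" and Q :: "nat set set"
  assumes finite_P: "finite P" and P_gt_1: "\<And>p. p \<in> P \<Longrightarrow> 1 < p"
    and Q_sub: "Q \<subseteq> Pow P" and Q_empty: "{} \<in> Q" and Q_down: "\<And>A B. A \<in> Q \<Longrightarrow> B \<subseteq> A \<Longrightarrow> B \<in> Q"
begin

definition phi :: "nat set \<Rightarrow> real" where "phi A = (\<Prod>p\<in>A. real p - 1)"

definition nn :: "nat set \<Rightarrow> real" where "nn A = (\<Prod>p\<in>A. real p)"

definition H :: real where "H = (\<Sum>A\<in>Q. 1 / phi A)"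

definition lam :: "nat set \<Rightarrow> real" where
  "lam T = (- 1) ^ card T * nn T / H * (\<Sum>A\<in>{A\<in>Q. T \<subseteq> A}. 1 / phi A)"

lemma finite_Q: "finite Q" using Q_sub finite_P by (meson finite_Pow_iff finite_subset)

lemma Q_subD: "A \<in> Q \<Longrightarrow> A \<subseteq> P" using Q_sub by auto

lemma finite_mem_Q: "A \<in> Q \<Longrightarrow> finite A" using Q_subD finite_P finite_subset by blast

lemma phi_pos: "A \<subseteq> P \<Longrightarrow> 0 < phi A"
  unfolding phi_def using P_gt_1 by (intro prod_pos) force

lemma nn_pos: "A \<subseteq> P \<Longrightarrow> 0 < nn A"
  unfolding nn_def using P_gt_1 by (intro prod_pos) force

lemma H_ge_1: "1 \<le> H"
proof -
  have "1 / phi {} \<le> H" unfolding H_def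
    by (rule member_le_sum[OF Q_empty _ finite_Q]) (use phi_pos Q_subD in \<open>simp add: less_imp_le\<close>)
  then show ?thesis by (simp add: phi_def)
qed

lemma lam_empty: "lam {} = 1"
  using H_ge_1 by (simp add: lam_def nn_def H_def)

text \<open>Removing \<open>T\<close> maps the members of \<open>Q\<close> that contain
  \<open>T\<close> injectively into \<open>Q\<close>, so their sum is at most
  \<open>H / phi T\<close>. The remaining ratio \<open>nn T / phi T\<close> has factors
  \<open>p / (p - 1)\<close>, at most 2 each.\<close>

lemma abs_lam:
  assumes "T \<in> Q"
  shows "\<bar>lam T\<bar> \<le> 2 ^ card T"
proof -
  let ?S = "\<Sum>A\<in>{A\<in>Q. T \<subseteq> A}. 1 / phi A"
  have T: "T \<subseteq> P" "finite T" using assms Q_subD finite_mem_Q by auto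
  have "?S = (\<Sum>A\<in>{A\<in>Q. T \<subseteq> A}. 1 / phi T * (1 / phi (A - T)))"
  proof (rule sum.cong)
    fix A assume A: "A \<in> {A \<in> Q. T \<subseteq> A}"
    then have "finite A" using finite_mem_Q by auto
    then have "phi A = phi (A - T) * phi T" unfolding phi_def using A by (simp add: prod.subset_diff)
    then show "1 / phi A = 1 / phi T * (1 / phi (A - T))" by simp
  qed simp
  also have "\<dots> = 1 / phi T * (\<Sum>A\<in>{A\<in>Q. T \<subseteq> A}. 1 / phi (A - T))" by (simp add: sum_distrib_left)
  also have "(\<Sum>A\<in>{A\<in>Q. T \<subseteq> A}. 1 / phi (A - T)) = (\<Sum>B\<in>(\<lambda>A. A - T) ` {A\<in>Q. T \<subseteq> A}. 1 / phi B)"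
    by (subst sum.reindex) (auto intro!: inj_onI)
  also have "1 / phi T * \<dots> \<le> 1 / phi T * H"
    unfolding H_def
  proof (rule mult_left_mono[OF sum_mono2[OF finite_Q]])
    show "(\<lambda>A. A - T) ` {A \<in> Q. T \<subseteq> A} \<subseteq> Q" using Q_down by auto
    show "0 \<le> 1 / phi b" if "b \<in> Q - (\<lambda>A. A - T) ` {A \<in> Q. T \<subseteq> A}" for b
      using phi_pos[of b] Q_subD that by (simp add: less_imp_le)
    show "0 \<le> 1 / phi T" using phi_pos T by (simp add: less_imp_le)
  qed
  finally have S: "?S \<le> H / phi T" by simp
  have S0: "0 \<le> ?S" using phi_pos Q_subD by (intro sum_nonneg) (auto simp: less_imp_le)
  have "\<bar>lam T\<bar> = nn T / H * ?S"
    unfolding lam_def using S0 nn_pos[OF T(1)] H_ge_1 by (simp add: abs_mult power_abs)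
  also have "\<dots> \<le> nn T / H * (H / phi T)"
    using S nn_pos[OF T(1)] H_ge_1 by (intro mult_left_mono) auto
  also have "\<dots> = nn T / phi T" using H_ge_1 by simp
  also have "\<dots> = (\<Prod>p\<in>T. real p / (real p - 1))" by (simp add: nn_def phi_def prod_dividef)
  also have "\<dots> \<le> (\<Prod>p\<in>T. 2)"
  proof (rule prod_mono)
    fix p assume "p \<in> T"
    then have "2 \<le> real p" using P_gt_1 T(1) by force
    then show "0 \<le> real p / (real p - 1) \<and> real p / (real p - 1) \<le> 2" by (simp add: field_simps)
  qed
  finally show ?thesis by simp
qed

text \<open>The density of the integers \<open>n\<close> for which \<open>X\<close> is the set of primes of \<open>P\<close> dividing \<open>n\<close>.\<close>

definition pr :: "nat set \<Rightarrow> real" where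
  "pr X = (\<Prod>p\<in>X. 1 / real p) * (\<Prod>p\<in>P - X. 1 - 1 / real p)"

lemma mean_prod:
  "(\<Sum>X\<in>Pow P. pr X * (\<Prod>p\<in>P. f p (p \<in> X))) = (\<Prod>p\<in>P. f p True / real p + f p False * (1 - 1 / real p))"
proof -
  have "pr X * (\<Prod>p\<in>P. f p (p \<in> X)) = (\<Prod>p\<in>X. f p True / real p) * (\<Prod>p\<in>P - X. f p False * (1 - 1 / real p))" if "X \<in> Pow P" for X
  proof -
    have "(\<Prod>p\<in>P. f p (p \<in> X)) = (\<Prod>p\<in>P - X. f p (p \<in> X)) * (\<Prod>p\<in>X. f p (p \<in> X))"
      using that finite_P by (intro prod.subset_diff) auto
    then show ?thesis unfolding pr_def by (simp add: prod.distrib[symmetric] prod_dividef mult_ac)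
  qed
  then show ?thesis unfolding prod_add[OF finite_P] by (intro sum.cong) auto
qed

lemma pr_subset:
  assumes "U \<subseteq> P"
  shows "(\<Sum>X\<in>Pow P. pr X * of_bool (U \<subseteq> X)) = 1 / nn U"
proof -
  let ?f = "\<lambda>p b. if p \<in> U then of_bool b else (1 :: real)"
  have f: "(\<Prod>p\<in>P. ?f p (p \<in> X)) = of_bool (U \<subseteq> X)" for X
  proof (cases "U \<subseteq> X")
    case True
    then show ?thesis by (simp add: subset_iff prod.neutral)
  next
    case False
    then obtain p where "p \<in> U" "p \<notin> X" by auto
    then have "\<exists>p\<in>P. ?f p (p \<in> X) = 0" using assms by (intro bexI[of _ p]) auto
    then show ?thesis using False finite_P by (subst prod_zero) auto
  qed
  have "(\<Prod>p\<in>P. ?f p True / real p + ?f p False * (1 - 1 / real p)) = (\<Prod>p\<in>P. if p \<in> U then 1 / real p else 1)"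
    using P_gt_1 by (intro prod.cong) auto
  also have "\<dots> = (\<Prod>p\<in>U. 1 / real p)"
    using assms finite_P by (simp add: prod.If_cases Int_absorb1 flip: Int_def)
  also have "\<dots> = 1 / nn U" by (simp add: nn_def prod_dividef)
  finally show ?thesis using mean_prod[of ?f] f by simp
qed

text \<open>Values -1 and \<open>1 / (p - 1)\<close>. In the model where \<open>p\<close> divides
  with probability \<open>1 / p\<close> this has mean 0 and second moment
  \<open>1 / (p - 1)\<close>, so the products over sets \<open>A\<close> are orthogonal with square
  norms \<open>1 / phi A\<close>, as in \<open>mean_g\<close>.\<close>

definition g :: "nat \<Rightarrow> bool \<Rightarrow> real" where "g p b = 1 / (real p - 1) * (1 + (if b then - real p else 0))"

lemma sum_lam:
  assumes "X \<subseteq> P"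
  shows "(\<Sum>T\<in>Q. lam T * of_bool (T \<subseteq> X)) = (\<Sum>A\<in>Q. \<Prod>p\<in>A. g p (p \<in> X)) / H"
proof -
  have "(\<Prod>p\<in>A. g p (p \<in> X)) = (\<Sum>T\<in>Q. of_bool (T \<subseteq> A) * (1 / phi A * ((- 1) ^ card T * nn T * of_bool (T \<subseteq> X))))" if "A \<in> Q" for A
  proof -
    have fin: "finite A" using that finite_mem_Q by auto
    have "(\<Prod>p\<in>A. g p (p \<in> X)) = 1 / phi A * (\<Prod>p\<in>A. (if p \<in> X then - real p else 0) + 1)"
      unfolding g_def prod.distrib by (simp add: phi_def prod_dividef add.commute)
    also have "(\<Prod>p\<in>A. (if p \<in> X then - real p else 0) + 1) = (\<Sum>T\<in>Pow A. (\<Prod>p\<in>T. if p \<in> X then - real p else 0))"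
      by (simp add: prod_add[OF fin])
    also have "\<dots> = (\<Sum>T\<in>Pow A. (- 1) ^ card T * nn T * of_bool (T \<subseteq> X))"
    proof (rule sum.cong)
      fix T assume T: "T \<in> Pow A"
      then have finT: "finite T" using fin finite_subset by auto
      show "(\<Prod>p\<in>T. if p \<in> X then - real p else 0) = (- 1) ^ card T * nn T * of_bool (T \<subseteq> X)"
      proof (cases "T \<subseteq> X")
        case True
        then have "(\<Prod>p\<in>T. if p \<in> X then - real p else 0) = (\<Prod>p\<in>T. - real p)" by (intro prod.cong) auto
        then show ?thesis using True by (simp add: prod_uminus nn_def)
      next
        case False
        then have "\<exists>p\<in>T. (if p \<in> X then - real p else 0) = 0" by auto
        then show ?thesis using False finT by (subst prod_zero) auto
      qed
    qed simp
    also have "\<dots> = (\<Sum>T\<in>Q. of_bool (T \<subseteq> A) * ((- 1) ^ card T * nn T * of_bool (T \<subseteq> X)))"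
    proof -
      have "Pow A = {T\<in>Q. T \<subseteq> A}" using Q_down that by auto
      then show ?thesis using finite_Q by (simp add: sum.inter_filter of_bool_def if_distrib[of "\<lambda>x. x * _"] cong: if_cong)
    qed
    finally show ?thesis by (simp add: sum_distrib_left mult_ac)
  qed
  then have "(\<Sum>A\<in>Q. \<Prod>p\<in>A. g p (p \<in> X)) = (\<Sum>A\<in>Q. \<Sum>T\<in>Q. of_bool (T \<subseteq> A) * (1 / phi A * ((- 1) ^ card T * nn T * of_bool (T \<subseteq> X))))"
    by (intro sum.cong) auto
  also have "\<dots> = (\<Sum>T\<in>Q. \<Sum>A\<in>Q. of_bool (T \<subseteq> A) * (1 / phi A * ((- 1) ^ card T * nn T * of_bool (T \<subseteq> X))))"
    by (rule sum.swap)
  also have "\<dots> = (\<Sum>T\<in>Q. H * (lam T * of_bool (T \<subseteq> X)))"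
  proof (rule sum.cong)
    fix T
    have "(\<Sum>A\<in>Q. of_bool (T \<subseteq> A) * (1 / phi A * ((- 1) ^ card T * nn T * of_bool (T \<subseteq> X))))
        = (\<Sum>A\<in>{A\<in>Q. T \<subseteq> A}. 1 / phi A) * ((- 1) ^ card T * nn T * of_bool (T \<subseteq> X))"
      unfolding sum.inter_filter[OF finite_Q] sum_distrib_right by (intro sum.cong) auto
    then show "(\<Sum>A\<in>Q. of_bool (T \<subseteq> A) * (1 / phi A * ((- 1) ^ card T * nn T * of_bool (T \<subseteq> X)))) = H * (lam T * of_bool (T \<subseteq> X))"
      using H_ge_1 by (simp add: lam_def)
  qed simp
  finally show ?thesis using H_ge_1 by (simp add: sum_distrib_left[symmetric])
qed

lemma mean_g:
  assumes "A \<in> Q" "B \<in> Q"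
  shows "(\<Sum>X\<in>Pow P. pr X * ((\<Prod>p\<in>A. g p (p \<in> X)) * (\<Prod>p\<in>B. g p (p \<in> X)))) = (if A = B then 1 / phi A else 0)"
proof -
  let ?f = "\<lambda>p b. (if p \<in> A then g p b else 1) * (if p \<in> B then g p b else 1)"
  have AB: "A \<subseteq> P" "B \<subseteq> P" using assms Q_subD by auto
  have "(\<Prod>p\<in>A. g p (p \<in> X)) * (\<Prod>p\<in>B. g p (p \<in> X)) = (\<Prod>p\<in>P. ?f p (p \<in> X))" for X
    using AB finite_P by (simp add: prod.distrib prod.If_cases Int_absorb1 flip: Int_def)
  then have "(\<Sum>X\<in>Pow P. pr X * ((\<Prod>p\<in>A. g p (p \<in> X)) * (\<Prod>p\<in>B. g p (p \<in> X))))
      = (\<Prod>p\<in>P. ?f p True / real p + ?f p False * (1 - 1 / real p))" using mean_prod[of ?f] by simp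
  also have "\<dots> = (if A = B then 1 / phi A else 0)"
  proof (cases "A = B")
    case True
    have "?f p True / real p + ?f p False * (1 - 1 / real p) = (if p \<in> A then 1 / (real p - 1) else 1)" if "p \<in> P" for p
    proof -
      have p: "1 < real p" using P_gt_1[OF that] by simp
      have "g p True * g p True / real p + g p False * g p False * (1 - 1 / real p) = 1 / (real p - 1)"
      proof -
        have "g p True = - 1" "g p False = 1 / (real p - 1)" using p by (simp_all add: g_def field_simps)
        then have "g p True * g p True / real p + g p False * g p False * (1 - 1 / real p) = 1 / real p + (1 / (real p - 1)) * (1 / (real p - 1)) * ((real p - 1) / real p)"
          using p by (simp add: diff_divide_distrib)
        also have "\<dots> = 1 / real p + 1 / ((real p - 1) * real p)" using p by simp
        also have "\<dots> = 1 / (real p - 1)" using p by (simp add: field_simps)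
        finally show ?thesis .
      qed
      then show ?thesis using True p by (simp add: diff_divide_distrib)
    qed
    then have "(\<Prod>p\<in>P. ?f p True / real p + ?f p False * (1 - 1 / real p)) = (\<Prod>p\<in>P. if p \<in> A then 1 / (real p - 1) else 1)"
      by (intro prod.cong) auto
    also have "\<dots> = (\<Prod>p\<in>A. 1 / (real p - 1))"
      using AB finite_P by (simp add: prod.If_cases Int_absorb1 flip: Int_def)
    finally show ?thesis using True by (simp add: phi_def prod_dividef)
  next
    case False
    then obtain q where q: "(q \<in> A \<and> q \<notin> B) \<or> (q \<in> B \<and> q \<notin> A)" by auto
    then have qP: "q \<in> P" using AB by auto
    have p: "1 < real q" using P_gt_1[OF qP] by simp
    have "g q True / real q + g q False * (1 - 1 / real q) = 0"
    proof -
      have "g q True = - 1" "g q False = 1 / (real q - 1)" using p by (simp_all add: g_def field_simps)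
      then have "g q True / real q + g q False * (1 - 1 / real q) = - 1 / real q + 1 / (real q - 1) * ((real q - 1) / real q)"
        using p by (simp add: diff_divide_distrib)
      also have "\<dots> = 0" using p by simp
      finally show ?thesis .
    qed
    then have "\<exists>q\<in>P. ?f q True / real q + ?f q False * (1 - 1 / real q) = 0" using q qP by (intro bexI[of _ q]) auto
    then show ?thesis using False finite_P by (subst prod_zero) auto
  qed
  finally show ?thesis .
qed

text \<open>In the independent model the quadratic form is the second moment of the sum of the
  weights \<open>lam T\<close> over \<open>T \<subseteq> X\<close>. By \<open>sum_lam\<close> this
  random variable is a sum of orthogonal products of \<open>g\<close> divided by \<open>H\<close>;
  the squared norms add up to \<open>H\<close>, which leaves \<open>H / H^2\<close>.\<close>

theorem selberg_main: "(\<Sum>S\<in>Q. \<Sum>T\<in>Q. lam S * lam T / nn (S \<union> T)) = 1 / H"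
proof -
  have "(\<Sum>S\<in>Q. \<Sum>T\<in>Q. lam S * lam T / nn (S \<union> T)) = (\<Sum>S\<in>Q. \<Sum>T\<in>Q. \<Sum>X\<in>Pow P. pr X * ((lam S * of_bool (S \<subseteq> X)) * (lam T * of_bool (T \<subseteq> X))))"
  proof (intro sum.cong refl)
    fix S T assume "S \<in> Q" "T \<in> Q"
    then have "S \<union> T \<subseteq> P" using Q_subD by auto
    from pr_subset[OF this, symmetric]
    show "lam S * lam T / nn (S \<union> T) = (\<Sum>X\<in>Pow P. pr X * ((lam S * of_bool (S \<subseteq> X)) * (lam T * of_bool (T \<subseteq> X))))"
      by (simp add: divide_inverse[of "lam S * lam T"] inverse_eq_divide sum_distrib_left of_bool_conj mult_ac)
  qed
  also have "\<dots> = (\<Sum>X\<in>Pow P. \<Sum>S\<in>Q. \<Sum>T\<in>Q. pr X * ((lam S * of_bool (S \<subseteq> X)) * (lam T * of_bool (T \<subseteq> X))))"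
    by (subst sum.swap[of _ "Pow P"]) (intro sum.cong refl sum.swap)
  also have "\<dots> = (\<Sum>X\<in>Pow P. pr X * ((\<Sum>S\<in>Q. lam S * of_bool (S \<subseteq> X)) * (\<Sum>T\<in>Q. lam T * of_bool (T \<subseteq> X))))"
  proof (intro sum.cong refl)
    fix X
    show "(\<Sum>S\<in>Q. \<Sum>T\<in>Q. pr X * ((lam S * of_bool (S \<subseteq> X)) * (lam T * of_bool (T \<subseteq> X))))
      = pr X * ((\<Sum>S\<in>Q. lam S * of_bool (S \<subseteq> X)) * (\<Sum>T\<in>Q. lam T * of_bool (T \<subseteq> X)))"
      unfolding sum_product by (simp only: sum_distrib_left)
  qed
  also have "\<dots> = (\<Sum>X\<in>Pow P. pr X * (((\<Sum>A\<in>Q. \<Prod>p\<in>A. g p (p \<in> X)) / H) * ((\<Sum>A\<in>Q. \<Prod>p\<in>A. g p (p \<in> X)) / H)))"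
    by (intro sum.cong refl) (simp add: sum_lam)
  also have "\<dots> = (\<Sum>X\<in>Pow P. pr X * ((\<Sum>A\<in>Q. \<Prod>p\<in>A. g p (p \<in> X)) * (\<Sum>A\<in>Q. \<Prod>p\<in>A. g p (p \<in> X)))) / (H * H)"
    unfolding sum_divide_distrib[of _ "Pow P"] by (intro sum.cong refl) simp
  also have "(\<Sum>X\<in>Pow P. pr X * ((\<Sum>A\<in>Q. \<Prod>p\<in>A. g p (p \<in> X)) * (\<Sum>A\<in>Q. \<Prod>p\<in>A. g p (p \<in> X))))
      = (\<Sum>A\<in>Q. \<Sum>B\<in>Q. \<Sum>X\<in>Pow P. pr X * ((\<Prod>p\<in>A. g p (p \<in> X)) * (\<Prod>p\<in>B. g p (p \<in> X))))"
  proof -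
    have "pr X * ((\<Sum>A\<in>Q. \<Prod>p\<in>A. g p (p \<in> X)) * (\<Sum>A\<in>Q. \<Prod>p\<in>A. g p (p \<in> X)))
        = (\<Sum>A\<in>Q. \<Sum>B\<in>Q. pr X * ((\<Prod>p\<in>A. g p (p \<in> X)) * (\<Prod>p\<in>B. g p (p \<in> X))))" for X
      unfolding sum_product by (simp only: sum_distrib_left)
    then have "(\<Sum>X\<in>Pow P. pr X * ((\<Sum>A\<in>Q. \<Prod>p\<in>A. g p (p \<in> X)) * (\<Sum>A\<in>Q. \<Prod>p\<in>A. g p (p \<in> X))))
        = (\<Sum>X\<in>Pow P. \<Sum>A\<in>Q. \<Sum>B\<in>Q. pr X * ((\<Prod>p\<in>A. g p (p \<in> X)) * (\<Prod>p\<in>B. g p (p \<in> X))))"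
      by (intro sum.cong refl)
    also have "\<dots> = (\<Sum>A\<in>Q. \<Sum>B\<in>Q. \<Sum>X\<in>Pow P. pr X * ((\<Prod>p\<in>A. g p (p \<in> X)) * (\<Prod>p\<in>B. g p (p \<in> X))))"
      by (subst sum.swap) (intro sum.cong refl sum.swap)
    finally show ?thesis .
  qed
  also have "\<dots> = (\<Sum>A\<in>Q. \<Sum>B\<in>Q. if A = B then 1 / phi A else 0)"
    by (intro sum.cong refl) (simp add: mean_g)
  also have "\<dots> = H" using finite_Q by (simp add: H_def)
  finally show ?thesis using H_ge_1 by simp
qed

text \<open>At most \<open>4 ^ card U\<close> pairs have union \<open>U\<close>, and each of them
  has weights with product at most \<open>4 ^ card U\<close>.\<close>

lemma union_sum_le:
  assumes "\<And>U. 0 \<le> f U"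
  shows "(\<Sum>S\<in>Q. \<Sum>T\<in>Q. \<bar>lam S * lam T\<bar> * f (S \<union> T)) \<le> (\<Sum>U\<in>Pow P. 16 ^ card U * f U)"
proof -
  let ?I = "Q \<times> Q"
  have "(\<Sum>S\<in>Q. \<Sum>T\<in>Q. \<bar>lam S * lam T\<bar> * f (S \<union> T)) = (\<Sum>(S, T)\<in>?I. \<bar>lam S * lam T\<bar> * f (S \<union> T))"
    by (rule sum.cartesian_product)
  also have "\<dots> \<le> (\<Sum>(S, T)\<in>?I. 4 ^ card (S \<union> T) * f (S \<union> T))"
  proof (rule sum_mono, clarify)
    fix S T assume ST: "S \<in> Q" "T \<in> Q"
    have fin: "finite S" "finite T" using ST finite_mem_Q by auto
    have "\<bar>lam S * lam T\<bar> \<le> 2 ^ card S * 2 ^ card T"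
      unfolding abs_mult by (intro mult_mono abs_lam ST) auto
    also have "\<dots> \<le> 2 ^ card (S \<union> T) * (2 ^ card (S \<union> T) :: real)"
      using fin by (intro mult_mono power_increasing card_mono) auto
    also have "\<dots> = 4 ^ card (S \<union> T)" by (simp add: power_mult_distrib[symmetric])
    finally show "\<bar>lam S * lam T\<bar> * f (S \<union> T) \<le> 4 ^ card (S \<union> T) * f (S \<union> T)"
      by (intro mult_right_mono assms)
  qed
  also have "\<dots> = (\<Sum>U\<in>Pow P. \<Sum>(S, T)\<in>{x \<in> ?I. fst x \<union> snd x = U}. 4 ^ card (S \<union> T) * f (S \<union> T))"
  proof -
    have "(\<lambda>(S, T). S \<union> T) ` ?I \<subseteq> Pow P" using Q_subD by auto
    from sum.group[OF _ _ this, symmetric, of "\<lambda>(S, T). 4 ^ card (S \<union> T) * f (S \<union> T)"]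
    show ?thesis using finite_Q finite_P by (simp add: case_prod_unfold)
  qed
  also have "\<dots> \<le> (\<Sum>U\<in>Pow P. 16 ^ card U * f U)"
  proof (rule sum_mono)
    fix U assume U: "U \<in> Pow P"
    let ?J = "{x \<in> ?I. fst x \<union> snd x = U}"
    have finU: "finite U" using U finite_P finite_subset by auto
    have "?J \<subseteq> Pow U \<times> Pow U" by auto
    then have "card ?J \<le> card (Pow U \<times> Pow U)" using finU by (intro card_mono) auto
    also have "\<dots> = 4 ^ card U" using finU by (simp add: card_cartesian_product card_Pow power_mult_distrib[symmetric])
    finally have "real (card ?J) \<le> real (4 ^ card U)" by (simp only: of_nat_le_iff)
    then have J: "real (card ?J) \<le> 4 ^ card U" by simp
    have "(\<Sum>(S, T)\<in>?J. 4 ^ card (S \<union> T) * f (S \<union> T)) = (\<Sum>x\<in>?J. 4 ^ card U * f U)"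
      by (intro sum.cong) auto
    also have "\<dots> = real (card ?J) * (4 ^ card U * f U)" by simp
    also have "\<dots> \<le> 4 ^ card U * (4 ^ card U * f U)" using J assms by (intro mult_right_mono) auto
    also have "\<dots> = 16 ^ card U * f U" by (simp add: mult.assoc[symmetric] power_mult_distrib[symmetric])
    finally show "(\<Sum>(S, T)\<in>?J. 4 ^ card (S \<union> T) * f (S \<union> T)) \<le> 16 ^ card U * f U" .
  qed
  finally show ?thesis .
qed

lemma sum_superset:
  assumes "Q0 \<subseteq> P"
  shows "(\<Sum>U\<in>Pow P. 16 ^ card U * (of_bool (Q0 \<subseteq> U) / nn U)) \<le> (\<Prod>p\<in>Q0. 16 / real p) * (\<Prod>p\<in>P. 1 + 16 / real p)"
proof -
  have "(\<Sum>U\<in>Pow P. 16 ^ card U * (of_bool (Q0 \<subseteq> U) / nn U)) = (\<Sum>U\<in>Pow P. (\<Prod>p\<in>U. 16 / real p) * (\<Prod>p\<in>P - U. if p \<in> Q0 then 0 else 1))"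
  proof (rule sum.cong)
    fix U assume U: "U \<in> Pow P"
    have "(\<Prod>p\<in>P - U. if p \<in> Q0 then 0 else (1::real)) = of_bool (Q0 \<subseteq> U)"
    proof (cases "Q0 \<subseteq> U")
      case True then show ?thesis by (auto intro!: prod.neutral)
    next
      case False
      then have "\<exists>p\<in>P - U. (if p \<in> Q0 then 0 else (1::real)) = 0" using assms by auto
      then show ?thesis using False finite_P by (subst prod_zero) auto
    qed
    then show "16 ^ card U * (of_bool (Q0 \<subseteq> U) / nn U) = (\<Prod>p\<in>U. 16 / real p) * (\<Prod>p\<in>P - U. if p \<in> Q0 then 0 else 1)"
      by (simp add: nn_def prod_dividef)
  qed simp
  also have "\<dots> = (\<Prod>p\<in>P. 16 / real p + (if p \<in> Q0 then 0 else 1))" by (rule prod_add[OF finite_P, symmetric])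
  also have "\<dots> = (\<Prod>p\<in>P - Q0. 16 / real p + (if p \<in> Q0 then 0 else 1)) * (\<Prod>p\<in>Q0. 16 / real p + (if p \<in> Q0 then 0 else 1))"
    by (rule prod.subset_diff[OF assms finite_P])
  also have "\<dots> = (\<Prod>p\<in>P - Q0. 1 + 16 / real p) * (\<Prod>p\<in>Q0. 16 / real p)"
    by (intro arg_cong2[of _ _ _ _ "(*)"] prod.cong) auto
  also have "\<dots> \<le> (\<Prod>p\<in>P. 1 + 16 / real p) * (\<Prod>p\<in>Q0. 16 / real p)"
  proof (rule mult_right_mono)
    have "(\<Prod>p\<in>P - Q0. 1 + 16 / real p) * 1 \<le> (\<Prod>p\<in>P - Q0. 1 + 16 / real p) * (\<Prod>p\<in>Q0. 1 + 16 / real p)"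
      by (intro mult_left_mono prod_ge_1 prod_nonneg) auto
    also have "\<dots> = (\<Prod>p\<in>P. 1 + 16 / real p)" by (rule prod.subset_diff[OF assms finite_P, symmetric])
    finally show "(\<Prod>p\<in>P - Q0. 1 + 16 / real p) \<le> (\<Prod>p\<in>P. 1 + 16 / real p)" by simp
  qed (auto intro: prod_nonneg)
  finally show ?thesis by (simp add: mult.commute)
qed

end

subsection \<open>Sums over primes and squarefree numbers\<close>

lemma prod_dvd_if_coprime:
  fixes f :: "'b \<Rightarrow> 'a::semiring_gcd"
  assumes "finite A" "\<And>x. x \<in> A \<Longrightarrow> f x dvd m" "\<And>x y. x \<in> A \<Longrightarrow> y \<in> A \<Longrightarrow> x \<noteq> y \<Longrightarrow> coprime (f x) (f y)"
  shows "prod f A dvd m"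
  using assms
proof (induction A rule: finite_induct)
  case (insert x A)
  have "coprime (f x) (prod f A)" by (rule prod_coprime_right) (use insert in auto)
  then show ?case using insert by (simp add: divides_mult)
qed simp

lemma prod_primes_dvd:
  fixes A :: "nat set"
  assumes "finite A" "\<And>p. p \<in> A \<Longrightarrow> prime p" "\<And>p. p \<in> A \<Longrightarrow> p dvd m"
  shows "\<Prod>A dvd m"
  using assms by (intro prod_dvd_if_coprime primes_coprime)

text \<open>Chebyshev's argument: with \<open>n = 2 ^ j\<close>, all these primes exceed
  \<open>n\<close> and divide the binomial coefficient \<open>2 * n choose n\<close>, which is at
  most \<open>4 ^ n\<close>.\<close>

lemma card_primes_dyadic:
  "real j * real (card {p::nat. prime p \<and> 2 ^ j < p \<and> p \<le> 2 ^ Suc j}) \<le> 2 * 2 ^ j"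
proof -
  let ?n = "2 ^ j :: nat" and ?A = "{p::nat. prime p \<and> 2 ^ j < p \<and> p \<le> 2 ^ Suc j}"
  have fin: "finite ?A" by (rule finite_subset[of _ "{..2 ^ Suc j}"]) auto
  have "\<Prod>?A dvd (2 * ?n choose ?n)"
  proof (rule prod_primes_dvd[OF fin])
    fix p assume p: "p \<in> ?A"
    have "fact ?n * fact (2 * ?n - ?n) * (2 * ?n choose ?n) = (fact (2 * ?n) :: nat)"
      by (rule binomial_fact_lemma) simp
    moreover have "p dvd fact (2 * ?n)" "\<not> p dvd fact ?n"
      using p by (auto simp: prime_dvd_fact_iff)
    ultimately show "p dvd (2 * ?n choose ?n)"
      using p by (metis (no_types, lifting) add_diff_cancel_left' mem_Collect_eq mult_2 prime_dvd_mult_iff)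
  qed auto
  then have "\<Prod>?A \<le> (2 * ?n choose ?n)" by (rule dvd_imp_le) simp
  also have "\<dots> \<le> (\<Sum>k\<le>2 * ?n. 2 * ?n choose k)" by (rule member_le_sum) auto
  also have "\<dots> = 2 ^ (2 * ?n)" by (rule choose_row_sum)
  finally have "\<Prod>?A \<le> 2 ^ (2 * ?n)" .
  moreover have "?n ^ card ?A \<le> \<Prod>?A"
  proof -
    have "(\<Prod>p\<in>?A. ?n) \<le> (\<Prod>p\<in>?A. p)" by (rule prod_mono) auto
    then show ?thesis by simp
  qed
  ultimately have "(2::nat) ^ (j * card ?A) \<le> 2 ^ (2 * ?n)" by (simp add: power_mult)
  then have "j * card ?A \<le> 2 * ?n" by (simp add: power_increasing_iff)
  then have "real (j * card ?A) \<le> real (2 * ?n)" by (simp only: of_nat_le_iff)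
  then show ?thesis by simp
qed

lemma sum_inv_primes_dyadic:
  assumes "1 \<le> j"
  shows "(\<Sum>p\<in>{p. prime p \<and> 2 ^ j < p \<and> p \<le> 2 ^ Suc j}. 1 / real p) \<le> 2 / real j"
proof -
  let ?A = "{p::nat. prime p \<and> 2 ^ j < p \<and> p \<le> 2 ^ Suc j}"
  have "(\<Sum>p\<in>?A. 1 / real p) \<le> (\<Sum>p\<in>?A. 1 / 2 ^ j)"
  proof (rule sum_mono)
    fix p assume p: "p \<in> ?A"
    then have "real (2 ^ j) \<le> real p" by (simp only: of_nat_le_iff) auto
    moreover have "0 < real p" using p prime_gt_0_nat by auto
    ultimately show "1 / real p \<le> 1 / 2 ^ j" by (intro divide_left_mono) auto
  qed
  also have "\<dots> = real (card ?A) / 2 ^ j" by simp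
  also have "\<dots> \<le> 2 / real j" using card_primes_dyadic[of j] assms by (simp add: field_simps)
  finally show ?thesis .
qed

lemma harm_le_ln:
  assumes "1 \<le> n" shows "harm n \<le> 1 + ln (real n)"
proof -
  have "harm n - ln (real n) \<le> harm 1 - ln (real 1)"
    by (rule euler_mascheroni_sequence_decreasing[of 1 n]) (use assms in auto)
  then show ?thesis by (simp add: harm_def)
qed

lemma sum_inv_primes_pow2:
  "(\<Sum>p\<in>{p. prime p \<and> p \<le> 2 ^ Suc J}. 1 / real p) \<le> 1 / 2 + 2 * harm J"
proof (induction J)
  case 0
  have "{p::nat. prime p \<and> p \<le> 2} = {2}" using prime_ge_2_nat by (auto intro: antisym)
  then show ?case by (simp add: harm_def)
next
  case (Suc J)
  let ?A = "{p::nat. prime p \<and> p \<le> 2 ^ Suc J}" and ?B = "{p::nat. prime p \<and> 2 ^ Suc J < p \<and> p \<le> 2 ^ Suc (Suc J)}"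
  have "{p::nat. prime p \<and> p \<le> 2 ^ Suc (Suc J)} = ?A \<union> ?B" by auto
  moreover have "finite ?A" "finite ?B"
    by (rule finite_subset[of _ "{..2 ^ Suc J}"]; force) (rule finite_subset[of _ "{..2 ^ Suc (Suc J)}"]; force)
  moreover have "?A \<inter> ?B = {}" by auto
  ultimately have "(\<Sum>p\<in>{p. prime p \<and> p \<le> 2 ^ Suc (Suc J)}. 1 / real p) = (\<Sum>p\<in>?A. 1 / real p) + (\<Sum>p\<in>?B. 1 / real p)"
    by (simp only: sum.union_disjoint)
  also have "\<dots> \<le> (1 / 2 + 2 * harm J) + 2 / real (Suc J)"
    by (intro add_mono Suc sum_inv_primes_dyadic) simp
  also have "\<dots> = 1 / 2 + 2 * harm (Suc J)" by (simp add: harm_Suc inverse_eq_divide)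
  finally show ?case .
qed

text \<open>The dyadic block \<open>j\<close> contributes at most \<open>2 / j\<close>, so a
  harmonic sum up to the binary logarithm of \<open>n\<close> appears. The leading factor 2 stems
  from Chebyshev's bound and doubles the powers of the logarithm in the sieve estimates.\<close>

lemma sum_inv_primes:
  assumes "3 \<le> n"
  shows "(\<Sum>p\<in>{p. prime p \<and> p \<le> n}. 1 / real p) \<le> 2 * ln (ln (real n)) + 5"
proof -
  define J where "J = nat \<lfloor>log 2 (real n)\<rfloor>"
  have ln2: "0 < ln (2::real)" "1 / 2 \<le> ln (2::real)" using ln_2_less_1 ln2_ge_two_thirds by auto
  have log1: "1 \<le> log 2 (real n)" using assms by simp
  then have J1: "1 \<le> J" unfolding J_def by linarith
  have "real n = 2 powr log 2 (real n)" using assms by simp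
  also have "\<dots> \<le> 2 powr (real (Suc J))" unfolding J_def using log1 by (intro powr_mono) linarith+
  also have "\<dots> = real (2 ^ Suc J)" by (subst powr_realpow) auto
  finally have "n \<le> 2 ^ Suc J" by (simp only: of_nat_le_iff)
  have "(\<Sum>p\<in>{p. prime p \<and> p \<le> n}. 1 / real p) \<le> (\<Sum>p\<in>{p. prime p \<and> p \<le> 2 ^ Suc J}. 1 / real p)"
  proof (rule sum_mono2)
    show "finite {p::nat. prime p \<and> p \<le> 2 ^ Suc J}" by (rule finite_subset[of _ "{..2 ^ Suc J}"]) auto
    show "{p. prime p \<and> p \<le> n} \<subseteq> {p. prime p \<and> p \<le> 2 ^ Suc J}"
      using order.trans[OF _ \<open>n \<le> 2 ^ Suc J\<close>] by blast
  qed simp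
  also have "\<dots> \<le> 1 / 2 + 2 * harm J" by (rule sum_inv_primes_pow2)
  also have "\<dots> \<le> 1 / 2 + 2 * (1 + ln (real J))" using harm_le_ln[OF J1] by simp
  also have "ln (real J) \<le> ln (2 * ln (real n))"
  proof -
    have "real J \<le> log 2 (real n)" unfolding J_def using log1 by linarith
    also have "\<dots> = ln (real n) / ln 2" by (simp add: log_def)
    also have "\<dots> \<le> ln (real n) / (1 / 2)" using ln2 assms by (intro divide_left_mono) auto
    finally show ?thesis using J1 by simp
  qed
  also have "ln (2 * ln (real n)) = ln 2 + ln (ln (real n))" using assms by (intro ln_mult_pos) auto
  finally show ?thesis using ln_2_less_1 by simp
qed

lemma squarefree_eq_prod:
  fixes q :: nat
  assumes "squarefree q"
  shows "\<Prod>(prime_factors q) = q"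
proof -
  have q0: "q \<noteq> 0" using assms not_squarefree_0[where ?'a = nat] by metis
  have "(\<Prod>p\<in>prime_factors q. p) = (\<Prod>p\<in>prime_factors q. p ^ multiplicity p q)"
  proof (rule prod.cong)
    fix p assume p: "p \<in> prime_factors q"
    then have "multiplicity p q = 1"
      using squarefree_factorial_semiring'[OF q0] assms by auto
    then show "p = p ^ multiplicity p q" by simp
  qed simp
  also have "\<dots> = q" using prod_prime_factors[OF q0] by simp
  finally show ?thesis by simp
qed

lemma sum_inv_squares: "(\<Sum>k\<in>{1..K}. 1 / (real k)\<^sup>2) \<le> 2"
proof -
  have "(\<Sum>k\<in>{1..Suc K}. 1 / (real k)\<^sup>2) \<le> 2 - 1 / real (Suc K)" for K
  proof (induction K)
    case (Suc K)
    have "1 / (a + 1)\<^sup>2 \<le> 1 / a - 1 / (a + 1)" if "0 < a" for a :: real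
    proof -
      have "1 / (a + 1)\<^sup>2 \<le> 1 / (a * (a + 1))"
        using that by (intro divide_left_mono) (auto simp: power2_eq_square intro: mult_right_mono)
      also have "\<dots> = 1 / a - 1 / (a + 1)" using that by (simp add: field_simps)
      finally show ?thesis .
    qed
    from this[of "real (Suc K)"]
    have "1 / (real (Suc (Suc K)))\<^sup>2 \<le> 1 / real (Suc K) - 1 / real (Suc (Suc K))" by (simp add: add.commute)
    with Suc show ?case by simp
  qed simp
  from this[of "K - 1"] show ?thesis by (cases K) (auto intro: order.trans)
qed

text \<open>Every \<open>n \<le> z\<close> is uniquely a squarefree number times a square. As the
  reciprocals of the squares sum to at most 2, the harmonic sum is at most twice the sum over
  squarefree numbers.\<close>

lemma sum_inv_squarefree: "ln (real z) / 2 \<le> (\<Sum>q\<in>{q. squarefree q \<and> q \<le> z}. 1 / real q)" if "1 \<le> z"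
proof -
  let ?S = "{q. squarefree q \<and> q \<le> z}"
  have fin: "finite ?S" by (rule finite_subset[of _ "{..z}"]) auto
  let ?h = "\<lambda>n. (squarefree_part n, square_part n)"
  have "ln (real z) \<le> harm z" using ln_le_harm[of z] that by (intro order.trans[OF _ ln_le_harm]) simp
  also have "harm z = (\<Sum>n\<in>{1..z}. 1 / real n)" by (simp add: harm_def inverse_eq_divide)
  also have "\<dots> = (\<Sum>n\<in>{1..z}. case ?h n of (q, k) \<Rightarrow> 1 / real q * (1 / (real k)\<^sup>2))"
  proof (rule sum.cong)
    fix n
    have "real n = real (squarefree_part n * square_part n ^ 2)"
      by (rule arg_cong[OF squarefree_decompose])
    then have "real n = real (squarefree_part n) * (real (square_part n))\<^sup>2"
      by (simp only: of_nat_mult of_nat_power)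
    then show "1 / real n = (case ?h n of (q, k) \<Rightarrow> 1 / real q * (1 / (real k)\<^sup>2))" by simp
  qed simp
  also have "\<dots> = (\<Sum>(q, k)\<in>?h ` {1..z}. 1 / real q * (1 / (real k)\<^sup>2))"
  proof (subst sum.reindex)
    show "inj_on ?h {1..z}"
    proof (rule inj_onI)
      fix m n assume h: "?h m = ?h n"
      have "m = squarefree_part m * square_part m ^ 2" by (rule squarefree_decompose)
      also have "\<dots> = squarefree_part n * square_part n ^ 2" using h by simp
      also have "\<dots> = n" by (rule squarefree_decompose[symmetric])
      finally show "m = n" .
    qed
  qed simp
  also have "\<dots> \<le> (\<Sum>(q, k)\<in>?S \<times> {1..z}. 1 / real q * (1 / (real k)\<^sup>2))"
  proof (rule sum_mono2)
    show "?h ` {1..z} \<subseteq> ?S \<times> {1..z}"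
    proof clarify
      fix n assume n: "n \<in> {1..z}"
      have "squarefree_part n dvd squarefree_part n * square_part n ^ 2" "square_part n dvd squarefree_part n * square_part n ^ 2"
        by simp_all
      then have "squarefree_part n dvd n" "square_part n dvd n"
        unfolding squarefree_decompose[of n, symmetric] .
      moreover have "1 \<le> square_part n" using n square_part_0_iff[of n] by (cases "square_part n") auto
      ultimately have "squarefree_part n \<le> z" "square_part n \<le> z" "1 \<le> square_part n"
        using n by (auto dest!: dvd_imp_le)
      then show "squarefree_part n \<in> ?S \<and> square_part n \<in> {1..z}" using n by auto
    qed
  qed (use fin in auto)
  also have "\<dots> = (\<Sum>q\<in>?S. 1 / real q) * (\<Sum>k\<in>{1..z}. 1 / (real k)\<^sup>2)"
    by (simp add: sum_product sum.cartesian_product)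
  also have "\<dots> \<le> (\<Sum>q\<in>?S. 1 / real q) * 2"
    by (intro mult_left_mono sum_inv_squares sum_nonneg) auto
  finally show ?thesis by simp
qed

section \<open>The Selberg sieve with a set of omitted primes\<close>

definition sieve_primes :: "nat \<Rightarrow> nat set \<Rightarrow> nat set" where
  "sieve_primes z E = {p. prime p \<and> p \<le> z} - E"

definition sieve_sets :: "nat \<Rightarrow> nat set \<Rightarrow> nat set set" where
  "sieve_sets z E = {A. A \<subseteq> sieve_primes z E \<and> \<Prod>A \<le> z}"

lemma finite_sieve_primes: "finite (sieve_primes z E)"
  unfolding sieve_primes_def by (rule finite_subset[of _ "{..z}"]) auto

lemma prod_primes_pos: "A \<subseteq> sieve_primes z E \<Longrightarrow> 0 < \<Prod>A"
  by (rule prod_pos) (auto simp: sieve_primes_def prime_gt_0_nat)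

lemma selberg_sieve:
  assumes "1 \<le> z"
  shows "selberg (sieve_primes z E) (sieve_sets z E)"
proof
  show "finite (sieve_primes z E)" by (rule finite_sieve_primes)
  show "1 < p" if "p \<in> sieve_primes z E" for p using that prime_gt_1_nat by (auto simp: sieve_primes_def)
  show "sieve_sets z E \<subseteq> Pow (sieve_primes z E)" by (auto simp: sieve_sets_def)
  show "{} \<in> sieve_sets z E" using assms by (simp add: sieve_sets_def)
  fix A B assume A: "A \<in> sieve_sets z E" and B: "B \<subseteq> A"
  then have fin: "finite A" unfolding sieve_sets_def by (intro finite_subset[OF _ finite_sieve_primes[of z E]]) auto
  have "\<Prod>B dvd \<Prod>A" using fin B by (rule prod_dvd_prod_subset)
  moreover have "0 < \<Prod>A" using A prod_primes_pos by (auto simp: sieve_sets_def)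
  ultimately have "\<Prod>B \<le> \<Prod>A" by (simp add: dvd_imp_le)
  then show "B \<in> sieve_sets z E" using A B by (auto simp: sieve_sets_def)
qed

text \<open>Splitting a set into its parts inside and outside \<open>E\<close> bounds the sum over
  all sets of primes by the sum \<open>H\<close> without \<open>E\<close> times an Euler product
  over \<open>E\<close>. The full sum dominates that of the reciprocals of squarefree
  numbers.\<close>

lemma sieve_H_ge:
  assumes "1 \<le> z" "finite E" "\<And>p. p \<in> E \<Longrightarrow> prime p"
  shows "ln (real z) / 2 \<le> (\<Prod>p\<in>E. 1 + 1 / (real p - 1)) * selberg.H (sieve_sets z E)"
proof -
  interpret full: selberg "sieve_primes z {}" "sieve_sets z {}" by (rule selberg_sieve[OF assms(1)])
  interpret s: selberg "sieve_primes z E" "sieve_sets z E" by (rule selberg_sieve[OF assms(1)])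
  have phi_eq: "full.phi A = s.phi A" for A by (simp add: full.phi_def s.phi_def)
  have "ln (real z) / 2 \<le> (\<Sum>q\<in>{q. squarefree q \<and> q \<le> z}. 1 / real q)" by (rule sum_inv_squarefree[OF assms(1)])
  also have "\<dots> = (\<Sum>q\<in>{q. squarefree q \<and> q \<le> z}. 1 / real (\<Prod>(prime_factors q)))"
    by (intro sum.cong) (auto simp: squarefree_eq_prod)
  also have "\<dots> = (\<Sum>A\<in>prime_factors ` {q. squarefree q \<and> q \<le> z}. 1 / real (\<Prod>A))"
    by (subst sum.reindex) (auto intro!: inj_onI, metis squarefree_eq_prod)
  also have "\<dots> \<le> (\<Sum>A\<in>sieve_sets z {}. 1 / real (\<Prod>A))"
  proof (rule sum_mono2[OF full.finite_Q])
    show "prime_factors ` {q. squarefree q \<and> q \<le> z} \<subseteq> sieve_sets z {}"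
    proof clarify
      fix q :: nat assume q: "squarefree q" "q \<le> z"
      then have "q \<noteq> 0" using not_squarefree_0[where ?'a = nat] by metis
      then have "p \<le> z" if "p dvd q" for p using that q dvd_imp_le[of p q] by simp
      then show "prime_factors q \<in> sieve_sets z {}"
        using q by (auto simp: sieve_sets_def sieve_primes_def squarefree_eq_prod)
    qed
  qed (simp add: prod_nonneg)
  also have "\<dots> \<le> (\<Sum>A\<in>sieve_sets z {}. 1 / s.phi A)"
  proof (rule sum_mono)
    fix A assume A: "A \<in> sieve_sets z {}"
    then have sub: "A \<subseteq> sieve_primes z {}" by (rule full.Q_subD)
    have "s.phi A \<le> real (\<Prod>A)" unfolding s.phi_def of_nat_prod
    proof (rule prod_mono)
      fix p assume "p \<in> A"
      then have "1 < p" using sub full.P_gt_1 by auto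
      then show "0 \<le> real p - 1 \<and> real p - 1 \<le> real p" by simp
    qed
    then show "1 / real (\<Prod>A) \<le> 1 / s.phi A"
      using full.phi_pos[OF sub] phi_eq by (intro divide_left_mono) auto
  qed
  also have "\<dots> = (\<Sum>A\<in>sieve_sets z {}. case (A \<inter> E, A - E) of (B, C) \<Rightarrow> 1 / s.phi B * (1 / s.phi C))"
  proof (rule sum.cong)
    fix A assume "A \<in> sieve_sets z {}"
    then have "finite A" by (rule full.finite_mem_Q)
    then have "s.phi A = s.phi (A \<inter> E) * s.phi (A - E)"
      unfolding s.phi_def by (metis prod.Int_Diff)
    then show "1 / s.phi A = (case (A \<inter> E, A - E) of (B, C) \<Rightarrow> 1 / s.phi B * (1 / s.phi C))" by simp
  qed simp
  also have "\<dots> = (\<Sum>(B, C)\<in>(\<lambda>A. (A \<inter> E, A - E)) ` sieve_sets z {}. 1 / s.phi B * (1 / s.phi C))"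
    by (subst sum.reindex) (auto intro!: inj_onI)
  also have "\<dots> \<le> (\<Sum>(B, C)\<in>Pow E \<times> sieve_sets z E. 1 / s.phi B * (1 / s.phi C))"
  proof (rule sum_mono2)
    show "finite (Pow E \<times> sieve_sets z E)" using assms(2) s.finite_Q by simp
    show "(\<lambda>A. (A \<inter> E, A - E)) ` sieve_sets z {} \<subseteq> Pow E \<times> sieve_sets z E"
    proof clarify
      fix A assume A: "A \<in> sieve_sets z {}"
      then have "A - E \<in> sieve_sets z {}" by (rule full.Q_down) auto
      then show "A \<inter> E \<in> Pow E \<and> A - E \<in> sieve_sets z E" by (auto simp: sieve_sets_def sieve_primes_def)
    qed
    fix x assume "x \<in> Pow E \<times> sieve_sets z E - (\<lambda>A. (A \<inter> E, A - E)) ` sieve_sets z {}"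
    then obtain B C where x: "x = (B, C)" "B \<subseteq> E" "C \<in> sieve_sets z E" by auto
    have "0 \<le> s.phi B" unfolding s.phi_def
    proof (rule prod_nonneg)
      fix p assume "p \<in> B"
      then have "1 \<le> p" using x(2) assms(3) prime_ge_1_nat by blast
      then show "0 \<le> real p - 1" by simp
    qed
    moreover have "0 < s.phi C" using x s.Q_subD s.phi_pos by blast
    ultimately show "0 \<le> (case x of (B, C) \<Rightarrow> 1 / s.phi B * (1 / s.phi C))" using x by simp
  qed
  also have "\<dots> = (\<Sum>B\<in>Pow E. 1 / s.phi B) * s.H"
    by (simp add: s.H_def sum_product sum.cartesian_product)
  also have "(\<Sum>B\<in>Pow E. 1 / s.phi B) = (\<Prod>p\<in>E. 1 / (real p - 1) + 1)"
    by (simp add: prod_add[OF assms(2)] s.phi_def prod_dividef)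
  finally show ?thesis by (simp add: add.commute)
qed

lemma prod_one_plus_le_exp:
  assumes "\<And>p. p \<in> E \<Longrightarrow> 0 \<le> f p"
  shows "(\<Prod>p\<in>E. 1 + f p) \<le> exp (\<Sum>p\<in>E. f p :: real)"
proof (cases "finite E")
  case True
  have "(\<Prod>p\<in>E. 1 + f p) \<le> (\<Prod>p\<in>E. exp (f p))"
    using assms by (intro prod_mono) (auto simp: add_nonneg_nonneg)
  then show ?thesis using True by (simp add: exp_sum)
qed simp

text \<open>Nothing is known about \<open>B\<close> except that it has at most \<open>z0\<close>
  primes, all of them at least \<open>z0\<close>; this suffices to bound its Euler factor by
  \<open>exp 2\<close>. The small primes cost \<open>ln z0 ^ 4\<close>: one factor 2 in the exponent
  comes from \<open>1 / (p - 1) \<le> 2 / p\<close>, the other from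
  \<open>sum_inv_primes\<close>.\<close>

lemma sieve_H_bound:
  assumes "3 \<le> z" "3 \<le> z0" "finite B" "\<And>p. p \<in> B \<Longrightarrow> prime p \<and> z0 \<le> p" "card B \<le> z0"
  shows "ln (real z) / (exp 14 * ln (real z0) ^ 4) \<le> selberg.H (sieve_sets z ({p. prime p \<and> p \<le> z0} \<union> B))"
proof -
  let ?P0 = "{p. prime p \<and> p \<le> z0}"
  let ?E = "?P0 \<union> B"
  have fin0: "finite ?P0" by (rule finite_subset[of _ "{..z0}"]) auto
  have fin: "finite ?E" using fin0 assms(3) by simp
  have pr: "prime p" if "p \<in> ?E" for p using that assms(4) by auto
  interpret s: selberg "sieve_primes z ?E" "sieve_sets z ?E" by (rule selberg_sieve) (use assms in simp)
  have inv: "1 / (real p - 1) \<le> 2 / real p" "0 \<le> 1 / (real p - 1)" if "p \<in> ?E" for p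
    using prime_ge_2_nat[OF pr[OF that]] by (auto simp: field_simps)
  have "(\<Prod>p\<in>?E. 1 + 1 / (real p - 1)) \<le> exp (\<Sum>p\<in>?E. 1 / (real p - 1))"
    by (rule prod_one_plus_le_exp) (use inv in auto)
  also have "(\<Sum>p\<in>?E. 1 / (real p - 1)) \<le> (\<Sum>p\<in>?E. 2 / real p)" by (rule sum_mono) (rule inv)
  also have "\<dots> \<le> (\<Sum>p\<in>?P0. 2 / real p) + (\<Sum>p\<in>B. 2 / real p)"
    using sum.union_inter[OF fin0 assms(3), of "\<lambda>p. 2 / real p"]
      sum_nonneg[of "?P0 \<inter> B" "\<lambda>p. 2 / real p"] by simp
  also have "(\<Sum>p\<in>B. 2 / real p) \<le> (\<Sum>p\<in>B. 2 / real z0)"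
    using assms by (intro sum_mono divide_left_mono) (auto intro!: mult_pos_pos simp: prime_gt_0_nat)
  also have "\<dots> = 2 * real (card B) / real z0" by simp
  also have "\<dots> \<le> 2" using assms(2,5) by (simp add: divide_le_eq)
  also have "(\<Sum>p\<in>?P0. 2 / real p) = 2 * (\<Sum>p\<in>?P0. 1 / real p)" by (simp add: sum_distrib_left)
  also have "\<dots> \<le> 2 * (2 * ln (ln (real z0)) + 5)" using sum_inv_primes[OF assms(2)] by simp
  finally have "(\<Prod>p\<in>?E. 1 + 1 / (real p - 1)) \<le> exp (4 * ln (ln (real z0)) + 12)" by (simp add: algebra_simps)
  also have "\<dots> = ln (real z0) ^ 4 * exp 12"
  proof -
    have l: "0 < ln (real z0)" using assms by simp
    have "exp (4 * ln (ln (real z0))) = exp (ln (ln (real z0))) ^ 4" by (simp add: exp_of_nat_mult[symmetric])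
    then show ?thesis using l by (simp add: exp_add)
  qed
  finally have prod: "(\<Prod>p\<in>?E. 1 + 1 / (real p - 1)) \<le> ln (real z0) ^ 4 * exp 12" .
  have "ln (real z) / 2 \<le> (\<Prod>p\<in>?E. 1 + 1 / (real p - 1)) * s.H"
    by (rule sieve_H_ge[OF _ fin pr]) (use assms in auto)
  also have "\<dots> \<le> (ln (real z0) ^ 4 * exp 12) * s.H" using s.H_ge_1 prod by (intro mult_right_mono) auto
  finally have "ln (real z) \<le> 2 * exp 12 * ln (real z0) ^ 4 * s.H" by (simp add: mult_ac)
  also have "\<dots> \<le> exp 14 * ln (real z0) ^ 4 * s.H"
  proof -
    have "2 * exp 12 \<le> exp 2 * (exp 12 :: real)" using exp_ge_add_one_self[of 2] by (intro mult_right_mono) auto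
    also have "\<dots> = exp 14" by (simp add: exp_add[symmetric])
    finally show ?thesis using s.H_ge_1 assms by (intro mult_right_mono) auto
  qed
  finally show ?thesis using assms by (simp add: field_simps)
qed

lemma sieve_R_bound:
  assumes "3 \<le> z"
  shows "(\<Prod>p\<in>sieve_primes z E. 1 + 16 / real p) \<le> exp 80 * ln (real z) ^ 32"
proof -
  have "(\<Prod>p\<in>sieve_primes z E. 1 + 16 / real p) \<le> exp (\<Sum>p\<in>sieve_primes z E. 16 / real p)"
    by (rule prod_one_plus_le_exp) simp
  also have "(\<Sum>p\<in>sieve_primes z E. 16 / real p) \<le> (\<Sum>p\<in>{p. prime p \<and> p \<le> z}. 16 / real p)"
  proof (rule sum_mono2)
    show "finite {p. prime p \<and> p \<le> z}" by (rule finite_subset[of _ "{..z}"]) auto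
  qed (auto simp: sieve_primes_def)
  also have "\<dots> = 16 * (\<Sum>p\<in>{p. prime p \<and> p \<le> z}. 1 / real p)" by (simp add: sum_distrib_left)
  also have "\<dots> \<le> 16 * (2 * ln (ln (real z)) + 5)" using sum_inv_primes[OF assms] by simp
  finally have "(\<Prod>p\<in>sieve_primes z E. 1 + 16 / real p) \<le> exp (80 + 32 * ln (ln (real z)))" by (simp add: algebra_simps)
  also have "\<dots> = exp 80 * ln (real z) ^ 32"
  proof -
    have l: "0 < ln (real z)" using assms by simp
    have "exp (32 * ln (ln (real z))) = exp (ln (ln (real z))) ^ 32" by (simp add: exp_of_nat_mult[symmetric])
    then show ?thesis using l by (simp add: exp_add)
  qed
  finally show ?thesis .
qed

subsection \<open>Rational points near a spectrum\<close>

text \<open>In the first nonzero term the prime \<open>p i0\<close> divides the reduced denominator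
  but none of the later denominators, so the later terms cannot cancel it.\<close>

lemma fraction_chain_nonzero:
  fixes c :: "nat \<Rightarrow> int" and q p :: "nat \<Rightarrow> nat" and \<epsilon> :: "nat \<Rightarrow> int"
  assumes q: "\<And>i. i < s \<Longrightarrow> 0 < q i" "\<And>i. i < s \<Longrightarrow> coprime (c i) (int (q i))"
    and p: "\<And>i. i < s \<Longrightarrow> prime (p i)" "\<And>i. i < s \<Longrightarrow> p i dvd q i" "\<And>i j. i < j \<Longrightarrow> j < s \<Longrightarrow> \<not> p i dvd q j"
    and \<epsilon>: "\<And>i. i < s \<Longrightarrow> \<bar>\<epsilon> i\<bar> \<le> 1" "k < s" "\<epsilon> k \<noteq> 0"
  shows "(\<Sum>i<s. of_int (\<epsilon> i * c i) / real (q i)) \<noteq> 0"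
proof
  assume zero: "(\<Sum>i<s. of_int (\<epsilon> i * c i) / real (q i)) = 0"
  define i0 where "i0 = (LEAST i. \<epsilon> i \<noteq> 0)"
  have i0: "\<epsilon> i0 \<noteq> 0" unfolding i0_def by (rule LeastI[of _ k]) (rule \<epsilon>(3))
  have "i0 \<le> k" unfolding i0_def by (rule Least_le) (rule \<epsilon>(3))
  then have i0s: "i0 < s" using \<epsilon>(2) by simp
  have below: "\<epsilon> i = 0" if "i < i0" for i using not_less_Least that unfolding i0_def by blast
  let ?J = "{i0<..<s}"
  let ?P = "\<Prod>j\<in>?J. q j"
  have "(\<Sum>i<s. of_int (\<epsilon> i * c i) / real (q i)) = (\<Sum>i\<in>insert i0 ?J. of_int (\<epsilon> i * c i) / real (q i))"
  proof (rule sum.mono_neutral_right)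
    show "insert i0 ?J \<subseteq> {..<s}" using i0s by auto
    show "\<forall>i\<in>{..<s} - insert i0 ?J. of_int (\<epsilon> i * c i) / real (q i) = 0"
    proof
      fix i assume "i \<in> {..<s} - insert i0 ?J"
      then have "i < i0" by auto
      then show "of_int (\<epsilon> i * c i) / real (q i) = 0" using below by simp
    qed
  qed simp
  then have *: "of_int (\<epsilon> i0 * c i0) / real (q i0) + (\<Sum>i\<in>?J. of_int (\<epsilon> i * c i) / real (q i)) = 0"
    using zero by simp
  have prodJ: "real ?P * (of_int (\<epsilon> i * c i) / real (q i)) = of_int (\<epsilon> i * c i * int (\<Prod>j\<in>?J - {i}. q j))" if "i \<in> ?J" for i
  proof -
    have "?P = q i * (\<Prod>j\<in>?J - {i}. q j)" using that by (simp add: prod.remove)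
    then show ?thesis using q(1)[of i] that by simp
  qed
  have "0 = real (q i0) * (real ?P * (of_int (\<epsilon> i0 * c i0) / real (q i0) + (\<Sum>i\<in>?J. of_int (\<epsilon> i * c i) / real (q i))))"
    unfolding * by simp
  also have "\<dots> = real ?P * of_int (\<epsilon> i0 * c i0) + real (q i0) * (\<Sum>i\<in>?J. real ?P * (of_int (\<epsilon> i * c i) / real (q i)))"
    using q(1)[OF i0s] by (simp add: distrib_left sum_distrib_left)
  also have "(\<Sum>i\<in>?J. real ?P * (of_int (\<epsilon> i * c i) / real (q i))) = (\<Sum>i\<in>?J. of_int (\<epsilon> i * c i * int (\<Prod>j\<in>?J - {i}. q j)))"
    by (intro sum.cong refl prodJ)
  finally have "real_of_int (int ?P * (\<epsilon> i0 * c i0) + int (q i0) * (\<Sum>i\<in>?J. \<epsilon> i * c i * int (\<Prod>j\<in>?J - {i}. q j))) = 0"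
    by simp
  then have "int ?P * (\<epsilon> i0 * c i0) + int (q i0) * (\<Sum>i\<in>?J. \<epsilon> i * c i * int (\<Prod>j\<in>?J - {i}. q j)) = 0"
    by (simp only: of_int_eq_0_iff)
  then have "int ?P * (\<epsilon> i0 * c i0) = int (q i0) * (- (\<Sum>i\<in>?J. \<epsilon> i * c i * int (\<Prod>j\<in>?J - {i}. q j)))"
    by simp
  then have "int (q i0) dvd int ?P * (\<epsilon> i0 * c i0)" by (rule dvdI)
  moreover have "\<epsilon> i0 = 1 \<or> \<epsilon> i0 = - 1" using \<epsilon>(1)[OF i0s] i0 by linarith
  ultimately have "int (q i0) dvd int ?P * c i0" by auto
  then have "int (q i0) dvd int ?P"
    using q(2)[OF i0s] by (simp add: coprime_commute coprime_dvd_mult_left_iff)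
  then have "q i0 dvd ?P" by (simp only: int_dvd_int_iff)
  then have "p i0 dvd ?P" using p(2)[OF i0s] dvd_trans by blast
  then obtain j where "j \<in> ?J" "p i0 dvd q j"
    using prime_dvd_prod_iff[of ?J "p i0" q] p(1)[OF i0s] by auto
  then show False using p(3)[of i0 j] by auto
qed

context cyclic
begin

lemma spec_scale_add:
  assumes "g \<in> spec (scale k A)" "h \<in> spec A"
  shows "g + h \<in> spec (scale (Suc k) A)"
  using assms
proof (induction A arbitrary: g h rule: spec.induct)
  case (2 r m D)
  then obtain i g' j h' where *: "g = i * r + g'" "i \<in> {- int (k * m)..int (k * m)}" "g' \<in> spec (scale k D)"
    "h = j * r + h'" "j \<in> {- int m..int m}" "h' \<in> spec D"
    by (auto simp: scale_def)
  then have "g' + h' \<in> spec (scale (Suc k) D)" using 2 by blast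
  moreover have "i + j \<in> {- int (Suc k * m)..int (Suc k * m)}" using * by auto
  moreover have "g + h = (i + j) * r + (g' + h')" using * by (simp add: algebra_simps)
  ultimately show ?case unfolding scale_def list.map prod.case spec.simps
    by (intro image_eqI[of _ _ "(i + j, g' + h')"]) (auto simp: scale_def)
qed (simp add: scale_def)

lemma spec_scale_mono:
  assumes "k \<le> l"
  shows "spec (scale k A) \<subseteq> spec (scale l A)"
proof (induction A rule: spec.induct)
  case (2 r m D)
  have "k * m \<le> l * m" using assms by simp
  then have "{- int (k * m)..int (k * m)} \<subseteq> {- int (l * m)..int (l * m)}" by (metis atLeastatMost_subset_iff neg_le_iff_le of_nat_le_iff)
  then show ?case using 2 unfolding scale_def list.map prod.case spec.simps by (intro image_mono Sigma_mono) auto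
qed (simp add: scale_def)

lemma zero_spec: "0 \<in> spec D"
  by (induction D rule: spec.induct) (auto intro!: image_eqI[of _ _ "(0, 0)"])

text \<open>The logarithm of the size of \<open>scale s A\<close> grows only like
  \<open>ln s\<close> for each entry, whereas \<open>s\<close> independent elements would produce
  \<open>2 ^ s\<close> subset sums.\<close>

lemma spec_scale_sum:
  assumes "finite I" "\<And>i. i \<in> I \<Longrightarrow> g i \<in> spec A" "card I \<le> s"
  shows "(\<Sum>i\<in>I. g i) \<in> spec (scale s A)"
proof -
  have "(\<Sum>i\<in>I. g i) \<in> spec (scale (card I) A)"
    using assms(1,2)
  proof (induction I rule: finite_induct)
    case empty show ?case by (simp add: zero_spec)
  next
    case (insert i I)
    then have "(\<Sum>i\<in>I. g i) + g i \<in> spec (scale (Suc (card I)) A)" by (intro spec_scale_add) auto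
    then show ?case using insert by (simp add: add.commute)
  qed
  then show ?thesis using spec_scale_mono[OF assms(3)] by blast
qed

text \<open>The tolerance is \<open>\<eta>\<close> and \<open>Y\<close> bounds the denominators. The
  case \<open>q = 1\<close> is left out: near an integer the sums over progressions stay bounded,
  see \<open>ap_near_0\<close>.\<close>

definition near :: "int set \<Rightarrow> real \<Rightarrow> real \<Rightarrow> nat \<Rightarrow> int \<Rightarrow> nat \<Rightarrow> bool" where
  "near \<Gamma> \<eta> Y z0 c q \<longleftrightarrow> 1 < q \<and> real q \<le> Y \<and> coprime c (int q) \<and> (\<forall>p. prime p \<and> p dvd q \<longrightarrow> z0 \<le> p) \<and>
     (\<exists>\<gamma>\<in>\<Gamma>. \<bar>of_int \<gamma> / of_int N - of_int c / real q\<bar> \<le> \<eta>)"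

text \<open>If each fraction of a long sequence has a prime in its denominator that does not divide any later
  denominator, then all subset sums of the sequence are distinct.  The corresponding sums of elements
  of the spectrum are too few for that.\<close>

lemma no_long_chain:
  assumes near: "\<And>i. i < s \<Longrightarrow> near (spec A) \<eta> Y z0 (c i) (q i)"
    and p: "\<And>i. i < s \<Longrightarrow> prime (p i)" "\<And>i. i < s \<Longrightarrow> p i dvd q i" "\<And>i j. i < j \<Longrightarrow> j < s \<Longrightarrow> \<not> p i dvd q j"
    and card: "real (card (spec (scale s A))) < 2 ^ s" and sep: "s * \<eta> < 1 / Y ^ s" and Y: "0 < Y"
  shows False
proof -
  obtain g where g: "\<And>i. i < s \<Longrightarrow> g i \<in> spec A" "\<And>i. i < s \<Longrightarrow> \<bar>of_int (g i) / of_int N - of_int (c i) / real (q i)\<bar> \<le> \<eta>"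
    using near unfolding near_def by metis
  have q: "0 < q i" "coprime (c i) (int (q i))" "real (q i) \<le> Y" if "i < s" for i
    using near[OF that] by (auto simp: near_def)
  have "inj_on (\<lambda>I. \<Sum>i\<in>I. g i) (Pow {..<s})"
  proof (rule inj_onI)
    fix I J assume I: "I \<in> Pow {..<s}" and J: "J \<in> Pow {..<s}" and eq: "(\<Sum>i\<in>I. g i) = (\<Sum>i\<in>J. g i)"
    show "I = J"
    proof (rule ccontr)
      assume "I \<noteq> J"
      define \<epsilon> :: "nat \<Rightarrow> int" where "\<epsilon> i = of_bool (i \<in> I) - of_bool (i \<in> J)" for i
      obtain k where kIJ: "(k \<in> I) \<noteq> (k \<in> J)" using \<open>I \<noteq> J\<close> by blast
      have k: "k < s" "\<epsilon> k \<noteq> 0" using kIJ I J by (auto simp: \<epsilon>_def)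
      have \<epsilon>1: "\<bar>\<epsilon> i\<bar> \<le> 1" for i by (simp add: \<epsilon>_def)
      have sumg: "(\<Sum>i<s. \<epsilon> i * g i) = 0"
      proof -
        have *: "(\<Sum>i<s. of_bool (i \<in> K) * g i) = (\<Sum>i\<in>K. g i)" if "K \<in> Pow {..<s}" for K
          by (rule sum.mono_neutral_cong_right) (use that in auto)
        show ?thesis unfolding \<epsilon>_def left_diff_distrib sum_subtractf *[OF I] *[OF J] using eq by simp
      qed
      let ?x = "\<Sum>i<s. of_int (\<epsilon> i * c i) / real (q i)"
      have x0: "?x \<noteq> 0" 
        by (rule fraction_chain_nonzero[where q = q and c = c and p = p and \<epsilon> = \<epsilon> and k = k]) (use q p \<epsilon>1 k in auto)
      have "?x = (\<Sum>i<s. of_int (\<epsilon> i) * (of_int (c i) / real (q i) - of_int (g i) / of_int N))"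
      proof -
        have "(\<Sum>i<s. of_int (\<epsilon> i) * (of_int (g i) / of_int N)) = of_int (\<Sum>i<s. \<epsilon> i * g i) / (of_int N :: real)"
          by (simp add: sum_divide_distrib)
        then have "(\<Sum>i<s. of_int (\<epsilon> i) * (of_int (g i) / of_int N)) = (0 :: real)" unfolding sumg by simp
        then show ?thesis by (simp add: right_diff_distrib sum_subtractf)
      qed
      also have "\<bar>\<dots>\<bar> \<le> (\<Sum>i<s. \<bar>of_int (\<epsilon> i) * (of_int (c i) / real (q i) - of_int (g i) / of_int N)\<bar>)" by (rule sum_abs)
      also have "\<dots> \<le> (\<Sum>i<s. 1 * \<eta>)"
      proof (rule sum_mono)
        fix i assume "i \<in> {..<s}"
        then have "\<bar>of_int (c i) / real (q i) - of_int (g i) / of_int N\<bar> \<le> \<eta>" using g(2)[of i] by (simp add: abs_minus_commute)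
        moreover have "\<bar>of_int (\<epsilon> i)\<bar> \<le> (1 :: real)" using \<epsilon>1[of i] by linarith
        ultimately show "\<bar>of_int (\<epsilon> i) * (of_int (c i) / real (q i) - of_int (g i) / of_int N)\<bar> \<le> 1 * \<eta>"
          unfolding abs_mult by (intro mult_mono) auto
      qed
      finally have small: "\<bar>?x\<bar> \<le> s * \<eta>" by simp
      let ?P = "\<Prod>i<s. q i"
      have "real ?P * ?x = of_int (\<Sum>i<s. \<epsilon> i * c i * int (\<Prod>j\<in>{..<s} - {i}. q j))"
        unfolding sum_distrib_left of_int_sum
      proof (intro sum.cong refl)
        fix i assume i: "i \<in> {..<s}"
        have "?P = q i * (\<Prod>j\<in>{..<s} - {i}. q j)" using i by (simp add: prod.remove)
        then show "real ?P * (of_int (\<epsilon> i * c i) / real (q i)) = of_int (\<epsilon> i * c i * int (\<Prod>j\<in>{..<s} - {i}. q j))"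
          using q(1)[of i] i by simp
      qed
      moreover have Ppos: "0 < real ?P" unfolding of_nat_prod by (rule prod_pos) (use q(1) in auto)
      ultimately obtain k :: int where k: "real ?P * ?x = of_int k" by blast
      have "real ?P * ?x \<noteq> 0" using mult_eq_0_iff[of "real ?P" ?x] x0 less_imp_not_eq2[OF Ppos] by simp
      then have "k \<noteq> 0" unfolding k by simp
      then have "1 \<le> \<bar>k\<bar>" by linarith
      \<comment> \<open>A nonzero fraction whose denominator divides \<open>?P\<close> cannot be
        smaller than \<open>1 / Y ^ s\<close>, while \<open>small\<close> bounds it by the
        accumulated tolerance.\<close>
      then have "1 \<le> real ?P * \<bar>?x\<bar>" using k Ppos by (metis abs_mult abs_of_pos of_int_abs of_int_1_le_iff)
      also have "\<dots> \<le> Y ^ s * \<bar>?x\<bar>"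
      proof (rule mult_right_mono)
        have "(\<Prod>i<s. real (q i)) \<le> (\<Prod>i<s. Y)" by (rule prod_mono) (use q(3) in auto)
        then show "real ?P \<le> Y ^ s" by simp
      qed simp
      also have "\<dots> \<le> Y ^ s * (s * \<eta>)" using small Y by (intro mult_left_mono) auto
      finally show False using sep Y by (simp add: field_simps)
    qed
  qed
  moreover have "(\<lambda>I. \<Sum>i\<in>I. g i) ` Pow {..<s} \<subseteq> spec (scale s A)"
  proof (rule image_subsetI)
    fix I assume I: "I \<in> Pow {..<s}"
    have "card I \<le> s" using I card_mono[of "{..<s}" I] by auto
    then show "(\<Sum>i\<in>I. g i) \<in> spec (scale s A)"
      using I g(1) by (intro spec_scale_sum) (auto intro: finite_subset[of _ "{..<s}"])
  qed
  ultimately have "card (Pow {..<s}) \<le> card (spec (scale s A))" by (intro card_inj_on_le finite_spec)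
  then have "(2::nat) ^ s \<le> card (spec (scale s A))" by (simp add: card_Pow)
  then have "real (2 ^ s) \<le> real (card (spec (scale s A)))" by (simp only: of_nat_le_iff)
  then show False using card by simp
qed

text \<open>Greedy choice: as long as the primes chosen so far miss some nearby fraction, that
  fraction, with any prime of its denominator, extends the chain, because no earlier prime divides
  the new denominator. By \<open>no_long_chain\<close> this stops before length
  \<open>s\<close>.\<close>

lemma bad_primes:
  assumes "real (card (spec (scale s A))) < 2 ^ s" "s * \<eta> < 1 / Y ^ s" "0 < Y"
  obtains B where "finite B" "card B \<le> s" "\<And>p. p \<in> B \<Longrightarrow> prime p \<and> z0 \<le> p"
    "\<And>c q. near (spec A) \<eta> Y z0 c q \<Longrightarrow> \<exists>p\<in>B. p dvd q"
proof -
  let ?good = "\<lambda>B. finite B \<and> card B \<le> s \<and> (\<forall>p\<in>B. prime p \<and> z0 \<le> p) \<and> (\<forall>c q. near (spec A) \<eta> Y z0 c q \<longrightarrow> (\<exists>p\<in>B. p dvd q))"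
  let ?chain = "\<lambda>n c q p. (\<forall>i<n. near (spec A) \<eta> Y z0 (c i) (q i) \<and> prime (p i) \<and> p i dvd q i) \<and> (\<forall>i j. i < j \<and> j < n \<longrightarrow> \<not> p i dvd q j)"
  have "(\<exists>B. ?good B) \<or> (\<exists>c q p. ?chain n c q p)" if "n \<le> s" for n
    using that
  proof (induction n)
    case 0 show ?case by simp
  next
    case (Suc n)
    show ?case
    proof (cases "\<exists>B. ?good B")
      case False
      with Suc obtain c q p where ch: "?chain n c q p" by auto
      let ?B = "p ` {..<n}"
      have "finite ?B" "card ?B \<le> s" using Suc.prems card_image_le[of "{..<n}" p] by auto
      moreover have "prime r \<and> z0 \<le> r" if r: "r \<in> ?B" for r
      proof -
        obtain i where i: "i < n" "r = p i" using r by auto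
        then have "near (spec A) \<eta> Y z0 (c i) (q i)" "prime (p i)" "p i dvd q i" using ch by auto
        then show ?thesis using i by (auto simp: near_def)
      qed
      ultimately have "\<not> (\<forall>c q. near (spec A) \<eta> Y z0 c q \<longrightarrow> (\<exists>p\<in>?B. p dvd q))" using False by blast
      then obtain c' q' where new: "near (spec A) \<eta> Y z0 c' q'" "\<And>i. i < n \<Longrightarrow> \<not> p i dvd q'" by auto
      then have "q' \<noteq> 1" by (auto simp: near_def)
      then obtain p' where p': "prime p'" "p' dvd q'" using prime_factor_nat by blast
      have "?chain (Suc n) (c(n := c')) (q(n := q')) (p(n := p'))"
      proof (intro conjI allI impI)
        fix i assume "i < Suc n"
        then show "near (spec A) \<eta> Y z0 ((c(n := c')) i) ((q(n := q')) i)" "prime ((p(n := p')) i)" "(p(n := p')) i dvd (q(n := q')) i"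
          using conjunct1[OF ch, rule_format, of i] new(1) p' by (auto simp: less_Suc_eq)
      next
        fix i j assume "i < j \<and> j < Suc n"
        then show "\<not> (p(n := p')) i dvd (q(n := q')) j"
          using conjunct2[OF ch, rule_format, of i j] new(2)[of i] by (auto simp: less_Suc_eq)
      qed
      then show ?thesis by (intro disjI2 exI)
    qed simp
  qed
  from this[of s] have dich: "(\<exists>B. ?good B) \<or> (\<exists>c q p. ?chain s c q p)" by simp
  have no: "\<not> ?chain s c q p" for c q p
  proof
    assume ch: "?chain s c q p"
    show False
    proof (rule no_long_chain[where s = s and A = A and \<eta> = \<eta> and Y = Y and ?z0.0 = z0 and c = c and q = q and p = p])
      fix i assume "i < s"
      with ch have "near (spec A) \<eta> Y z0 (c i) (q i) \<and> prime (p i) \<and> p i dvd q i" by (elim conjE allE[of _ i]) (rule mp)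
      then show "near (spec A) \<eta> Y z0 (c i) (q i)" "prime (p i)" "p i dvd q i" by simp_all
    next
      fix i j :: nat assume "i < j" "j < s"
      with conjunct2[OF ch] show "\<not> p i dvd q j" by (elim allE[of _ i] allE[of _ j]) (erule mp, rule conjI)
    qed (rule assms)+
  qed
  have "\<exists>B. ?good B"
  proof (rule ccontr)
    assume n: "\<nexists>B. ?good B"
    have "\<exists>c q p. ?chain s c q p" by (rule disjE[OF dich], erule notE[OF n], assumption)
    then show False by (elim exE) (erule notE[OF no])
  qed
  then obtain B where B: "?good B" by (rule exE)
  show thesis by (rule that[of B]) (use B in auto)
qed

end

subsection \<open>Exponential sums over arithmetic progressions\<close>

lemma abs_sin_pi_ge:
  assumes "\<bar>t\<bar> \<le> 1 / 2"
  shows "\<bar>t\<bar> \<le> \<bar>sin (pi * t)\<bar>"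
proof -
  let ?x = "pi * t"
  have coeffs: "(\<Sum>m<3. sin_coeff m * ?x ^ m) = ?x"
    by (simp add: numeral_3_eq_3 sin_coeff_def)
  have "\<bar>sin ?x - ?x\<bar> \<le> inverse (fact 3) * \<bar>?x\<bar> ^ 3"
    using Maclaurin_sin_bound[of ?x 3] unfolding coeffs .
  also have "inverse (fact 3) = (1 / 6 :: real)" by (simp add: fact_numeral)
  also have "1 / 6 * \<bar>?x\<bar> ^ 3 = \<bar>?x\<bar>\<^sup>2 / 6 * \<bar>?x\<bar>" by (simp add: power3_eq_cube power2_eq_square)
  also have "\<dots> \<le> 1 / 2 * \<bar>?x\<bar>"
  proof (rule mult_right_mono)
    have pi: "pi < 3.2" using pi_approx by simp
    have "\<bar>?x\<bar> = pi * \<bar>t\<bar>" by (simp add: abs_mult)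
    also have "\<dots> \<le> 3.2 * (1 / 2)" using assms pi by (intro mult_mono) auto
    finally have "\<bar>?x\<bar> \<le> 1.6" by simp
    then have "\<bar>?x\<bar>\<^sup>2 \<le> 1.6\<^sup>2" by (intro power_mono) auto
    moreover have "y / 6 \<le> 1 / 2" if "y \<le> 1.6\<^sup>2" for y :: real using that by (simp add: power2_eq_square)
    ultimately show "\<bar>?x\<bar>\<^sup>2 / 6 \<le> 1 / 2" by blast
  qed simp
  finally have "\<bar>?x\<bar> / 2 \<le> \<bar>sin ?x\<bar>" by linarith
  moreover have "2 * \<bar>t\<bar> \<le> pi * \<bar>t\<bar>" using pi_ge_two by (intro mult_right_mono) auto
  then have "2 * \<bar>t\<bar> \<le> \<bar>?x\<bar>" by (simp add: abs_mult)
  ultimately show ?thesis by linarith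
qed

context cyclic
begin

lemma norm_e_minus_1: 
  assumes "of_int k / of_int N = t + (of_int j :: real)"
  shows "norm (e k - 1) = 2 * \<bar>sin (pi * t)\<bar>"
proof -
  have "2 * pi * of_int k / of_int N = 2 * (pi * t) + 2 * pi * of_int j"
    using arg_cong[OF assms, of "\<lambda>x. 2 * pi * x"] by (simp only: times_divide_eq_right distrib_left mult.assoc)
  then have "e k = cis (2 * (pi * t)) * cis (2 * pi * of_int j)"
    unfolding e_def by (simp only: cis_mult)
  then have ek: "e k = cis (2 * (pi * t))" by (simp add: cis_multiple_2pi)
  have "(norm (e k - 1))\<^sup>2 = (cos (2 * (pi * t)) - 1)\<^sup>2 + (sin (2 * (pi * t)))\<^sup>2"
    unfolding ek cmod_power2 by simp
  also have "\<dots> = (2 * sin (pi * t))\<^sup>2 * ((sin (pi * t))\<^sup>2 + (cos (pi * t))\<^sup>2)"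
    unfolding cos_double_sin sin_double by algebra
  also have "\<dots> = (2 * sin (pi * t))\<^sup>2" by (simp only: sin_cos_squared_add mult_1_right)
  also have "\<dots> = (2 * \<bar>sin (pi * t)\<bar>)\<^sup>2" by (simp only: power_mult_distrib power2_abs)
  finally have "(norm (e k - 1))\<^sup>2 = (2 * \<bar>sin (pi * t)\<bar>)\<^sup>2" .
  then show ?thesis by (rule power2_eq_imp_eq) simp_all
qed

definition ap :: "int \<Rightarrow> nat \<Rightarrow> int \<Rightarrow> complex" where
  "ap x m s = (\<Sum>n\<in>{0..<N}. of_bool (int m dvd x + n) * e (- s * n))"

lemma ap_geometric:
  assumes "0 < m" "int m \<le> N"
  obtains J a where "\<bar>int (m * J) - N\<bar> \<le> int m" "\<And>s. ap x m s = e (- s * a) * (\<Sum>j<J. e (- s * int m) ^ j)"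
proof -
  define a where "a = (- x) mod int m"
  have a: "0 \<le> a" "a < int m" using assms(1) by (auto simp: a_def)
  have xa: "int m dvd x + a"
    using dvd_minus_mod[of "int m" "- x"] unfolding a_def by (subst dvd_minus_iff[symmetric]) simp
  define J where "J = nat ((N - a + int m - 1) div int m)"
  have m0: "0 < int m" using assms(1) by simp
  have "0 \<le> N - a + int m - 1" using a assms(2) by linarith
  then have J: "int J = (N - a + int m - 1) div int m"
    unfolding J_def using m0 by (simp add: pos_imp_zdiv_nonneg_iff)
  have Jiff: "j < int J \<longleftrightarrow> a + int m * j < N" for j
  proof
    let ?d = "N - a + int m - 1"
    have div: "?d = int J * int m + ?d mod int m" "0 \<le> ?d mod int m" "?d mod int m < int m"
      unfolding J using m0 by simp_all
    show "a + int m * j < N" if "j < int J"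
    proof -
      have "(j + 1) * int m \<le> int J * int m" using that m0 by (intro mult_right_mono) auto
      then have "j * int m + int m \<le> ?d" using div by (simp only: distrib_right mult_1)
      then show ?thesis by (simp only: mult.commute)
    qed
    show "j < int J" if "a + int m * j < N"
    proof (rule ccontr)
      assume "\<not> j < int J"
      then have "int J * int m \<le> j * int m" using m0 by (intro mult_right_mono) auto
      then have "?d < j * int m + int m" using div by linarith
      then show False using that by (simp only: mult.commute)
    qed
  qed
  show thesis
  proof
    have "\<not> (int J < int J)" by simp
    then have "N \<le> a + int m * int J" unfolding Jiff by simp
    moreover have "int m * int J < N + int m"
    proof (cases J)
      case (Suc i)
      then have "int i < int J" by simp
      then have "a + int m * int i < N" unfolding Jiff .
      then show ?thesis using a Suc by (simp add: algebra_simps)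
    qed (use N_pos m0 in simp)
    ultimately show "\<bar>int (m * J) - N\<bar> \<le> int m" using a by simp
    fix s
    have "ap x m s = (\<Sum>n\<in>{n\<in>{0..<N}. int m dvd x + n}. e (- s * n))"
      unfolding ap_def by (intro sum.mono_neutral_cong_right) auto
    also have "{n\<in>{0..<N}. int m dvd x + n} = (\<lambda>j. a + int m * int j) ` {..<J}"
    proof (intro set_eqI iffI)
      fix n assume "n \<in> {n\<in>{0..<N}. int m dvd x + n}"
      then have n: "0 \<le> n" "n < N" "int m dvd x + n" by auto
      have "int m dvd x + a" by (rule xa)
      then have "int m dvd n - a" using n(3) by (metis add_diff_cancel_left dvd_diff)
      then obtain j where j: "n - a = int m * j" by (rule dvdE)
      have "0 \<le> j"
      proof (rule ccontr)
        assume "\<not> 0 \<le> j"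
        then have "j \<le> - 1" by simp
        then have "int m * j \<le> int m * - 1" using m0 by (intro mult_left_mono) auto
        then show False using j n a by simp
      qed
      have "j < int J" unfolding Jiff using j n by simp
      then show "n \<in> (\<lambda>j. a + int m * int j) ` {..<J}"
        using j \<open>0 \<le> j\<close> by (intro image_eqI[of _ _ "nat j"]) auto
    next
      fix n assume "n \<in> (\<lambda>j. a + int m * int j) ` {..<J}"
      then obtain j where j: "n = a + int m * int j" "j < J" by auto
      have "int m dvd x + a" by (rule xa)
      then have "int m dvd x + n" unfolding j by (simp flip: add.assoc)
      then show "n \<in> {n\<in>{0..<N}. int m dvd x + n}" using j Jiff[of "int j"] a by auto
    qed
    also have "(\<Sum>n\<in>(\<lambda>j. a + int m * int j) ` {..<J}. e (- s * n)) = (\<Sum>j<J. e (- s * (a + int m * int j)))"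
      by (subst sum.reindex) (use m0 in \<open>auto intro!: inj_onI\<close>)
    also have "\<dots> = (\<Sum>j<J. e (- s * a) * e (- s * int m) ^ j)"
    proof (rule sum.cong)
      fix j
      have pow: "e (k * int j) = e k ^ j" for k
        by (induction j) (simp_all add: distrib_left e_add)
      have "- s * (a + int m * int j) = - s * a + (- s * int m) * int j" by (simp add: algebra_simps)
      then show "e (- s * (a + int m * int j)) = e (- s * a) * e (- s * int m) ^ j"
        by (simp only: e_add pow)
    qed simp
    finally show "ap x m s = e (- s * a) * (\<Sum>j<J. e (- s * int m) ^ j)" by (simp add: sum_distrib_left)
  qed
qed

lemma ap_0:
  assumes "0 < m" "int m \<le> N"
  shows "norm (ap x m 0 - of_real (of_int N / m)) \<le> 1"
proof -
  obtain J a where J: "\<bar>int (m * J) - N\<bar> \<le> int m" "\<And>s. ap x m s = e (- s * a) * (\<Sum>j<J. e (- s * int m) ^ j)"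
    using ap_geometric[OF assms, of x] by blast
  have "ap x m 0 = of_real J" using J(2)[of 0] by simp
  then have "norm (ap x m 0 - of_real (of_int N / m)) = \<bar>real J - of_int N / m\<bar>"
    by (metis norm_of_real of_real_diff real_norm_def)
  also have "real J - of_int N / m = of_int (int (m * J) - N) / m" using assms by (simp add: field_simps)
  also have "\<bar>\<dots>\<bar> = of_int \<bar>int (m * J) - N\<bar> / m" by simp
  also have "\<dots> \<le> of_int (int m) / m" using J(1) by (intro divide_right_mono) (simp_all only: of_int_le_iff of_nat_0_le_iff)
  finally show ?thesis using assms by simp
qed

lemma ap_trivial:
  assumes "0 < m" "int m \<le> N"
  shows "norm (ap x m s) \<le> 2 * of_int N / m"
proof -
  obtain J a where J: "\<bar>int (m * J) - N\<bar> \<le> int m" "\<And>s. ap x m s = e (- s * a) * (\<Sum>j<J. e (- s * int m) ^ j)"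
    using ap_geometric[OF assms, of x] by blast
  have "norm (ap x m s) = norm (\<Sum>j<J. e (- s * int m) ^ j)" unfolding J(2) norm_mult by simp
  also have "\<dots> \<le> (\<Sum>j<J. norm (e (- s * int m) ^ j))" by (rule norm_sum)
  also have "\<dots> = real J" by (simp add: norm_power)
  also have "\<dots> \<le> 2 * of_int N / m"
  proof -
    have "int (m * J) \<le> 2 * N" using J(1) assms by linarith
    then have "of_int (int (m * J)) \<le> (of_int (2 * N) :: real)" by (simp only: of_int_le_iff)
    then show ?thesis using assms by (simp add: field_simps)
  qed
  finally show ?thesis .
qed

lemma norm_e_uminus: "norm (e (- k) - 1) = norm (e k - 1)"
  unfolding e_minus by (metis complex_cnj_diff complex_cnj_one complex_mod_cnj)

lemma ap_bound:
  assumes "0 < m" "int m \<le> N" and t: "of_int (s * int m) / of_int N = t + (of_int j :: real)" "t \<noteq> 0" "\<bar>t\<bar> \<le> 1 / 2"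
  shows "norm (ap x m s) \<le> 1 / \<bar>t\<bar>"
proof -
  obtain J a where J: "\<bar>int (m * J) - N\<bar> \<le> int m" "\<And>s. ap x m s = e (- s * a) * (\<Sum>j<J. e (- s * int m) ^ j)"
    using ap_geometric[OF assms(1,2), of x] by blast
  let ?w = "e (- s * int m)"
  have "norm (?w - 1) = 2 * \<bar>sin (pi * t)\<bar>"
    using norm_e_uminus[of "s * int m"] norm_e_minus_1[OF t(1)] by simp
  then have w: "2 * \<bar>t\<bar> \<le> norm (?w - 1)" using abs_sin_pi_ge[OF t(3)] by simp
  have geo: "(?w - 1) * (\<Sum>j<J. ?w ^ j) = ?w ^ J - 1" by (rule power_diff_1_eq[symmetric])
  have "2 * \<bar>t\<bar> * norm (ap x m s) = 2 * \<bar>t\<bar> * norm (\<Sum>j<J. ?w ^ j)" unfolding J(2) norm_mult by simp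
  also have "\<dots> \<le> norm (?w - 1) * norm (\<Sum>j<J. ?w ^ j)" using w by (intro mult_right_mono) auto
  also have "\<dots> = norm (?w ^ J - 1)" using geo norm_mult by metis
  also have "\<dots> \<le> 2" using norm_triangle_ineq4[of "?w ^ J" 1] by (simp add: norm_power)
  finally show ?thesis using t(2) by (simp add: field_simps)
qed

text \<open>The geometric series runs over almost a whole period: \<open>m * J\<close> differs from
  \<open>N\<close> by at most \<open>m\<close> and \<open>e\<close> is trivial on multiples of
  \<open>N\<close>. Hence the numerator is as small as the denominator, and no term of size
  \<open>1 / \<bar>\<delta>\<bar>\<close> arises at nonzero frequencies close to 0.\<close>

lemma ap_near_0:
  assumes "0 < m" "int m \<le> N" and t: "of_int s / of_int N = \<delta> + (of_int j :: real)" "\<delta> \<noteq> 0" "m * \<bar>\<delta>\<bar> \<le> 1 / 2"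
  shows "norm (ap x m s) \<le> 4"
proof -
  obtain J a where J: "\<bar>int (m * J) - N\<bar> \<le> int m" "\<And>s. ap x m s = e (- s * a) * (\<Sum>j<J. e (- s * int m) ^ j)"
    using ap_geometric[OF assms(1,2), of x] by blast
  let ?w = "e (- s * int m)"
  have tm: "of_int (s * int m) / of_int N = m * \<delta> + (of_int (j * int m) :: real)"
    using arg_cong[OF t(1), of "\<lambda>x. x * real m"] by (simp add: algebra_simps)
  have "norm (?w - 1) = 2 * \<bar>sin (pi * (m * \<delta>))\<bar>"
    using norm_e_uminus[of "s * int m"] norm_e_minus_1[OF tm] by simp
  then have w: "2 * (m * \<bar>\<delta>\<bar>) \<le> norm (?w - 1)" using abs_sin_pi_ge[of "m * \<delta>"] t(3) by (simp add: abs_mult)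
  have geo: "(?w - 1) * (\<Sum>j<J. ?w ^ j) = ?w ^ J - 1" by (rule power_diff_1_eq[symmetric])
  have pow: "e (k * int j) = e k ^ j" for k j
    by (induction j) (simp_all add: distrib_left e_add)
  define r where "r = int (m * J) - N"
  have r: "real_of_int \<bar>r\<bar> \<le> real m"
    using J(1) unfolding r_def[symmetric] by (metis of_int_le_iff of_int_of_nat_eq)
  have "?w ^ J = e (- s * int m * int J)" by (simp only: pow)
  also have "- s * int m * int J = - (s * r) + N * (- s)" by (simp add: r_def algebra_simps)
  finally have wJ: "?w ^ J = e (- (s * r))" by (simp only: e_add e_N_mult mult_1_right)
  have "of_int (s * r) / of_int N = of_int r * (of_int s / of_int N :: real)" by simp
  then have tr: "of_int (s * r) / of_int N = of_int r * \<delta> + (of_int (j * r) :: real)"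
    unfolding t(1) by (simp only: of_int_mult distrib_left mult.commute)
  have "2 * (m * \<bar>\<delta>\<bar>) * norm (ap x m s) = 2 * (m * \<bar>\<delta>\<bar>) * norm (\<Sum>j<J. ?w ^ j)" unfolding J(2) norm_mult by simp
  also have "\<dots> \<le> norm (?w - 1) * norm (\<Sum>j<J. ?w ^ j)" using w by (intro mult_right_mono) auto
  also have "\<dots> = norm (?w ^ J - 1)" using geo norm_mult by metis
  also have "\<dots> = 2 * \<bar>sin (pi * (of_int r * \<delta>))\<bar>" unfolding wJ norm_e_uminus by (rule norm_e_minus_1[OF tr])
  also have "\<dots> \<le> 2 * \<bar>pi * (of_int r * \<delta>)\<bar>" using abs_sin_x_le_abs_x by simp
  also have "\<dots> = 2 * pi * (of_int \<bar>r\<bar> * \<bar>\<delta>\<bar>)" by (simp add: abs_mult)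
  also have "\<dots> \<le> 2 * 4 * (real m * \<bar>\<delta>\<bar>)"
    using r pi_less_4 by (intro mult_mono) auto
  finally have "2 * (m * \<bar>\<delta>\<bar>) * norm (ap x m s) \<le> 2 * (m * \<bar>\<delta>\<bar>) * 4" by simp
  then show ?thesis using assms(1) t(2) by simp
qed

end

text \<open>Decay of the sum over a progression of modulus \<open>m\<close>, in units of
  \<open>N / m\<close>, where \<open>t\<close> is \<open>N\<close> times the distance of the
  frequency from a fraction whose denominator divides \<open>m\<close>: the trivial bound near the
  centre, the geometric series elsewhere.\<close>

definition kern :: "real \<Rightarrow> real" where
  "kern t = (if \<bar>t\<bar> \<le> 1 / 2 then 2 else 1 / \<bar>t\<bar>)"

lemma kern_nonneg: "0 \<le> kern t" by (simp add: kern_def)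

lemma kern_le_2: "kern t \<le> 2" by (auto simp: kern_def field_simps)

lemma sum_inverse_le:
  fixes k :: "int \<Rightarrow> nat"
  assumes "finite I" "inj_on k I" "\<And>s. s \<in> I \<Longrightarrow> k s \<in> {1..n}" "1 \<le> n"
  shows "(\<Sum>s\<in>I. 1 / real (k s)) \<le> 1 + ln (real n)"
proof -
  have "(\<Sum>s\<in>I. 1 / real (k s)) = (\<Sum>j\<in>k ` I. 1 / real j)" using assms(2) by (simp add: sum.reindex)
  also have "\<dots> \<le> (\<Sum>j\<in>{1..n}. 1 / real j)" by (rule sum_mono2) (use assms(3) in auto)
  also have "\<dots> = harm n" by (simp add: harm_def inverse_eq_divide)
  finally show ?thesis using harm_le_ln[OF assms(4)] by linarith
qed

lemma sum_kern_le:
  fixes N :: int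
  assumes "1 < N" "0 \<le> x" "x \<le> of_int N"
  shows "(\<Sum>s\<in>{1..<N}. kern (of_int s - x)) \<le> 6 + 2 * ln (of_int N)"
proof -
  define f where "f = \<lfloor>x\<rfloor>"
  have f: "of_int f \<le> x" "x < of_int f + 1" "0 \<le> f" "f \<le> N"
    using assms by (auto simp: f_def le_floor_iff floor_le_iff)
  let ?A = "{1..<N} \<inter> {..<f}" and ?B = "{1..<N} \<inter> {f + 2..}"
  have N: "1 \<le> nat N" "ln (real (nat N)) = ln (of_int N)" using assms by auto
  have A: "(\<Sum>s\<in>?A. kern (of_int s - x)) \<le> 1 + ln (of_int N)"
  proof -
    have "(\<Sum>s\<in>?A. kern (of_int s - x)) \<le> (\<Sum>s\<in>?A. 1 / real (nat (f - s)))"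
    proof (rule sum_mono)
      fix s assume s: "s \<in> ?A"
      then have "1 \<le> f - s" by simp
      then have "1 \<le> (of_int (f - s) :: real)" by (simp only: of_int_1_le_iff)
      moreover have "of_int (f - s) \<le> \<bar>of_int s - x\<bar>" using f(1) by simp
      ultimately have "kern (of_int s - x) \<le> 1 / of_int (f - s)" by (simp add: kern_def frac_le)
      then show "kern (of_int s - x) \<le> 1 / real (nat (f - s))" using s by simp
    qed
    also have "\<dots> \<le> 1 + ln (real (nat N))"
      by (rule sum_inverse_le) (use N f in \<open>auto intro!: inj_onI\<close>)
    finally show ?thesis using N by simp
  qed
  have B: "(\<Sum>s\<in>?B. kern (of_int s - x)) \<le> 1 + ln (of_int N)"
  proof -
    have "(\<Sum>s\<in>?B. kern (of_int s - x)) \<le> (\<Sum>s\<in>?B. 1 / real (nat (s - f - 1)))"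
    proof (rule sum_mono)
      fix s assume s: "s \<in> ?B"
      then have "1 \<le> s - f - 1" by simp
      then have "1 \<le> (of_int (s - f - 1) :: real)" by (simp only: of_int_1_le_iff)
      moreover have "of_int (s - f - 1) \<le> \<bar>of_int s - x\<bar>" using f(2) by simp
      ultimately have "kern (of_int s - x) \<le> 1 / of_int (s - f - 1)" by (simp add: kern_def frac_le)
      then show "kern (of_int s - x) \<le> 1 / real (nat (s - f - 1))" using s by simp
    qed
    also have "\<dots> \<le> 1 + ln (real (nat N))"
      by (rule sum_inverse_le) (use N f in \<open>auto intro!: inj_onI\<close>)
    finally show ?thesis using N by simp
  qed
  have "(\<Sum>s\<in>{1..<N}. kern (of_int s - x)) \<le> (\<Sum>s\<in>(?A \<union> ?B) \<union> {f, f + 1}. kern (of_int s - x))"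
    by (rule sum_mono2) (auto simp: kern_nonneg)
  also have "\<dots> \<le> (\<Sum>s\<in>?A \<union> ?B. kern (of_int s - x)) + (\<Sum>s\<in>{f, f + 1}. kern (of_int s - x))"
    by (subst sum.union_inter[symmetric]) (auto intro!: sum_nonneg simp: kern_nonneg)
  also have "(\<Sum>s\<in>?A \<union> ?B. kern (of_int s - x)) = (\<Sum>s\<in>?A. kern (of_int s - x)) + (\<Sum>s\<in>?B. kern (of_int s - x))"
    by (rule sum.union_disjoint) auto
  also have "(\<Sum>s\<in>{f, f + 1}. kern (of_int s - x)) \<le> 4"
    using kern_le_2[of "of_int f - x"] kern_le_2[of "of_int (f + 1) - x"] by simp
  finally show ?thesis using A B by simp
qed

lemma prod_primes_dvd_int_iff:
  assumes "finite U" "\<And>p. p \<in> U \<Longrightarrow> prime p"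
  shows "int (\<Prod>U) dvd k \<longleftrightarrow> (\<forall>p\<in>U. int p dvd k)"
proof
  show "\<forall>p\<in>U. int p dvd k" if "int (\<Prod>U) dvd k"
  proof
    fix p assume "p \<in> U"
    then have "p dvd \<Prod>U" using assms(1) by (rule dvd_prodI[rotated])
    then have "int p dvd int (\<Prod>U)" by (simp only: int_dvd_int_iff)
    then show "int p dvd k" using that by (rule dvd_trans)
  qed
  show "int (\<Prod>U) dvd k" if "\<forall>p\<in>U. int p dvd k"
  proof -
    have "\<Prod>U dvd nat \<bar>k\<bar>" by (rule prod_primes_dvd) (use assms that in auto)
    then show ?thesis by simp
  qed
qed

lemma sqrt_prod: "sqrt (\<Prod>p\<in>A. f p) = (\<Prod>p\<in>A. sqrt (f p))"
  by (induction A rule: infinite_finite_induct) (simp_all add: real_sqrt_mult)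

subsection \<open>The sieve majorant\<close>

text \<open>\<open>W\<close> is the level of Dirichlet approximation; it exceeds
  \<open>2 * z^2\<close> because the moduli in the square of the sieve reach \<open>z^2\<close>.
  Omitting the primes up to 256 ensures \<open>16 / p \<le> 1 / sqrt p\<close> for the remaining
  ones, as used in \<open>Psi_le\<close>.\<close>

locale sieved = cyclic +
  fixes x0 :: int and z :: nat and E :: "nat set" and W :: nat
  assumes z3: "3 \<le> z" and W: "2 * z\<^sup>2 \<le> W" "int W \<le> N"
    and E_big: "\<And>p. prime p \<Longrightarrow> p \<le> 256 \<Longrightarrow> p \<in> E"
begin

abbreviation P where "P \<equiv> sieve_primes z E"
abbreviation Q where "Q \<equiv> sieve_sets z E"

sublocale selberg P Q by (rule selberg_sieve) (use z3 in simp)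

lemma P_prime: "p \<in> P \<Longrightarrow> prime p" by (simp add: sieve_primes_def)

lemma finite_sub_P: "U \<subseteq> P \<Longrightarrow> finite U" using finite_P finite_subset by blast

lemma dvd_prod_iff:
  assumes "U \<subseteq> P" shows "int (\<Prod>U) dvd k \<longleftrightarrow> (\<forall>p\<in>U. int p dvd k)"
  by (rule prod_primes_dvd_int_iff[OF finite_sub_P[OF assms]]) (use assms P_prime in auto)

lemma nn_prod: "nn U = real (\<Prod>U)" by (simp add: nn_def)

lemma nn_nonneg: "0 \<le> nn U" by (simp add: nn_def prod_nonneg)

lemma prime_dvd_prod_P:
  assumes "U \<subseteq> P" "prime p" shows "p dvd \<Prod>U \<longleftrightarrow> p \<in> U"
proof -
  have "p dvd r \<longleftrightarrow> p = r" if "r \<in> U" for r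
    using primes_dvd_imp_eq[OF assms(2), of r] P_prime[of r] assms(1) that by auto
  then show ?thesis using prime_dvd_prod_iff[OF finite_sub_P[OF assms(1)] assms(2), of "\<lambda>r. r"] by simp
qed

lemma inj_prod: "inj_on (\<lambda>U. \<Prod>U) (Pow P)"
proof (rule inj_onI)
  fix S T assume S: "S \<in> Pow P" and T: "T \<in> Pow P" and eq: "\<Prod>S = \<Prod>T"
  have "p \<in> S \<longleftrightarrow> p \<in> T" if "prime p" for p
    using prime_dvd_prod_P[of S p] prime_dvd_prod_P[of T p] S T eq that by simp
  then show "S = T" using S T P_prime by blast
qed

lemma Q_prod: "T \<in> Q \<Longrightarrow> \<Prod>T \<le> z" by (simp add: sieve_sets_def)

lemma card_Q: "card Q \<le> z"
proof -
  have "card Q = card ((\<lambda>T. \<Prod>T) ` Q)"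
    using inj_on_subset[OF inj_prod, of Q] Q_subD by (simp add: card_image subset_iff)
  also have "\<dots> \<le> card {1..z}"
  proof (rule card_mono)
    show "(\<lambda>T. \<Prod>T) ` Q \<subseteq> {1..z}" using Q_prod prod_primes_pos[of _ z E] Q_subD by (fastforce simp: Suc_le_eq)
  qed simp
  finally show ?thesis by simp
qed

definition Lam :: real where "Lam = (\<Sum>T\<in>Q. \<bar>lam T\<bar>)"

lemma Lam_le: "Lam \<le> real z ^ 2"
proof -
  have "\<bar>lam T\<bar> \<le> real z" if T: "T \<in> Q" for T
  proof -
    have "(\<Prod>p\<in>T. 2) \<le> (\<Prod>p\<in>T. p)" by (rule prod_mono) (use Q_subD[OF T] P_prime prime_ge_2_nat in auto)
    then have "2 ^ card T \<le> z" using Q_prod[OF T] by simp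
    then have "real (2 ^ card T) \<le> real z" by (simp only: of_nat_le_iff)
    then have "(2::real) ^ card T \<le> real z" by (simp only: of_nat_power of_nat_numeral)
    then show ?thesis using abs_lam[OF T] by (rule order.trans[rotated])
  qed
  then have "Lam \<le> (\<Sum>T\<in>Q. real z)" unfolding Lam_def by (rule sum_mono)
  also have "\<dots> \<le> real z * real z" using card_Q by (simp add: mult_right_mono)
  finally show ?thesis by (simp add: power2_eq_square)
qed

lemma Lam_nonneg: "0 \<le> Lam" by (simp add: Lam_def sum_nonneg)

text \<open>The sieve acts on the integers from \<open>x0\<close> to \<open>x0 + N - 1\<close>.
  Divisibility is not a property of residues modulo \<open>N\<close>, so the representative
  \<open>n mod N\<close> is taken, and the transform consists of the geometric sums
  \<open>ap\<close>.\<close>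

definition nu :: "int \<Rightarrow> real" where
  "nu n = (\<Sum>T\<in>Q. lam T * of_bool (int (\<Prod>T) dvd x0 + n mod N))\<^sup>2"

lemma per_nu: "per nu" by (simp add: per_def nu_def)

lemma nu_nonneg: "0 \<le> nu n" by (simp add: nu_def)

lemma nu_eq_1:
  assumes "\<And>p. p \<in> P \<Longrightarrow> \<not> int p dvd x0 + n mod N"
  shows "nu n = 1"
proof -
  have "(\<Sum>T\<in>Q. lam T * of_bool (int (\<Prod>T) dvd x0 + n mod N)) = (\<Sum>T\<in>Q. if T = {} then lam {} else 0)"
  proof (rule sum.cong)
    fix T assume T: "T \<in> Q"
    have "\<not> int (\<Prod>T) dvd x0 + n mod N" if "T \<noteq> {}"
      using dvd_prod_iff[OF Q_subD[OF T]] assms Q_subD[OF T] that by blast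
    then show "lam T * of_bool (int (\<Prod>T) dvd x0 + n mod N) = (if T = {} then lam {} else 0)" by auto
  qed simp
  then show ?thesis using Q_empty finite_Q lam_empty by (simp add: nu_def)
qed

lemma FT_nu: "FT (cc nu) s = (\<Sum>S\<in>Q. \<Sum>T\<in>Q. of_real (lam S * lam T) * ap x0 (\<Prod>(S \<union> T)) s)"
proof -
  have sq: "nu n = (\<Sum>S\<in>Q. \<Sum>T\<in>Q. lam S * lam T * of_bool (int (\<Prod>(S \<union> T)) dvd x0 + n))" if "n \<in> {0..<N}" for n
  proof -
    have "of_bool (int (\<Prod>S) dvd x0 + n) * of_bool (int (\<Prod>T) dvd x0 + n) = (of_bool (int (\<Prod>(S \<union> T)) dvd x0 + n) :: real)"
      if "S \<in> Q" "T \<in> Q" for S T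
      using dvd_prod_iff[of S] dvd_prod_iff[of T] dvd_prod_iff[of "S \<union> T"] Q_subD that by (auto simp: ball_Un)
    then show ?thesis using that unfolding nu_def power2_eq_square sum_product
      by (intro sum.cong refl) (simp add: mult.assoc mult.left_commute)
  qed
  have ob: "complex_of_real (of_bool b) = of_bool b" for b by simp
  have "FT (cc nu) s = (\<Sum>n\<in>{0..<N}. \<Sum>S\<in>Q. \<Sum>T\<in>Q. of_real (lam S * lam T) * (of_bool (int (\<Prod>(S \<union> T)) dvd x0 + n) * e (- s * n)))"
    unfolding FT_def
  proof (rule sum.cong)
    fix n assume "n \<in> {0..<N}"
    from sq[OF this] show "cc nu n * e (- s * n) = (\<Sum>S\<in>Q. \<Sum>T\<in>Q. of_real (lam S * lam T) * (of_bool (int (\<Prod>(S \<union> T)) dvd x0 + n) * e (- s * n)))"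
      by (simp only: of_real_sum sum_distrib_right of_real_mult ob mult.assoc)
  qed simp
  also have "\<dots> = (\<Sum>S\<in>Q. \<Sum>n\<in>{0..<N}. \<Sum>T\<in>Q. of_real (lam S * lam T) * (of_bool (int (\<Prod>(S \<union> T)) dvd x0 + n) * e (- s * n)))"
    by (rule sum.swap)
  also have "\<dots> = (\<Sum>S\<in>Q. \<Sum>T\<in>Q. \<Sum>n\<in>{0..<N}. of_real (lam S * lam T) * (of_bool (int (\<Prod>(S \<union> T)) dvd x0 + n) * e (- s * n)))"
    by (intro sum.cong refl sum.swap)
  finally show ?thesis by (simp only: ap_def sum_distrib_left)
qed

lemma union_m:
  assumes "S \<in> Q" "T \<in> Q"
  shows "0 < \<Prod>(S \<union> T)" "2 * \<Prod>(S \<union> T) \<le> W" "int (\<Prod>(S \<union> T)) \<le> N"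
proof -
  have sub: "S \<union> T \<subseteq> P" "S \<inter> T \<subseteq> P" using assms Q_subD by auto
  show "0 < \<Prod>(S \<union> T)" using sub(1) by (rule prod_primes_pos)
  have "\<Prod>(S \<union> T) \<le> \<Prod>(S \<union> T) * \<Prod>(S \<inter> T)" using prod_primes_pos[OF sub(2)] by simp
  also have "\<dots> = \<Prod>S * \<Prod>T" using finite_mem_Q assms by (intro prod.union_inter)
  also have "\<dots> \<le> z * z" using Q_prod assms by (intro mult_le_mono)
  finally show w: "2 * \<Prod>(S \<union> T) \<le> W" using W(1) by (simp add: power2_eq_square)
  then show "int (\<Prod>(S \<union> T)) \<le> N" using W(2) by linarith
qed

lemma Lam_sq: "(\<Sum>S\<in>Q. \<Sum>T\<in>Q. \<bar>lam S * lam T\<bar> * c) = Lam\<^sup>2 * c"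
  unfolding Lam_def power2_eq_square sum_product by (simp add: abs_mult sum_distrib_right)

lemma norm_FT_nu_0: "norm (FT (cc nu) 0) \<le> of_int N / H + Lam\<^sup>2"
proof -
  let ?m = "\<lambda>S T. \<Prod>(S \<union> T)"
  let ?main = "\<Sum>S\<in>Q. \<Sum>T\<in>Q. of_real (lam S * lam T) * complex_of_real (of_int N / real (?m S T))"
  have "?main = of_real (of_int N * (\<Sum>S\<in>Q. \<Sum>T\<in>Q. lam S * lam T / nn (S \<union> T)))"
    by (simp add: sum_distrib_left nn_prod mult.commute)
  then have main: "?main = of_real (of_int N / H)" unfolding selberg_main by simp
  have "FT (cc nu) 0 - ?main = (\<Sum>S\<in>Q. \<Sum>T\<in>Q. of_real (lam S * lam T) * (ap x0 (?m S T) 0 - of_real (of_int N / real (?m S T))))"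
    unfolding FT_nu by (simp only: sum_subtractf right_diff_distrib)
  also have "norm \<dots> \<le> (\<Sum>S\<in>Q. \<Sum>T\<in>Q. \<bar>lam S * lam T\<bar> * 1)"
  proof (intro sum_norm_le)
    fix S T assume "S \<in> Q" "T \<in> Q"
    then have "norm (ap x0 (?m S T) 0 - of_real (of_int N / real (?m S T))) \<le> 1" using union_m by (intro ap_0) auto
    then have "\<bar>lam S * lam T\<bar> * norm (ap x0 (?m S T) 0 - of_real (of_int N / real (?m S T))) \<le> \<bar>lam S * lam T\<bar> * 1"
      by (intro mult_left_mono) auto
    then show "norm (of_real (lam S * lam T) * (ap x0 (?m S T) 0 - of_real (of_int N / real (?m S T)))) \<le> \<bar>lam S * lam T\<bar> * 1"
      by (simp only: norm_mult norm_of_real)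
  qed
  finally have "norm (FT (cc nu) 0 - of_real (of_int N / H)) \<le> Lam\<^sup>2" unfolding main Lam_sq by simp
  moreover have "norm (complex_of_real (of_int N / H)) = of_int N / H"
    using H_ge_1 N_pos by (subst norm_of_real) simp
  ultimately show ?thesis using norm_triangle_sub[of "FT (cc nu) 0" "of_real (of_int N / H)"] by linarith
qed

text \<open>The part of the sieve's quadratic form, in absolute values, with moduli divisible by
  \<open>q\<close>. Only these moduli resonate with frequencies near a reduced fraction of
  denominator \<open>q\<close>.\<close>

definition Psi :: "nat \<Rightarrow> real" where
  "Psi q = (\<Sum>S\<in>Q. \<Sum>T\<in>Q. \<bar>lam S * lam T\<bar> * (of_bool (q dvd \<Prod>(S \<union> T)) / nn (S \<union> T)))"

lemma Psi_nonneg: "0 \<le> Psi q" unfolding Psi_def by (intro sum_nonneg mult_nonneg_nonneg) (auto simp: nn_nonneg)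

lemma Psi_eq_0:
  assumes "prime p" "p dvd q" "p \<notin> P" shows "Psi q = 0"
proof -
  have "\<not> q dvd \<Prod>(S \<union> T)" if "S \<in> Q" "T \<in> Q" for S T
  proof
    assume "q dvd \<Prod>(S \<union> T)"
    with assms(2) have "p dvd \<Prod>(S \<union> T)" by (rule dvd_trans)
    moreover have "S \<union> T \<subseteq> P" using that Q_subD by blast
    ultimately show False using prime_dvd_prod_P[OF _ assms(1)] assms(3) by blast
  qed
  then show ?thesis unfolding Psi_def by (intro sum.neutral ballI) simp
qed

text \<open>If \<open>q\<close> divides a product of sieving primes, \<open>union_sum_le\<close> and
  \<open>sum_superset\<close> bound the sum by an Euler product times the product of
  \<open>16 / p\<close> over the primes of \<open>q\<close>; each of these is at most
  \<open>1 / sqrt p\<close>. Otherwise the sum is empty.\<close>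

lemma Psi_le: "Psi q \<le> exp 80 * ln (real z) ^ 32 / sqrt (real q)"
proof (cases "\<exists>U\<subseteq>P. q dvd \<Prod>U")
  case True
  then obtain U where U: "U \<subseteq> P" "q dvd \<Prod>U" by blast
  have "squarefree (\<Prod>U)"
  proof (rule squarefree_prod_coprime)
    fix a b assume "a \<in> U" "b \<in> U" "a \<noteq> b"
    then show "coprime a b" using U(1) P_prime by (intro primes_coprime) auto
  next
    fix a assume "a \<in> U"
    then show "squarefree a" using U(1) P_prime by (intro squarefree_prime) auto
  qed
  then have sf: "squarefree q" using U(2) squarefree_mono by blast
  let ?Q0 = "prime_factors q"
  have q: "\<Prod>?Q0 = q" using sf by (rule squarefree_eq_prod)
  have sub: "?Q0 \<subseteq> U" if "U \<subseteq> P" "q dvd \<Prod>U" for U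
  proof
    fix p assume "p \<in> ?Q0"
    then have p: "prime p" "p dvd q" by auto
    from p(2) that(2) have "p dvd \<Prod>U" by (rule dvd_trans)
    then show "p \<in> U" using prime_dvd_prod_P[OF that(1) p(1)] by simp
  qed
  have Q0: "?Q0 \<subseteq> P" using sub[OF U] U(1) by (rule order.trans)
  have dvd_iff: "q dvd \<Prod>U \<longleftrightarrow> ?Q0 \<subseteq> U" if "U \<subseteq> P" for U
  proof
    show "?Q0 \<subseteq> U" if "q dvd \<Prod>U" using sub[OF \<open>U \<subseteq> P\<close> that] .
    show "q dvd \<Prod>U" if "?Q0 \<subseteq> U"
      using prod_dvd_prod_subset[OF finite_sub_P[OF \<open>U \<subseteq> P\<close>] that, of "\<lambda>p. p"] unfolding q .
  qed
  have "Psi q = (\<Sum>S\<in>Q. \<Sum>T\<in>Q. \<bar>lam S * lam T\<bar> * (of_bool (?Q0 \<subseteq> S \<union> T) / nn (S \<union> T)))"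
    unfolding Psi_def using Q_subD by (intro sum.cong refl) (auto simp: dvd_iff)
  also have "\<dots> \<le> (\<Sum>U\<in>Pow P. 16 ^ card U * (of_bool (?Q0 \<subseteq> U) / nn U))"
    by (rule union_sum_le[where f = "\<lambda>U. of_bool (?Q0 \<subseteq> U) / nn U"]) (simp add: nn_nonneg)
  also have "\<dots> \<le> (\<Prod>p\<in>?Q0. 16 / real p) * (\<Prod>p\<in>P. 1 + 16 / real p)" by (rule sum_superset[OF Q0])
  also have "\<dots> \<le> (1 / sqrt (real q)) * (exp 80 * ln (real z) ^ 32)"
  proof (rule mult_mono)
    have "(\<Prod>p\<in>?Q0. 16 / real p) \<le> (\<Prod>p\<in>?Q0. 1 / sqrt (real p))"
    proof (rule prod_mono)
      fix p assume "p \<in> ?Q0"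
      then have "p \<in> P" using Q0 by blast
      then have "256 \<le> p" using E_big[of p] by (cases "p \<le> 256") (auto simp: sieve_primes_def)
      then have "sqrt (16\<^sup>2) \<le> sqrt (real p)" by (intro real_sqrt_le_mono) simp
      then have s: "16 \<le> sqrt (real p)" by (simp only: real_sqrt_abs)
      have "16 * sqrt (real p) \<le> sqrt (real p) * sqrt (real p)" using s by (intro mult_right_mono) auto
      then have "16 * sqrt (real p) \<le> real p" by simp
      then show "0 \<le> 16 / real p \<and> 16 / real p \<le> 1 / sqrt (real p)"
        using s \<open>256 \<le> p\<close> by (simp add: field_simps)
    qed
    also have "\<dots> = 1 / sqrt (real (\<Prod>?Q0))" by (simp add: prod_dividef sqrt_prod)
    finally show "(\<Prod>p\<in>?Q0. 16 / real p) \<le> 1 / sqrt (real q)" by (simp only: q)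
    show "(\<Prod>p\<in>P. 1 + 16 / real p) \<le> exp 80 * ln (real z) ^ 32" using z3 by (rule sieve_R_bound)
  qed (auto intro!: prod_nonneg)
  finally show ?thesis by (simp add: mult.commute)
next
  case False
  then have "\<not> q dvd \<Prod>(S \<union> T)" if "S \<in> Q" "T \<in> Q" for S T
    using False Un_least[OF Q_subD[OF that(1)] Q_subD[OF that(2)]] by blast
  then have "Psi q = 0" unfolding Psi_def by (intro sum.neutral ballI) simp
  then show ?thesis using z3 by simp
qed

text \<open>The moduli are at most \<open>W / 2\<close>. If \<open>q\<close> does not divide the
  modulus \<open>m\<close>, then \<open>m * s / N\<close> stays at distance at least
  \<open>1 / (2 * q)\<close> from all integers, and the sum is at most \<open>2 * W\<close>. If
  \<open>q\<close> divides \<open>m\<close>, the sum is bounded by 4 for \<open>q = 1\<close> and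
  follows the profile \<open>kern\<close> around \<open>c / q\<close> for \<open>q > 1\<close>;
  adding up the latter gives \<open>Psi q\<close>.\<close>

lemma norm_FT_nu:
  assumes s: "s \<in> {1..<N}" and c: "coprime c (int q)" "0 < q" "q \<le> W" "\<bar>real q * (of_int s / of_int N) - of_int c\<bar> < 1 / W"
  shows "norm (FT (cc nu) s) \<le> Lam\<^sup>2 * (2 * real W + 4) + of_bool (1 < q) * (of_int N * Psi q * kern (of_int s - of_int c * of_int N / q))"
proof -
  define \<delta> where "\<delta> = of_int s / of_int N - of_int c / (real q)"
  have W0: "0 < W" using W(1) z3 by (cases W) (auto simp: power2_eq_square)
  have "real q * \<delta> = real q * (of_int s / of_int N) - of_int c" using c(2) by (simp add: \<delta>_def right_diff_distrib)
  then have "real q * \<bar>\<delta>\<bar> < 1 / W" using c(4) by (metis abs_mult abs_of_nat)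
  then have \<delta>: "real q * \<bar>\<delta>\<bar> * W < 1" using W0 by (simp add: field_simps)
  have sN: "of_int s - of_int c * of_int N / real q = of_int N * \<delta>"
    using N_pos by (simp add: \<delta>_def right_diff_distrib)
  have bound: "norm (ap x0 m s) \<le> (2 * real W + 4) + of_bool (1 < q) * (of_int N * kern (of_int N * \<delta>) * (of_bool (q dvd m) / real m))"
    if m: "0 < m" "2 * m \<le> W" "int m \<le> N" for m
  proof (cases "q dvd m")
    case False
    have kn: "0 \<le> of_bool (1 < q) * (of_int N * kern (of_int N * \<delta>) * (of_bool (q dvd m) / real m))" using False by simp
    define t :: real where "t = of_int (s * int m) / of_int N - of_int (round (of_int (s * int m) / of_int N :: real))"
    have t2: "\<bar>t\<bar> \<le> 1 / 2" unfolding t_def using of_int_round_abs_le abs_minus_commute by metis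
    let ?j = "round (of_int (s * int m) / of_int N :: real)"
    have "\<not> int q dvd c * int m - ?j * int q"
    proof
      assume "int q dvd c * int m - ?j * int q"
      then have "int q dvd c * int m" using dvd_diff_left_iff[of "int q" "?j * int q" "c * int m"] by simp
      then have "int q dvd int m" using c(1) by (simp add: coprime_commute coprime_dvd_mult_right_iff)
      then show False using False by (simp only: int_dvd_int_iff)
    qed
    then have "c * int m - ?j * int q \<noteq> 0" by (metis dvd_0_right)
    then have "1 \<le> \<bar>c * int m - ?j * int q\<bar>" by linarith
    then have "(1::real) \<le> of_int \<bar>c * int m - ?j * int q\<bar>" by (simp only: of_int_1_le_iff)
    moreover have "of_int (c * int m - ?j * int q) = real q * t - real m * (real q * \<delta>)"
    proof -
      have "real m * (real q * \<delta>) = real q * (of_int (s * int m) / of_int N) - of_int (c * int m)"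
        using c(2) by (simp add: \<delta>_def right_diff_distrib)
      then show ?thesis by (simp add: t_def right_diff_distrib)
    qed
    ultimately have "1 \<le> \<bar>real q * t - real m * (real q * \<delta>)\<bar>" by simp
    also have "\<dots> \<le> real q * \<bar>t\<bar> + real m * (real q * \<bar>\<delta>\<bar>)"
      using abs_triangle_ineq4[of "real q * t" "real m * (real q * \<delta>)"] by (simp add: abs_mult)
    also have "real m * (real q * \<bar>\<delta>\<bar>) \<le> 1 / 2"
    proof -
      have "real (2 * m) \<le> real W" using m(2) by (simp only: of_nat_le_iff)
      then have "2 * real m * (real q * \<bar>\<delta>\<bar>) \<le> real W * (real q * \<bar>\<delta>\<bar>)" by (intro mult_right_mono) auto
      then show ?thesis using \<delta> by (simp add: mult_ac)
    qed
    finally have tq: "1 \<le> 2 * real q * \<bar>t\<bar>" by linarith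
    then have t0: "t \<noteq> 0" by auto
    have "norm (ap x0 m s) \<le> 1 / \<bar>t\<bar>"
      by (rule ap_bound[OF m(1,3) _ t0 t2, of s ?j]) (simp add: t_def)
    also have "\<dots> \<le> 2 * real q" using tq t0 by (simp add: field_simps)
    also have "\<dots> \<le> 2 * real W" using c(3) by simp
    finally show ?thesis using kn by linarith
  next
    case True
    then obtain k where k: "m = q * k" by (rule dvdE)
    have "real (2 * m) \<le> real W" using m(2) by (simp only: of_nat_le_iff)
    then have "2 * real m * \<bar>\<delta>\<bar> \<le> real W * \<bar>\<delta>\<bar>" by (intro mult_right_mono) auto
    also have "1 * (real W * \<bar>\<delta>\<bar>) \<le> real q * (real W * \<bar>\<delta>\<bar>)" using c(2) by (intro mult_right_mono) auto
    then have "real W * \<bar>\<delta>\<bar> \<le> real q * (real W * \<bar>\<delta>\<bar>)" by simp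
    also have "\<dots> < 1" using \<delta> by (simp add: mult_ac)
    finally have m\<delta>: "real m * \<bar>\<delta>\<bar> \<le> 1 / 2" by simp
    show ?thesis
    proof (cases "q = 1")
      case True
      have sN': "of_int s / of_int N = \<delta> + of_int c" by (simp add: \<delta>_def True)
      have "\<delta> \<noteq> 0"
      proof
        assume "\<delta> = 0"
        then have "of_int s = (of_int (c * N) :: real)" using sN' N_pos by (simp add: field_simps)
        then have "s = c * N" by (simp only: of_int_eq_iff)
        then have "N dvd s" by simp
        then show False using s zdvd_not_zless[of s N] by auto
      qed
      then have "norm (ap x0 m s) \<le> 4" by (rule ap_near_0[OF m(1,3) sN' _ m\<delta>])
      then show ?thesis using True by simp
    next
      case False
      then have q1: "1 < q" using c(2) by simp
      have "norm (ap x0 m s) \<le> of_int N / real m * kern (of_int N * \<delta>)"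
      proof (cases "\<bar>of_int N * \<delta>\<bar> \<le> 1 / 2")
        case True
        then show ?thesis using ap_trivial[OF m(1,3), of x0 s] by (simp add: kern_def mult.commute)
      next
        case False
        then have \<delta>0: "\<delta> \<noteq> 0" by auto
        have tm: "of_int (s * int m) / of_int N = real m * \<delta> + of_int (c * int k)"
          using c(2) by (simp add: \<delta>_def k right_diff_distrib)
        have "norm (ap x0 m s) \<le> 1 / \<bar>real m * \<delta>\<bar>"
          by (rule ap_bound[OF m(1,3) tm]) (use \<delta>0 m(1) m\<delta> in \<open>auto simp: abs_mult\<close>)
        also have "\<dots> = of_int N / real m * kern (of_int N * \<delta>)"
          using False N_pos by (simp add: kern_def abs_mult)
        finally show ?thesis .
      qed
      then show ?thesis using q1 True by (simp add: mult_ac)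
    qed
  qed
  let ?K = "of_bool (1 < q) * (of_int N * kern (of_int N * \<delta>))"
  have "norm (FT (cc nu) s) \<le> (\<Sum>S\<in>Q. \<Sum>T\<in>Q. \<bar>lam S * lam T\<bar> * ((2 * real W + 4) + ?K * (of_bool (q dvd \<Prod>(S \<union> T)) / nn (S \<union> T))))"
    unfolding FT_nu
  proof (intro sum_norm_le)
    fix S T assume "S \<in> Q" "T \<in> Q"
    then have "norm (ap x0 (\<Prod>(S \<union> T)) s) \<le> (2 * real W + 4) + ?K * (of_bool (q dvd \<Prod>(S \<union> T)) / nn (S \<union> T))"
      using bound[of "\<Prod>(S \<union> T)"] union_m by (simp only: nn_prod mult.assoc)
    then show "norm (of_real (lam S * lam T) * ap x0 (\<Prod>(S \<union> T)) s) \<le> \<bar>lam S * lam T\<bar> * ((2 * real W + 4) + ?K * (of_bool (q dvd \<Prod>(S \<union> T)) / nn (S \<union> T)))"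
      unfolding norm_mult norm_of_real by (rule mult_left_mono) simp
  qed
  also have "\<dots> = (\<Sum>S\<in>Q. \<Sum>T\<in>Q. \<bar>lam S * lam T\<bar> * (2 * real W + 4)) + ?K * Psi q"
    unfolding Psi_def by (simp only: distrib_left sum.distrib sum_distrib_left mult.left_commute)
  finally show ?thesis unfolding Lam_sq sN by (simp add: mult_ac)
qed

end

section \<open>Adapting the sieve to a given spectrum\<close>

context cyclic
begin

lemma numerator_range:
  assumes s: "s \<in> {1..<N}" and c: "coprime c (int q)" "1 < q" "\<bar>real q * (of_int s / of_int N) - of_int c\<bar> < 1"
  shows "0 < c" "c < int q"
proof -
  have "0 < of_int s / (of_int N :: real)" "of_int s / of_int N < (1 :: real)" using s by auto
  then have "0 < real q * (of_int s / of_int N)" "real q * (of_int s / of_int N) < real q * 1"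
    using c(2) by (intro mult_pos_pos mult_strict_left_mono; simp)+
  then have "(-1 :: real) < of_int c" "of_int c < real q + 1" using c(3) by linarith+
  then have "0 \<le> c" "c \<le> int q" by linarith+
  moreover have "c \<noteq> 0" "c \<noteq> int q" using c(1,2) by auto
  ultimately show "0 < c" "c < int q" by auto
qed

text \<open>The unknown phase cancels in the difference of two frequencies, which then lies in the
  doubled spectrum and close to the difference of the two fractions. Both fractions lie strictly
  between 0 and 1, so if they are distinct their difference is not an integer and its reduced
  denominator exceeds 1.\<close>

lemma near_diff:
  assumes s: "s1 \<in> {1..<N}" "s2 \<in> {1..<N}"
    and g: "g1 \<in> spec D" "N dvd s1 + \<phi> - g1" "g2 \<in> spec D" "N dvd s2 + \<phi> - g2"
    and c1: "coprime c1 (int q1)" "1 < q1" "\<bar>real q1 * (of_int s1 / of_int N) - of_int c1\<bar> < 1 / W"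
    and c2: "coprime c2 (int q2)" "1 < q2" "\<bar>real q2 * (of_int s2 / of_int N) - of_int c2\<bar> < 1 / W"
    and Y: "real q1 * real q2 \<le> Y" and W: "1 \<le> W" and z0: "\<And>p. prime p \<Longrightarrow> p dvd q1 * q2 \<Longrightarrow> z0 \<le> p"
    and ne: "of_int c1 / real q1 \<noteq> of_int c2 / real q2"
  obtains c q where "near (spec (scale 2 D)) (2 / W) Y z0 c q" "q dvd q1 * q2"
proof -
  have W1: "1 / W \<le> 1" using W by simp
  have r1: "0 < c1" "c1 < int q1" using numerator_range[OF s(1) c1(1,2)] c1(3) W1 by linarith+
  have r2: "0 < c2" "c2 < int q2" using numerator_range[OF s(2) c2(1,2)] c2(3) W1 by linarith+
  define x where "x = c1 * int q2 - c2 * int q1"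
  define y where "y = q1 * q2"
  have y0: "0 < y" using c1(2) c2(2) by (simp add: y_def)
  have xy: "of_int c1 / real q1 - of_int c2 / real q2 = of_int x / real y"
    using c1(2) c2(2) by (simp add: x_def y_def field_simps)
  define d where "d = gcd x (int y)"
  have d0: "0 < d" using y0 by (simp add: d_def)
  define c0 where "c0 = x div d"
  define q where "q = nat (int y div d)"
  have "d dvd int y" "d dvd x" by (simp_all add: d_def)
  then have yq: "int y = int q * d" and xc: "x = c0 * d"
    using d0 y0 by (simp_all add: q_def c0_def pos_imp_zdiv_nonneg_iff)
  have q0: "0 < q" using yq y0 by (cases q) auto
  have cop: "coprime c0 (int q)"
  proof -
    have "coprime (x div d) (int y div d)" unfolding d_def using y0 by (intro div_gcd_coprime) simp
    then show ?thesis using d0 y0 by (simp add: c0_def q_def pos_imp_zdiv_nonneg_iff)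
  qed
  have fr: "of_int x / real y = of_int c0 / real q"
  proof -
    have "real y = real q * of_int d" using arg_cong[OF yq, of real_of_int] by simp
    moreover have "of_int x = of_int c0 * (of_int d :: real)" using xc by simp
    ultimately show ?thesis using d0 by simp
  qed
  have qy: "q dvd q1 * q2"
  proof -
    have "int q dvd int y" unfolding yq by simp
    then show ?thesis unfolding y_def by (simp only: int_dvd_int_iff)
  qed
  have q1: "q \<noteq> 1"
  proof
    assume "q = 1"
    then have "of_int c0 = of_int c1 / real q1 - of_int c2 / real q2" using xy fr by simp
    moreover have "0 < of_int c1 / real q1" "of_int c1 / real q1 < 1" "0 < of_int c2 / real q2" "of_int c2 / real q2 < 1"
      using r1 r2 c1(2) c2(2) by (simp_all add: field_simps)
    ultimately have "of_int c0 < (1 :: real)" "- 1 < (of_int c0 :: real)" by linarith+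
    then have "c0 = 0" by linarith
    then show False using xy fr ne by simp
  qed
  have "N dvd (s1 + \<phi> - g1) - (s2 + \<phi> - g2)" by (rule dvd_diff[OF g(2,4)])
  then obtain j where "(s1 + \<phi> - g1) - (s2 + \<phi> - g2) = N * j" by (rule dvdE)
  then have j: "s1 - s2 = (g1 - g2) + N * j" by simp
  have "of_int (s1 - s2) / (of_int N :: real) = of_int (g1 - g2) / of_int N + of_int j"
    unfolding j using N_pos by (simp add: add_divide_distrib)
  then have \<gamma>: "of_int (g1 - g2) / of_int N - of_int (c0 - j * int q) / real q
       = (of_int s1 / of_int N - of_int c1 / real q1) - (of_int s2 / of_int N - of_int c2 / real q2)"
    using xy fr q0 by (simp add: diff_divide_distrib)
  have \<delta>: "\<bar>of_int s / of_int N - of_int c / real q\<bar> \<le> 1 / W"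
    if "1 < q" "\<bar>real q * (of_int s / of_int N) - of_int c\<bar> < 1 / W" for s c q
  proof -
    have "real q * \<bar>of_int s / of_int N - of_int c / real q\<bar> = \<bar>real q * (of_int s / of_int N - of_int c / real q)\<bar>"
      by (simp add: abs_mult)
    also have "real q * (of_int s / of_int N - of_int c / real q) = real q * (of_int s / of_int N) - of_int c"
      using that(1) by (simp add: right_diff_distrib)
    finally have lt: "real q * \<bar>of_int s / of_int N - of_int c / real q\<bar> < 1 / W" using that(2) by simp
    have "1 * \<bar>of_int s / of_int N - of_int c / real q\<bar> \<le> real q * \<bar>of_int s / of_int N - of_int c / real q\<bar>"
      using that(1) by (intro mult_right_mono) auto
    also note lt
    finally show ?thesis by simp
  qed
  have "\<bar>of_int (g1 - g2) / of_int N - of_int (c0 - j * int q) / real q\<bar> \<le> 2 / W"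
    unfolding \<gamma> using \<delta>[OF c1(2,3)] \<delta>[OF c2(2,3)] by (simp add: abs_if split: if_splits)
  moreover have "g1 - g2 \<in> spec (scale 2 D)"
  proof -
    have "scale 1 D = D" unfolding scale_def by (induction D) auto
    then have "g1 + - g2 \<in> spec (scale (Suc 1) D)" using g by (intro spec_scale_add uminus_spec) auto
    then show ?thesis by (simp add: numeral_2_eq_2)
  qed
  moreover have "coprime (c0 - j * int q) (int q)"
    using cop gcd_add_mult[of "int q" "- j" c0] by (simp add: coprime_iff_gcd_eq_1 gcd.commute)
  moreover have "real q \<le> Y"
  proof -
    have "q \<le> q1 * q2" using qy y0 by (intro dvd_imp_le) (auto simp: y_def)
    then have "real q \<le> real (q1 * q2)" by (simp only: of_nat_le_iff)
    then show ?thesis using Y by simp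
  qed
  moreover have "z0 \<le> p" if "prime p" "p dvd q" for p using z0 that qy dvd_trans by blast
  ultimately have "near (spec (scale 2 D)) (2 / W) Y z0 (c0 - j * int q) q"
    unfolding near_def using q0 q1 by (intro conjI bexI[of _ "g1 - g2"]) auto
  then show thesis using qy by (rule that)
qed

text \<open>Entries of multiplicity 0 change neither the spectrum nor its complexity. Without them
  each entry contributes at least \<open>ln 3 \<ge> 1\<close>, so the number of frequencies is
  bounded by the complexity.\<close>

lemma filter_pos:
  defines "D' \<equiv> \<lambda>D. filter (\<lambda>(r, m). 0 < m) D"
  shows "spec (D' D) = spec D" "lcard (D' D) = lcard D" "length (D' D) \<le> lcard D"
proof -
  show "spec (D' D) = spec D" unfolding D'_def
  proof (induction D rule: spec.induct)
    case (2 r m D)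
    have "spec ((r, 0) # D) = spec D" by (force simp: image_iff)
    then show ?case using 2 by (cases "m = 0") (simp_all del: spec.simps(2) add: spec.simps(2)[of r m])
  qed simp
  show "lcard (D' D) = lcard D" unfolding D'_def
    by (induction D rule: spec.induct) auto
  show "length (D' D) \<le> lcard D" unfolding D'_def
  proof (induction D rule: spec.induct)
    case (2 r m D)
    have "1 \<le> ln (2 * real m + 1)" if "0 < m"
    proof -
      have "exp 1 \<le> (3::real)" by (rule exp_le)
      also have "\<dots> \<le> 2 * real m + 1" using that by simp
      finally show ?thesis using ln_ge_iff[of "2 * real m + 1" 1] that by simp
    qed
    then show ?case using 2 by auto
  qed simp
qed

lemma dirichlet:
  assumes "0 < W"
  obtains c q where "coprime c (int q)" "0 < q" "q \<le> W" "\<bar>real q * \<theta> - of_int c\<bar> < 1 / real W"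
proof -
  obtain h k where hk: "coprime h k" "0 < k" "k \<le> int W" "\<bar>of_int k * \<theta> - of_int h\<bar> < 1 / W"
    using Dirichlet_approx_coprime[OF assms] by blast
  show thesis by (rule that[of h "nat k"]) (use hk in auto)
qed

text \<open>For a given spectrum the sieve omits the primes up to \<open>z0\<close> and the few bad
  primes. A translate of the spectrum has at most \<open>exp L\<close> elements. Those near
  fractions of denominator above \<open>exp (8 * L)\<close> carry small coefficients, and the others
  with a relevant denominator all cluster around a single fraction, so their total is only
  logarithmic instead of proportional to their number.\<close>

theorem sieve_majorized:
  fixes L H \<epsilon> :: real and z z0 W s :: nat
  defines "R \<equiv> exp 80 * ln (real z) ^ 32"
  assumes z: "3 \<le> z" "2 * z\<^sup>2 \<le> W" "int W \<le> N" and z0: "256 \<le> z0" "s \<le> z0" "1 \<le> s"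
    and a: "\<And>n. a n = 0 \<or> a n = 1" "\<And>n p. a n = 1 \<Longrightarrow> prime p \<Longrightarrow> z0 < p \<Longrightarrow> p \<le> z \<Longrightarrow> \<not> int p dvd x0 + n mod N"
    and L: "0 \<le> L" "L * (1 + ln (2 * real s)) < s * ln 2" "2 * real s * exp (16 * L * s) < W"
    and H: "0 < H" "2 * H \<le> ln z / (exp 14 * ln z0 ^ 4)" "2 * H * real z ^ 4 \<le> of_int N"
    and \<epsilon>: "exp L * (real z ^ 4 * (2 * real W + 4)) + 2 * of_int N * R * exp (- 3 * L) + of_int N * (R / sqrt z0) * (6 + 2 * ln (of_int N)) \<le> of_int N * \<epsilon>"
  shows "majorized a L H \<epsilon>"
  unfolding majorized_def
proof (intro allI impI)
  fix D0 assume D0: "lcard D0 \<le> L"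
  define D where "D = filter (\<lambda>(r, m). 0 < m) D0"
  have D: "spec D = spec D0" "lcard D \<le> L" "length D \<le> L"
    using filter_pos[of D0] D0 unfolding D_def by auto
  have W0: "0 < W" using z by (cases W) (auto simp: power2_eq_square)
  have R0: "0 \<le> R" unfolding R_def using z by simp
  \<comment> \<open>The sums of \<open>s\<close> elements number at most a power of \<open>s\<close>
    with exponent of order \<open>L\<close>, because \<open>length D \<le> L\<close>; the hypothesis
    on \<open>s\<close> makes this smaller than \<open>2 ^ s\<close>.\<close>
  have card: "real (card (spec (scale s (scale 2 D)))) < 2 ^ s"
  proof -
    have "scale s (scale 2 D) = scale (2 * s) D" unfolding scale_def by (simp add: case_prod_unfold mult_ac)
    then have "real (card (spec (scale s (scale 2 D)))) \<le> exp (lcard (scale (2 * s) D))" using card_spec by simp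
    also have "\<dots> \<le> exp (L * (1 + ln (2 * real s)))"
    proof -
      have "0 \<le> ln (2 * real s)" using z0 by (intro ln_ge_zero) simp
      with D(3) have "length D * ln (2 * real s) \<le> L * ln (2 * real s)" by (rule mult_right_mono)
      moreover have "lcard (scale (2 * s) D) \<le> length D * ln (2 * real s) + lcard D"
        using lcard_scale[of "2 * s" D] z0 by simp
      ultimately have "lcard (scale (2 * s) D) \<le> L * (1 + ln (2 * real s))"
        using D(2) unfolding distrib_left by linarith
      then show ?thesis by simp
    qed
    also have "\<dots> < exp (s * ln 2)" using L(2) by simp
    also have "\<dots> = 2 ^ s" by (simp add: exp_of_nat_mult)
    finally show ?thesis .
  qed
  have sep: "s * (2 / real W) < 1 / exp (16 * L) ^ s"
  proof -
    have "exp (16 * L) ^ s = exp (16 * L * s)" by (simp add: exp_of_nat_mult[symmetric] mult.commute)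
    then show ?thesis using L(3) W0 by (simp add: field_simps)
  qed
  \<comment> \<open>Two frequencies will be subtracted: differences lie in the spectrum of
    \<open>scale 2 D\<close>, two tolerances add up to \<open>2 / W\<close>, and a product of two
    denominators up to \<open>exp (8 * L)\<close> is at most \<open>exp (16 * L)\<close>.\<close>
  obtain B where B: "finite B" "card B \<le> s" "\<And>p. p \<in> B \<Longrightarrow> prime p \<and> z0 \<le> p"
    "\<And>c q. near (spec (scale 2 D)) (2 / real W) (exp (16 * L)) z0 c q \<Longrightarrow> \<exists>p\<in>B. p dvd q"
    by (rule bad_primes[OF card sep]) auto
  define E where "E = {p. prime p \<and> p \<le> z0} \<union> B"
  interpret sv: sieved N x0 z E W
    by unfold_locales (use z z0 in \<open>auto simp: E_def\<close>)
  have Psi: "sv.Psi q \<le> R / sqrt (real q)" for q unfolding R_def by (rule sv.Psi_le)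
  show "\<exists>\<nu>. per \<nu> \<and> (\<forall>n. a n \<le> \<nu> n) \<and> norm (FT (cc \<nu>) 0) \<le> of_int N / H \<and>
     (\<forall>\<phi>. (\<Sum>s\<in>{1..<N}. if \<exists>g\<in>spec D0. N dvd s + \<phi> - g then norm (FT (cc \<nu>) s) else 0) \<le> of_int N * \<epsilon>)"
  proof (intro exI[of _ sv.nu] conjI allI)
    show "per sv.nu" by (rule sv.per_nu)
    show "a n \<le> sv.nu n" for n
    proof (cases "a n = 1")
      case True
      have "sv.nu n = 1"
      proof (rule sv.nu_eq_1)
        fix p assume "p \<in> sieve_primes z E"
        then have "prime p" "z0 < p" "p \<le> z" by (auto simp: sieve_primes_def E_def)
        then show "\<not> int p dvd x0 + n mod N" by (rule a(2)[OF True])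
      qed
      then show ?thesis using True by simp
    next
      case False
      then show ?thesis using a(1)[of n] sv.nu_nonneg[of n] by simp
    qed
    have Lam4: "sv.Lam\<^sup>2 \<le> real z ^ 4"
      using power_mono[OF sv.Lam_le sv.Lam_nonneg, of 2] by (simp flip: power_mult)
    show "norm (FT (cc sv.nu) 0) \<le> of_int N / H"
    proof -
      have "ln z / (exp 14 * ln z0 ^ 4) \<le> sv.H" unfolding E_def
        by (rule sieve_H_bound) (use z z0 B in auto)
      then have "2 * H \<le> sv.H" using H(2) by linarith
      then have "of_int N / sv.H \<le> of_int N / (2 * H)" using H(1) N_pos by (intro divide_left_mono) auto
      moreover have "real z ^ 4 \<le> of_int N / (2 * H)" using H(1,3) by (simp add: field_simps)
      moreover have "of_int N / (2 * H) + of_int N / (2 * H) = of_int N / H" using H(1) by (simp add: field_simps)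
      ultimately show ?thesis using sv.norm_FT_nu_0 Lam4 by linarith
    qed
    fix \<phi>
    define T where "T = {s\<in>{1..<N}. \<exists>g\<in>spec D. N dvd s + \<phi> - g}"
    have finT: "finite T" by (rule finite_subset[of _ "{1..<N}"]) (auto simp: T_def)
    have cardT: "real (card T) \<le> exp L"
    proof -
      have "T \<subseteq> (\<lambda>g. (g - \<phi>) mod N) ` spec D"
      proof
        fix s assume "s \<in> T"
        then obtain g where g: "s \<in> {1..<N}" "g \<in> spec D" "N dvd s + \<phi> - g" unfolding T_def by auto
        have "N dvd s - (g - \<phi>)" using g(3) by (simp add: algebra_simps)
        then have "s mod N = (g - \<phi>) mod N" by (simp only: mod_eq_dvd_iff)
        then have "s = (g - \<phi>) mod N" using g(1) by simp
        then show "s \<in> (\<lambda>g. (g - \<phi>) mod N) ` spec D" using g(2) by blast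
      qed
      then have "card T \<le> card (spec D)" using finite_spec by (rule surj_card_le[rotated])
      then have "real (card T) \<le> real (card (spec D))" by (simp only: of_nat_le_iff)
      also have "\<dots> \<le> exp (lcard D)" by (rule card_spec)
      also have "\<dots> \<le> exp L" using D(2) by simp
      finally show ?thesis .
    qed
    have "\<forall>s::int. \<exists>c q. coprime c (int q) \<and> 0 < q \<and> q \<le> W \<and> \<bar>real q * (of_int s / of_int N) - of_int c\<bar> < 1 / real W"
      using dirichlet[OF W0] by metis
    then obtain c q where cq: "\<And>s. coprime (c s) (int (q s))" "\<And>s. 0 < q s" "\<And>s. q s \<le> W"
      "\<And>s::int. \<bar>real (q s) * (of_int s / of_int N) - of_int (c s)\<bar> < 1 / real W"
      by metis
    \<comment> \<open>The only frequencies where the majorant may be large. If \<open>q s\<close> is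
      1 or has a prime outside the sieve, only the error term survives; if \<open>q s\<close>
      exceeds \<open>exp (8 * L)\<close>, \<open>Psi\<close> saves \<open>exp (4 * L)\<close>
      against at most \<open>exp L\<close> frequencies.\<close>
    define T2 where "T2 = {s\<in>T. 1 < q s \<and> real (q s) \<le> exp (8 * L) \<and> (\<forall>p. prime p \<and> p dvd q s \<longrightarrow> p \<in> sieve_primes z E)}"
    have pz0: "z0 \<le> p" "p \<notin> B" if "p \<in> sieve_primes z E" for p
      using that by (auto simp: sieve_primes_def E_def)
    \<comment> \<open>Otherwise \<open>near_diff\<close> gives a fraction near the doubled spectrum
      whose denominator contains a bad prime. That prime would divide \<open>q s1\<close> or
      \<open>q s2\<close>, whose prime factors are all used in the sieve.\<close>
    have same: "of_int (c s1) / real (q s1) = of_int (c s2) / real (q s2)" if s: "s1 \<in> T2" "s2 \<in> T2" for s1 s2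
    proof (rule ccontr)
      assume ne: "of_int (c s1) / real (q s1) \<noteq> of_int (c s2) / real (q s2)"
      have T: "s1 \<in> {1..<N}" "s2 \<in> {1..<N}" using s by (auto simp: T2_def T_def)
      obtain g1 g2 where g: "g1 \<in> spec D" "N dvd s1 + \<phi> - g1" "g2 \<in> spec D" "N dvd s2 + \<phi> - g2"
        using s by (auto simp: T2_def T_def)
      have q: "1 < q s1" "1 < q s2" "real (q s1) \<le> exp (8 * L)" "real (q s2) \<le> exp (8 * L)" using s by (auto simp: T2_def)
      have pr: "p \<in> sieve_primes z E" if p: "prime p" "p dvd q s1 * q s2" for p
        using s prime_dvd_mult_iff[OF p(1)] p by (auto simp: T2_def)
      have "real (q s1) * real (q s2) \<le> exp (8 * L) * exp (8 * L)" using q by (intro mult_mono) auto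
      also have "\<dots> = exp (16 * L)" by (simp flip: exp_add)
      finally have Y: "real (q s1) * real (q s2) \<le> exp (16 * L)" .
      obtain c' q' where n: "near (spec (scale 2 D)) (2 / real W) (exp (16 * L)) z0 c' q'" "q' dvd q s1 * q s2"
      proof (rule near_diff[OF T g cq(1) q(1) cq(4) cq(1) q(2) cq(4) Y _ _ ne, of z0])
        show "1 \<le> real W" using W0 by simp
        show "z0 \<le> p" if "prime p" "p dvd q s1 * q s2" for p using pr[OF that] by (rule pz0)
      qed
      then obtain p where p: "p \<in> B" "p dvd q'" using B(4) by blast
      then have "prime p" using B(3) by blast
      moreover have "p dvd q s1 * q s2" using p(2) n(2) by (rule dvd_trans)
      ultimately show False using pr pz0(2) p(1) by blast
    qed
    have kern2: "(\<Sum>s\<in>T2. kern (of_int s - of_int (c s) * of_int N / real (q s))) \<le> 6 + 2 * ln (of_int N)"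
    proof (cases "T2 = {}")
      case True
      have "0 \<le> ln (of_int N :: real)" using N_gt_1 by (intro ln_ge_zero) simp
      then show ?thesis using True by simp
    next
      case False
      then obtain t where t: "t \<in> T2" by blast
      define x where "x = of_int (c t) / real (q t) * of_int N"
      have tN: "t \<in> {1..<N}" "1 < q t" using t by (auto simp: T2_def T_def)
      have W1: "1 / real W \<le> 1" using W0 by simp
      have ct: "0 < c t" "c t < int (q t)"
        using numerator_range[OF tN(1) cq(1) tN(2)] cq(4)[of t] W1 by linarith+
      have x: "0 \<le> x" "x \<le> of_int N"
      proof -
        have "0 \<le> of_int (c t) / real (q t)" using ct by simp
        then show "0 \<le> x" unfolding x_def using N_pos by (intro mult_nonneg_nonneg) auto
        have "of_int (c t) \<le> real (q t)" using ct by linarith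
        then have "of_int (c t) / real (q t) \<le> 1" using tN by simp
        then have "x \<le> 1 * of_int N" unfolding x_def using N_pos by (intro mult_right_mono) auto
        then show "x \<le> of_int N" by simp
      qed
      have "(\<Sum>s\<in>T2. kern (of_int s - of_int (c s) * of_int N / real (q s))) = (\<Sum>s\<in>T2. kern (of_int s - x))"
      proof (rule sum.cong)
        fix s assume "s \<in> T2"
        then show "kern (of_int s - of_int (c s) * of_int N / real (q s)) = kern (of_int s - x)"
          using same[OF _ t, of s] by (simp add: x_def flip: times_divide_eq_left)
      qed simp
      also have "\<dots> \<le> (\<Sum>s\<in>{1..<N}. kern (of_int s - x))"
        by (rule sum_mono2) (auto simp: T2_def T_def kern_nonneg)
      also have "\<dots> \<le> 6 + 2 * ln (of_int N)" by (rule sum_kern_le[OF N_gt_1 x])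
      finally show ?thesis .
    qed
    let ?k = "\<lambda>s. kern (of_int s - of_int (c s) * of_int N / real (q s))"
    let ?K = "real z ^ 4 * (2 * real W + 4) + 2 * of_int N * R * exp (- 4 * L)"
    have pw: "norm (FT (cc sv.nu) s) \<le> ?K + (if s \<in> T2 then of_int N * (R / sqrt z0) * ?k s else 0)" if s: "s \<in> T" for s
    proof -
      have "s \<in> {1..<N}" using s by (simp add: T_def)
      then have "norm (FT (cc sv.nu) s) \<le> sv.Lam\<^sup>2 * (2 * real W + 4) + of_bool (1 < q s) * (of_int N * sv.Psi (q s) * ?k s)"
        using cq by (intro sv.norm_FT_nu)
      moreover have "sv.Lam\<^sup>2 * (2 * real W + 4) \<le> real z ^ 4 * (2 * real W + 4)"
        using Lam4 by (intro mult_right_mono) auto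
      moreover have "of_bool (1 < q s) * (of_int N * sv.Psi (q s) * ?k s)
         \<le> 2 * of_int N * R * exp (- 4 * L) + (if s \<in> T2 then of_int N * (R / sqrt z0) * ?k s else 0)" (is "?l \<le> ?r1 + ?r2")
      proof -
        have r1: "0 \<le> ?r1" using R0 N_pos by simp
        have r2: "0 \<le> ?r2" using R0 N_pos kern_nonneg by simp
        consider "q s = 1 \<or> (\<exists>p. prime p \<and> p dvd q s \<and> p \<notin> sieve_primes z E)" | "exp (8 * L) < real (q s)" | "s \<in> T2"
          using s cq(2)[of s] unfolding T2_def by (cases "q s = 1") force+
        then show ?thesis
        proof cases
          case 1
          then have "?l = 0" using sv.Psi_eq_0 by auto
          then show ?thesis using r1 r2 by linarith
        next
          case 2
          have "exp (8 * L) = (exp (4 * L))\<^sup>2" by (simp flip: exp_double)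
          then have "sqrt ((exp (4 * L))\<^sup>2) \<le> sqrt (real (q s))" using 2 by (intro real_sqrt_le_mono) simp
          then have sq: "exp (4 * L) \<le> sqrt (real (q s))" by simp
          have "sv.Psi (q s) \<le> R / sqrt (real (q s))" by (rule Psi)
          also have "\<dots> \<le> R / exp (4 * L)" using sq R0 by (intro divide_left_mono) (auto intro: mult_pos_pos order.strict_trans2[OF exp_gt_zero])
          also have "\<dots> = R * exp (- 4 * L)" by (simp add: exp_minus field_simps)
          finally have "of_int N * sv.Psi (q s) * ?k s \<le> of_int N * (R * exp (- 4 * L)) * 2"
            using N_pos R0 kern_le_2 kern_nonneg sv.Psi_nonneg by (intro mult_mono) auto
          moreover have "?l \<le> of_int N * sv.Psi (q s) * ?k s"
            using N_pos kern_nonneg sv.Psi_nonneg by (cases "1 < q s") auto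
          ultimately show ?thesis using r2 by (simp add: mult_ac)
        next
          case 3
          then have q1: "1 < q s" by (simp add: T2_def)
          then obtain p where p: "prime p" "p dvd q s" using prime_factor_nat[of "q s"] by auto
          then have "z0 \<le> p" using 3 pz0(1)[of p] by (auto simp: T2_def)
          moreover have "p \<le> q s" using p q1 by (intro dvd_imp_le) auto
          ultimately have "sqrt (real z0) \<le> sqrt (real (q s))" by (intro real_sqrt_le_mono) simp
          then have "R / sqrt (real (q s)) \<le> R / sqrt z0" using R0 z0 by (intro divide_left_mono) auto
          then have "sv.Psi (q s) \<le> R / sqrt z0" using Psi[of "q s"] by linarith
          then have "of_int N * sv.Psi (q s) * ?k s \<le> of_int N * (R / sqrt z0) * ?k s"
            using N_pos kern_nonneg by (intro mult_right_mono mult_left_mono) auto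
          moreover have "?l = of_int N * sv.Psi (q s) * ?k s" "?r2 = of_int N * (R / sqrt z0) * ?k s" using 3 q1 by simp_all
          ultimately show ?thesis using r1 by linarith
        qed
      qed
      ultimately show ?thesis by linarith
    qed
    have "(\<Sum>s\<in>{1..<N}. if \<exists>g\<in>spec D0. N dvd s + \<phi> - g then norm (FT (cc sv.nu) s) else 0) = (\<Sum>s\<in>T. norm (FT (cc sv.nu) s))"
      unfolding T_def D(1)[symmetric] by (rule sum.inter_filter[symmetric]) simp
    also have "\<dots> \<le> (\<Sum>s\<in>T. ?K + (if s \<in> T2 then of_int N * (R / sqrt z0) * ?k s else 0))"
      by (rule sum_mono) (rule pw)
    also have "\<dots> = card T * ?K + (\<Sum>s\<in>T2. of_int N * (R / sqrt z0) * ?k s)"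
    proof -
      have "{s \<in> T. s \<in> T2} = T2" by (auto simp: T2_def)
      then show ?thesis using sum.inter_filter[OF finT, of "\<lambda>s. of_int N * (R / sqrt z0) * ?k s" "\<lambda>s. s \<in> T2"] by (simp add: sum.distrib)
    qed
    also have "\<dots> = card T * ?K + of_int N * (R / sqrt z0) * (\<Sum>s\<in>T2. ?k s)" by (simp only: sum_distrib_left)
    also have "\<dots> \<le> exp L * ?K + of_int N * (R / sqrt z0) * (6 + 2 * ln (of_int N))"
      using cardT kern2 R0 N_pos by (intro add_mono mult_right_mono mult_left_mono) auto
    also have "exp L * ?K = exp L * (real z ^ 4 * (2 * real W + 4)) + 2 * of_int N * R * exp (- 3 * L)"
    proof -
      have "exp L * exp (- 4 * L) = exp (- 3 * L)" by (simp flip: exp_add)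
      then show ?thesis by (simp add: distrib_left mult.left_commute)
    qed
    finally show "(\<Sum>s\<in>{1..<N}. if \<exists>g\<in>spec D0. N dvd s + \<phi> - g then norm (FT (cc sv.nu) s) else 0) \<le> of_int N * \<epsilon>"
      using \<epsilon> by linarith
  qed
qed

end

subsection \<open>Squarefull numbers\<close>

text \<open>Write \<open>n\<close> as its squarefree part times the square of \<open>?k\<close>. A
  prime of the squarefree part that did not divide \<open>?k\<close> would divide \<open>n\<close>
  only once, so the squarefree part divides \<open>?k\<close> and one more square can be split
  off.\<close>

lemma squarefull_factorization:
  assumes "squarefull n" "0 < n"
  obtains a b where "n = a\<^sup>2 * b ^ 3" "0 < a" "0 < b"
proof -
  let ?b = "squarefree_part n" and ?k = "square_part n"
  have n: "n = ?b * ?k\<^sup>2" by (rule squarefree_decompose)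
  have sf: "squarefree ?b" using assms(2) by simp
  have b0: "?b \<noteq> 0" using sf by (metis not_squarefree_0)
  have "p dvd ?k" if p: "prime p" "p dvd ?b" for p
  proof (rule ccontr)
    assume "\<not> p dvd ?k"
    then have "coprime (p\<^sup>2) (?k\<^sup>2)" using p(1) by (simp add: prime_imp_coprime)
    moreover have "p dvd n" using p(2) n by (metis dvd_mult2)
    then have "p\<^sup>2 dvd ?b * ?k\<^sup>2" using assms(1) p(1) n unfolding squarefull_def by metis
    ultimately have "p\<^sup>2 dvd ?b" using coprime_dvd_mult_left_iff by blast
    then have "is_unit p" using sf by (metis squarefree_def)
    then show False using p(1) by (metis not_prime_unit)
  qed
  then have "\<Prod>(prime_factors ?b) dvd ?k"
    by (intro prod_dvd_if_coprime) (auto intro: primes_coprime)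
  then have "?b dvd ?k" using squarefree_eq_prod[OF sf] by metis
  then obtain a where a: "?k = ?b * a" by (rule dvdE)
  have "n = ?b * (?b * a)\<^sup>2" using n a by metis
  also have "\<dots> = a\<^sup>2 * ?b ^ 3" by (simp add: power2_eq_square power3_eq_cube)
  finally have n': "n = a\<^sup>2 * ?b ^ 3" .
  then have "a \<noteq> 0" using assms(2) by (metis less_irrefl mult_zero_left zero_power2)
  then show thesis using that[OF n'] b0 by simp
qed

lemma card_le_diff:
  fixes F :: "nat set"
  assumes "finite F" "0 \<le> K" "\<And>a b. a \<in> F \<Longrightarrow> b \<in> F \<Longrightarrow> a < b \<Longrightarrow> real b - real a \<le> K"
  shows "real (card F) \<le> 1 + K"
proof (cases "F = {}")
  case False
  let ?m = "Min F"
  have "F \<subseteq> {?m..?m + nat \<lfloor>K\<rfloor>}"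
  proof
    fix b assume b: "b \<in> F"
    then have le: "?m \<le> b" using assms(1) by simp
    have m: "?m \<in> F" using assms(1) False by simp
    have "real b - real ?m \<le> K"
    proof (cases "?m < b")
      case True then show ?thesis using assms(3)[OF m b] by simp
    qed (use assms(2) le in simp)
    then have "real (b - ?m) \<le> K" using le by (simp add: of_nat_diff)
    then have "b - ?m \<le> nat \<lfloor>K\<rfloor>" by (simp add: le_nat_floor)
    then show "b \<in> {?m..?m + nat \<lfloor>K\<rfloor>}" using le by simp
  qed
  then have "card F \<le> card {?m..?m + nat \<lfloor>K\<rfloor>}" by (intro card_mono) auto
  also have "\<dots> = 1 + nat \<lfloor>K\<rfloor>" by simp
  finally have "card F \<le> 1 + nat \<lfloor>K\<rfloor>" .
  then have "real (card F) \<le> 1 + real (nat \<lfloor>K\<rfloor>)" by linarith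
  also have "real (nat \<lfloor>K\<rfloor>) \<le> K" using assms(2) by simp
  finally show ?thesis by simp
qed (use assms in simp)

definition squarefull_in :: "real \<Rightarrow> real \<Rightarrow> nat set" where
  "squarefull_in x y = {n. 0 < n \<and> x < real n \<and> real n \<le> x + y \<and> squarefull n}"

lemma finite_squarefull_in: "finite (squarefull_in x y)"
  by (rule finite_subset[of _ "{..nat \<lfloor>x + y\<rfloor>}"]) (auto simp: squarefull_in_def le_nat_floor)

text \<open>With \<open>u\<close> the fifth root of \<open>x\<close>, either
  \<open>b \<le> u\<close>, or \<open>b > u\<close> and then \<open>a \<le> 2 * u\<close>. For a
  fixed small variable, increasing the other one by 1 moves \<open>a^2 * b^3\<close> by at least
  \<open>u^2\<close>: for fixed \<open>b\<close> by \<open>b^3 * a\<close>, whose square is at least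
  \<open>x\<close>, and for fixed \<open>a\<close> by \<open>b^2\<close>. This leaves at most
  \<open>3 * u\<close> choices with at most \<open>1 + y / u^2\<close> numbers each.\<close>

lemma card_squarefull_in:
  fixes u x y :: real
  assumes u: "1 \<le> u" "u ^ 5 = x" and y: "0 \<le> y" "y \<le> x"
  shows "real (card (squarefull_in x y)) \<le> 3 * (u + y / u)"
proof -
  let ?in = "\<lambda>n. x < real n \<and> real n \<le> x + y"
  define F where "F b = {a. 0 < a \<and> ?in (a\<^sup>2 * b ^ 3)}" for b :: nat
  define G where "G a = {b. u < real b \<and> ?in (a\<^sup>2 * b ^ 3)}" for a :: nat
  let ?U = "{1..nat \<lfloor>u\<rfloor>}" and ?V = "{1..nat \<lfloor>2 * u\<rfloor>}"
  have u0: "0 < u" using u by simp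
  have x0: "0 < x" using u0 u(2) by auto
  have fin: "n \<le> nat \<lfloor>x + y\<rfloor>" if "?in n" for n using that by (simp add: le_nat_floor)
  have dist: "real (n - m) \<le> y" if "?in m" "?in n" "m \<le> n" for m n using that by (simp add: of_nat_diff)
  have finF: "finite (F b)" if "0 < b" for b
  proof (rule finite_subset)
    show "F b \<subseteq> {..nat \<lfloor>x + y\<rfloor>}"
    proof
      fix a assume "a \<in> F b"
      then have a: "0 < a" "?in (a\<^sup>2 * b ^ 3)" by (auto simp: F_def)
      have "a * 1 \<le> a * (a * b ^ 3)" using a(1) that by (intro mult_le_mono2) (simp add: Suc_le_eq)
      then have "a \<le> a\<^sup>2 * b ^ 3" by (simp add: power2_eq_square mult.assoc)
      then show "a \<in> {..nat \<lfloor>x + y\<rfloor>}" using fin[OF a(2)] by simp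
    qed
  qed simp
  have finG: "finite (G a)" if "0 < a" for a
  proof (rule finite_subset)
    show "G a \<subseteq> {..nat \<lfloor>x + y\<rfloor>}"
    proof
      fix b assume "b \<in> G a"
      then have b: "0 < b" "?in (a\<^sup>2 * b ^ 3)" using u0 by (auto simp: G_def intro: Nat.gr0I)
      have "b * 1 \<le> b * (a\<^sup>2 * b\<^sup>2)" using b(1) that by (intro mult_le_mono2) (simp add: Suc_le_eq)
      then have "b \<le> a\<^sup>2 * b ^ 3" by (simp add: power2_eq_square power3_eq_cube mult_ac)
      then show "b \<in> {..nat \<lfloor>x + y\<rfloor>}" using fin[OF b(2)] by simp
    qed
  qed simp
  have u24: "u\<^sup>2 * u\<^sup>2 \<le> x"
  proof -
    have "u ^ 4 \<le> u ^ 5" using u(1) by (rule power_increasing[rotated]) simp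
    then show ?thesis using u(2) by (simp add: power_numeral_reduce mult.assoc)
  qed
  have cardF: "real (card (F b)) \<le> 1 + y / u\<^sup>2" if b: "0 < b" for b
  proof (rule card_le_diff[OF finF[OF b]])
    fix a a' assume a: "a \<in> F b" "a' \<in> F b" "a < a'"
    have sq: "u\<^sup>2 \<le> real (b ^ 3 * a)"
    proof (rule power2_le_imp_le)
      have "(u\<^sup>2)\<^sup>2 \<le> x" using u24 by (simp add: power2_eq_square)
      also have "\<dots> \<le> real (a\<^sup>2 * b ^ 3)" using a by (simp add: F_def)
      also have "\<dots> \<le> real (b ^ 3 * (a\<^sup>2 * b ^ 3))"
        using mult_le_mono1[of 1 "b ^ 3" "a\<^sup>2 * b ^ 3"] b by (simp only: of_nat_le_iff) (simp add: Suc_le_eq)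
      also have "\<dots> = (real (b ^ 3 * a))\<^sup>2" by (simp add: power2_eq_square)
      finally show "(u\<^sup>2)\<^sup>2 \<le> (real (b ^ 3 * a))\<^sup>2" .
    qed simp
    have "b ^ 3 * a * (a' - a) + a\<^sup>2 * b ^ 3 \<le> a'\<^sup>2 * b ^ 3"
    proof -
      obtain k where k: "a' = a + k" using a(3) less_imp_add_positive by blast
      show ?thesis unfolding k by (simp add: power2_eq_square algebra_simps)
    qed
    then have "b ^ 3 * a * (a' - a) \<le> a'\<^sup>2 * b ^ 3 - a\<^sup>2 * b ^ 3" by simp
    then have "real (b ^ 3 * a * (a' - a)) \<le> real (a'\<^sup>2 * b ^ 3 - a\<^sup>2 * b ^ 3)" by (simp only: of_nat_le_iff)
    also have "\<dots> \<le> y" by (rule dist) (use a in \<open>auto simp: F_def power_mono\<close>)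
    finally have le: "real (b ^ 3 * a) * (real a' - real a) \<le> y" using a(3) by (simp add: of_nat_diff)
    have "u\<^sup>2 * (real a' - real a) \<le> real (b ^ 3 * a) * (real a' - real a)" using a(3) by (intro mult_right_mono sq) simp
    also note le
    finally have "u\<^sup>2 * (real a' - real a) \<le> y" .
    then show "real a' - real a \<le> y / u\<^sup>2" using u0 by (simp add: field_simps)
  qed (use y in simp)
  have cardG: "real (card (G a)) \<le> 1 + y / u\<^sup>2" if a: "0 < a" for a
  proof (rule card_le_diff[OF finG[OF a]])
    fix b b' assume b: "b \<in> G a" "b' \<in> G a" "b < b'"
    have ub: "u \<le> real b" using b by (simp add: G_def)
    then have "u\<^sup>2 \<le> (real b)\<^sup>2" using u0 by (intro power_mono) auto
    then have sq: "u\<^sup>2 \<le> real (b\<^sup>2)" by simp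
    have "b\<^sup>2 * (b' - b) \<le> a\<^sup>2 * b' ^ 3 - a\<^sup>2 * b ^ 3"
    proof -
      obtain k where k: "b' = b + k" using b(3) less_imp_add_positive by blast
      have "b\<^sup>2 * k \<le> b' ^ 3 - b ^ 3" unfolding k by (simp add: power2_eq_square power3_eq_cube algebra_simps)
      also have "\<dots> \<le> a\<^sup>2 * (b' ^ 3 - b ^ 3)" using a by simp
      finally show ?thesis unfolding k by (simp add: diff_mult_distrib2)
    qed
    then have "real (b\<^sup>2 * (b' - b)) \<le> real (a\<^sup>2 * b' ^ 3 - a\<^sup>2 * b ^ 3)" by (simp only: of_nat_le_iff)
    also have "\<dots> \<le> y" by (rule dist) (use b in \<open>auto simp: G_def power_mono\<close>)
    finally have le: "real (b\<^sup>2) * (real b' - real b) \<le> y" using b(3) by (simp add: of_nat_diff)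
    have "u\<^sup>2 * (real b' - real b) \<le> real (b\<^sup>2) * (real b' - real b)" using b(3) by (intro mult_right_mono sq) simp
    also note le
    finally have "u\<^sup>2 * (real b' - real b) \<le> y" .
    then show "real b' - real b \<le> y / u\<^sup>2" using u0 by (simp add: field_simps)
  qed (use y in simp)
  have sub: "squarefull_in x y \<subseteq> (\<Union>b\<in>?U. (\<lambda>a. a\<^sup>2 * b ^ 3) ` F b) \<union> (\<Union>a\<in>?V. (\<lambda>b. a\<^sup>2 * b ^ 3) ` G a)"
  proof
    fix n assume n: "n \<in> squarefull_in x y"
    then obtain a b where ab: "n = a\<^sup>2 * b ^ 3" "0 < a" "0 < b"
      using squarefull_factorization by (auto simp: squarefull_in_def)
    have inn: "?in (a\<^sup>2 * b ^ 3)" using n ab(1) by (simp add: squarefull_in_def)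
    show "n \<in> (\<Union>b\<in>?U. (\<lambda>a. a\<^sup>2 * b ^ 3) ` F b) \<union> (\<Union>a\<in>?V. (\<lambda>b. a\<^sup>2 * b ^ 3) ` G a)"
    proof (cases "real b \<le> u")
      case True
      then have "b \<in> ?U" using ab(3) by (simp add: le_nat_floor Suc_le_eq)
      moreover have "a \<in> F b" using ab inn by (simp add: F_def)
      ultimately show ?thesis using ab(1) by blast
    next
      case False
      then have b: "u < real b" by simp
      have "(real a)\<^sup>2 * u ^ 3 \<le> (real a)\<^sup>2 * real b ^ 3" using b u0 by (intro mult_left_mono power_mono) auto
      also have "\<dots> \<le> 2 * x" using inn y by simp
      also have "2 * x = 2 * u\<^sup>2 * u ^ 3" using u(2) by (simp add: power_numeral_reduce mult.assoc)
      finally have "(real a)\<^sup>2 \<le> 2 * u\<^sup>2" using u0 by simp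
      also have "\<dots> \<le> (2 * u)\<^sup>2" by (simp add: power_mult_distrib)
      finally have "real a \<le> 2 * u" using u0 by (intro power2_le_imp_le[of "real a" "2 * u"]) auto
      then have "a \<in> ?V" using ab(2) by (simp add: le_nat_floor Suc_le_eq)
      moreover have "b \<in> G a" using b inn by (simp add: G_def)
      ultimately show ?thesis using ab(1) by blast
    qed
  qed
  have "card (squarefull_in x y) \<le> card ((\<Union>b\<in>?U. (\<lambda>a. a\<^sup>2 * b ^ 3) ` F b) \<union> (\<Union>a\<in>?V. (\<lambda>b. a\<^sup>2 * b ^ 3) ` G a))"
    by (rule card_mono[OF _ sub]) (auto simp: finF finG)
  also have "\<dots> \<le> card (\<Union>b\<in>?U. (\<lambda>a. a\<^sup>2 * b ^ 3) ` F b) + card (\<Union>a\<in>?V. (\<lambda>b. a\<^sup>2 * b ^ 3) ` G a)"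
    by (rule card_Un_le)
  also have "\<dots> \<le> (\<Sum>b\<in>?U. card (F b)) + (\<Sum>a\<in>?V. card (G a))"
    by (intro add_mono order.trans[OF card_UN_le] sum_mono card_image_le) (auto simp: finF finG)
  finally have "real (card (squarefull_in x y)) \<le> real ((\<Sum>b\<in>?U. card (F b)) + (\<Sum>a\<in>?V. card (G a)))"
    by (simp only: of_nat_le_iff)
  also have "\<dots> = (\<Sum>b\<in>?U. real (card (F b))) + (\<Sum>a\<in>?V. real (card (G a)))" by simp
  also have "\<dots> \<le> (\<Sum>b\<in>?U. 1 + y / u\<^sup>2) + (\<Sum>a\<in>?V. 1 + y / u\<^sup>2)"
    by (intro add_mono sum_mono cardF cardG) auto
  also have "\<dots> = (real (nat \<lfloor>u\<rfloor>) + real (nat \<lfloor>2 * u\<rfloor>)) * (1 + y / u\<^sup>2)" by (simp add: distrib_right)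
  also have "\<dots> \<le> (u + 2 * u) * (1 + y / u\<^sup>2)" using u0 y by (intro mult_right_mono add_mono) auto
  also have "\<dots> = 3 * (u + y / u)" using u0 by (simp add: field_simps power2_eq_square)
  finally show ?thesis .
qed

lemma squarefull_kappa:
  assumes "squarefull m" "0 < m"
  shows "(real_of_int (kappa (int m)))\<^sup>2 \<le> real m"
proof -
  have "(\<Prod>p\<in>prime_factors (int m). p\<^sup>2) dvd int m"
  proof (rule prod_dvd_if_coprime)
    fix p assume "p \<in> prime_factors (int m)"
    then have p: "prime p" "p dvd int m" by auto
    have n: "p = int (nat p)" using prime_gt_0_int[OF p(1)] by simp
    have "prime (nat p)" using p(1) n by (metis prime_nat_iff_prime)
    moreover have "nat p dvd m" using p(2) n by (metis int_dvd_int_iff)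
    ultimately have "(nat p)\<^sup>2 dvd m" using assms(1) unfolding squarefull_def by blast
    then have "int ((nat p)\<^sup>2) dvd int m" by (simp only: int_dvd_int_iff)
    then show "p\<^sup>2 dvd int m" using n by (metis of_nat_power)
  next
    fix p q assume "p \<in> prime_factors (int m)" "q \<in> prime_factors (int m)" "p \<noteq> q"
    then show "coprime (p\<^sup>2) (q\<^sup>2)" using primes_coprime[of p q] by auto
  qed simp
  then have "(kappa (int m))\<^sup>2 dvd int m" by (simp add: kappa_def prod_power_distrib)
  then have "(kappa (int m))\<^sup>2 \<le> int m" using assms(2) by (intro zdvd_imp_le) auto
  then have "real_of_int ((kappa (int m))\<^sup>2) \<le> real_of_int (int m)" by (simp only: of_int_le_iff)
  then show ?thesis by simp
qed

subsection \<open>Consequences of the abc conjecture\<close>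

lemma prime_factors_int_gt_1: "p \<in> prime_factors (m :: int) \<Longrightarrow> 1 < p"
  by (intro prime_gt_1_int) auto

lemma kappa_pos: "0 < kappa m"
  unfolding kappa_def by (rule prod_pos) (use prime_factors_int_gt_1 in force)

lemma kappa_le:
  assumes "0 < m" shows "kappa m \<le> m"
proof -
  have "kappa m dvd m" unfolding kappa_def
    by (rule prod_dvd_if_coprime) (auto intro: primes_coprime)
  then show ?thesis using assms by (rule zdvd_imp_le)
qed

lemma kappa_mult_le:
  assumes "m \<noteq> 0" "n \<noteq> 0" shows "kappa (m * n) \<le> kappa m * kappa n"
proof -
  let ?M = "prime_factors m" and ?N = "prime_factors n"
  have "0 < \<Prod>(?M \<inter> ?N)" "0 < \<Prod>(?M \<union> ?N)" by (rule prod_pos; use prime_factors_int_gt_1 in force)+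
  then have "\<Prod>(?M \<union> ?N) * 1 \<le> \<Prod>(?M \<union> ?N) * \<Prod>(?M \<inter> ?N)" by (intro mult_left_mono) auto
  also have "\<dots> = kappa m * kappa n" unfolding kappa_def by (rule prod.union_inter) auto
  finally show ?thesis using assms by (simp add: kappa_def prime_factors_product)
qed

lemma kappa_mono_dvd:
  assumes "m dvd n" "n \<noteq> 0" shows "kappa m \<le> kappa n"
proof -
  let ?M = "prime_factors m" and ?N = "prime_factors n"
  have sub: "?M \<subseteq> ?N" using assms by (intro dvd_prime_factors)
  have "0 < \<Prod>(?N - ?M)" by (rule prod_pos) (use prime_factors_int_gt_1 in force)
  then have "1 * kappa m \<le> \<Prod>(?N - ?M) * kappa m" using kappa_pos[of m] by (intro mult_right_mono) auto
  also have "\<dots> = kappa n" unfolding kappa_def by (rule prod.subset_diff[symmetric]) (use sub in auto)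
  finally show ?thesis by simp
qed

lemma kappa_square: "kappa (m\<^sup>2) = kappa m"
  unfolding kappa_def by (cases "m = 0") (simp_all add: power2_eq_square prime_factors_product)

text \<open>Dividing by the common factor may destroy squarefullness, but a radical does not grow
  when passing to a divisor. So the three radicals are estimated before the division, by the square
  roots of \<open>n - d\<close>, \<open>n + d\<close> and \<open>n\<close>; only the radical of
  \<open>d'\<close> is bounded trivially.\<close>

lemma kappa_ap_bound:
  assumes d: "0 < d" "d < n" and sf: "squarefull (n - d)" "squarefull n" "squarefull (n + d)"
    and g: "int n = g * n'" "int d = g * d'" "0 < g"
  shows "real_of_int (kappa ((n'\<^sup>2 - d'\<^sup>2) * d'\<^sup>2 * n'\<^sup>2)) \<le> real n * sqrt n * of_int d'"
proof -
  have "0 < g * n'" "0 < g * d'" using d g by linarith+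
  then have n': "0 < n'" and d': "0 < d'" using g(3) by (simp_all add: zero_less_mult_iff)
  have lt: "d' < n'"
  proof -
    have "g * d' < g * n'" using d(2) g(1,2) by linarith
    then show ?thesis using g(3) by simp
  qed
  have sq: "d'\<^sup>2 < n'\<^sup>2" using lt d' by (intro power_strict_mono) auto
  have sqrt: "real_of_int (kappa (int m)) \<le> sqrt m" if "squarefull m" "0 < m" for m
    using squarefull_kappa[OF that] kappa_pos[of "int m"] by (intro real_le_rsqrt)
  have fac: "int (n - d) * int (n + d) = g\<^sup>2 * (n'\<^sup>2 - d'\<^sup>2)"
    using d g(1,2) by (simp add: of_nat_diff) (simp add: power2_eq_square algebra_simps)
  have "kappa (n'\<^sup>2 - d'\<^sup>2) \<le> kappa (int (n - d) * int (n + d))"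
    by (rule kappa_mono_dvd) (use fac d in auto)
  also have "\<dots> \<le> kappa (int (n - d)) * kappa (int (n + d))" by (rule kappa_mult_le) (use d in auto)
  finally have "real_of_int (kappa (n'\<^sup>2 - d'\<^sup>2)) \<le> of_int (kappa (int (n - d)) * kappa (int (n + d)))" by (simp only: of_int_le_iff)
  also have "\<dots> = of_int (kappa (int (n - d))) * of_int (kappa (int (n + d)))" by simp
  also have "\<dots> \<le> sqrt (n - d) * sqrt (n + d)"
    using d sf kappa_pos less_imp_le by (intro mult_mono sqrt) auto
  also have "\<dots> = sqrt (real (n - d) * real (n + d))" by (simp add: real_sqrt_mult)
  also have "real (n - d) * real (n + d) = (real n)\<^sup>2 - (real d)\<^sup>2" using d by (simp add: of_nat_diff power2_eq_square algebra_simps)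
  also have "sqrt \<dots> \<le> sqrt ((real n)\<^sup>2)" by (intro real_sqrt_le_mono) simp
  finally have 1: "real_of_int (kappa (n'\<^sup>2 - d'\<^sup>2)) \<le> real n" by simp
  have 2: "real_of_int (kappa (d'\<^sup>2)) \<le> of_int d'" unfolding kappa_square of_int_le_iff by (rule kappa_le[OF d'])
  have "kappa n' \<le> kappa (int n)" by (rule kappa_mono_dvd) (use g d in auto)
  then have "real_of_int (kappa (n'\<^sup>2)) \<le> of_int (kappa (int n))" unfolding kappa_square by (simp only: of_int_le_iff)
  also have "\<dots> \<le> sqrt n" by (rule sqrt) (use sf d in auto)
  finally have 3: "real_of_int (kappa (n'\<^sup>2)) \<le> sqrt n" .
  have "kappa ((n'\<^sup>2 - d'\<^sup>2) * d'\<^sup>2 * n'\<^sup>2) \<le> kappa ((n'\<^sup>2 - d'\<^sup>2) * d'\<^sup>2) * kappa (n'\<^sup>2)"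
    by (rule kappa_mult_le) (use sq n' d' in auto)
  also have "\<dots> \<le> kappa (n'\<^sup>2 - d'\<^sup>2) * kappa (d'\<^sup>2) * kappa (n'\<^sup>2)"
    by (intro mult_right_mono kappa_mult_le) (use sq n' d' kappa_pos[of "n'\<^sup>2"] in auto)
  finally have "real_of_int (kappa ((n'\<^sup>2 - d'\<^sup>2) * d'\<^sup>2 * n'\<^sup>2)) \<le> of_int (kappa (n'\<^sup>2 - d'\<^sup>2) * kappa (d'\<^sup>2) * kappa (n'\<^sup>2))"
    by (simp only: of_int_le_iff)
  also have "\<dots> = of_int (kappa (n'\<^sup>2 - d'\<^sup>2)) * of_int (kappa (d'\<^sup>2)) * of_int (kappa (n'\<^sup>2))" by simp
  also have "\<dots> \<le> real n * of_int d' * sqrt n"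
    using 1 2 3 kappa_pos d' by (intro mult_mono) (auto simp: less_imp_le)
  finally show ?thesis by (simp add: mult_ac)
qed

text \<open>For coprime \<open>n'\<close> and \<open>d'\<close> the conjecture bounds
  \<open>n'^2\<close> by nearly \<open>n powr (3/2) * d'\<close>, which forces \<open>d\<close> to
  be large. The exponent loss 1/100 is small enough to keep the threshold above 6/25.\<close>

lemma abc_no_squarefull_ap:
  assumes abc_conjecture
  obtains X :: real where "1 < X"
    "\<And>n d. X \<le> real n \<Longrightarrow> 0 < d \<Longrightarrow> real d \<le> real n powr (6/25) \<Longrightarrow>
       squarefull (n - d) \<Longrightarrow> squarefull n \<Longrightarrow> squarefull (n + d) \<Longrightarrow> False"
proof -
  obtain C :: real where C: "0 < C" and abc: "\<And>a b c :: int. a + b = c \<Longrightarrow> gcd a b = 1 \<Longrightarrow> a * b * c \<noteq> 0 \<Longrightarrow>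
      real_of_int (max \<bar>a\<bar> (max \<bar>b\<bar> \<bar>c\<bar>)) \<le> C * real_of_int (kappa (a * b * c)) powr (1 + 1/100)"
    using assms unfolding abc_conjecture_def by (elim allE[of _ "1/100"]) auto
  show thesis
  \<comment> \<open>The exponents below add up to 303/200 + 2 * 6/25 = 399/200. This is 1/200 short
    of 2, hence the 200th power of a number exceeding \<open>C\<close>.\<close>
  proof (rule that[of "(C + 1) powr 200"])
    show X1: "1 < (C + 1) powr 200" using powr_less_mono2[of 200 1 "C + 1"] C by simp
    fix n d :: nat
    assume X: "(C + 1) powr 200 \<le> real n" and d: "0 < d" "real d \<le> real n powr (6/25)"
      and sf: "squarefull (n - d)" "squarefull n" "squarefull (n + d)"
    have n1: "1 < real n" using X X1 by simp
    \<comment> \<open>Ensures that the natural subtraction \<open>n - d\<close> is not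
      truncated.\<close>
    have dn: "d < n"
    proof -
      have "real n powr (6/25) < real n powr 1" using n1 by (intro powr_less_mono) auto
      then show ?thesis using d n1 by simp
    qed
    define g where "g = gcd (int n) (int d)"
    define n' where "n' = int n div g"
    define d' where "d' = int d div g"
    have g0: "0 < g" using d by (simp add: g_def)
    have g: "int n = g * n'" "int d = g * d'" by (simp_all add: g_def n'_def d'_def)
    have "0 < g * n'" "0 < g * d'" using d dn g by linarith+
    then have n': "0 < n'" and d': "0 < d'" using g0 by (simp_all add: zero_less_mult_iff)
    have cop: "coprime n' d'" unfolding n'_def d'_def g_def using d by (intro div_gcd_coprime) simp
    have lt: "d' < n'"
    proof -
      have "g * d' < g * n'" using dn g by linarith
      then show ?thesis using g0 by simp
    qed
    have sq: "d'\<^sup>2 < n'\<^sup>2" using lt d' by (intro power_strict_mono) auto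
    let ?K = "kappa ((n'\<^sup>2 - d'\<^sup>2) * d'\<^sup>2 * n'\<^sup>2)"
    have "gcd (n'\<^sup>2 - d'\<^sup>2) (d'\<^sup>2) = 1"
    proof -
      have "gcd (n'\<^sup>2) (d'\<^sup>2) = 1" using cop by simp
      then show ?thesis by (metis gcd_diff1 )
    qed
    then have "real_of_int (max \<bar>n'\<^sup>2 - d'\<^sup>2\<bar> (max \<bar>d'\<^sup>2\<bar> \<bar>n'\<^sup>2\<bar>)) \<le> C * real_of_int ?K powr (1 + 1/100)"
      by (intro abc) (use sq n' d' in auto)
    moreover have "n'\<^sup>2 \<le> max \<bar>n'\<^sup>2 - d'\<^sup>2\<bar> (max \<bar>d'\<^sup>2\<bar> \<bar>n'\<^sup>2\<bar>)" by simp
    then have "real_of_int (n'\<^sup>2) \<le> real_of_int (max \<bar>n'\<^sup>2 - d'\<^sup>2\<bar> (max \<bar>d'\<^sup>2\<bar> \<bar>n'\<^sup>2\<bar>))" by (simp only: of_int_le_iff)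
    ultimately have "real_of_int (n'\<^sup>2) \<le> C * real_of_int ?K powr (1 + 1/100)" by linarith
    also have "\<dots> \<le> C * (real n powr (3/2) * of_int d') powr (101/100)"
    proof -
      have "real_of_int ?K \<le> real n * sqrt n * of_int d'" by (rule kappa_ap_bound[OF d(1) dn sf g g0])
      also have "real n * sqrt n = real n powr (3/2)"
        using n1 by (simp add: powr_half_sqrt[symmetric] powr_mult_base)
      finally have "real_of_int ?K powr (101/100) \<le> (real n powr (3/2) * of_int d') powr (101/100)"
        using kappa_pos less_imp_le by (intro powr_mono2) auto
      then show ?thesis using C by simp
    qed
    also have "(real n powr (3/2) * of_int d') powr (101/100) = real n powr (303/200) * of_int d' powr (101/100)"
      using d' by (subst powr_mult) (auto simp: powr_powr)
    \<comment> \<open>Raising the exponent of \<open>d'\<close> to 2 makes the inequality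
      homogeneous in the common factor: multiplying by its square turns \<open>n'\<close> and
      \<open>d'\<close> back into \<open>n\<close> and \<open>d\<close>. This is what lowers the
      threshold for \<open>d\<close> from about 1/2 to about 1/4.\<close>
    also have "\<dots> \<le> real n powr (303/200) * (of_int d')\<^sup>2"
    proof -
      have "(of_int d' :: real) powr (101/100) \<le> of_int d' powr 2" using d' by (intro powr_mono) auto
      then show ?thesis using d' by (intro mult_left_mono) auto
    qed
    finally have "real_of_int (n'\<^sup>2) \<le> C * (real n powr (303/200) * (of_int d')\<^sup>2)" using C by simp
    then have "(of_int g)\<^sup>2 * real_of_int (n'\<^sup>2) \<le> (of_int g)\<^sup>2 * (C * (real n powr (303/200) * (of_int d')\<^sup>2))"
      by (intro mult_left_mono) auto
    also have "(of_int g)\<^sup>2 * real_of_int (n'\<^sup>2) = (real n)\<^sup>2" using arg_cong[OF g(1), of real_of_int] by (simp add: power_mult_distrib)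
    also have "(of_int g)\<^sup>2 * (C * (real n powr (303/200) * (of_int d')\<^sup>2)) = C * real n powr (303/200) * (real d)\<^sup>2"
      using arg_cong[OF g(2), of real_of_int] by (simp add: power_mult_distrib mult_ac)
    also have "\<dots> \<le> C * real n powr (303/200) * (real n powr (6/25))\<^sup>2"
      using C d by (intro mult_left_mono power_mono) auto
    also have "\<dots> = C * real n powr (399/200)"
      using n1 by (simp add: power2_eq_square flip: powr_add)
    finally have "real n powr 2 \<le> C * real n powr (399/200)" using n1 by simp
    also have "real n powr 2 = real n powr (1/200) * real n powr (399/200)" by (simp flip: powr_add)
    finally have "real n powr (1/200) \<le> C" using n1 by simp
    moreover have "((C + 1) powr 200) powr (1/200) \<le> real n powr (1/200)" using X by (intro powr_mono2) auto
    moreover have "((C + 1) powr 200) powr (1/200) = C + 1" using C unfolding powr_powr by simp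
    ultimately show False by linarith
  qed
qed

lemma real_nat_ceiling:
  assumes "0 \<le> (x::real)" shows "x \<le> real (nat \<lceil>x\<rceil>)" "real (nat \<lceil>x\<rceil>) \<le> x + 1"
  using assms by (simp_all add: real_nat_ceiling_ge of_nat_nat)

lemma real_nat_floor:
  assumes "0 \<le> (x::real)" shows "x - 1 \<le> real (nat \<lfloor>x\<rfloor>)" "real (nat \<lfloor>x\<rfloor>) \<le> x"
  using assms by (simp_all add: of_nat_nat)

subsection \<open>Squarefull numbers in short intervals\<close>

text \<open>Here \<open>l\<close> is the logarithm of the modulus.  The parameters of the relative Roth theorem and of the
  sieve are \<open>L = l powr (1/10)\<close>, \<open>H = l / ln l ^ 5\<close>, \<open>\<epsilon> = 1 / l ^ 10\<close>; the density is
  \<open>l powr - (1001/1000)\<close>, the sieving primes lie between \<open>l ^ 120\<close> and \<open>exp (l / 50)\<close>, about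
  \<open>l powr (1/5)\<close> primes are removed, and \<open>l powr (1/25)\<close> increments give the contradiction.\<close>

locale large_parameter =
  fixes l :: real
  assumes bounds:
    "2 \<le> l"
    "3 \<le> exp (l / 50) - 1 \<and> 2 * (exp (l / 50))\<^sup>2 \<le> exp (l / 2) - 1 \<and> 256 \<le> l ^ 120 \<and> l powr (1/5) + 1 \<le> l ^ 120"
    "l powr (1/10) * (1 + ln (2 * (l powr (1/5) + 1))) < l powr (1/5) * ln 2"
    "2 * (l powr (1/5) + 1) * exp (16 * l powr (1/10) * (l powr (1/5) + 1)) < exp (l / 2) - 1"
    "2 * (l / ln l ^ 5) \<le> ln (exp (l / 50) - 1) / (exp 14 * ln (l ^ 120 + 1) ^ 4)"
    "2 * (l / ln l ^ 5) * exp (l / 50) ^ 4 \<le> exp l"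
    "exp (l powr (1/10)) * (exp (l / 50) ^ 4 * (2 * exp (l / 2) + 4)) \<le> exp l / l ^ 10 / 3"
    "2 * (exp 80 * l ^ 32) * exp (- 3 * l powr (1/10)) \<le> 1 / l ^ 10 / 3"
    "(exp 80 * l ^ 32) / l ^ 60 * (6 + 2 * l) \<le> 1 / l ^ 10 / 3"
    "1 \<le> l / ln l ^ 5 \<and> 1 / l ^ 10 \<le> (l powr - (1001/1000)) ^ 5 / 80000 \<and> 1 / l ^ 10 \<le> 1 / (l / ln l ^ 5) \<and> 1 \<le> l powr (1/10) \<and> exp (l powr (1/10)) / exp l \<le> 1 / l ^ 10"
    "2000 * (l powr (1/10))\<^sup>2 / (1 / l ^ 10)\<^sup>2 \<le> l ^ 21 \<and> 3 \<le> l ^ 21 \<and> 4 * (l powr (1/25) + 1)\<^sup>2 * ln (l ^ 21 + 1) \<le> l powr (1/10)"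
    "2 / (l / ln l ^ 5) < l powr - (1001/1000) * (1 + l powr (1/25) * ((l / ln l ^ 5 * l powr - (1001/1000))\<^sup>2 / 40000))"

lemma eventually_large_parameter: "eventually large_parameter at_top"
  unfolding large_parameter_def by (intro eventually_conj; real_asymp)

text \<open>The threshold \<open>l0\<close> depends neither on \<open>x0\<close> nor on
  \<open>a\<close>. This uniformity in the position is essential, since an interval of length
  \<open>y\<close> may begin anywhere beyond \<open>y\<close>.\<close>

lemma density_bound:
  obtains l0 :: real where "\<And>N x0 a. cyclic N \<Longrightarrow> l0 \<le> ln (real_of_int N) \<Longrightarrow> (\<And>n. a n = 0 \<or> a n = 1) \<Longrightarrow>
     cyclic.per N a \<Longrightarrow> cyclic.ap_free N a \<Longrightarrow>
     (\<And>n p. a n = 1 \<Longrightarrow> prime p \<Longrightarrow> nat \<lceil>ln (real_of_int N) ^ 120\<rceil> < p \<Longrightarrow> p \<le> nat \<lfloor>exp (ln (real_of_int N) / 50)\<rfloor> \<Longrightarrow>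
        \<not> int p dvd x0 + n mod N) \<Longrightarrow>
     (\<Sum>n\<in>{0..<N}. a n) < of_int N * ln (real_of_int N) powr - (1001/1000)"
proof -
  obtain l0 where large: "\<And>l. l0 \<le> l \<Longrightarrow> large_parameter l"
    using eventually_large_parameter unfolding eventually_at_top_linorder by blast
  show thesis
  proof (rule that[of l0])
    fix N x0 and a :: "int \<Rightarrow> real"
    assume "cyclic N" and l0: "l0 \<le> ln (real_of_int N)" and a: "\<And>n. a n = 0 \<or> a n = 1"
      and per: "cyclic.per N a" and ap: "cyclic.ap_free N a"
      and sieved: "\<And>n p. a n = 1 \<Longrightarrow> prime p \<Longrightarrow> nat \<lceil>ln (real_of_int N) ^ 120\<rceil> < p \<Longrightarrow> p \<le> nat \<lfloor>exp (ln (real_of_int N) / 50)\<rfloor> \<Longrightarrow>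
        \<not> int p dvd x0 + n mod N"
    interpret cyclic N by fact
    define l where "l = ln (real_of_int N)"
    define z0 where "z0 = nat \<lceil>l ^ 120\<rceil>"
    define z where "z = nat \<lfloor>exp (l / 50)\<rfloor>"
    define W where "W = nat \<lfloor>exp (l / 2)\<rfloor>"
    define s where "s = nat \<lceil>l powr (1/5)\<rceil>"
    define L where "L = l powr (1/10)"
    define H where "H = l / ln l ^ 5"
    define \<epsilon> where "\<epsilon> = 1 / l ^ 10"
    define \<alpha> where "\<alpha> = l powr - (1001/1000)"
    define k where "k = nat \<lceil>l ^ 21\<rceil>"
    define I where "I = nat \<lceil>l powr (1/25)\<rceil>"
    interpret large_parameter l unfolding l_def by (rule large[OF l0])
    note e = bounds
    have l2: "2 \<le> l" by (rule e)
    have expl: "exp l = of_int N" using N_pos by (simp add: l_def)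
    have z0: "l ^ 120 \<le> real z0" "real z0 \<le> l ^ 120 + 1" using l2 unfolding z0_def by (intro real_nat_ceiling; simp)+
    have z: "exp (l / 50) - 1 \<le> real z" "real z \<le> exp (l / 50)" unfolding z_def by (intro real_nat_floor; simp)+
    have W: "exp (l / 2) - 1 \<le> real W" "real W \<le> exp (l / 2)" unfolding W_def by (intro real_nat_floor; simp)+
    have s: "l powr (1/5) \<le> real s" "real s \<le> l powr (1/5) + 1" unfolding s_def by (intro real_nat_ceiling; simp)+
    have k: "l ^ 21 \<le> real k" "real k \<le> l ^ 21 + 1" using l2 unfolding k_def by (intro real_nat_ceiling; simp)+
    have I: "l powr (1/25) \<le> real I" "real I \<le> l powr (1/25) + 1" unfolding I_def by (intro real_nat_ceiling; simp)+
    have pos: "0 < L" "0 < \<alpha>" "0 < \<epsilon>" using l2 by (simp_all add: L_def \<alpha>_def \<epsilon>_def)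
    have H1: "1 \<le> H" using e(10) by (simp add: H_def)
    have z3: "3 \<le> z" using e(2) z(1) by linarith
    have z0_256: "256 \<le> z0" using e(2) z0(1) by linarith
    have s1: "1 \<le> real s" using s(1) ge_one_powr_ge_zero[of l "1/5"] l2 by linarith
    have major: "majorized a L H \<epsilon>"
    proof (rule sieve_majorized[where z = z and ?z0.0 = z0 and s = s and W = W and ?x0.0 = x0])
      show "2 * z\<^sup>2 \<le> W"
      proof -
        have "real z ^ 2 \<le> exp (l / 50) ^ 2" using z(2) by (intro power_mono) auto
        then have "2 * (real z)\<^sup>2 \<le> real W" using e(2) W(1) by linarith
        then have "real (2 * z\<^sup>2) \<le> real W" by simp
        then show ?thesis by (simp only: of_nat_le_iff)
      qed
      show "int W \<le> N"
      proof -
        have "exp (l / 2) \<le> exp l" using l2 by simp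
        then have "real W \<le> of_int N" using W(2) expl by linarith
        then show ?thesis by linarith
      qed
      show "s \<le> z0" using e(2) s(2) z0(1) by linarith
      show "1 \<le> s" using s1 by simp
      show "\<not> int p dvd x0 + n mod N" if "a n = 1" "prime p" "z0 < p" "p \<le> z" for n p
        using sieved[OF that(1,2)] that(3,4) unfolding z0_def z_def l_def by blast
      show "L * (1 + ln (2 * real s)) < s * ln 2"
      proof -
        have "ln (2 * real s) \<le> ln (2 * (l powr (1/5) + 1))" using s s1 by (subst ln_le_cancel_iff) auto
        then have "L * (1 + ln (2 * real s)) \<le> L * (1 + ln (2 * (l powr (1/5) + 1)))" using pos(1) by (intro mult_left_mono) auto
        also have "\<dots> < l powr (1/5) * ln 2" using e(3) by (simp add: L_def)
        also have "\<dots> \<le> s * ln 2" using s by (intro mult_right_mono) auto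
        finally show ?thesis .
      qed
      show "2 * real s * exp (16 * L * real s) < real W"
      proof -
        have "2 * real s * exp (16 * L * real s) \<le> 2 * (l powr (1/5) + 1) * exp (16 * L * (l powr (1/5) + 1))"
          using s pos(1) by (intro mult_mono) (auto intro!: mult_left_mono)
        also have "\<dots> < exp (l / 2) - 1" using e(4) by (simp add: L_def)
        finally show ?thesis using W(1) by linarith
      qed
      show "2 * H \<le> ln (real z) / (exp 14 * ln (real z0) ^ 4)"
      proof -
        have "2 * H \<le> ln (exp (l / 50) - 1) / (exp 14 * ln (l ^ 120 + 1) ^ 4)" using e(5) by (simp add: H_def)
        also have "\<dots> \<le> ln (real z) / (exp 14 * ln (real z0) ^ 4)"
        proof (rule frac_le)
          show "0 \<le> ln (real z)" using z3 by (intro ln_ge_zero) simp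
          show "ln (exp (l / 50) - 1) \<le> ln (real z)" using l2 z3 z(1) by (subst ln_le_cancel_iff) auto
          have "ln 1 < ln (real z0)" using z0_256 by (subst ln_less_cancel_iff) auto
          then have lz0: "0 < ln (real z0)" by simp
          then show "0 < exp 14 * ln (real z0) ^ 4" by simp
          have "ln (real z0) \<le> ln (l ^ 120 + 1)" using z0 z0_256 by (subst ln_le_cancel_iff) auto
          then show "exp 14 * ln (real z0) ^ 4 \<le> exp 14 * ln (l ^ 120 + 1) ^ 4" using lz0 by (intro mult_left_mono power_mono) auto
        qed
        finally show ?thesis .
      qed
      show "2 * H * real z ^ 4 \<le> of_int N"
      proof -
        have "2 * H * real z ^ 4 \<le> 2 * H * exp (l / 50) ^ 4" using z(2) H1 by (intro mult_left_mono power_mono) auto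
        also have "\<dots> \<le> exp l" using e(6) by (simp only: H_def)
        finally show ?thesis by (simp only: expl)
      qed
      let ?R = "exp 80 * ln (real z) ^ 32"
      have R0: "0 \<le> ?R" using z3 by simp
      have R: "?R \<le> exp 80 * l ^ 32"
      proof -
        have "ln (real z) \<le> ln (exp (l / 50))" using z(2) z3 by (subst ln_le_cancel_iff) auto
        then have "ln (real z) \<le> l" using l2 by simp
        then show ?thesis using z3 by (intro mult_left_mono power_mono) auto
      qed
      have 1: "exp L * (real z ^ 4 * (2 * real W + 4)) \<le> of_int N * (\<epsilon> / 3)"
      proof -
        have "real z ^ 4 * (2 * real W + 4) \<le> exp (l / 50) ^ 4 * (2 * exp (l / 2) + 4)"
          using z(2) W(2) by (intro mult_mono power_mono) auto
        then have "exp L * (real z ^ 4 * (2 * real W + 4)) \<le> exp L * (exp (l / 50) ^ 4 * (2 * exp (l / 2) + 4))"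
          by (intro mult_left_mono) auto
        also have "\<dots> \<le> exp l / l ^ 10 / 3" using e(7) by (simp only: L_def)
        finally show ?thesis unfolding expl by (simp add: \<epsilon>_def)
      qed
      have 2: "2 * of_int N * ?R * exp (- 3 * L) \<le> of_int N * (\<epsilon> / 3)"
      proof -
        have "2 * ?R * exp (- 3 * L) \<le> 2 * (exp 80 * l ^ 32) * exp (- 3 * L)" using R by (intro mult_right_mono) auto
        also have "\<dots> \<le> \<epsilon> / 3" using e(8) by (simp add: L_def \<epsilon>_def)
        finally have "of_int N * (2 * ?R * exp (- 3 * L)) \<le> of_int N * (\<epsilon> / 3)" using N_pos by (intro mult_left_mono) auto
        then show ?thesis by (simp only: mult_ac)
      qed
      \<comment> \<open>This fixes the lower end of the sieving range: \<open>sqrt z0\<close> is at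
        least \<open>l ^ 60\<close>, which absorbs \<open>l ^ 32\<close> from the Euler product, one
        factor \<open>l\<close> from the harmonic sum and \<open>l ^ 10\<close> from
        \<open>\<epsilon>\<close>.\<close>
      have 3: "of_int N * (?R / sqrt z0) * (6 + 2 * ln (real_of_int N)) \<le> of_int N * (\<epsilon> / 3)"
      proof -
        have "l ^ 60 \<le> sqrt (real z0)" using z0(1) by (intro real_le_rsqrt) (simp flip: power_mult)
        then have "?R / sqrt z0 \<le> (exp 80 * l ^ 32) / l ^ 60" using R R0 l2 by (intro frac_le) auto
        then have "?R / sqrt z0 * (6 + 2 * l) \<le> (exp 80 * l ^ 32) / l ^ 60 * (6 + 2 * l)" using l2 by (intro mult_right_mono) auto
        also have "\<dots> \<le> \<epsilon> / 3" using e(9) by (simp add: \<epsilon>_def)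
        finally have "of_int N * (?R / sqrt z0 * (6 + 2 * l)) \<le> of_int N * (\<epsilon> / 3)" using N_pos by (intro mult_left_mono) auto
        then show ?thesis by (simp only: l_def mult.assoc)
      qed
      have "of_int N * \<epsilon> = of_int N * (\<epsilon> / 3) + of_int N * (\<epsilon> / 3) + of_int N * (\<epsilon> / 3)" by simp
      then show "exp L * (real z ^ 4 * (2 * real W + 4)) + 2 * of_int N * ?R * exp (- 3 * L) + of_int N * (?R / sqrt z0) * (6 + 2 * ln (real_of_int N)) \<le> of_int N * \<epsilon>"
        using 1 2 3 by linarith
    qed (use a z3 z0_256 pos H1 in auto)
    have good: "good L H \<epsilon> a" unfolding good_def using a per ap major by blast
    show "(\<Sum>n\<in>{0..<N}. a n) < of_int N * ln (real_of_int N) powr - (1001/1000)"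
    proof (rule ccontr)
      assume "\<not> (\<Sum>n\<in>{0..<N}. a n) < of_int N * ln (real_of_int N) powr - (1001/1000)"
      then have dens: "of_int N * \<alpha> \<le> (\<Sum>n\<in>{0..<N}. a n)" by (simp add: \<alpha>_def l_def)
      have c1: "2000 * L\<^sup>2 / \<epsilon>\<^sup>2 \<le> real k" "3 \<le> k"
      proof -
        show "2000 * L\<^sup>2 / \<epsilon>\<^sup>2 \<le> real k" using e(11) k unfolding L_def \<epsilon>_def by linarith
        have "3 \<le> real k" using e(11) k by linarith
        then show "3 \<le> k" by simp
      qed
      have c2: "4 * (real I)\<^sup>2 * ln (real k) \<le> L"
      proof -
        have "ln (real k) \<le> ln (l ^ 21 + 1)" using k c1(2) by (subst ln_le_cancel_iff) auto
        moreover have "(real I)\<^sup>2 \<le> (l powr (1/25) + 1)\<^sup>2" using I by (intro power_mono) auto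
        moreover have "0 \<le> ln (real k)" using c1(2) by (intro ln_ge_zero) simp
        ultimately have "4 * (real I)\<^sup>2 * ln (real k) \<le> 4 * (l powr (1/25) + 1)\<^sup>2 * ln (l ^ 21 + 1)"
          by (intro mult_mono) auto
        then show ?thesis using e(11) unfolding L_def by linarith
      qed
      \<comment> \<open>Already Bernoulli's inequality suffices: the total gain has order
        \<open>l powr (1/25 - 1/500)\<close> up to powers of \<open>ln l\<close>, whereas only a
        ratio of order \<open>l powr (1/1000)\<close>, up to such powers, has to be bridged.\<close>
      have c3: "2 / H < \<alpha> * (1 + (H * \<alpha>)\<^sup>2 / 40000) ^ I"
      proof -
        let ?\<kappa> = "(H * \<alpha>)\<^sup>2 / 40000"
        have "1 + l powr (1/25) * ?\<kappa> \<le> 1 + real I * ?\<kappa>" using I by (intro add_left_mono mult_right_mono) auto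
        also have "\<dots> \<le> (1 + ?\<kappa>) ^ I" by (rule Bernoulli_inequality) (rule order.trans[of _ 0]; simp)
        finally have "\<alpha> * (1 + l powr (1/25) * ?\<kappa>) \<le> \<alpha> * (1 + ?\<kappa>) ^ I" using pos by (intro mult_left_mono) auto
        then show ?thesis using e(12) unfolding H_def \<alpha>_def by linarith
      qed
      show False
      proof (rule relative_roth[OF good H1 pos(2) dens pos(3) _ _ _ _ c1 c2 c3])
        show "\<epsilon> \<le> \<alpha> ^ 5 / 80000" "\<epsilon> \<le> 1 / H" "1 \<le> L" "exp L / of_int N \<le> \<epsilon>"
          using e(10) expl by (simp_all only: \<epsilon>_def \<alpha>_def H_def L_def)
      qed
    qed
  qed
qed

section \<open>From residues back to intervals of integers\<close>

lemma card_squarefull_in_trivial: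
  assumes "0 \<le> y" shows "real (card (squarefull_in x y)) \<le> 1 + y"
  by (rule card_le_diff[OF finite_squarefull_in assms]) (auto simp: squarefull_in_def)

lemma sum_inverse_squares:
  assumes "1 \<le> a" "a \<le> b"
  shows "(\<Sum>p\<in>{a<..b}. 1 / (real p)\<^sup>2) \<le> 1 / real a - 1 / real b"
  using assms(2)
proof (induction b rule: dec_induct)
  case (step b)
  have "{a<..Suc b} = insert (Suc b) {a<..b}" using step by auto
  moreover have "1 / (real (Suc b))\<^sup>2 \<le> 1 / real b - 1 / real (Suc b)"
  proof -
    have b: "0 < real b" using step assms(1) by linarith
    then have "1 / (real (Suc b))\<^sup>2 \<le> 1 / (real b * real (Suc b))"
      unfolding power2_eq_square by (intro divide_left_mono mult_right_mono mult_pos_pos) auto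
    also have "\<dots> = 1 / real b - 1 / real (Suc b)" using b by (simp add: field_simps)
    finally show ?thesis .
  qed
  ultimately show ?case using step.IH by simp
qed simp

lemma card_multiples_le:
  fixes m :: nat
  assumes "0 < m" "0 \<le> y" "finite A" "\<And>n. n \<in> A \<Longrightarrow> x < real n \<and> real n \<le> x + y \<and> m dvd n"
  shows "real (card A) \<le> 1 + y / m"
proof -
  let ?B = "(\<lambda>n. n div m) ` A"
  have "inj_on (\<lambda>n. n div m) A" by (rule inj_onI) (metis assms(4) dvd_div_mult_self)
  then have "real (card A) = real (card ?B)" by (simp add: card_image)
  also have "\<dots> \<le> 1 + y / m"
  proof (rule card_le_diff)
    fix a b assume "a \<in> ?B" "b \<in> ?B" "a < b"
    then obtain i j where ij: "i \<in> A" "a = i div m" "j \<in> A" "b = j div m" by auto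
    have "real i = real m * real a" "real j = real m * real b"
      using assms(4)[OF ij(1)] assms(4)[OF ij(3)] ij by (simp_all flip: of_nat_mult)
    then have "real m * (real b - real a) \<le> y" using assms(4)[OF ij(1)] assms(4)[OF ij(3)] by (simp add: right_diff_distrib)
    then show "real b - real a \<le> y / m" using assms(1) by (simp add: field_simps)
  qed (use assms in auto)
  finally show ?thesis .
qed

text \<open>A prime dividing a squarefull number does so twice, so a prime \<open>p\<close> accounts
  for at most \<open>1 + y / p^2\<close> numbers. The constants 1 add up to \<open>z\<close>, which
  therefore has to be a small power of \<open>y\<close>.\<close>

lemma card_squarefull_with_prime_factor:
  assumes "1 \<le> z0" "0 \<le> y"
  shows "real (card {n\<in>squarefull_in x y. \<exists>p. prime p \<and> z0 < p \<and> p \<le> z \<and> p dvd n}) \<le> real z + y / z0"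
    (is "real (card ?A) \<le> _")
proof (cases "z0 \<le> z")
  case True
  let ?B = "\<lambda>p. {n\<in>squarefull_in x y. p\<^sup>2 dvd n}"
  have "?A \<subseteq> (\<Union>p\<in>{z0<..z}. ?B p)" by (auto simp: squarefull_in_def squarefull_def)
  then have "card ?A \<le> card (\<Union>p\<in>{z0<..z}. ?B p)" by (intro card_mono) (auto simp: finite_squarefull_in)
  also have "\<dots> \<le> (\<Sum>p\<in>{z0<..z}. card (?B p))" by (rule card_UN_le) simp
  finally have "real (card ?A) \<le> real (\<Sum>p\<in>{z0<..z}. card (?B p))" by (simp only: of_nat_le_iff)
  also have "\<dots> = (\<Sum>p\<in>{z0<..z}. real (card (?B p)))" by simp
  also have "\<dots> \<le> (\<Sum>p\<in>{z0<..z}. 1 + y * (1 / (real p)\<^sup>2))"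
  proof (rule sum_mono)
    fix p assume "p \<in> {z0<..z}"
    then have "real (card (?B p)) \<le> 1 + y / real (p\<^sup>2)"
    proof (intro card_multiples_le[where x = x])
      show "finite (?B p)" by (simp add: finite_squarefull_in)
    qed (use assms in \<open>auto simp: squarefull_in_def\<close>)
    then show "real (card (?B p)) \<le> 1 + y * (1 / (real p)\<^sup>2)" by simp
  qed
  also have "\<dots> = real (z - z0) + y * (\<Sum>p\<in>{z0<..z}. 1 / (real p)\<^sup>2)" by (simp only: sum.distrib sum_distrib_left) simp
  also have "\<dots> \<le> real z + y * (1 / z0)"
  proof (intro add_mono mult_left_mono)
    have "0 \<le> 1 / real z" by simp
    then show "(\<Sum>p\<in>{z0<..z}. 1 / (real p)\<^sup>2) \<le> 1 / real z0" using sum_inverse_squares[OF assms(1) True] by linarith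
  qed (use assms in auto)
  finally show ?thesis by simp
next
  case False
  then have A: "?A = {}" by auto
  show ?thesis unfolding A using assms by simp
qed

text \<open>The numbers with a prime factor in the sieving range are few. The others, shifted by the
  integer part of \<open>x\<close>, form a sieved set modulo \<open>N\<close>, to which
  \<open>density_bound\<close> applies because a progression among them would contradict the abc
  conjecture.\<close>

lemma squarefull_short_interval:
  assumes abc_conjecture
  obtains Y :: real where "\<And>x y. 1 \<le> x \<Longrightarrow> Y \<le> y \<Longrightarrow> y \<le> x \<Longrightarrow> y < x powr (6/25) \<Longrightarrow>
    real (card (squarefull_in x y)) \<le> 5 * y * ln (y + 1) powr - (1001/1000) + (5 * y) powr (1/50) + y / ln (y + 1) ^ 120"
proof -
  obtain X where X: "1 < X" "\<And>n d. X \<le> real n \<Longrightarrow> 0 < d \<Longrightarrow> real d \<le> real n powr (6/25) \<Longrightarrow>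
       squarefull (n - d) \<Longrightarrow> squarefull n \<Longrightarrow> squarefull (n + d) \<Longrightarrow> False"
    using abc_no_squarefull_ap[OF assms] by metis
  obtain l0 :: real where l0: "\<And>N x0 a. cyclic N \<Longrightarrow> l0 \<le> ln (real_of_int N) \<Longrightarrow> (\<And>n. a n = 0 \<or> a n = 1) \<Longrightarrow>
     cyclic.per N a \<Longrightarrow> cyclic.ap_free N a \<Longrightarrow>
     (\<And>n p. a n = 1 \<Longrightarrow> prime p \<Longrightarrow> nat \<lceil>ln (real_of_int N) ^ 120\<rceil> < p \<Longrightarrow> p \<le> nat \<lfloor>exp (ln (real_of_int N) / 50)\<rfloor> \<Longrightarrow>
        \<not> int p dvd x0 + n mod N) \<Longrightarrow>
     (\<Sum>n\<in>{0..<N}. a n) < of_int N * ln (real_of_int N) powr - (1001/1000)"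
    using density_bound by metis
  show thesis
  proof (rule that[of "max X (exp l0)"])
    fix x y :: real
    assume x: "1 \<le> x" and Y: "max X (exp l0) \<le> y" and yx: "y \<le> x" "y < x powr (6/25)"
    have y1: "1 < y" using Y X(1) by simp
    \<comment> \<open>The offsets lie in \<open>{1..M}\<close>, and \<open>N\<close> exceeds every
      possible value of \<open>\<bar>u + v - 2 * w\<bar>\<close> for offsets. Progressions modulo
      \<open>N\<close> are thus progressions of integers.\<close>
    define M where "M = \<lfloor>y\<rfloor> + 1"
    define N where "N = 2 * M + 1"
    define x0 where "x0 = \<lfloor>x\<rfloor>"
    define l where "l = ln (real_of_int N)"
    define z0 where "z0 = nat \<lceil>l ^ 120\<rceil>"
    define z where "z = nat \<lfloor>exp (l / 50)\<rfloor>"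
    have M: "y < of_int M" "of_int M \<le> y + 1" unfolding M_def by linarith+
    have M1: "1 \<le> M" using y1 by (simp add: M_def)
    interpret cyclic N by unfold_locales (use M1 in \<open>auto simp: N_def\<close>)
    have N: "2 * y + 1 < of_int N" "of_int N \<le> 5 * y" using M y1 by (simp_all add: N_def)
    have x0: "1 \<le> x0" "of_int x0 \<le> x" "x < of_int x0 + 1" using x unfolding x0_def by linarith+
    let ?S = "squarefull_in x y"
    let ?bad = "\<lambda>n. \<exists>p. prime p \<and> z0 < p \<and> p \<le> z \<and> p dvd n"
    define A where "A = {n\<in>?S. \<not> ?bad n}"
    have range: "int n - x0 \<in> {1..M}" if "n \<in> ?S" for n
    proof -
      have n: "x < real n" "real n \<le> x + y" using that by (auto simp: squarefull_in_def)
      have "of_int x0 < (of_int (int n) :: real)" using n x0 by simp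
      moreover have "of_int (int n) < (of_int (x0 + M + 1) :: real)" using n x0 M by simp
      ultimately have "x0 < int n" "int n < x0 + M + 1" by (simp_all only: of_int_less_iff)
      then show ?thesis by simp
    qed
    define a :: "int \<Rightarrow> real" where "a k = of_bool (nat (x0 + k mod N) \<in> A)" for k
    have ak: "\<exists>n\<in>A. k mod N = int n - x0 \<and> k mod N \<in> {1..M}" if "a k \<noteq> 0" for k
    proof
      show n: "nat (x0 + k mod N) \<in> A" using that by (simp add: a_def split: if_splits)
      have "0 \<le> k mod N" using N_pos by simp
      then have "k mod N = int (nat (x0 + k mod N)) - x0" using x0 by simp
      then show "k mod N = int (nat (x0 + k mod N)) - x0 \<and> k mod N \<in> {1..M}"
        using range[of "nat (x0 + k mod N)"] n by (simp add: A_def)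
    qed
    have per: "per a" unfolding per_def a_def by simp
    have apfree: "ap_free a"
      unfolding ap_free_def
    proof (intro allI impI)
      fix u v w assume uvw: "a u \<noteq> 0 \<and> a v \<noteq> 0 \<and> a w \<noteq> 0 \<and> N dvd u + v - 2 * w"
      obtain n1 where n1: "n1 \<in> A" "u mod N = int n1 - x0" "u mod N \<in> {1..M}" using ak[of u] uvw by blast
      obtain n2 where n2: "n2 \<in> A" "v mod N = int n2 - x0" "v mod N \<in> {1..M}" using ak[of v] uvw by blast
      obtain n where n: "n \<in> A" "w mod N = int n - x0" "w mod N \<in> {1..M}" using ak[of w] uvw by blast
      have "u mod N + v mod N - 2 * (w mod N) = (u + v - 2 * w) - N * (u div N + v div N - 2 * (w div N))"
        by (simp add: minus_mult_div_eq_mod[symmetric] algebra_simps)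
      then have "N dvd u mod N + v mod N - 2 * (w mod N)" using uvw by (simp only: dvd_diff dvd_triv_left)
      moreover have "\<bar>u mod N + v mod N - 2 * (w mod N)\<bar> < N"
      proof -
        have "N = 2 * M + 1" by (rule N_def)
        then show ?thesis using n1(3) n2(3) n(3) unfolding atLeastAtMost_iff by linarith
      qed
      ultimately have "u mod N + v mod N - 2 * (w mod N) = 0"
        using dvd_imp_le_int[of "u mod N + v mod N - 2 * (w mod N)" N] N_pos by linarith
      then have mid: "int n1 + int n2 = 2 * int n" using n1 n2 n by simp
      have noap: False if m: "m1 \<in> A" "m2 \<in> A" "m1 < m2" "int m1 + int m2 = 2 * int n" for m1 m2
      proof -
        define d where "d = n - m1"
        have d: "0 < d" "m1 = n - d" "m2 = n + d" using m by (auto simp: d_def)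
        have S: "n - d \<in> ?S" "n \<in> ?S" "n + d \<in> ?S" using m(1,2) d n(1) by (auto simp: A_def)
        have xn: "x < real n" using S by (simp add: squarefull_in_def)
        have "real (n + d) \<le> x + y" using S by (simp add: squarefull_in_def)
        then have "real d \<le> y" using xn by simp
        also have "\<dots> \<le> x powr (6/25)" using yx by simp
        also have "\<dots> \<le> real n powr (6/25)" using x xn by (intro powr_mono2) auto
        finally show False using X(2)[of n d] S d xn Y yx by (auto simp: squarefull_in_def)
      qed
      have "n1 = n2" using noap[of n1 n2] noap[of n2 n1] n1 n2 mid by (cases n1 n2 rule: linorder_cases) auto
      then have "u mod N = w mod N" using mid n1 n by simp
      then show "N dvd u - w" by (simp only: mod_eq_dvd_iff)
    qed
    have "l0 \<le> l"
    proof -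
      have "exp l0 \<le> of_int N" using Y N y1 by simp
      then have "ln (exp l0) \<le> ln (real_of_int N)" using N y1 by (subst ln_le_cancel_iff) auto
      then show ?thesis by (simp add: l_def)
    qed
    then have sum_a: "(\<Sum>n\<in>{0..<N}. a n) < of_int N * l powr - (1001/1000)" unfolding l_def
    proof (rule l0[OF cyclic_axioms _ _ per apfree])
      show "a k = 0 \<or> a k = 1" for k by (simp add: a_def)
      fix k p assume k: "a k = 1" and p: "prime p" "nat \<lceil>ln (real_of_int N) ^ 120\<rceil> < p" "p \<le> nat \<lfloor>exp (ln (real_of_int N) / 50)\<rfloor>"
      have "z0 < p" "p \<le> z" using p(2,3) by (simp_all only: z0_def z_def l_def)
      obtain n where n: "n \<in> A" "k mod N = int n - x0" using ak[of k] k by auto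
      then have "\<not> p dvd n" using p(1) \<open>z0 < p\<close> \<open>p \<le> z\<close> by (auto simp: A_def)
      then show "\<not> int p dvd x0 + k mod N" using n(2) by simp
    qed
    have cardA: "real (card A) \<le> (\<Sum>n\<in>{0..<N}. a n)"
    proof -
      have "card A = card ((\<lambda>n. int n - x0) ` A)" by (rule card_image[symmetric]) (simp add: inj_on_def)
      also have "\<dots> \<le> card {k\<in>{0..<N}. nat (x0 + k mod N) \<in> A}"
      proof (rule card_mono)
        show "finite {k\<in>{0..<N}. nat (x0 + k mod N) \<in> A}" by (rule finite_subset[of _ "{0..<N}"]) auto
        show "(\<lambda>n. int n - x0) ` A \<subseteq> {k\<in>{0..<N}. nat (x0 + k mod N) \<in> A}"
        proof (rule image_subsetI)
          fix n assume n: "n \<in> A"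
          then have r: "int n - x0 \<in> {1..M}" using range by (simp add: A_def)
          then have "int n - x0 \<in> {0..<N}" by (simp add: N_def)
          then show "int n - x0 \<in> {k\<in>{0..<N}. nat (x0 + k mod N) \<in> A}" using n by simp
        qed
      qed
      finally have "real (card A) \<le> real (card {k\<in>{0..<N}. nat (x0 + k mod N) \<in> A})" by (simp only: of_nat_le_iff)
      also have "\<dots> = (\<Sum>n\<in>{0..<N}. a n)"
        unfolding a_def of_bool_def by (subst sum.inter_filter[symmetric]) simp_all
      finally show ?thesis .
    qed
    have g: "0 < ln (y + 1)" "ln (y + 1) \<le> l"
    proof -
      show "0 < ln (y + 1)" using y1 by simp
      show "ln (y + 1) \<le> l" unfolding l_def using N y1 by (subst ln_le_cancel_iff) auto
    qed
    have z0: "l ^ 120 \<le> real z0" unfolding z0_def using g by (intro real_nat_ceiling) simp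
    have z0_1: "1 \<le> z0"
    proof -
      have "0 < l ^ 120" using g by (intro zero_less_power) linarith
      then show ?thesis using z0 by linarith
    qed
    have z: "real z \<le> exp (l / 50)" unfolding z_def by (intro real_nat_floor) simp
    have "?S = A \<union> {n\<in>?S. ?bad n}" by (auto simp: A_def)
    then have "card ?S \<le> card A + card {n\<in>?S. ?bad n}" by (metis card_Un_le)
    then have "real (card ?S) \<le> real (card A) + real (card {n\<in>?S. ?bad n})" by linarith
    also have "\<dots> \<le> of_int N * l powr - (1001/1000) + (real z + y / z0)"
      using cardA sum_a card_squarefull_with_prime_factor[of z0 y x z] z0_1 y1 by linarith
    also have "\<dots> \<le> 5 * y * ln (y + 1) powr - (1001/1000) + ((5 * y) powr (1/50) + y / ln (y + 1) ^ 120)"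
    proof (intro add_mono)
      show "of_int N * l powr - (1001/1000) \<le> 5 * y * ln (y + 1) powr - (1001/1000)"
        using N g y1 by (intro mult_mono powr_mono2') auto
      have "exp (l / 50) = of_int N powr (1/50)" using N y1 by (simp add: powr_def l_def)
      also have "\<dots> \<le> (5 * y) powr (1/50)" using N y1 by (intro powr_mono2) auto
      finally show "real z \<le> (5 * y) powr (1/50)" using z by linarith
      have "ln (y + 1) ^ 120 \<le> l ^ 120" using g by (intro power_mono) auto
      also note z0
      finally have "ln (y + 1) ^ 120 \<le> real z0" .
      moreover have "0 < ln (y + 1) ^ 120" using g(1) by (rule zero_less_power)
      ultimately show "y / real z0 \<le> y / ln (y + 1) ^ 120" using y1 z0_1 by (intro divide_left_mono mult_pos_pos) auto
    qed
    finally show "real (card ?S) \<le> 5 * y * ln (y + 1) powr - (1001/1000) + (5 * y) powr (1/50) + y / ln (y + 1) ^ 120"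
      by simp
  qed
qed

text \<open>With \<open>u = x powr (1/5)\<close> the assumption on \<open>y\<close> says exactly
  that \<open>u \<le> y powr (5/6)\<close>, since 6/25 * 5/6 = 1/5. The other term
  \<open>y / u\<close> is no larger because \<open>u \<ge> y powr (1/5)\<close>.\<close>

lemma squarefull_long_interval:
  assumes "1 \<le> x" "1 \<le> y" "y \<le> x" "x powr (6/25) \<le> y"
  shows "real (card (squarefull_in x y)) \<le> 6 * y powr (5/6)"
proof -
  define u where "u = x powr (1/5)"
  have u1: "1 \<le> u" using assms by (simp add: u_def ge_one_powr_ge_zero)
  have u5: "u ^ 5 = x" using assms by (simp add: u_def powr_power)
  have "u = (x powr (6/25)) powr (5/6)" by (simp add: u_def powr_powr)
  also have "\<dots> \<le> y powr (5/6)" using assms by (intro powr_mono2) auto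
  finally have 1: "u \<le> y powr (5/6)" .
  have "y powr (1/6) \<le> y powr (1/5)" using assms by (intro powr_mono) auto
  also have "\<dots> \<le> u" unfolding u_def using assms by (intro powr_mono2) auto
  finally have "y / u \<le> y / y powr (1/6)" using assms u1 by (intro divide_left_mono) (auto intro!: mult_pos_pos)
  also have "\<dots> = y powr (5/6)"
  proof -
    have "y = y powr (5/6) * y powr (1/6)" using assms by (simp flip: powr_add)
    then show ?thesis using assms by (simp add: field_simps)
  qed
  finally have 2: "y / u \<le> y powr (5/6)" .
  have "real (card (squarefull_in x y)) \<le> 3 * (u + y / u)"
    by (rule card_squarefull_in[OF u1 u5]) (use assms in auto)
  also have "\<dots> \<le> 3 * (y powr (5/6) + y powr (5/6))" by (intro mult_left_mono add_mono 1 2) simp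
  finally show ?thesis by simp
qed

lemma Q2_diff:
  assumes "0 \<le> y" shows "real (Q2 (x + y)) - real (Q2 x) = real (card (squarefull_in x y))"
proof -
  let ?A = "\<lambda>x. {n. 0 < n \<and> real n \<le> x \<and> squarefull n}"
  have fin: "finite (?A x)" for x by (rule finite_subset[of _ "{..nat \<lfloor>x\<rfloor>}"]) (auto simp: le_nat_floor)
  have "?A (x + y) = ?A x \<union> squarefull_in x y" using assms by (auto simp: squarefull_in_def)
  moreover have "?A x \<inter> squarefull_in x y = {}" by (auto simp: squarefull_in_def)
  ultimately have "card (?A (x + y)) = card (?A x) + card (squarefull_in x y)"
    using fin finite_squarefull_in by (simp add: card_Un_disjoint)
  then show ?thesis by (simp add: Q2_def)
qed

theorem theorem5:
  assumes "abc_conjecture"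
  shows "\<exists>c::real. c > 0 \<and> (\<exists>C::real. C > 0 \<and>
           (\<forall>x y :: real. 1 \<le> x \<and> 1 \<le> y \<and> y \<le> x \<longrightarrow>
              real (Q2 (x + y)) - real (Q2 x) \<le> C * y / (ln (y + 1)) powr (1 + c)))"
proof -
  obtain Y where Y: "\<And>x y. 1 \<le> x \<Longrightarrow> Y \<le> y \<Longrightarrow> y \<le> x \<Longrightarrow> y < x powr (6/25) \<Longrightarrow>
    real (card (squarefull_in x y)) \<le> 5 * y * ln (y + 1) powr - (1001/1000) + (5 * y) powr (1/50) + y / ln (y + 1) ^ 120"
    using squarefull_short_interval[OF assms] by metis
  let ?f = "\<lambda>y. y / ln (y + 1) powr (1001/1000)"
  have "eventually (\<lambda>y::real. 5 * y * ln (y + 1) powr - (1001/1000) + (5 * y) powr (1/50) + y / ln (y + 1) ^ 120 \<le> 7 * ?f y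
      \<and> 6 * y powr (5/6) \<le> 7 * ?f y) at_top"
    by (intro eventually_conj; real_asymp)
  then obtain Y1 :: real where Y1: "\<And>y. Y1 \<le> y \<Longrightarrow> 5 * y * ln (y + 1) powr - (1001/1000) + (5 * y) powr (1/50) + y / ln (y + 1) ^ 120 \<le> 7 * ?f y"
      "\<And>y. Y1 \<le> y \<Longrightarrow> 6 * y powr (5/6) \<le> 7 * ?f y"
    unfolding eventually_at_top_linorder by blast
  define Y2 where "Y2 = max Y Y1"
  \<comment> \<open>The second summand covers \<open>y < Y2\<close>, where the trivial count
    \<open>1 + y \<le> 2 * y\<close> is used.\<close>
  define C where "C = 7 + 2 * ln (\<bar>Y2\<bar> + 1) powr (1001/1000)"
  have C7: "7 \<le> C" by (simp add: C_def)
  have "real (Q2 (x + y)) - real (Q2 x) \<le> C * ?f y" if xy: "1 \<le> x" "1 \<le> y" "y \<le> x" for x y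
  proof -
    have f0: "0 \<le> ?f y" using xy by simp
    have Cf: "7 * ?f y \<le> C * ?f y" using C7 f0 by (rule mult_right_mono)
    have "real (card (squarefull_in x y)) \<le> C * ?f y"
    proof (cases "Y2 \<le> y")
      case True
      then have le: "Y \<le> y" "Y1 \<le> y" by (simp_all add: Y2_def)
      show ?thesis
      proof (cases "y < x powr (6/25)")
        case True
        then show ?thesis using Y[OF xy(1) le(1) xy(3) True] Y1(1)[OF le(2)] Cf by linarith
      next
        case False
        then have "real (card (squarefull_in x y)) \<le> 6 * y powr (5/6)"
          using xy by (intro squarefull_long_interval) auto
        then show ?thesis using Y1(2)[OF le(2)] Cf by linarith
      qed
    next
      case False
      let ?g = "ln (y + 1) powr (1001/1000)"
      have g: "0 < ?g" using xy by simp
      have "?g \<le> ln (\<bar>Y2\<bar> + 1) powr (1001/1000)" using False xy by (intro powr_mono2) auto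
      then have "2 * ?g \<le> C" by (simp add: C_def)
      then have "2 * ?g * ?f y \<le> C * ?f y" using f0 by (rule mult_right_mono)
      moreover have "2 * ?g * ?f y = 2 * y" using g by simp
      ultimately show ?thesis using card_squarefull_in_trivial[of y x] xy by linarith
    qed
    then show ?thesis using Q2_diff[of y x] xy by simp
  qed
  then show ?thesis using C7 by (intro exI[of _ "1/1000"] exI[of _ C] conjI allI impI) auto
qed

end
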